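(* Let $f:[-1,1]\to[-1,1]$ be real analytic and let $-1=c_0<c_1<\dots<c_{m-1}<c_m=1$ ($m\ge 2$) be points such that $f(c_j)=(-1)^{j+1}$ for $j=0,\dots,m$, such that on $[-1,1]$ the derivative $f'$ vanishes only on $Z=\{c_1,\dots,c_{m-1}\}$, and such that $f''$ does not vanish on $Z$. Assume moreover that $f$ is analytically expanding (Assumption A in the context). Then there is a unique $f$-invariant probability measure $\rho$ on $[-1,1]$ that is absolutely continuous with respect to Lebesgue measure. If $X$ is real-analytic on $[-1,1]$ and $A\in\mathcal C^1[-1,1]$, then the power series $$\Psi(\lambda)=\sum_{n=0}^\infty\lambda^n\int_{-1}^1\rho(dx)\,X(x)\,\frac{d}{dx}A(f^n x)$$ (which converges for sufficiently small $|\lambda|$) extends to a meromorphic function of $\lambda$ in $\mathbf C$, without pole at $\lambda=1$.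
   Context: Here $f^n$ is the $n$-th iterate of $f$. Change of variable. Fix a holomorphic function $\omega$ from a small open neighborhood $U_0$ of $[-1,1]$ in $\mathbf C$ to a small open neighborhood $W$ of $[-1,1]$ in a Riemann surface which is 2-sheeted over $\mathbf C$ near $-1$ and $1$, with inverse $\varpi=\omega^{-1}:W\to U_0$. It is assumed that $\omega(-x)=-\omega(x)$, $\omega(\pm1)=\pm1$, $\omega[-1,1]=[-1,1]$, $\omega'(\pm1)=\omega'''(\pm1)=0$. Concretely, as a $\mathbf C$-valued function $\omega$ restricts to an increasing homeomorphism of $[-1,1]$ with $\omega'>0$ on $(-1,1)$ and $\omega(\pm(1-\xi))=\pm(1-C\xi^2+D\xi^4+\cdots)$ with $C>0$; $\varpi$ restricted to $[-1,1]$ is the inverse homeomorphism. (Example: $\omega(x)=\sin(\pi x/2)$.) Put $g=\varpi\circ f\circ\omega:[-1,1]\to[-1,1]$, $d_j=\varpi(c_j)$, and let $g_j$ be the (monotone) restriction of $g$ to $[d_{j-1},d_j]$, which maps onto $[-1,1]$, for $j=1,\dots,m$. Let $\psi_j:[-1,1]\to[d_{j-1},d_j]$ be the inverse of $g_j$. Each $\psi_j$ extends holomorphically to a neighborhood of $[-1,1]$ in $\mathbf C$. Assumption A ($f$ is analytically expanding): there is a bounded open connected set $U$ with $[-1,1]\subset U\subset\mathbf C$ such that the $\psi_j$ ($j=1,\dots,m$) extend to continuous functions $\bar U\to\mathbf C$, holomorphic in $U$, with $\psi_j\bar U\subset U$, where $\bar U$ is the closure of $U$. *)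

theory Defs
  imports "HOL-Probability.Probability" "HOL-Complex_Analysis.Complex_Analysis"
    "HOL-Library.Landau_Symbols"
begin

definition real_analytic_on :: "(real \<Rightarrow> real) \<Rightarrow> real set \<Rightarrow> bool" where
  "real_analytic_on f S \<longleftrightarrow>
     (\<forall>x0\<in>S. \<exists>r>0. \<exists>a::nat \<Rightarrow> real.
        \<forall>x\<in>S. \<bar>x - x0\<bar> < r \<longrightarrow> (\<lambda>n. a n * (x - x0) ^ n) sums f x)"

text \<open>Derivative of a function on \<open>[-1,1]\<close>: two-sided in the interior, one-sided at the end points;
  values outside \<open>[-1,1]\<close> play no role. It is meaningful only where the derivative exists.\<close>

definition interval_deriv :: "(real \<Rightarrow> real) \<Rightarrow> real \<Rightarrow> real" where
  "interval_deriv f x = vector_derivative f (at x within {-1..1})"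

definition C1_interval :: "(real \<Rightarrow> real) \<Rightarrow> bool" where
  "C1_interval A \<longleftrightarrow>
     (\<exists>A'. continuous_on {-1..1} A' \<and>
        (\<forall>x\<in>{-1..1}. (A has_real_derivative A' x) (at x within {-1..1})))"

text \<open>The admissible changes of variable. The map is viewed as a complex-valued function,
  that is, composed with the projection of the Riemann surface to the plane. Then the surface being
  two-sheeted near \<open>1\<close> and \<open>-1\<close>, and the map being a biholomorphism from a small neighbourhood of
  \<open>[-1,1]\<close> onto a neighbourhood of \<open>[-1,1]\<close> in that surface, is expressed by the non-vanishing of the
  derivative on \<open>(-1,1)\<close> and of the quadratic coefficient at the end points.\<close>

definition change_of_variable :: "(complex \<Rightarrow> complex) \<Rightarrow> bool" where
  "change_of_variable \<omega> \<longleftrightarrow>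
     (\<exists>U0. open U0 \<and> of_real ` {-1..1::real} \<subseteq> U0 \<and> \<omega> holomorphic_on U0) \<and>
     (\<forall>x\<in>{-1..1::real}. \<omega> (- of_real x) = - \<omega> (of_real x)) \<and>
     \<omega> 1 = 1 \<and> \<omega> (-1) = -1 \<and>
     \<omega> ` of_real ` {-1..1::real} = of_real ` {-1..1::real} \<and>
     strict_mono_on {-1..1::real} (\<lambda>x. Re (\<omega> (of_real x))) \<and>
     (\<forall>x\<in>{-1<..<1::real}. deriv \<omega> (of_real x) \<in> \<real> \<and> Re (deriv \<omega> (of_real x)) > 0) \<and>
     (\<forall>\<sigma>\<in>{1, -1}. deriv \<omega> \<sigma> = 0 \<and> (deriv ^^ 3) \<omega> \<sigma> = 0) \<and>
     (\<exists>C E :: real. C > 0 \<and>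
        (\<forall>\<sigma>\<in>{1, -1}.
           (\<lambda>\<xi>. \<omega> (\<sigma> * (1 - \<xi>)) - \<sigma> * (1 - of_real C * \<xi> ^ 2 + of_real E * \<xi> ^ 4))
             \<in> O[at 0](\<lambda>\<xi>. \<xi> ^ 5)))"

definition omega_real :: "(complex \<Rightarrow> complex) \<Rightarrow> real \<Rightarrow> real" where
  "omega_real \<omega> x = Re (\<omega> (of_real x))"

definition varpi :: "(complex \<Rightarrow> complex) \<Rightarrow> real \<Rightarrow> real" where
  "varpi \<omega> = the_inv_into {-1..1} (omega_real \<omega>)"

definition conj_map :: "(complex \<Rightarrow> complex) \<Rightarrow> (real \<Rightarrow> real) \<Rightarrow> real \<Rightarrow> real" where
  "conj_map \<omega> f = varpi \<omega> \<circ> f \<circ> omega_real \<omega>"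

definition inv_branch ::
    "(complex \<Rightarrow> complex) \<Rightarrow> (real \<Rightarrow> real) \<Rightarrow> (nat \<Rightarrow> real) \<Rightarrow> nat \<Rightarrow> real \<Rightarrow> real" where
  "inv_branch \<omega> f c j =
     the_inv_into {varpi \<omega> (c (j - 1))..varpi \<omega> (c j)} (conj_map \<omega> f)"

definition analytically_expanding ::
    "(complex \<Rightarrow> complex) \<Rightarrow> (real \<Rightarrow> real) \<Rightarrow> (nat \<Rightarrow> real) \<Rightarrow> nat \<Rightarrow> bool" where
  "analytically_expanding \<omega> f c m \<longleftrightarrow>
     (\<exists>U :: complex set. bounded U \<and> open U \<and> connected U \<and> of_real ` {-1..1::real} \<subseteq> U \<and>
        (\<forall>j\<in>{1..m}. \<exists>\<psi>. continuous_on (closure U) \<psi> \<and> \<psi> holomorphic_on U \<and>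
           (\<forall>x\<in>{-1..1}. \<psi> (of_real x) = of_real (inv_branch \<omega> f c j x)) \<and>
           \<psi> ` closure U \<subseteq> U))"

text \<open>Invariant probability measures on \<open>[-1,1]\<close> (with its Borel sets) that are absolutely
  continuous with respect to Lebesgue measure.\<close>

definition ac_invariant_prob :: "(real \<Rightarrow> real) \<Rightarrow> real measure \<Rightarrow> bool" where
  "ac_invariant_prob f \<rho> \<longleftrightarrow>
     sets \<rho> = sets (restrict_space lborel {-1..1}) \<and> prob_space \<rho> \<and>
     f \<in> \<rho> \<rightarrow>\<^sub>M \<rho> \<and> distr \<rho> \<rho> f = \<rho> \<and>
     absolutely_continuous (restrict_space lborel {-1..1}) \<rho>"

definition Psi_coeff ::
    "(real \<Rightarrow> real) \<Rightarrow> real measure \<Rightarrow> (real \<Rightarrow> real) \<Rightarrow> (real \<Rightarrow> real) \<Rightarrow> nat \<Rightarrow> real" where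
  "Psi_coeff f \<rho> X A n = (\<integral>x. X x * interval_deriv (\<lambda>y. A ((f ^^ n) y)) x \<partial>\<rho>)"

end

theory Submission
  imports Defs
begin

text \<open>After conjugation by \<open>\<omega>\<close> the map has inverse branches \<open>b j\<close> that are analytic and contracting
  near \<open>[-1,1]\<close>, and the signed transfer operator \<open>L \<phi> = (\<Sum>j. (-1) ^ j * (b j)' * (\<phi> \<circ> b j))\<close> acts on
  functions holomorphic near \<open>[-1,1]\<close>. Cauchy's formula makes its powers approximable by finite rank
  operators with arbitrarily small geometric error, so that every correlation series
  \<open>\<Sum>n. \<lambda> ^ n * \<integral> B * L ^ n \<phi>\<close> is meromorphic in the plane; mixing removes the pole at \<open>1\<close> if \<open>\<phi>\<close>
  has mean zero.

  The conjugated density \<open>h * (X \<circ> \<omega>) / \<omega>'\<close> of the susceptibility is not analytic: it has simple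
  poles at \<open>1\<close> and \<open>-1\<close>, as \<open>\<omega>'\<close> vanishes there. One step of the dynamics maps their span to itself
  modulo analytic functions vanishing at both ends, by a triangular matrix whose diagonal entries are
  different from \<open>1\<close>; the polar part therefore contributes a rational factor without pole at \<open>1\<close>.
  On analytic functions \<open>\<phi>\<close> vanishing at both ends integration by parts turns the coefficient into
  a correlation for \<open>\<phi>'\<close>, which has mean zero.\<close>

subsection \<open>Power series with meromorphic continuation\<close>

text \<open>The sign \<open>(-1) ^ j\<close> is that of \<open>(b j)'\<close> on
  \<open>[-1,1]\<close>. Hence \<open>L\<close> is there the positive transfer operator that
  preserves integrals, while its formula stays holomorphic off the interval: the former gives the L1
  estimates for mixing, the latter Cauchy's formula. Resolvents are tested against scalar
  functionals, so a rank one perturbation costs one division of power series. The end points are the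
  obstacle. The folds of \<open>f\<close> and those of \<open>\<omega>\<close> all become critical
  points of \<open>F = f \<circ> \<omega>\<close>, and \<open>F (b j z) = \<omega> z\<close>.
  Differentiating this up to third order at \<open>1\<close> and \<open>-1\<close> shows that
  branches with a common value there have equal squared first and equal second derivatives, and that
  \<open>(b j)''\<close> vanishes where \<open>b j\<close> takes an end value. Neighbouring branches
  then cancel in alternating sums, \<open>h'\<close> vanishes at both ends, and the simple poles
  have no constant term. The remainders vanish at both ends, so integration by parts has no boundary
  terms. At \<open>1\<close> a pole is excluded by Abel summation: if the coefficients tend to
  \<open>0\<close>, so does \<open>1 - x\<close> times the sum at \<open>x\<close>, as
  \<open>x\<close> increases to \<open>1\<close>.\<close>

definition meromorphic_fps :: "complex set \<Rightarrow> complex fps \<Rightarrow> bool" where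
  "meromorphic_fps S A \<longleftrightarrow> (\<exists>F. F meromorphic_on S \<and> F has_fps_expansion A)"

lemma meromorphic_fps_add:
  "meromorphic_fps S A \<Longrightarrow> meromorphic_fps S B \<Longrightarrow> meromorphic_fps S (A + B)"
  unfolding meromorphic_fps_def by (blast intro: meromorphic_on_add has_fps_expansion_add)

lemma meromorphic_fps_mult:
  "meromorphic_fps S A \<Longrightarrow> meromorphic_fps S B \<Longrightarrow> meromorphic_fps S (A * B)"
  unfolding meromorphic_fps_def by (blast intro: meromorphic_on_mult has_fps_expansion_mult)

lemma meromorphic_fps_inverse:
  "meromorphic_fps S A \<Longrightarrow> fps_nth A 0 \<noteq> 0 \<Longrightarrow> meromorphic_fps S (inverse A)"
  unfolding meromorphic_fps_def by (blast intro: meromorphic_on_inverse has_fps_expansion_inverse)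

lemma meromorphic_fps_const: "meromorphic_fps S (fps_const c)"
  unfolding meromorphic_fps_def by (intro exI[of _ "\<lambda>_. c"]) auto

lemma meromorphic_fps_X: "meromorphic_fps S fps_X"
  unfolding meromorphic_fps_def
  by (intro exI[of _ "\<lambda>x. x"]) (auto intro: fps_expansion_intros analytic_on_imp_meromorphic_on)

lemma meromorphic_fps_sum:
  "(\<And>i. i \<in> I \<Longrightarrow> meromorphic_fps S (A i)) \<Longrightarrow> meromorphic_fps S (\<Sum>i\<in>I. A i)"
proof (induction I rule: infinite_finite_induct)
  case empty
  then show ?case using meromorphic_fps_const[of S 0] by simp
next
  case (infinite I)
  then show ?case using meromorphic_fps_const[of S 0] by simp
qed (auto intro: meromorphic_fps_add)

lemma meromorphic_fps_power: "meromorphic_fps S A \<Longrightarrow> meromorphic_fps S (A ^ n)"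
  using meromorphic_fps_const[of S 1] by (induction n) (auto intro: meromorphic_fps_mult)

lemma meromorphic_fps_diff:
  assumes "meromorphic_fps S A" "meromorphic_fps S B"
  shows "meromorphic_fps S (A - B)"
proof -
  have "A - B = A + fps_const (-1) * B" by (simp flip: fps_const_neg)
  then show ?thesis
    using meromorphic_fps_add[OF assms(1) meromorphic_fps_mult[OF meromorphic_fps_const assms(2)]]
    by metis
qed

text \<open>Needed for the sections of a series along residue classes mod \<open>N\<close>:
  continuing a section to radius \<open>R ^ N\<close> in the variable \<open>z ^ N\<close> means
  continuing it to radius \<open>R\<close> in \<open>z\<close>.\<close>

lemma meromorphic_fps_compose_X_power:
  assumes "meromorphic_fps (ball 0 (R ^ N)) A" "N > 0" "R > 0"
  shows "meromorphic_fps (ball 0 R) (A oo fps_X ^ N)"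
proof -
  obtain F where F: "F meromorphic_on ball 0 (R ^ N)" "F has_fps_expansion A"
    using assms unfolding meromorphic_fps_def by blast
  have "(\<lambda>z. F (z ^ N)) meromorphic_on ball 0 R"
  proof (rule meromorphic_on_compose[OF F(1)])
    show "(\<lambda>z. z ^ N) analytic_on ball 0 R"
      by (intro analytic_intros)
    show "(\<lambda>z. z ^ N) ` ball 0 R \<subseteq> ball (0::complex) (R ^ N)"
      using assms by (auto simp: norm_power intro!: power_strict_mono)
  qed
  moreover have "(F \<circ> (\<lambda>z. z ^ N)) has_fps_expansion (A oo fps_X ^ N)"
    using assms by (intro has_fps_expansion_compose F fps_expansion_intros) auto
  ultimately show ?thesis
    unfolding meromorphic_fps_def by (auto simp: o_def)
qed

lemma has_fps_expansion_imp_eventually_eq: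
  fixes F G :: "complex \<Rightarrow> complex"
  assumes "F has_fps_expansion A" "G has_fps_expansion A"
  shows "eventually (\<lambda>z. F z = G z) (nhds 0)"
proof -
  have "eventually (\<lambda>z. eval_fps A z = F z) (nhds 0)" "eventually (\<lambda>z. eval_fps A z = G z) (nhds 0)"
    using assms by (auto simp: has_fps_expansion_def)
  then show ?thesis by eventually_elim auto
qed

text \<open>Identity principle. The conclusion holds on punctured neighbourhoods only, because
  \<open>meromorphic_on\<close> leaves the values at isolated points free. The difference either
  vanishes off a sparse set or avoids \<open>0\<close> off a sparse set, and the common expansion at
  \<open>0\<close> rules out the latter.\<close>

lemma meromorphic_fps_unique:
  assumes "F meromorphic_on S" "G meromorphic_on S" "open S" "connected S" "0 \<in> S"
    and "F has_fps_expansion A" "G has_fps_expansion A" and "z \<in> S"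
  shows "eventually (\<lambda>w. F w = G w) (at z)"
proof -
  have mero: "(\<lambda>z. F z - G z) meromorphic_on S"
    using assms by (intro meromorphic_intros)
  have ev0: "eventually (\<lambda>w. F w - G w = 0) (at 0)"
    using has_fps_expansion_imp_eventually_eq[OF assms(6,7)]
    by (auto simp: eventually_at_filter elim: eventually_mono)
  have "eventually (\<lambda>w. F w - G w = 0) (cosparse S)"
  proof (rule ccontr)
    assume "\<not> ?thesis"
    then have "eventually (\<lambda>w. F w - G w \<noteq> 0) (cosparse S)"
      using meromorphic_imp_constant_or_avoid[OF mero assms(3,4)] by blast
    then have "eventually (\<lambda>w. F w - G w \<noteq> 0) (at 0)"
      using assms(3,5) by (auto simp: eventually_cosparse_open_eq)
    with ev0 have "eventually (\<lambda>w::complex. False) (at 0)" by eventually_elim auto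
    then show False by simp
  qed
  then show ?thesis using assms(3,8) by (auto simp: eventually_cosparse_open_eq)
qed

text \<open>After \<open>remove_sings\<close> the continuations to different discs agree at every
  common point, so they can be patched together pointwise.\<close>

lemma meromorphic_fps_glue:
  assumes "\<And>R. R > 0 \<Longrightarrow> meromorphic_fps (ball 0 R) A"
  shows "meromorphic_fps UNIV A"
proof -
  have "\<exists>F. F meromorphic_on (ball 0 (real n + 1)) \<and> F has_fps_expansion A" for n :: nat
    using assms[of "real n + 1"] unfolding meromorphic_fps_def by simp
  then obtain F where F: "\<And>n::nat. F n meromorphic_on (ball 0 (real n + 1))"
      "\<And>n. F n has_fps_expansion A"
    by metis
  \<comment> \<open>The disc of radius \<open>nat \<lceil>norm z\<rceil> + 1\<close> is one that
    certainly contains \<open>z\<close>; by \<open>agree\<close> every other disc containing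
    \<open>z\<close> gives the same value.\<close>
  define G where "G z = remove_sings (F (nat \<lceil>norm z\<rceil>)) z" for z
  have agree: "remove_sings (F n) z = remove_sings (F k) z"
    if "norm z < real n + 1" "norm z < real k + 1" for n k z
  proof (rule remove_sings_cong)
    define R where "R = min (real n + 1) (real k + 1)"
    show "eventually (\<lambda>w. F n w = F k w) (at z)"
      by (rule meromorphic_fps_unique[of _ "ball 0 R" _ A])
         (use that in \<open>auto simp: R_def intro!: meromorphic_on_subset[OF F(1)] F(2)\<close>)
  qed simp
  have G: "G z = remove_sings (F n) z" if "norm z < real n + 1" for n z
    unfolding G_def by (rule agree) (use that in linarith)+
  have ev: "eventually (\<lambda>w. G w = remove_sings (F n) w) (nhds z)" if "norm z < real n + 1" for n z
  proof -
    have "eventually (\<lambda>w. w \<in> ball 0 (real n + 1)) (nhds z)"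
      using that by (intro eventually_nhds_in_open) auto
    then show ?thesis by eventually_elim (auto intro: G)
  qed
  have "G meromorphic_on UNIV"
  proof (subst meromorphic_on_meromorphic_at, safe)
    fix z :: complex
    define n where "n = nat \<lceil>norm z\<rceil>"
    have n: "norm z < real n + 1" unfolding n_def by linarith
    have "remove_sings (F n) meromorphic_on {z}"
      by (rule meromorphic_on_subset[OF remove_sings_meromorphic[OF F(1)[of n]]]) (use n in auto)
    moreover have "eventually (\<lambda>w. G w = remove_sings (F n) w) (at z)"
      using ev[OF n] by (auto simp: eventually_at_filter elim: eventually_mono)
    ultimately show "G meromorphic_on {z}"
      by (subst meromorphic_on_cong[of _ _ "remove_sings (F n)" "{z}"]) auto
  qed
  moreover have "G has_fps_expansion A"
  proof -
    have "F 0 analytic_on {0}"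
      using F(2) has_fps_expansion_imp_analytic_0 by blast
    then have "eventually (\<lambda>w. remove_sings (F 0) w = F 0 w) (nhds 0)"
      by (rule eventually_remove_sings_eq_nhds)
    with ev[of 0 0] have "eventually (\<lambda>w. G w = F 0 w) (nhds 0)"
      by (auto elim: eventually_elim2)
    then show ?thesis
      using F(2)[of 0] has_fps_expansion_cong by blast
  qed
  ultimately show ?thesis unfolding meromorphic_fps_def by blast
qed

text \<open>Regularity at \<open>p\<close> is stated as analyticity of the continuation and not as
  absence of a pole, since analyticity passes directly to sums and products.\<close>

definition meromorphic_fps_regular :: "complex \<Rightarrow> complex fps \<Rightarrow> bool" where
  "meromorphic_fps_regular p A \<longleftrightarrow>
     (\<exists>F. F meromorphic_on UNIV \<and> F analytic_on {p} \<and> F has_fps_expansion A)"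

lemma meromorphic_fps_regular_add:
  "meromorphic_fps_regular p A \<Longrightarrow> meromorphic_fps_regular p B \<Longrightarrow> meromorphic_fps_regular p (A + B)"
  unfolding meromorphic_fps_regular_def
  by (blast intro: meromorphic_on_add has_fps_expansion_add analytic_on_add)

lemma meromorphic_fps_regular_mult:
  "meromorphic_fps_regular p A \<Longrightarrow> meromorphic_fps_regular p B \<Longrightarrow> meromorphic_fps_regular p (A * B)"
  unfolding meromorphic_fps_regular_def
  by (blast intro: meromorphic_on_mult has_fps_expansion_mult analytic_on_mult)

lemma meromorphic_fps_regular_const: "meromorphic_fps_regular p (fps_const c)"
  unfolding meromorphic_fps_regular_def by (intro exI[of _ "\<lambda>_. c"]) auto

lemma meromorphic_fps_regular_X: "meromorphic_fps_regular p fps_X"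
  unfolding meromorphic_fps_regular_def
  by (intro exI[of _ "\<lambda>x. x"]) (auto intro: fps_expansion_intros analytic_on_imp_meromorphic_on)

text \<open>The factor \<open>1 / (1 - \<mu> * z)\<close> can have a pole only where
  \<open>\<mu> * z = 1\<close>, which the last hypothesis keeps away from \<open>p\<close>.\<close>

lemma meromorphic_fps_regular_div_linear:
  assumes "meromorphic_fps_regular p C" "A * (1 - fps_const \<mu> * fps_X) = C" "\<mu> * p \<noteq> 1"
  shows "meromorphic_fps_regular p A"
proof -
  obtain F where F: "F meromorphic_on UNIV" "F analytic_on {p}" "F has_fps_expansion C"
    using assms(1) unfolding meromorphic_fps_regular_def by blast
  define Q where "Q = 1 - fps_const \<mu> * fps_X"
  have "A = A * (Q * inverse Q)"
    by (subst inverse_mult_eq_1') (auto simp: Q_def)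
  also have "\<dots> = C * inverse Q" using assms(2) unfolding Q_def[symmetric] by (simp add: mult.assoc[symmetric])
  finally have A: "A = C * inverse Q" .
  have "(\<lambda>z. F z * inverse (1 - \<mu> * z)) has_fps_expansion C * inverse Q"
    unfolding Q_def by (intro fps_expansion_intros F) auto
  moreover have "(\<lambda>z. F z * inverse (1 - \<mu> * z)) analytic_on {p}"
    using assms(3) by (intro analytic_intros F) auto
  moreover have "(\<lambda>z. F z * inverse (1 - \<mu> * z)) meromorphic_on UNIV"
    by (intro meromorphic_intros F)
  ultimately show ?thesis
    unfolding meromorphic_fps_regular_def A by blast
qed

text \<open>Return from formal series to functions. \<open>remove_sings\<close> fixes the values at
  isolated points and changes nothing near \<open>0\<close> and \<open>p\<close>, where the
  continuation is already analytic.\<close>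

lemma meromorphic_fps_regular_nicely:
  assumes "meromorphic_fps_regular p (Abs_fps a)"
  shows "\<exists>r>0. \<exists>F. (\<forall>z. norm z < r \<longrightarrow> (\<lambda>n. z ^ n * a n) sums F z) \<and>
           F nicely_meromorphic_on UNIV \<and> \<not> is_pole F p"
proof -
  obtain F where F: "F meromorphic_on UNIV" "F analytic_on {p}" "F has_fps_expansion (Abs_fps a)"
    using assms unfolding meromorphic_fps_regular_def by blast
  have "F analytic_on {0}"
    using F(3) has_fps_expansion_imp_analytic_0 by blast
  then have "eventually (\<lambda>w. remove_sings F w = F w) (nhds 0)"
    by (rule eventually_remove_sings_eq_nhds)
  moreover have "eventually (\<lambda>w. eval_fps (Abs_fps a) w = F w) (nhds 0)"
    using F(3) by (auto simp: has_fps_expansion_def)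
  moreover have "eventually (\<lambda>w. w \<in> eball 0 (fps_conv_radius (Abs_fps a))) (nhds 0)"
    using F(3) by (intro eventually_nhds_in_open) (auto simp: has_fps_expansion_def zero_ereal_def)
  ultimately have "eventually (\<lambda>w. (\<lambda>n. w ^ n * a n) sums remove_sings F w) (nhds 0)"
  proof eventually_elim
    case (elim w)
    have "summable (\<lambda>n. fps_nth (Abs_fps a) n * w ^ n)"
      using elim(3) by (intro summable_fps) (auto simp: eball_def)
    then have "(\<lambda>n. a n * w ^ n) sums eval_fps (Abs_fps a) w"
      by (simp add: eval_fps_def summable_sums)
    then show ?case using elim by (simp add: mult.commute)
  qed
  then obtain r where "r > 0" "\<And>w. norm w < r \<Longrightarrow> (\<lambda>n. w ^ n * a n) sums remove_sings F w"
    by (auto simp: eventually_nhds_metric)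
  moreover have "\<not> is_pole (remove_sings F) p"
  proof -
    have "eventually (\<lambda>w. remove_sings F w = F w) (nhds p)"
      by (rule eventually_remove_sings_eq_nhds[OF F(2)])
    then have "is_pole (remove_sings F) p \<longleftrightarrow> is_pole F p"
      by (intro is_pole_cong) (auto simp: eventually_at_filter elim: eventually_mono)
    then show ?thesis using F(2) analytic_at_imp_no_pole by blast
  qed
  ultimately show ?thesis
    using remove_sings_nicely_meromorphic[OF F(1)] by blast
qed

text \<open>Once the coefficients are below \<open>e / 2\<close>, the tail of the series is at most
  \<open>(e / 2) / (1 - x)\<close>, which the factor \<open>1 - x\<close> absorbs. The initial
  segment is bounded by \<open>K\<close> and is killed by the same factor as \<open>x\<close> tends
  to \<open>1\<close>.\<close>

lemma power_series_Abel_null: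
  fixes a :: "nat \<Rightarrow> complex"
  assumes "a \<longlonglongrightarrow> 0" "\<And>x. 0 \<le> x \<Longrightarrow> x < 1 \<Longrightarrow> (\<lambda>n. a n * of_real x ^ n) sums s x"
  shows "((\<lambda>x. of_real (1 - x) * s x) \<longlongrightarrow> 0) (at_left (1::real))"
proof (rule tendstoI)
  fix e :: real assume "e > 0"
  have "eventually (\<lambda>n. norm (a n) < e / 2) sequentially"
    using tendstoD[OF assms(1), of "e/2"] \<open>e > 0\<close> by simp
  then obtain N where N: "\<And>n. n \<ge> N \<Longrightarrow> norm (a n) < e / 2"
    by (auto simp: eventually_sequentially)
  define K where "K = (\<Sum>n<N. norm (a n))"
  have bound: "norm (of_real (1 - x) * s x) \<le> (1 - x) * K + e / 2" if x: "0 \<le> x" "x < 1" for x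
  proof -
    have K0: "K \<ge> 0" by (simp add: K_def sum_nonneg)
    have "s x = (\<Sum>n. a (n + N) * of_real x ^ (n + N)) + (\<Sum>n<N. a n * of_real x ^ n)"
      using assms(2)[OF x] suminf_split_initial_segment[of "\<lambda>n. a n * of_real x ^ n" N]
      by (auto simp: sums_iff)
    moreover have "norm (\<Sum>n<N. a n * of_real x ^ n) \<le> K"
    proof -
      have "norm (a n * of_real x ^ n) \<le> norm (a n)" for n
        using x by (simp add: norm_mult norm_power mult_left_le power_le_one)
      then show ?thesis unfolding K_def by (intro sum_norm_le) auto
    qed
    moreover have "norm (\<Sum>n. a (n + N) * of_real x ^ (n + N)) \<le> (\<Sum>n. (e/2) * x ^ n)"
    proof (rule norm_suminf_le)
      fix n
      have "norm (a (n + N)) * x ^ (n + N) \<le> (e/2) * x ^ n"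
      proof (rule mult_mono)
        show "x ^ (n + N) \<le> x ^ n" using x by (intro power_decreasing) auto
      qed (use N[of "n+N"] x \<open>e > 0\<close> in auto)
      then show "norm (a (n + N) * of_real x ^ (n + N)) \<le> (e/2) * x ^ n"
        using x by (simp add: norm_mult norm_power)
    next
      show "summable (\<lambda>n. (e/2) * x ^ n)" using x by (intro summable_mult summable_geometric) auto
    qed
    moreover have "(\<Sum>n. (e/2) * x ^ n) = (e/2) / (1 - x)"
      using x by (subst suminf_mult) (auto simp: suminf_geometric)
    ultimately have "norm (s x) \<le> (e/2) / (1 - x) + K"
      using norm_triangle_mono by (metis (no_types, lifting))
    then have "(1 - x) * norm (s x) \<le> (1 - x) * ((e/2) / (1 - x) + K)"
      using x by (intro mult_left_mono) auto
    also have "\<dots> = (1 - x) * K + e / 2" using x by (simp add: field_simps)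
    finally show ?thesis using x by (simp add: norm_mult del: of_real_diff)
  qed
  have "((\<lambda>x. (1 - x) * K) \<longlongrightarrow> (1 - 1) * K) (at_left (1::real))"
    by (intro tendsto_intros)
  then have "eventually (\<lambda>x. (1 - x) * K < e / 2) (at_left 1)"
    using \<open>e > 0\<close> by (intro order_tendstoD(2)[of _ 0]) auto
  moreover have "eventually (\<lambda>x. 0 \<le> x \<and> x < (1::real)) (at_left 1)"
    unfolding eventually_at_left_field by (intro exI[of _ 0]) auto
  ultimately show "eventually (\<lambda>x. dist (of_real (1 - x) * s x) 0 < e) (at_left 1)"
    by eventually_elim (use bound in fastforce)
qed

text \<open>A pole at \<open>1\<close> would keep \<open>(1 - x) * norm (F x)\<close> away from
  \<open>0\<close> as \<open>x\<close> increases to \<open>1\<close>, against the Abel estimate.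
  Null coefficients are bounded, so the series represents the continuation in the whole unit disc
  and the estimate does apply to it.\<close>

lemma meromorphic_fps_regular_if_coeffs_null:
  assumes "meromorphic_fps UNIV (Abs_fps a)" "a \<longlonglongrightarrow> 0"
  shows "meromorphic_fps_regular 1 (Abs_fps a)"
proof -
  obtain F0 where F0: "F0 meromorphic_on UNIV" "F0 has_fps_expansion (Abs_fps a)"
    using assms(1) unfolding meromorphic_fps_def by blast
  define F where "F = remove_sings F0"
  have nice: "F nicely_meromorphic_on UNIV"
    unfolding F_def by (rule remove_sings_nicely_meromorphic[OF F0(1)])
  have mero: "F meromorphic_on UNIV" using nice by (auto simp: nicely_meromorphic_on_def)
  have "F0 analytic_on {0}"
    using F0(2) has_fps_expansion_imp_analytic_0 by blast
  then have "eventually (\<lambda>w. F w = F0 w) (nhds 0)"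
    unfolding F_def by (rule eventually_remove_sings_eq_nhds)
  then have F: "F has_fps_expansion (Abs_fps a)"
    using F0(2) has_fps_expansion_cong by blast
  have "Bseq a" using assms(2) convergentI convergent_imp_Bseq by blast
  then obtain B where B: "B > 0" "\<And>n. norm (a n) \<le> B" by (auto simp: Bseq_def)
  define G where "G = eval_fps (Abs_fps a)"
  have sums: "(\<lambda>n. a n * z ^ n) sums G z" if "norm z < 1" for z
  proof -
    have "summable (\<lambda>n. a n * z ^ n)"
    proof (rule summable_comparison_test')
      show "summable (\<lambda>n. B * norm z ^ n)"
        using that by (intro summable_mult summable_geometric) auto
      show "norm (a n * z ^ n) \<le> B * norm z ^ n" for n
        using B by (auto simp: norm_mult norm_power intro!: mult_right_mono)
    qed
    then show ?thesis by (simp add: G_def eval_fps_def summable_sums)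
  qed
  have rad: "fps_conv_radius (Abs_fps a) \<ge> 1"
    unfolding fps_conv_radius_def
    by (rule conv_radius_geI_ex') (use sums in \<open>auto simp: sums_iff\<close>)
  have Ghol: "G holomorphic_on ball 0 1"
    unfolding G_def using rad
    by (intro holomorphic_on_eval_fps) (auto simp: in_eball_iff eball_def one_ereal_def intro: less_le_trans[of _ "ereal 1"])
  then have Gmero: "G meromorphic_on ball 0 1"
    using analytic_on_open analytic_on_imp_meromorphic_on by blast
  have Gexp: "G has_fps_expansion (Abs_fps a)"
    unfolding G_def using less_le_trans[OF _ rad, of 0] by (intro eval_fps_has_fps_expansion) simp
  have FG: "F z = G z" if "norm z < 1" for z
  proof -
    have "eventually (\<lambda>w. F0 w = G w) (at z)"
      by (rule meromorphic_fps_unique[OF _ Gmero _ _ _ F0(2) Gexp])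
         (use that F0(1) in \<open>auto intro: meromorphic_on_subset\<close>)
    then have "F z = remove_sings G z"
      unfolding F_def by (rule remove_sings_cong) simp
    also have "\<dots> = G z"
      using Ghol that by (intro remove_sings_at_analytic) (auto simp: analytic_on_open intro: analytic_on_subset[of _ "ball 0 1"])
    finally show ?thesis .
  qed
  have lim: "((\<lambda>x. of_real (1 - x) * F (of_real x)) \<longlongrightarrow> 0) (at_left (1::real))"
  proof (rule power_series_Abel_null[OF assms(2)])
    fix x :: real assume "0 \<le> x" "x < 1"
    then show "(\<lambda>n. a n * of_real x ^ n) sums F (of_real x)"
      using sums[of "of_real x"] FG[of "of_real x"] by simp
  qed
  have "\<not> is_pole F 1"
  proof
    assume pole: "is_pole F 1"
    have iso: "isolated_singularity_at F 1"
      using mero unfolding meromorphic_on_altdef by auto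
    then obtain e where e: "e > 0" "F analytic_on ball 1 e - {1}"
      unfolding isolated_singularity_at_def by blast
    have hol: "F holomorphic_on ball 1 e - {1}"
      using e(2) by (rule analytic_imp_holomorphic)
    define n where "n = nat (- zorder F 1)"
    obtain h r where "r > 0" and h: "h 1 \<noteq> 0" "h holomorphic_on cball 1 r" and n: "n > 0"
      and eq: "\<And>w. w \<in> cball 1 r - {1} \<Longrightarrow> F w = h w / (w - 1) ^ n"
      using zorder_exist_pole[OF hol open_ball _ pole] e(1) unfolding n_def by auto
    have "isCont h 1"
      using holomorphic_on_imp_continuous_on[OF h(2)] \<open>r > 0\<close>
      by (intro continuous_on_interior[of "cball 1 r"]) auto
    then have "((\<lambda>x. h (of_real x)) \<longlongrightarrow> h 1) (at_left (1::real))"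
      by (intro isCont_tendsto_compose[of _ h]) (auto intro!: tendsto_eq_intros)
    moreover have "((\<lambda>x. h (of_real x)) \<longlongrightarrow> 0) (at_left (1::real))"
    proof (rule Lim_null_comparison[OF _ tendsto_norm_zero[OF lim]])
      have "eventually (\<lambda>x. max 0 (1 - r) < x \<and> x < (1::real)) (at_left 1)"
        unfolding eventually_at_left_field using \<open>r > 0\<close> by (intro exI[of _ "max 0 (1 - r)"]) auto
      then show "\<forall>\<^sub>F x in at_left 1. norm (h (of_real x)) \<le> norm (of_real (1 - x) * F (of_real x))"
      proof eventually_elim
        case (elim x)
        have "norm (1 - complex_of_real x) = 1 - x"
          using elim by (metis abs_of_nonneg diff_ge_0_iff_ge less_imp_le norm_of_real of_real_1 of_real_diff)
        moreover from this have "norm (complex_of_real x - 1) = 1 - x" by (simp add: norm_minus_commute)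
        ultimately have "complex_of_real x \<in> cball 1 r - {1}"
          using elim by (auto simp: dist_norm)
        from eq[OF this] have "h (of_real x) = F (of_real x) * (of_real x - 1) ^ n"
          using elim by simp
        then have "norm (h (of_real x)) = norm (F (of_real x)) * (1 - x) ^ n"
          using \<open>norm (complex_of_real x - 1) = 1 - x\<close> by (simp add: norm_mult norm_power)
        \<comment> \<open>Any order \<open>n \<ge> 1\<close> reduces to a simple pole, since
          \<open>1 - x\<close> is at most \<open>1\<close>.\<close>
        also have "(1 - x) ^ n \<le> (1 - x) ^ 1"
          using elim n by (intro power_decreasing) auto
        finally have "norm (h (of_real x)) \<le> norm (F (of_real x)) * (1 - x)"
          by (simp add: mult_left_mono)
        then show ?case
          using \<open>norm (1 - complex_of_real x) = 1 - x\<close>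
          by (simp add: norm_mult mult.commute)
      qed
    qed
    ultimately have "h 1 = 0"
      using tendsto_unique trivial_limit_at_left_real by blast
    then show False using h(1) by blast
  qed
  then have "F analytic_on {1}"
    using nice by (intro nicely_meromorphic_on_imp_analytic_at[of _ UNIV]) auto
  with mero F show ?thesis unfolding meromorphic_fps_regular_def by blast
qed

subsection \<open>Resolvents of operators approximable by finite rank\<close>

lemma meromorphic_fps_geometric_bound:
  fixes a :: "nat \<Rightarrow> complex"
  assumes "\<And>n. norm (a n) \<le> K * q ^ n" "0 \<le> q" "q * R < 1" "R > 0"
  shows "meromorphic_fps (ball 0 R) (Abs_fps a)"
proof -
  \<comment> \<open>The condition \<open>q * R < 1\<close> leaves room for a larger radius, half way
    between \<open>R\<close> and \<open>1 / q\<close>, so the closed disc of radius \<open>R\<close>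
    lies inside the disc of convergence.\<close>
  obtain R' where R': "R < R'" "q * R' < 1"
  proof (cases "q = 0")
    case True
    then show ?thesis using that[of "R + 1"] by auto
  next
    case False
    then show ?thesis using assms that[of "(R + 1 / q) / 2"] by (auto simp: field_simps)
  qed
  have "summable (\<lambda>n. a n * z ^ n)" if "norm z < R'" for z
  proof (rule summable_comparison_test')
    have "q * norm z < 1"
      using that R'(2) assms(2) by (metis less_imp_le mult_left_mono order.strict_trans1)
    then show "summable (\<lambda>n. K * (q * norm z) ^ n)"
      using assms(2) by (intro summable_mult summable_geometric) auto
    show "norm (a n * z ^ n) \<le> K * (q * norm z) ^ n" for n
      using mult_right_mono[OF assms(1)[of n], of "norm z ^ n"]
      by (simp add: norm_mult norm_power power_mult_distrib mult.assoc)
  qed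
  then have *: "summable (\<lambda>n. a n * of_real r ^ n)" if "0 < r" "r < R'" for r :: real
    using that by simp
  have rad: "fps_conv_radius (Abs_fps a) \<ge> R'"
    unfolding fps_conv_radius_def by (rule conv_radius_geI_ex') (use * in simp)
  define G where "G = eval_fps (Abs_fps a)"
  have "G holomorphic_on ball 0 R"
    unfolding G_def
  proof (intro holomorphic_on_eval_fps subsetI)
    fix z :: complex assume "z \<in> ball 0 R"
    then have "ereal (norm z) < ereal R'" using R' by simp
    from less_le_trans[OF this rad] show "z \<in> eball 0 (fps_conv_radius (Abs_fps a))"
      by (simp add: in_eball_iff)
  qed
  then have "G meromorphic_on ball 0 R"
    using analytic_on_open analytic_on_imp_meromorphic_on by blast
  moreover have "0 < fps_conv_radius (Abs_fps a)"
    using less_le_trans[OF _ rad, of 0] R' assms(4) by simp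
  then have "G has_fps_expansion (Abs_fps a)"
    unfolding G_def by (rule eval_fps_has_fps_expansion)
  ultimately show ?thesis unfolding meromorphic_fps_def by blast
qed

definition linear_functionals_on :: "('a \<Rightarrow> complex) set \<Rightarrow> (('a \<Rightarrow> complex) \<Rightarrow> complex) set" where
  "linear_functionals_on E = {\<phi>. (\<forall>v\<in>E. \<forall>w\<in>E. \<phi> (\<lambda>z. v z + w z) = \<phi> v + \<phi> w) \<and>
     (\<forall>c. \<forall>v\<in>E. \<phi> (\<lambda>z. c * v z) = c * \<phi> v)}"

locale function_space =
  fixes E :: "('a \<Rightarrow> complex) set"
  assumes add_closed: "v \<in> E \<Longrightarrow> w \<in> E \<Longrightarrow> (\<lambda>z. v z + w z) \<in> E"
    and scale_closed: "v \<in> E \<Longrightarrow> (\<lambda>z. c * v z) \<in> E"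
begin

definition linear_on :: "(('a \<Rightarrow> complex) \<Rightarrow> ('a \<Rightarrow> complex)) \<Rightarrow> bool" where
  "linear_on S \<longleftrightarrow> (\<forall>v\<in>E. S v \<in> E) \<and>
     (\<forall>v\<in>E. \<forall>w\<in>E. S (\<lambda>z. v z + w z) = (\<lambda>z. S v z + S w z)) \<and>
     (\<forall>c. \<forall>v\<in>E. S (\<lambda>z. c * v z) = (\<lambda>z. c * S v z))"

lemma linear_on_funpow_in: "linear_on S \<Longrightarrow> v \<in> E \<Longrightarrow> (S ^^ n) v \<in> E"
  by (induction n) (auto simp: linear_on_def)

lemma linear_on_rank_one:
  assumes "linear_on S" "\<kappa> \<in> linear_functionals_on E" "u \<in> E"
  shows "linear_on (\<lambda>v z. S v z + \<kappa> v * u z)"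
  unfolding linear_on_def
proof (intro conjI ballI allI)
  note S = assms(1)[unfolded linear_on_def] and \<kappa> = assms(2)[unfolded linear_functionals_on_def]
  fix v assume v: "v \<in> E"
  have "S v \<in> E" using S v by blast
  then show "(\<lambda>z. S v z + \<kappa> v * u z) \<in> E" by (intro add_closed scale_closed assms(3))
  fix c
  have "S (\<lambda>z. c * v z) = (\<lambda>z. c * S v z)" "\<kappa> (\<lambda>z. c * v z) = c * \<kappa> v"
    using S \<kappa> v by blast+
  then show "(\<lambda>z. S (\<lambda>z. c * v z) z + \<kappa> (\<lambda>z. c * v z) * u z) = (\<lambda>z. c * (S v z + \<kappa> v * u z))"
    by (simp add: distrib_left mult.assoc)
next
  note S = assms(1)[unfolded linear_on_def] and \<kappa> = assms(2)[unfolded linear_functionals_on_def]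
  fix v w assume vw: "v \<in> E" "w \<in> E"
  have "S (\<lambda>z. v z + w z) = (\<lambda>z. S v z + S w z)" "\<kappa> (\<lambda>z. v z + w z) = \<kappa> v + \<kappa> w"
    using S \<kappa> vw by blast+
  then show "(\<lambda>z. S (\<lambda>z. v z + w z) z + \<kappa> (\<lambda>z. v z + w z) * u z) =
      (\<lambda>z. S v z + \<kappa> v * u z + (S w z + \<kappa> w * u z))"
    by (simp add: algebra_simps)
qed

lemma linear_functionals_on_compose:
  "linear_on S \<Longrightarrow> \<phi> \<in> linear_functionals_on E \<Longrightarrow> (\<lambda>v. \<phi> (S v)) \<in> linear_functionals_on E"
  unfolding linear_on_def linear_functionals_on_def by auto

text \<open>Duhamel expansion of the powers of a rank one perturbation, sorted by the last time
  \<open>k\<close> at which the rank one part acts: before it the perturbed map is iterated, after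
  it only \<open>S\<close>. The functional is kept arbitrary because the induction replaces
  \<open>\<phi>\<close> by \<open>\<phi>\<close> composed with \<open>S\<close>.\<close>

lemma funpow_rank_one:
  assumes S: "linear_on S" and \<kappa>: "\<kappa> \<in> linear_functionals_on E" and u: "u \<in> E" and v: "v \<in> E"
    and \<phi>: "\<phi> \<in> linear_functionals_on E"
  defines "S' \<equiv> (\<lambda>v z. S v z + \<kappa> v * u z)"
  shows "\<phi> ((S' ^^ n) v) = \<phi> ((S ^^ n) v) + (\<Sum>k<n. \<kappa> ((S' ^^ k) v) * \<phi> ((S ^^ (n - 1 - k)) u))"
  using \<phi>
proof (induction n arbitrary: \<phi>)
  case (Suc n)
  have S': "linear_on S'" unfolding S'_def by (rule linear_on_rank_one[OF S \<kappa> u])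
  define x where "x = (S' ^^ n) v"
  have x: "x \<in> E" unfolding x_def by (rule linear_on_funpow_in[OF S' v])
  have Sx: "S x \<in> E" using S x by (auto simp: linear_on_def)
  have "\<phi> ((S' ^^ Suc n) v) = \<phi> (\<lambda>z. S x z + \<kappa> x * u z)"
    by (simp add: x_def S'_def)
  also have "\<dots> = \<phi> (S x) + \<kappa> x * \<phi> u"
  proof -
    have "\<phi> (\<lambda>z. S x z + \<kappa> x * u z) = \<phi> (S x) + \<phi> (\<lambda>z. \<kappa> x * u z)"
      using Suc.prems Sx scale_closed[OF u, of "\<kappa> x"] unfolding linear_functionals_on_def by fast
    moreover have "\<phi> (\<lambda>z. \<kappa> x * u z) = \<kappa> x * \<phi> u"
      using Suc.prems u unfolding linear_functionals_on_def by fast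
    ultimately show ?thesis by simp
  qed
  finally have step: "\<phi> ((S' ^^ Suc n) v) = \<phi> (S x) + \<kappa> x * \<phi> u" .
  have IH: "\<phi> (S x) = \<phi> (S ((S ^^ n) v)) + (\<Sum>k<n. \<kappa> ((S' ^^ k) v) * \<phi> (S ((S ^^ (n - 1 - k)) u)))"
    using Suc.IH[OF linear_functionals_on_compose[OF S Suc.prems]] by (simp only: x_def)
  have shift: "(\<Sum>k<n. \<kappa> ((S' ^^ k) v) * \<phi> (S ((S ^^ (n - 1 - k)) u))) =
      (\<Sum>k<n. \<kappa> ((S' ^^ k) v) * \<phi> ((S ^^ (Suc n - 1 - k)) u))"
  proof (rule sum.cong)
    fix k assume "k \<in> {..<n}"
    then have *: "Suc n - 1 - k = Suc (n - 1 - k)" by auto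
    show "\<kappa> ((S' ^^ k) v) * \<phi> (S ((S ^^ (n - 1 - k)) u)) =
        \<kappa> ((S' ^^ k) v) * \<phi> ((S ^^ (Suc n - 1 - k)) u)"
      unfolding * by (simp only: funpow.simps o_apply)
  qed simp
  have "\<kappa> x * \<phi> u = \<kappa> ((S' ^^ n) v) * \<phi> ((S ^^ (Suc n - 1 - n)) u)" by (simp add: x_def)
  then show ?case
    unfolding step IH shift sum.lessThan_Suc by (simp only: funpow.simps o_apply add.assoc)
qed simp

text \<open>The series are the matrix coefficients of the resolvent \<open>(1 - \<lambda> S)\<close>
  to the power \<open>-1\<close>, so all meromorphic functions involved are scalar.\<close>

definition resolvent_meromorphic :: "complex set \<Rightarrow> (('a \<Rightarrow> complex) \<Rightarrow> complex) set \<Rightarrow>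
    (('a \<Rightarrow> complex) \<Rightarrow> ('a \<Rightarrow> complex)) \<Rightarrow> bool" where
  "resolvent_meromorphic D \<Lambda> S \<longleftrightarrow>
     (\<forall>v\<in>E. \<forall>\<phi>\<in>\<Lambda>. meromorphic_fps D (Abs_fps (\<lambda>n. \<phi> ((S ^^ n) v))))"

text \<open>A scalar version of the Sherman--Morrison formula for the resolvent of a rank one perturbation.\<close>

lemma resolvent_meromorphic_rank_one:
  assumes S: "linear_on S" and \<kappa>: "\<kappa> \<in> \<Lambda>" and u: "u \<in> E" and \<Lambda>: "\<Lambda> \<subseteq> linear_functionals_on E"
    and res: "resolvent_meromorphic D \<Lambda> S"
  shows "resolvent_meromorphic D \<Lambda> (\<lambda>v z. S v z + \<kappa> v * u z)"
  unfolding resolvent_meromorphic_def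
proof (intro ballI)
  fix v \<phi> assume v: "v \<in> E" and \<phi>: "\<phi> \<in> \<Lambda>"
  define S' where "S' = (\<lambda>v z. S v z + \<kappa> v * u z)"
  define G where "G \<phi> v = Abs_fps (\<lambda>n. \<phi> ((S ^^ n) v))" for \<phi> :: "('a \<Rightarrow> complex) \<Rightarrow> complex" and v
  define G' where "G' \<phi> = Abs_fps (\<lambda>n. \<phi> ((S' ^^ n) v))" for \<phi> :: "('a \<Rightarrow> complex) \<Rightarrow> complex"
  have mero: "meromorphic_fps D (G \<phi> w)" if "\<phi> \<in> \<Lambda>" "w \<in> E" for \<phi> w
    using res that by (auto simp: resolvent_meromorphic_def G_def)
  have G': "G' \<phi> = G \<phi> v + fps_X * (G' \<kappa> * G \<phi> u)" if "\<phi> \<in> \<Lambda>" for \<phi>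
  proof (rule fps_ext)
    fix n
    have \<phi>': "\<phi> \<in> linear_functionals_on E" using that \<Lambda> by blast
    have \<kappa>': "\<kappa> \<in> linear_functionals_on E" using \<kappa> \<Lambda> by blast
    show "fps_nth (G' \<phi>) n = fps_nth (G \<phi> v + fps_X * (G' \<kappa> * G \<phi> u)) n"
    proof (cases n)
      case (Suc k)
      have "fps_nth (fps_X * (G' \<kappa> * G \<phi> u)) n = fps_nth (G' \<kappa> * G \<phi> u) k"
        using Suc by (simp only: fps_X_mult_nth) simp
      also have "\<dots> = (\<Sum>i\<le>k. \<kappa> ((S' ^^ i) v) * \<phi> ((S ^^ (k - i)) u))"
        by (simp only: fps_mult_nth atLeast0AtMost G'_def G_def fps_nth_Abs_fps)
      moreover have "\<phi> ((S' ^^ n) v) = \<phi> ((S ^^ n) v) + (\<Sum>i\<le>k. \<kappa> ((S' ^^ i) v) * \<phi> ((S ^^ (k - i)) u))"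
        using funpow_rank_one[OF S \<kappa>' u v \<phi>', of n] Suc
        unfolding S'_def by (simp only: lessThan_Suc_atMost diff_Suc_1)
      ultimately show ?thesis by (simp only: fps_add_nth) (simp add: G'_def G_def)
    qed (simp add: G'_def G_def)
  qed
  \<comment> \<open>The determinant of the perturbation relative to \<open>S\<close>. Its constant
    coefficient is \<open>1\<close>, which makes it invertible as a power series; its zeros account
    for the poles that the perturbation may create.\<close>
  define H where "H = 1 - fps_X * G \<kappa> u"
  have "G' \<kappa> * H = G \<kappa> v"
  proof -
    have "G' \<kappa> - fps_X * (G' \<kappa> * G \<kappa> u) = G \<kappa> v"
      by (subst (1) G'[OF \<kappa>]) simp
    then show ?thesis unfolding H_def by (simp add: algebra_simps)
  qed
  moreover have H0: "fps_nth H 0 \<noteq> 0" by (simp add: H_def)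
  ultimately have "G' \<kappa> = G \<kappa> v * inverse H"
    by (metis inverse_mult_eq_1' mult.assoc mult.right_neutral)
  moreover have "meromorphic_fps D H"
    unfolding H_def using meromorphic_fps_const[of D 1]
    by (intro meromorphic_fps_diff meromorphic_fps_mult meromorphic_fps_X mero \<kappa> u) auto
  ultimately have "meromorphic_fps D (G' \<kappa>)"
    using H0 by (auto intro!: meromorphic_fps_mult meromorphic_fps_inverse mero \<kappa> v)
  then have "meromorphic_fps D (G' \<phi>)"
    by (subst G'[OF \<phi>]) (intro meromorphic_fps_add meromorphic_fps_mult meromorphic_fps_X mero \<phi> u v)
  then show "meromorphic_fps D (Abs_fps (\<lambda>n. \<phi> (((\<lambda>v z. S v z + \<kappa> v * u z) ^^ n) v)))"
    by (simp add: G'_def S'_def)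
qed

lemma resolvent_meromorphic_finite_rank:
  assumes S: "linear_on S" and \<Lambda>: "\<Lambda> \<subseteq> linear_functionals_on E"
    and "\<And>l. l < (N::nat) \<Longrightarrow> \<kappa> l \<in> \<Lambda>" "\<And>l. l < N \<Longrightarrow> u l \<in> E"
    and res: "resolvent_meromorphic D \<Lambda> S"
  shows "linear_on (\<lambda>v z. S v z + (\<Sum>l<N. \<kappa> l v * u l z)) \<and>
    resolvent_meromorphic D \<Lambda> (\<lambda>v z. S v z + (\<Sum>l<N. \<kappa> l v * u l z))"
  using assms(3,4)
proof (induction N)
  case 0
  then show ?case using S res by simp
next
  case (Suc N)
  define S' where "S' = (\<lambda>v z. S v z + (\<Sum>l<N. \<kappa> l v * u l z))"
  have IH: "linear_on S'" "resolvent_meromorphic D \<Lambda> S'"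
    using Suc unfolding S'_def by auto
  have "(\<lambda>v z. S v z + (\<Sum>l<Suc N. \<kappa> l v * u l z)) = (\<lambda>v z. S' v z + \<kappa> N v * u N z)"
    by (simp add: S'_def add.assoc)
  then show ?case
    using linear_on_rank_one[OF IH(1), of "\<kappa> N" "u N"]
      resolvent_meromorphic_rank_one[OF IH(1) Suc.prems(1)[of N] Suc.prems(2)[of N] \<Lambda> IH(2)]
      Suc.prems \<Lambda> by auto
qed

text \<open>Boundedness for the supremum norm over \<open>V\<close>, expressed through arbitrary
  pointwise bounds \<open>B\<close> in place of a supremum.\<close>

definition bounded_functionals :: "'a set \<Rightarrow> (('a \<Rightarrow> complex) \<Rightarrow> complex) set" where
  "bounded_functionals V = {\<phi> \<in> linear_functionals_on E.
     \<exists>K. \<forall>v\<in>E. \<forall>B. (\<forall>z\<in>V. norm (v z) \<le> B) \<longrightarrow> norm (\<phi> v) \<le> K * B}"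

text \<open>Subtracting the finite rank part leaves an operator \<open>S\<close> that shrinks bounds
  on \<open>V\<close> by a factor less than \<open>1 / R\<close>. Its resolvent coefficients are
  analytic on the disc of radius \<open>R\<close>, and the finite rank part is put back one rank at
  a time.\<close>

theorem resolvent_meromorphic_if_approximable:
  assumes T: "linear_on T" and bdd: "\<And>v. v \<in> E \<Longrightarrow> bounded (v ` V)"
    and approx: "\<And>\<epsilon>. \<epsilon> > 0 \<Longrightarrow> \<exists>N \<kappa> u. (\<forall>l<N. \<kappa> l \<in> bounded_functionals V \<and> u l \<in> E) \<and>
        (\<forall>v\<in>E. \<forall>B. (\<forall>z\<in>V. norm (v z) \<le> B) \<longrightarrow>
           (\<forall>z\<in>V. norm (T v z - (\<Sum>l<(N::nat). \<kappa> l v * u l z)) \<le> \<epsilon> * B))"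
    and R: "R > 0"
  shows "resolvent_meromorphic (ball 0 R) (bounded_functionals V) T"
proof -
  \<comment> \<open>Half of the critical value \<open>1 / R\<close>, so that a geometric series of
    ratio \<open>\<epsilon>\<close> converges beyond radius \<open>R\<close>.\<close>
  define \<epsilon> where "\<epsilon> = 1 / (2 * R)"
  have \<epsilon>: "\<epsilon> > 0" "\<epsilon> * R < 1" using R by (auto simp: \<epsilon>_def)
  obtain N \<kappa> u where ku: "\<And>l. l < N \<Longrightarrow> \<kappa> l \<in> bounded_functionals V" "\<And>l. l < N \<Longrightarrow> u l \<in> E"
    and app: "\<And>v B z. v \<in> E \<Longrightarrow> (\<forall>z\<in>V. norm (v z) \<le> B) \<Longrightarrow> z \<in> V \<Longrightarrow>
           norm (T v z - (\<Sum>l<(N::nat). \<kappa> l v * u l z)) \<le> \<epsilon> * B"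
    using approx[OF \<epsilon>(1)] by blast
  have sub: "bounded_functionals V \<subseteq> linear_functionals_on E" by (auto simp: bounded_functionals_def)
  define S where "S = (\<lambda>v z. T v z - (\<Sum>l<(N::nat). \<kappa> l v * u l z))"
  have S: "linear_on S"
  proof -
    have "linear_on (\<lambda>v z. T v z + (\<Sum>l<(n::nat). \<kappa> l v * (- u l z)))" if "n \<le> N" for n
      using that
    proof (induction n)
      case 0
      then show ?case using T by simp
    next
      case (Suc n)
      have "(\<lambda>z. - u n z) \<in> E" using scale_closed[OF ku(2)[of n], of "-1"] Suc by simp
      moreover have "linear_on (\<lambda>v z. T v z + (\<Sum>l<n. \<kappa> l v * (- u l z)))"
        using Suc by simp
      moreover have "\<kappa> n \<in> linear_functionals_on E" using ku(1)[of n] sub Suc by auto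
      ultimately have "linear_on (\<lambda>v z. T v z + (\<Sum>l<n. \<kappa> l v * (- u l z)) + \<kappa> n v * (- u n z))"
        by (rule linear_on_rank_one[rotated 2])
      then show ?case by (simp only: sum.lessThan_Suc add.assoc)
    qed
    from this[of N] show ?thesis by (simp add: S_def sum_negf)
  qed
  have res: "resolvent_meromorphic (ball 0 R) (bounded_functionals V) S"
    unfolding resolvent_meromorphic_def
  proof (intro ballI)
    fix v \<phi> assume v: "v \<in> E" and \<phi>: "\<phi> \<in> bounded_functionals V"
    obtain K where K: "\<And>v B. v \<in> E \<Longrightarrow> (\<forall>z\<in>V. norm (v z) \<le> B) \<Longrightarrow> norm (\<phi> v) \<le> K * B"
      using \<phi> unfolding bounded_functionals_def mem_Collect_eq by blast
    obtain B where B: "\<forall>z\<in>V. norm (v z) \<le> B"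
      using bdd[OF v] by (auto simp: bounded_iff)
    have B': "\<forall>z\<in>V. norm ((S ^^ n) v z) \<le> \<epsilon> ^ n * B" for n
    proof (induction n)
      case (Suc n)
      define w where "w = (S ^^ n) v"
      have "norm (S w z) \<le> \<epsilon> * (\<epsilon> ^ n * B)" if "z \<in> V" for z
        using app[OF linear_on_funpow_in[OF S v, of n] Suc that] unfolding w_def[symmetric]
        by (simp add: S_def)
      then show ?case by (simp add: w_def mult.assoc)
    qed (use B in simp)
    have "norm (\<phi> ((S ^^ n) v)) \<le> (K * B) * \<epsilon> ^ n" for n
    proof -
      have "norm (\<phi> ((S ^^ n) v)) \<le> K * (\<epsilon> ^ n * B)"
        by (rule K[OF linear_on_funpow_in[OF S v] B'])
      then show ?thesis by (simp only: mult_ac)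
    qed
    then show "meromorphic_fps (ball 0 R) (Abs_fps (\<lambda>n. \<phi> ((S ^^ n) v)))"
      using \<epsilon> R by (intro meromorphic_fps_geometric_bound[of _ "K * B" \<epsilon>]) auto
  qed
  show ?thesis
  proof -
    note fr = resolvent_meromorphic_finite_rank[of S "bounded_functionals V" N \<kappa> u "ball 0 R"]
    have "resolvent_meromorphic (ball 0 R) (bounded_functionals V) (\<lambda>v z. S v z + (\<Sum>l<N. \<kappa> l v * u l z))"
      using fr S sub ku res by blast
    moreover have "(\<lambda>v z. S v z + (\<Sum>l<N. \<kappa> l v * u l z)) = T"
      by (intro ext) (simp add: S_def)
    ultimately show ?thesis by (simp only:)
  qed
qed

end

subsection \<open>Neighbourhoods of the interval\<close>

definition seg :: "complex set" where
  "seg = complex_of_real ` {-1..1}"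

text \<open>For positive \<open>r\<close> the sum of \<open>seg\<close> and a disc of radius
  \<open>r\<close>. These sets are convex and shrink to \<open>seg\<close>, so mean value bounds,
  logarithms and the identity principle are available on each of them.\<close>

definition nbhd :: "real \<Rightarrow> complex set" where
  "nbhd r = (\<Union>x\<in>seg. ball x r)"

lemma of_real_in_seg_iff [simp]: "complex_of_real x \<in> seg \<longleftrightarrow> x \<in> {-1..1}"
  by (auto simp: seg_def)

lemma one_in_seg [simp]: "1 \<in> seg" "-1 \<in> seg" "0 \<in> seg"
  using of_real_in_seg_iff[of 1] of_real_in_seg_iff[of "-1"] of_real_in_seg_iff[of 0]
  by (auto simp del: of_real_in_seg_iff)

lemma compact_seg: "compact seg"
  unfolding seg_def by (intro compact_continuous_image continuous_intros) auto

lemma convex_seg: "convex seg"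
  unfolding seg_def by (intro convex_linear_image) (auto simp: linear_of_real)

lemma seg_norm_le: "z \<in> seg \<Longrightarrow> norm z \<le> 1"
  by (auto simp: seg_def)

lemma in_nbhd_iff: "z \<in> nbhd r \<longleftrightarrow> (\<exists>x\<in>seg. dist x z < r)"
  by (auto simp: nbhd_def)

lemma open_nbhd [simp, intro]: "open (nbhd r)"
  by (auto simp: nbhd_def)

lemma convex_nbhd: "convex (nbhd r)"
proof -
  have "(\<Union>x\<in>seg. \<Union>y\<in>ball 0 r. {x + y}) = nbhd r"
  proof safe
    fix x y :: complex assume "x \<in> seg" "y \<in> ball 0 r"
    then show "x + y \<in> nbhd r" unfolding in_nbhd_iff by (intro bexI[of _ x]) (auto simp: dist_norm)
  next
    fix z assume "z \<in> nbhd r"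
    then obtain x where "x \<in> seg" "dist x z < r" by (auto simp: in_nbhd_iff)
    then show "z \<in> (\<Union>x\<in>seg. \<Union>y\<in>ball 0 r. {x + y})"
      by (intro UN_I[of x] UN_I[of "z - x"]) (auto simp: dist_norm norm_minus_commute)
  qed
  then show ?thesis using convex_sums[OF convex_seg convex_ball] by metis
qed

lemma connected_nbhd: "connected (nbhd r)"
  by (rule convex_connected[OF convex_nbhd])

lemma nbhd_mono: "r \<le> s \<Longrightarrow> nbhd r \<subseteq> nbhd s"
  unfolding in_nbhd_iff by (meson less_le_trans subsetI in_nbhd_iff)

lemma seg_subset_nbhd: "r > 0 \<Longrightarrow> seg \<subseteq> nbhd r"
  by (metis in_nbhd_iff dist_self subsetI)

lemma ball_subset_nbhd: "z \<in> nbhd r \<Longrightarrow> ball z s \<subseteq> nbhd (r + s)"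
proof
  fix w assume "z \<in> nbhd r" "w \<in> ball z s"
  then obtain x where "x \<in> seg" "dist x z < r" "dist z w < s" by (auto simp: in_nbhd_iff)
  then show "w \<in> nbhd (r + s)"
    unfolding in_nbhd_iff by (intro bexI[of _ x]) (use dist_triangle[of x w z] in auto)
qed

lemma bounded_nbhd: "bounded (nbhd r)"
proof -
  have "norm z \<le> 1 + r" if z: "z \<in> nbhd r" for z
  proof -
    obtain x where "x \<in> seg" "dist x z < r" using z by (auto simp: in_nbhd_iff)
    then show ?thesis using seg_norm_le[of x] norm_triangle_sub[of z x]
      by (auto simp: dist_norm norm_minus_commute)
  qed
  then show ?thesis by (auto simp: bounded_iff)
qed

lemma closure_nbhd_subset: "r < s \<Longrightarrow> closure (nbhd r) \<subseteq> nbhd s"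
proof
  fix z assume "r < s" "z \<in> closure (nbhd r)"
  then obtain w where "w \<in> nbhd r" "dist w z < s - r"
    unfolding closure_approachable by (metis diff_gt_0_iff_gt)
  then show "z \<in> nbhd s" using ball_subset_nbhd[of w r "s - r"] by auto
qed

lemma compact_closure_nbhd: "compact (closure (nbhd r))"
  using bounded_nbhd by (simp add: compact_closure)

lemma nbhd_subset_open:
  assumes "open W" "seg \<subseteq> W"
  obtains r where "r > 0" "nbhd r \<subseteq> W"
  using compact_subset_open_imp_ball_epsilon_subset[OF compact_seg assms] unfolding nbhd_def by metis

lemma closure_nbhd_subset_open:
  assumes "open W" "seg \<subseteq> W"
  obtains r where "r > 0" "closure (nbhd r) \<subseteq> W"
proof -
  obtain s where s: "s > 0" "nbhd s \<subseteq> W" using nbhd_subset_open[OF assms] .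
  then show ?thesis using that[of "s/2"] closure_nbhd_subset[of "s/2" s] by auto
qed

lemma analytic_on_seg_iff: "\<phi> analytic_on seg \<longleftrightarrow> (\<exists>r>0. \<phi> holomorphic_on nbhd r)"
proof
  assume "\<phi> analytic_on seg"
  then obtain W where "open W" "seg \<subseteq> W" "\<phi> holomorphic_on W"
    unfolding analytic_on_holomorphic by blast
  then show "\<exists>r>0. \<phi> holomorphic_on nbhd r"
    by (metis nbhd_subset_open holomorphic_on_subset)
next
  assume "\<exists>r>0. \<phi> holomorphic_on nbhd r"
  then show "\<phi> analytic_on seg"
    unfolding analytic_on_holomorphic using seg_subset_nbhd open_nbhd by blast
qed

lemma analytic_on_seg_bounded:
  assumes "\<phi> analytic_on seg"
  obtains r B where "r > 0" "\<phi> holomorphic_on nbhd r" "\<And>z. z \<in> nbhd r \<Longrightarrow> norm (\<phi> z) \<le> B"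
proof -
  obtain s where s: "s > 0" "\<phi> holomorphic_on nbhd s" using assms analytic_on_seg_iff by blast
  define r where "r = s / 2"
  have sub: "closure (nbhd r) \<subseteq> nbhd s" using s by (intro closure_nbhd_subset) (auto simp: r_def)
  have "compact (\<phi> ` closure (nbhd r))"
    by (intro compact_continuous_image compact_closure_nbhd continuous_on_subset[OF _ sub]
        holomorphic_on_imp_continuous_on s)
  then obtain B where "\<forall>y\<in>\<phi> ` closure (nbhd r). norm y \<le> B"
    using compact_imp_bounded bounded_iff by blast
  then show ?thesis
    using that[of r B] s closure_subset[of "nbhd r"] nbhd_mono[of r s]
    by (auto simp: r_def intro: holomorphic_on_subset)
qed

lemma finite_common_radius:
  assumes "finite J" "\<And>j. j \<in> J \<Longrightarrow> \<exists>r>0. P j (r::real)"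
    and "\<And>j r s. P j r \<Longrightarrow> 0 < s \<Longrightarrow> s \<le> r \<Longrightarrow> P j s"
  shows "\<exists>r>0. \<forall>j\<in>J. P j r"
  using assms(1,2)
proof (induction J rule: finite_induct)
  case empty
  then show ?case by (intro exI[of _ 1]) auto
next
  case (insert j J)
  then obtain r s where "r > 0" "\<forall>j\<in>J. P j r" "s > 0" "P j s" by (metis insertCI)
  then show ?case using assms(3) by (intro exI[of _ "min r s"]) auto
qed

text \<open>Zeros of \<open>u\<close> are isolated, so a finite subcover of \<open>seg\<close> sees no zero outside \<open>seg\<close>.\<close>

lemma zeros_near_seg:
  assumes u: "u holomorphic_on nbhd R" "R > 0" and ne: "\<beta> \<in> nbhd R" "u \<beta> \<noteq> 0"
  obtains r where "0 < r" "r \<le> R" "\<And>z. z \<in> nbhd r \<Longrightarrow> u z = 0 \<Longrightarrow> z \<in> seg"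
proof -
  have "\<exists>e>0. \<forall>z\<in>ball x e. u z = 0 \<longrightarrow> z \<in> seg" if x: "x \<in> seg" for x
  proof (cases "u x = 0")
    case True
    have "x \<in> nbhd R" using x u(2) seg_subset_nbhd by blast
    from isolated_zeros[OF u(1) open_nbhd connected_nbhd this True ne]
    obtain e where "0 < e" "\<And>z. z \<in> ball x e - {x} \<Longrightarrow> u z \<noteq> 0" by metis
    then have "\<forall>z\<in>ball x e. u z = 0 \<longrightarrow> z \<in> seg" using x by blast
    then show ?thesis using \<open>0 < e\<close> by blast
  next
    case False
    have "isCont u x"
      using u x seg_subset_nbhd holomorphic_on_imp_continuous_on[OF u(1)] continuous_on_eq_continuous_at[OF open_nbhd] by blast
    then have "eventually (\<lambda>z. u z \<noteq> 0) (nhds x)"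
      using False by (metis continuous_at_imp_continuous_within isCont_def t1_space_nhds tendsto_imp_eventually_ne eventually_nhds_conv_at)
    then show ?thesis unfolding eventually_nhds_metric by (auto simp: dist_commute)
  qed
  then obtain e where e: "\<And>x. x \<in> seg \<Longrightarrow> e x > 0"
    "\<And>x z. x \<in> seg \<Longrightarrow> z \<in> ball x (e x) \<Longrightarrow> u z = 0 \<Longrightarrow> z \<in> seg" by metis
  obtain s where s: "s > 0" "nbhd s \<subseteq> (\<Union>x\<in>seg. ball x (e x))"
    by (rule nbhd_subset_open[of "\<Union>x\<in>seg. ball x (e x)"]) (use e in auto)
  show ?thesis
  proof (rule that[of "min s R"])
    show "z \<in> seg" if "z \<in> nbhd (min s R)" "u z = 0" for z
      using that s(2) e(2) nbhd_mono[of "min s R" s] by fastforce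
  qed (use s u in auto)
qed

text \<open>Cauchy's inequality on the circle of radius \<open>r / 2\<close>, on which the bound for
  the open ball is still valid; this is the origin of the factor \<open>2\<close>.\<close>

lemma norm_deriv_le_of_bounded:
  assumes "u holomorphic_on ball z r" "r > 0" "\<And>w. w \<in> ball z r \<Longrightarrow> norm (u w) \<le> B"
  shows "norm (deriv u z) \<le> 2 * B / r"
proof -
  have sub: "cball z (r/2) \<subseteq> ball z r" using assms(2) by auto
  have "norm ((deriv ^^ 1) u z) \<le> fact 1 * B / (r/2) ^ 1"
  proof (rule Cauchy_inequality)
    show "u holomorphic_on ball z (r/2)" using assms(1,2) by (auto elim: holomorphic_on_subset)
    show "continuous_on (cball z (r/2)) u"
      using assms(1) sub by (meson continuous_on_subset holomorphic_on_imp_continuous_on)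
    show "norm (u x) \<le> B" if "norm (z - x) = r/2" for x
      using that assms(2) by (intro assms(3)) (auto simp: dist_norm)
  qed (use assms in auto)
  then show ?thesis by (simp add: field_simps)
qed

text \<open>A zero-free function on a convex set has a logarithm \<open>g\<close>, whose derivative
  is the logarithmic derivative of \<open>u\<close>. The mean value bound for \<open>g\<close>
  controls the ratio of two values of \<open>u\<close>: this is the distortion estimate for products
  of derivatives along a word.\<close>

lemma norm_le_exp_of_log_deriv_bound:
  assumes S: "open S" "convex S" and u: "u holomorphic_on S" "\<And>z. z \<in> S \<Longrightarrow> u z \<noteq> 0"
    and bd: "\<And>z. z \<in> S \<Longrightarrow> norm (deriv u z) \<le> K * norm (u z)"
    and z: "z \<in> S" "w \<in> S"
  shows "norm (u z) \<le> exp (K * norm (z - w)) * norm (u w)"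
proof -
  obtain g where g: "g holomorphic_on S" "\<And>z. z \<in> S \<Longrightarrow> u z = exp (g z)"
    using contractible_imp_holomorphic_log[OF u(1) convex_imp_contractible[OF S(2)] u(2)] by auto
  have dg: "(g has_field_derivative deriv u z / u z) (at z within S)" if "z \<in> S" for z
  proof -
    have gd: "(g has_field_derivative deriv g z) (at z)"
      using g(1) S(1) that by (metis holomorphic_derivI)
    then have "((\<lambda>z. exp (g z)) has_field_derivative exp (g z) * deriv g z) (at z)"
      by (intro derivative_intros) auto
    then have "(u has_field_derivative exp (g z) * deriv g z) (at z)"
      by (rule has_field_derivative_transform_within_open[OF _ S(1) that]) (use g in auto)
    then have "deriv u z = u z * deriv g z" using g that by (simp add: DERIV_imp_deriv)
    then show ?thesis using u(2)[OF that] gd by (simp add: has_field_derivative_at_within)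
  qed
  have "norm (g z - g w) \<le> K * norm (z - w)"
  proof (rule field_differentiable_bound[OF S(2) dg])
    show "norm (deriv u z / u z) \<le> K" if "z \<in> S" for z
      using bd[OF that] u(2)[OF that] by (simp add: norm_divide divide_le_eq)
  qed (use z in auto)
  then have "Re (g z - g w) \<le> K * norm (z - w)" using complex_Re_le_cmod order_trans by blast
  then have "exp (Re (g z)) \<le> exp (K * norm (z - w) + Re (g w))" by simp
  then show ?thesis using g z by (simp add: exp_add)
qed

lemma Re_of_real_has_derivative:
  assumes "u holomorphic_on W" "open W" "complex_of_real x \<in> W"
  shows "((\<lambda>x. Re (u (of_real x))) has_real_derivative Re (deriv u (of_real x))) (at x)"
    and "((\<lambda>x. Im (u (of_real x))) has_real_derivative Im (deriv u (of_real x))) (at x)"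
    and "((\<lambda>x. u (of_real x)) has_vector_derivative deriv u (of_real x)) (at x within S)"
proof -
  have "(u has_field_derivative deriv u (of_real x)) (at (of_real x))"
    using assms by (metis holomorphic_derivI)
  then show *: "((\<lambda>x. u (of_real x)) has_vector_derivative deriv u (of_real x)) (at x within S)" for S
    by (rule has_vector_derivative_real_field)
  show "((\<lambda>x. Re (u (of_real x))) has_real_derivative Re (deriv u (of_real x))) (at x)"
    using has_vector_derivative_complex_iff *[of UNIV] by auto
  show "((\<lambda>x. Im (u (of_real x))) has_real_derivative Im (deriv u (of_real x))) (at x)"
    using has_vector_derivative_complex_iff *[of UNIV] by auto
qed

text \<open>The derivative of the imaginary part along the interval is that of the zero function.
  Uniqueness of derivatives within a closed interval includes the end points, where only one side is
  available.\<close>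

lemma Im_deriv_eq_0_of_real_on_seg:
  assumes "u holomorphic_on W" "open W" "seg \<subseteq> W"
    and "\<And>x. x \<in> {-1..1} \<Longrightarrow> Im (u (of_real x)) = 0" and x: "x \<in> {-1..1}"
  shows "Im (deriv u (of_real x)) = 0"
proof -
  have "of_real x \<in> W" using x assms(3) by auto
  then have 1: "((\<lambda>x. Im (u (of_real x))) has_vector_derivative Im (deriv u (of_real x))) (at x within {-1..1})"
    using has_field_derivative_at_within[OF Re_of_real_has_derivative(2)[OF assms(1,2)]]
    by (simp add: has_real_derivative_iff_has_vector_derivative[symmetric])
  have "((\<lambda>x. 0) has_vector_derivative 0) (at x within {-1..1::real})" by simp
  then have 2: "((\<lambda>x. Im (u (of_real x))) has_vector_derivative 0) (at x within {-1..1})"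
    by (rule has_vector_derivative_transform[rotated 2]) (use x assms(4) in auto)
  show ?thesis
    using vector_derivative_unique_within_closed_interval[of "-1" 1 x, OF _ _ 1[folded box_real] 2[folded box_real]] x
    by auto
qed

subsection \<open>Contracting inverse branches\<close>

fun word_map :: "(nat \<Rightarrow> 'a \<Rightarrow> 'a) \<Rightarrow> nat list \<Rightarrow> 'a \<Rightarrow> 'a" where
  "word_map b [] z = z"
| "word_map b (j # w) z = b j (word_map b w z)"

lemma word_map_Nil_eq: "word_map b [] = (\<lambda>z. z)"
  by (rule ext) simp

lemma word_map_Cons_eq: "word_map b (j # w) = (\<lambda>z. b j (word_map b w z))"
  by (rule ext) simp

definition words :: "nat \<Rightarrow> nat \<Rightarrow> nat list set" where
  "words m n = {w. set w \<subseteq> {..<m} \<and> length w = n}"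

lemma words_0 [simp]: "words m 0 = {[]}"
  by (auto simp: words_def)

lemma finite_words [simp, intro]: "finite (words m n)"
  unfolding words_def using finite_lists_length_eq[of "{..<m}" n] by simp

lemma sum_words_Suc: "(\<Sum>w\<in>words m (Suc n). F w) = (\<Sum>j<m. \<Sum>w\<in>words m n. F (j # w))"
proof -
  have "words m (Suc n) = (\<lambda>(j, w). j # w) ` ({..<m} \<times> words m n)"
    by (force simp: words_def image_iff length_Suc_conv)
  moreover have "inj_on (\<lambda>(j, w). j # w) ({..<m} \<times> words m n)" by (auto simp: inj_on_def)
  ultimately have "(\<Sum>w\<in>words m (Suc n). F w) = (\<Sum>(j,w)\<in>{..<m} \<times> words m n. F (j # w))"
    by (simp add: sum.reindex case_prod_unfold)
  then show ?thesis by (simp add: sum.cartesian_product)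
qed

text \<open>\<open>b_lower\<close> and \<open>b_upper\<close> encode the alternating orientation of
  the laps: \<open>b j\<close> runs from \<open>d j\<close> to \<open>d (Suc j)\<close> upwards for
  even \<open>j\<close> and downwards for odd \<open>j\<close>, so consecutive branches share a
  value at \<open>1\<close> or at \<open>-1\<close>.\<close>

locale branches =
  fixes U :: "complex set" and m :: nat and b :: "nat \<Rightarrow> complex \<Rightarrow> complex" and d :: "nat \<Rightarrow> real"
  assumes U_open: "open U" and U_bounded: "bounded U" and seg_U: "seg \<subseteq> U"
    and m2: "m \<ge> 2"
    and b_cont: "j < m \<Longrightarrow> continuous_on (closure U) (b j)"
    and b_hol: "j < m \<Longrightarrow> b j holomorphic_on U"
    and b_into: "j < m \<Longrightarrow> b j ` closure U \<subseteq> U"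
    and d_0: "d 0 = -1" and d_m: "d m = 1" and d_less: "j < m \<Longrightarrow> d j < d (Suc j)"
    and b_real: "j < m \<Longrightarrow> x \<in> {-1..1} \<Longrightarrow> Im (b j (of_real x)) = 0"
    and b_range: "j < m \<Longrightarrow> x \<in> {-1..1} \<Longrightarrow> Re (b j (of_real x)) \<in> {d j..d (Suc j)}"
    and b_lower: "j < m \<Longrightarrow> b j (of_real (- ((-1) ^ j))) = of_real (d j)"
    and b_upper: "j < m \<Longrightarrow> b j (of_real ((-1) ^ j)) = of_real (d (Suc j))"
    and b_deriv: "j < m \<Longrightarrow> x \<in> {-1..1} \<Longrightarrow> deriv (b j) (of_real x) \<noteq> 0"
begin

abbreviation bw :: "nat list \<Rightarrow> complex \<Rightarrow> complex" where "bw \<equiv> word_map b"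

lemma d_mono: "i \<le> j \<Longrightarrow> j \<le> m \<Longrightarrow> d i \<le> d j"
proof (induction j rule: dec_induct)
  case (step n)
  then show ?case using d_less[of n] by force
qed simp

lemma d_range: "j \<le> m \<Longrightarrow> d j \<in> {-1..1}"
  using d_mono[of 0 j] d_mono[of j m] d_0 d_m by auto

lemma b_U: "j < m \<Longrightarrow> z \<in> U \<Longrightarrow> b j z \<in> U"
  using b_into closure_subset by blast

lemma b_seg: "j < m \<Longrightarrow> z \<in> seg \<Longrightarrow> b j z \<in> seg"
proof -
  assume j: "j < m" and "z \<in> seg"
  then obtain x where x: "x \<in> {-1..1}" "z = of_real x" by (auto simp: seg_def)
  have "b j z = of_real (Re (b j z))" using b_real[OF j x(1)] unfolding x(2) by (simp add: complex_eq_iff)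
  moreover have "Re (b j z) \<in> {-1..1}"
    using b_range[OF j x(1)] d_range[of j] d_range[of "Suc j"] j x by auto
  ultimately show "b j z \<in> seg" by (metis of_real_in_seg_iff)
qed

lemma bw_U: "set w \<subseteq> {..<m} \<Longrightarrow> z \<in> U \<Longrightarrow> bw w z \<in> U"
  by (induction w) (auto intro: b_U)

lemma bw_seg: "set w \<subseteq> {..<m} \<Longrightarrow> z \<in> seg \<Longrightarrow> bw w z \<in> seg"
  by (induction w) (auto intro: b_seg)

lemma bw_hol: "set w \<subseteq> {..<m} \<Longrightarrow> bw w holomorphic_on U"
proof (induction w)
  case (Cons j w)
  have "(b j \<circ> bw w) holomorphic_on U"
    by (rule holomorphic_on_compose_gen[of _ _ _ U]) (use Cons b_hol bw_U in auto)
  then show ?case by (simp add: o_def word_map_Cons_eq)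
qed (simp add: word_map_Nil_eq)

lemma b_has_deriv: "j < m \<Longrightarrow> z \<in> U \<Longrightarrow> (b j has_field_derivative deriv (b j) z) (at z)"
  using b_hol U_open by (metis holomorphic_derivI)

lemma bw_has_deriv: "set w \<subseteq> {..<m} \<Longrightarrow> z \<in> U \<Longrightarrow> (bw w has_field_derivative deriv (bw w) z) (at z)"
  using bw_hol U_open by (metis holomorphic_derivI)

lemma deriv_bw_Cons:
  assumes "set (j # w) \<subseteq> {..<m}" "z \<in> U"
  shows "deriv (bw (j # w)) z = deriv (b j) (bw w z) * deriv (bw w) z"
proof -
  have "((\<lambda>z. b j (bw w z)) has_field_derivative deriv (b j) (bw w z) * deriv (bw w) z) (at z)"
    by (rule DERIV_chain2[OF b_has_deriv bw_has_deriv]) (use assms bw_U in auto)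
  then show ?thesis by (simp add: DERIV_imp_deriv word_map_Cons_eq)
qed

lemma deriv_bw_Nil [simp]: "deriv (bw []) z = 1"
  by (simp add: word_map_Nil_eq)

text \<open>The branches contract an infinitesimal Caratheodory metric of \<open>U\<close>: since \<open>b j\<close> maps \<open>U\<close> well
  inside \<open>U\<close>, so does \<open>b j + \<epsilon> (b j - b j z)\<close>, which has the same value but a derivative larger by
  the factor \<open>1 + \<epsilon>\<close> at \<open>z\<close> (Earle--Hamilton).\<close>

lemma contraction:
  obtains C q r where "C \<ge> 1" "0 < q" "q < 1" "r > 0" "nbhd r \<subseteq> U"
    "\<And>w z. set w \<subseteq> {..<m} \<Longrightarrow> z \<in> nbhd r \<Longrightarrow> norm (deriv (bw w) z) \<le> C * q ^ length w"
proof -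
  define K where "K = (\<Union>j\<in>{..<m}. b j ` closure U)"
  have "compact K"
    unfolding K_def using U_bounded
    by (intro compact_UN compact_continuous_image b_cont) (auto simp: compact_closure)
  moreover have "K \<subseteq> U" using b_into by (auto simp: K_def)
  ultimately obtain \<delta> where \<delta>: "\<delta> > 0" "(\<Union>x\<in>K. ball x \<delta>) \<subseteq> U"
    using compact_subset_open_imp_ball_epsilon_subset[OF _ U_open] by blast
  obtain M where M: "M > 0" "\<And>z. z \<in> U \<Longrightarrow> norm z \<le> M"
    using U_bounded by (auto simp: bounded_pos)
  \<comment> \<open>Two values of \<open>b j\<close> on \<open>U\<close> differ by at most
    \<open>2 * M\<close>, so the perturbed branch stays within \<open>\<delta> / 2\<close> of the
    compact set \<open>K\<close> and hence inside \<open>U\<close>.\<close>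
  define \<epsilon> where "\<epsilon> = \<delta> / (4 * M)"
  have \<epsilon>: "\<epsilon> > 0" "\<epsilon> * (2 * M) < \<delta>" using \<delta> M by (auto simp: \<epsilon>_def field_simps)
  define q where "q = 1 / (1 + \<epsilon>)"
  have q: "0 < q" "q < 1" using \<epsilon> by (auto simp: q_def)
  obtain s where s: "s > 0" "nbhd s \<subseteq> U" using nbhd_subset_open[OF U_open seg_U] .
  define r where "r = s / 2"
  have r: "r > 0" "nbhd r \<subseteq> U" using s nbhd_mono[of r s] by (auto simp: r_def)
  have ball: "ball z r \<subseteq> U" if "z \<in> nbhd r" for z
    using ball_subset_nbhd[OF that, of r] s(2) by (auto simp: r_def)
  \<comment> \<open>The metric is used through its test functions \<open>F\<close>, holomorphic on
    \<open>U\<close> with values in the unit disc. Keeping \<open>F\<close> general lets the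
    induction pass from \<open>F\<close> to \<open>F \<circ> p\<close>, which is again a test
    function.\<close>
  have claim: "norm (deriv (\<lambda>z. F (bw w z)) z) \<le> 2 / r * q ^ length w"
    if "set w \<subseteq> {..<m}" "F holomorphic_on U" "\<And>z. z \<in> U \<Longrightarrow> norm (F z) \<le> 1" "z \<in> nbhd r" for F w z
    using that
  proof (induction w arbitrary: F)
    case Nil
    have "norm (deriv F z) \<le> 2 * 1 / r"
      using Nil ball[OF Nil(4)] r(1)
      by (intro norm_deriv_le_of_bounded) (auto elim: holomorphic_on_subset)
    then show ?case by simp
  next
    case (Cons j w)
    have j: "j < m" "set w \<subseteq> {..<m}" using Cons.prems by auto
    have zU: "z \<in> U" using Cons.prems(4) r by auto
    define \<zeta> where "\<zeta> = bw w z"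
    have \<zeta>: "\<zeta> \<in> U" unfolding \<zeta>_def using bw_U j zU by blast
    define p where "p x = b j x + of_real \<epsilon> * (b j x - b j \<zeta>)" for x
    have p: "p x \<in> U" if "x \<in> U" for x
    proof -
      have "norm (b j x - b j \<zeta>) \<le> 2 * M"
        using M(2)[OF b_U[OF j(1) that]] M(2)[OF b_U[OF j(1) \<zeta>]] norm_triangle_ineq4[of "b j x" "b j \<zeta>"] by simp
      then have "norm (of_real \<epsilon> * (b j x - b j \<zeta>)) \<le> \<epsilon> * (2 * M)"
        using \<epsilon> by (simp add: norm_mult)
      then have "p x \<in> ball (b j x) \<delta>" using \<epsilon> by (simp add: p_def dist_norm)
      moreover have "b j x \<in> K" using j that closure_subset[of U] by (auto simp: K_def)
      ultimately show ?thesis using \<delta>(2) by blast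
    qed
    define G where "G x = F (p x)" for x
    have phol: "p holomorphic_on U" unfolding p_def by (intro holomorphic_intros b_hol j)
    have "(F \<circ> p) holomorphic_on U"
      by (rule holomorphic_on_compose_gen[OF phol Cons.prems(2)]) (use p in auto)
    then have Ghol: "G holomorphic_on U" by (simp add: G_def[abs_def] o_def)
    have IH: "norm (deriv (\<lambda>z. G (bw w z)) z) \<le> 2 / r * q ^ length w"
      by (rule Cons.IH[OF j(2) Ghol _ Cons.prems(4)]) (auto simp: G_def intro: Cons.prems p)
    have p\<zeta>: "p \<zeta> = b j \<zeta>" by (simp add: p_def)
    have dp: "(p has_field_derivative (1 + of_real \<epsilon>) * deriv (b j) \<zeta>) (at \<zeta>)"
      unfolding p_def using b_has_deriv[OF j(1) \<zeta>]
      by (auto intro!: derivative_eq_intros simp: algebra_simps)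
    have dF: "(F has_field_derivative deriv F (b j \<zeta>)) (at (b j \<zeta>))"
      using Cons.prems(2) U_open b_U[OF j(1) \<zeta>] by (metis holomorphic_derivI)
    have dG: "(G has_field_derivative deriv F (b j \<zeta>) * ((1 + of_real \<epsilon>) * deriv (b j) \<zeta>)) (at \<zeta>)"
      unfolding G_def by (rule DERIV_chain2[OF _ dp]) (use dF p\<zeta> in simp)
    have 1: "deriv (\<lambda>z. G (bw w z)) z = deriv F (b j \<zeta>) * ((1 + of_real \<epsilon>) * deriv (b j) \<zeta>) * deriv (bw w) z"
      by (rule DERIV_imp_deriv, rule DERIV_chain2[OF _ bw_has_deriv[OF j(2) zU]]) (use dG in \<open>simp add: \<zeta>_def\<close>)
    have "((\<lambda>z. F (b j z)) has_field_derivative deriv F (b j \<zeta>) * deriv (b j) \<zeta>) (at \<zeta>)"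
      by (rule DERIV_chain2[OF dF b_has_deriv[OF j(1) \<zeta>]])
    then have 2: "deriv (\<lambda>z. F (b j (bw w z))) z = deriv F (b j \<zeta>) * deriv (b j) \<zeta> * deriv (bw w) z"
      by (intro DERIV_imp_deriv, intro DERIV_chain2[OF _ bw_has_deriv[OF j(2) zU], of "\<lambda>z. F (b j z)"]) (simp add: \<zeta>_def)
    have "norm (1 + complex_of_real \<epsilon>) = 1 + \<epsilon>"
      using \<epsilon> by (metis abs_of_pos add_pos_pos norm_of_real of_real_1 of_real_add zero_less_one)
    then have "(1 + \<epsilon>) * norm (deriv (\<lambda>z. F (b j (bw w z))) z) = norm (deriv (\<lambda>z. G (bw w z)) z)"
      unfolding 1 2 by (simp add: norm_mult mult_ac)
    with IH have "(1 + \<epsilon>) * norm (deriv (\<lambda>z. F (b j (bw w z))) z) \<le> 2 / r * q ^ length w" by simp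
    then have "q * ((1 + \<epsilon>) * norm (deriv (\<lambda>z. F (b j (bw w z))) z)) \<le> q * (2 / r * q ^ length w)"
      using q by (intro mult_left_mono) auto
    moreover have "q * (1 + \<epsilon>) = 1" using \<epsilon> by (simp add: q_def)
    ultimately have "norm (deriv (\<lambda>z. F (b j (bw w z))) z) \<le> 2 / r * q ^ length w * q"
      by (simp only: mult.assoc[symmetric]) (simp add: mult_ac)
    then show ?case by (simp add: mult_ac)
  qed
  define C where "C = max 1 (M * (2 / r))"
  have "norm (deriv (bw w) z) \<le> C * q ^ length w" if w: "set w \<subseteq> {..<m}" and z: "z \<in> nbhd r" for w z
  proof -
    have zU: "z \<in> U" using z r by auto
    \<comment> \<open>The test function \<open>z / M\<close> is bounded by \<open>1\<close> on
      \<open>U\<close> and recovers the Euclidean derivative.\<close>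
    have "norm (deriv (\<lambda>z. (1 / of_real M) * bw w z) z) \<le> 2 / r * q ^ length w"
      by (rule claim[OF w, of "\<lambda>z. (1 / of_real M) * z"]) (use M z in \<open>auto simp: norm_mult norm_divide intro!: holomorphic_intros\<close>)
    moreover have "deriv (\<lambda>z. (1 / of_real M) * bw w z) z = (1 / of_real M) * deriv (bw w) z"
      by (rule DERIV_imp_deriv, rule DERIV_cmult, rule bw_has_deriv[OF w zU])
    ultimately have "norm ((1 / of_real M) * deriv (bw w) z) \<le> 2 / r * q ^ length w"
      by (simp only:)
    then have "norm (deriv (bw w) z) \<le> M * (2 / r) * q ^ length w"
      using M(1) by (simp add: norm_mult norm_divide field_simps)
    also have "\<dots> \<le> C * q ^ length w" using q by (intro mult_right_mono) (auto simp: C_def)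
    finally show ?thesis .
  qed
  then show ?thesis using that[of C q r] q r by (auto simp: C_def)
qed

end

subsection \<open>The transfer operator\<close>

abbreviation LI :: "real measure" where
  "LI \<equiv> restrict_space lborel {-1..1}"

lemma space_LI [simp]: "space LI = {-1..1}"
  by (simp add: space_restrict_space)

lemma finite_measure_LI: "finite_measure LI"
  by (rule finite_measureI) (simp add: emeasure_restrict_space)

interpretation LI: finite_measure LI
  by (rule finite_measure_LI)

lemma measure_LI_space: "measure LI {-1..1} = 2"
  by (subst measure_restrict_space) auto

lemma sets_LI: "sets LI = sets (restrict_space borel {-1..1})"
  by (simp add: sets_restrict_space)

lemma continuous_imp_measurable_LI:
  "continuous_on {-1..1} f \<Longrightarrow> f \<in> borel_measurable LI"
  using borel_measurable_continuous_on_restrict[of "{-1..1}" f]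
  by (subst measurable_cong_sets[OF sets_LI refl])

lemma bounded_imp_integrable_LI:
  fixes f :: "real \<Rightarrow> 'a :: {banach, second_countable_topology}"
  assumes "f \<in> borel_measurable LI" "\<And>x. x \<in> {-1..1} \<Longrightarrow> norm (f x) \<le> B"
  shows "integrable LI f"
  by (rule LI.integrable_const_bound[of _ B]) (use assms in auto)

lemma continuous_imp_integrable_LI:
  fixes f :: "real \<Rightarrow> 'a :: {banach, second_countable_topology}"
  assumes "continuous_on {-1..1} f"
  shows "integrable LI f"
proof -
  have "compact (f ` {-1..1})" using assms by (intro compact_continuous_image) auto
  then obtain B where "\<forall>y\<in>f ` {-1..1}. norm y \<le> B" using compact_imp_bounded bounded_iff by blast
  then show ?thesis
    using continuous_imp_measurable_LI[OF assms] by (intro bounded_imp_integrable_LI[of _ B]) auto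
qed

lemma AE_LI_neq: "finite D \<Longrightarrow> AE x in LI. x \<notin> D"
proof -
  assume "finite D"
  then have "AE x in lborel. x \<notin> D"
    by (intro AE_not_in) (auto intro: finite_imp_null_set_lborel)
  then show ?thesis by (subst AE_restrict_space_iff) auto
qed

lemma nn_integral_LI:
  "(\<integral>\<^sup>+x. u x \<partial>LI) = (\<integral>\<^sup>+x. u x * indicator {-1..1} x \<partial>lborel)"
  by (subst nn_integral_restrict_space) auto

lemma measurable_LI_indicator_iff:
  "(u :: real \<Rightarrow> ennreal) \<in> borel_measurable LI \<longleftrightarrow> (\<lambda>x. u x * indicator {-1..1} x) \<in> borel_measurable borel"
  by (subst borel_measurable_restrict_space_iff_ennreal) auto

lemma nn_integral_LI_substitution:
  fixes g g' :: "real \<Rightarrow> real" and u :: "real \<Rightarrow> ennreal"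
  assumes u: "u \<in> borel_measurable LI"
    and g: "\<And>x. x \<in> {-1..1} \<Longrightarrow> (g has_real_derivative g' x) (at x)"
    and g': "continuous_on {-1..1} g'" "\<And>x. x \<in> {-1..1} \<Longrightarrow> g' x \<ge> 0"
    and range: "-1 \<le> g (-1)" "g 1 \<le> 1"
  shows "(\<integral>\<^sup>+x. u x * indicator {g (-1)..g 1} x \<partial>LI) = (\<integral>\<^sup>+x. ennreal (g' x) * u (g x) \<partial>LI)"
proof -
  \<comment> \<open>Extension by zero turns a function measurable on the interval into a Borel
    function on the line, to which the substitution rule applies.\<close>
  define u0 where "u0 x = u x * indicator {-1..1} x" for x
  have u0: "u0 \<in> borel_measurable borel" using u measurable_LI_indicator_iff unfolding u0_def by blast
  have mono: "g x \<le> g y" if "-1 \<le> x" "x \<le> y" "y \<le> 1" for x y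
  proof (rule DERIV_nonneg_imp_nondecreasing[OF that(2)])
    fix t assume "x \<le> t" "t \<le> y"
    then have "t \<in> {-1..1}" using that by auto
    then show "\<exists>y. (g has_real_derivative y) (at t) \<and> 0 \<le> y" using g g' by blast
  qed
  have "(\<integral>\<^sup>+x. u x * indicator {g (-1)..g 1} x \<partial>LI) = (\<integral>\<^sup>+x. u0 x * indicator {g (-1)..g 1} x \<partial>lborel)"
    unfolding nn_integral_LI u0_def by (intro nn_integral_cong) (auto simp: mult_ac)
  also have "\<dots> = (\<integral>\<^sup>+x. u0 (g x) * g' x * indicator {-1..1} x \<partial>lborel)"
    by (rule nn_integral_substitution_aux[OF u0 _ g g']) auto
  also have "\<dots> = (\<integral>\<^sup>+x. ennreal (g' x) * u (g x) \<partial>LI)"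
    unfolding nn_integral_LI
  proof (intro nn_integral_cong)
    fix x :: real
    show "u0 (g x) * g' x * indicator {-1..1} x = ennreal (g' x) * u (g x) * indicator {-1..1} x"
    proof (cases "x \<in> {-1..1}")
      case True
      then have "g x \<in> {-1..1}" using mono[of "-1" x] mono[of x 1] range by auto
      then show ?thesis by (simp add: u0_def mult_ac)
    qed simp
  qed
  finally show ?thesis .
qed

text \<open>Reduces orientation reversing branches to the nondecreasing substitutions treated
  before.\<close>

lemma nn_integral_LI_reflect:
  fixes u :: "real \<Rightarrow> ennreal"
  assumes u: "u \<in> borel_measurable LI" and s: "s = 1 \<or> s = -1"
  shows "(\<integral>\<^sup>+x. u (s * x) \<partial>LI) = (\<integral>\<^sup>+x. u x \<partial>LI)"
proof -
  have "(\<lambda>x. u x * indicator {-1..1} x) \<in> borel_measurable borel"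
    using u measurable_LI_indicator_iff by blast
  from nn_integral_real_affine[OF this, of s 0] s
  have "(\<integral>\<^sup>+x. u x \<partial>LI) = (\<integral>\<^sup>+x. u (s * x) * indicator {-1..1} (s * x) \<partial>lborel)"
    unfolding nn_integral_LI by auto
  also have "\<dots> = (\<integral>\<^sup>+x. u (s * x) \<partial>LI)"
    unfolding nn_integral_LI using s by (intro nn_integral_cong) (auto split: split_indicator)
  finally show ?thesis by simp
qed

text \<open>By compactness the difference of the two functions has a positive minimum, and the
  interval has length \<open>2\<close>.\<close>

lemma integral_LI_reverse_mono_strict:
  fixes f g :: "real \<Rightarrow> real"
  assumes "continuous_on {-1..1} f" "continuous_on {-1..1} g" "\<And>x. x \<in> {-1..1} \<Longrightarrow> f x < g x"
  shows "(\<integral>x. f x \<partial>LI) < (\<integral>x. g x \<partial>LI)"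
proof -
  have "\<exists>x\<in>{-1..1}. \<forall>y\<in>{-1..1}. g x - f x \<le> g y - f y"
    by (rule continuous_attains_inf) (use assms in \<open>auto intro!: continuous_intros\<close>)
  then obtain x0 where x0: "x0 \<in> {-1..1}" "\<And>y. y \<in> {-1..1} \<Longrightarrow> g x0 - f x0 \<le> g y - f y" by blast
  have "(\<integral>x. (g x0 - f x0) \<partial>LI) \<le> (\<integral>x. g x - f x \<partial>LI)"
    by (rule integral_mono)
       (use x0 assms in \<open>auto intro!: continuous_imp_integrable_LI continuous_intros\<close>)
  moreover have "(\<integral>x. (g x0 - f x0) \<partial>LI) = 2 * (g x0 - f x0)"
    using measure_LI_space by simp
  moreover have "(\<integral>x. g x - f x \<partial>LI) = (\<integral>x. g x \<partial>LI) - (\<integral>x. f x \<partial>LI)"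
    by (intro Bochner_Integration.integral_diff continuous_imp_integrable_LI assms)
  ultimately show ?thesis using assms(3)[OF x0(1)] by simp
qed

section \<open>Jacobians of the branches and duality for the transfer operator\<close>

context branches
begin

definition \<beta> :: "nat \<Rightarrow> real \<Rightarrow> real" where
  "\<beta> j x = Re (b j (of_real x))"

definition jac :: "nat \<Rightarrow> real \<Rightarrow> real" where
  "jac j x = norm (deriv (b j) (of_real x))"

lemma of_real_\<beta>: "j < m \<Longrightarrow> x \<in> {-1..1} \<Longrightarrow> complex_of_real (\<beta> j x) = b j (of_real x)"
  using b_real by (simp add: \<beta>_def complex_eq_iff)

lemma \<beta>_range: "j < m \<Longrightarrow> x \<in> {-1..1} \<Longrightarrow> \<beta> j x \<in> {-1..1}"
  using b_range[of j x] d_range[of j] d_range[of "Suc j"] by (auto simp: \<beta>_def)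

lemma seg_in_U: "x \<in> {-1..1} \<Longrightarrow> complex_of_real x \<in> U"
  using seg_U by auto

lemma \<beta>_has_deriv: "j < m \<Longrightarrow> x \<in> {-1..1} \<Longrightarrow> (\<beta> j has_real_derivative Re (deriv (b j) (of_real x))) (at x)"
  unfolding \<beta>_def[abs_def] by (rule Re_of_real_has_derivative(1)[OF b_hol U_open seg_in_U])

lemma cont_deriv_b: "j < m \<Longrightarrow> continuous_on {-1..1} (\<lambda>x. deriv (b j) (complex_of_real x))"
  by (rule continuous_on_compose2[OF holomorphic_on_imp_continuous_on[OF holomorphic_deriv[OF b_hol U_open]]])
     (use seg_in_U in \<open>auto intro!: continuous_intros\<close>)

lemma jac_cont: "j < m \<Longrightarrow> continuous_on {-1..1} (jac j)"
  unfolding jac_def[abs_def] by (intro continuous_on_norm cont_deriv_b)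

lemma \<beta>_cont: "j < m \<Longrightarrow> continuous_on {-1..1} (\<beta> j)"
  by (meson \<beta>_has_deriv DERIV_isCont continuous_at_imp_continuous_on)

lemma Im_deriv_b: "j < m \<Longrightarrow> x \<in> {-1..1} \<Longrightarrow> Im (deriv (b j) (of_real x)) = 0"
  by (rule Im_deriv_eq_0_of_real_on_seg[OF b_hol U_open seg_U b_real])

text \<open>The derivative is real and never zero on the interval, hence of constant sign. The mean
  value theorem, applied between the two prescribed end values, decides which sign it is.\<close>

lemma Re_deriv_b_sign:
  assumes j: "j < m" and x: "x \<in> {-1..1}"
  shows "(-1) ^ j * Re (deriv (b j) (of_real x)) > 0"
proof (rule ccontr)
  define D where "D x = (-1) ^ j * Re (deriv (b j) (complex_of_real x))" for x
  assume "\<not> ?thesis"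
  then have neg: "D x \<le> 0" by (simp add: D_def)
  have ne: "D y \<noteq> 0" if "y \<in> {-1..1}" for y
    using b_deriv[OF j that] Im_deriv_b[OF j that] by (auto simp: D_def complex_eq_iff)
  have contD: "continuous_on {-1..1} D"
    unfolding D_def[abs_def] by (intro continuous_intros cont_deriv_b j)
  have D_neg: "D y < 0" if y: "y \<in> {-1..1}" for y
  proof (rule ccontr)
    assume "\<not> D y < 0"
    moreover have "connected (D ` {-1..1})" by (intro connected_continuous_image contD) auto
    ultimately have "0 \<in> D ` {-1..1}"
      using connectedD_interval[of "D ` {-1..1}" "D x" "D y" 0] neg x y by auto
    then show False using ne by force
  qed
  obtain \<xi> where \<xi>: "-1 < \<xi>" "\<xi> < 1" "\<beta> j 1 - \<beta> j (-1) = (1 - (-1)) * Re (deriv (b j) (of_real \<xi>))"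
    using MVT2[of "-1" 1 "\<beta> j" "\<lambda>x. Re (deriv (b j) (of_real x))"] \<beta>_has_deriv[OF j] by force
  have "\<beta> j (- ((-1) ^ j)) = d j" "\<beta> j ((-1) ^ j) = d (Suc j)"
    using b_lower[OF j] b_upper[OF j] by (auto simp: \<beta>_def)
  then have "(-1) ^ j * (\<beta> j 1 - \<beta> j (-1)) = d (Suc j) - d j"
    by (cases "even j") auto
  then have "(-1) ^ j * (\<beta> j 1 - \<beta> j (-1)) > 0" using d_less[OF j] by simp
  then have "D \<xi> > 0" unfolding \<xi>(3) D_def by (simp add: mult.left_commute)
  then show False using D_neg[of \<xi>] \<xi> by simp
qed

text \<open>On the interval the holomorphic weights of \<open>L\<close> are the Jacobians of the
  branches. This is the source of all positivity arguments.\<close>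

lemma signed_deriv_b:
  assumes j: "j < m" and x: "x \<in> {-1..1}"
  shows "(-1) ^ j * deriv (b j) (of_real x) = of_real (jac j x)"
proof -
  let ?D = "deriv (b j) (complex_of_real x)"
  have D: "?D = of_real (Re ?D)" using Im_deriv_b[OF j x] by (simp add: complex_eq_iff)
  have "norm ?D = \<bar>Re ?D\<bar>" by (subst D) simp
  also have "\<dots> = \<bar>(-1) ^ j * Re ?D\<bar>" by (simp add: abs_mult)
  also have "\<dots> = (-1) ^ j * Re ?D" using Re_deriv_b_sign[OF j x] by simp
  finally have "complex_of_real (jac j x) = (-1) ^ j * of_real (Re ?D)" by (simp add: jac_def)
  then show ?thesis using D by simp
qed

lemma branch_nn_integral:
  fixes u :: "real \<Rightarrow> ennreal"
  assumes j: "j < m" and u: "u \<in> borel_measurable LI"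
  shows "(\<integral>\<^sup>+x. u x * indicator {d j..d (Suc j)} x \<partial>LI) = (\<integral>\<^sup>+x. ennreal (jac j x) * u (\<beta> j x) \<partial>LI)"
proof -
  \<comment> \<open>Precomposing with multiplication by \<open>(-1) ^ j\<close> makes every branch
    nondecreasing.\<close>
  define s where "s = (-1::real) ^ j"
  have s: "s = 1 \<or> s = -1" unfolding s_def by (cases "even j") auto
  have sI: "s * x \<in> {-1..1}" if "x \<in> {-1..1}" for x using s that by auto
  define g where "g x = \<beta> j (s * x)" for x
  have g1: "g (-1) = d j" "g 1 = d (Suc j)"
    using b_lower[OF j] b_upper[OF j] by (auto simp: \<beta>_def g_def s_def)
  have "(\<integral>\<^sup>+x. u x * indicator {g (-1)..g 1} x \<partial>LI) = (\<integral>\<^sup>+x. ennreal (jac j (s * x)) * u (g x) \<partial>LI)"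
  proof (rule nn_integral_LI_substitution[OF u])
    fix x :: real assume x: "x \<in> {-1..1}"
    have "(g has_real_derivative Re (deriv (b j) (of_real (s * x))) * s) (at x)"
      unfolding g_def[abs_def]
      by (rule DERIV_chain2[of "\<beta> j" _ "\<lambda>x. s * x" x, OF \<beta>_has_deriv[OF j sI[OF x]]])
         (auto intro!: derivative_eq_intros)
    moreover have "Re (deriv (b j) (of_real (s * x))) * s = jac j (s * x)"
      using arg_cong[OF signed_deriv_b[OF j sI[OF x]], of Re] s unfolding s_def
      by (cases "even j") auto
    ultimately show "(g has_real_derivative jac j (s * x)) (at x)" by simp
  next
    show "continuous_on {-1..1} (\<lambda>x. jac j (s * x))"
      by (rule continuous_on_compose2[OF jac_cont[OF j]]) (use sI in \<open>auto intro!: continuous_intros\<close>)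
    show "-1 \<le> g (-1)" "g 1 \<le> 1" using g1 d_range[of j] d_range[of "Suc j"] j by auto
  qed (simp add: jac_def)
  also have "\<dots> = (\<integral>\<^sup>+x. ennreal (jac j x) * u (\<beta> j x) \<partial>LI)"
    unfolding g_def
  proof (rule nn_integral_LI_reflect[OF _ s])
    have "\<beta> j \<in> measurable LI LI"
      by (rule measurable_restrict_space2) (use \<beta>_range[OF j] continuous_imp_measurable_LI[OF \<beta>_cont[OF j]] in auto)
    moreover have "jac j \<in> borel_measurable LI"
      by (rule continuous_imp_measurable_LI[OF jac_cont[OF j]])
    ultimately show "(\<lambda>x. ennreal (jac j x) * u (\<beta> j x)) \<in> borel_measurable LI"
      using u by measurable
  qed
  finally show ?thesis by (simp add: g1)
qed

lemma \<beta>_measurable: "j < m \<Longrightarrow> \<beta> j \<in> measurable LI LI"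
  by (rule measurable_restrict_space2) (use \<beta>_range continuous_imp_measurable_LI[OF \<beta>_cont] in auto)

lemma jac_measurable: "j < m \<Longrightarrow> jac j \<in> borel_measurable LI"
  by (rule continuous_imp_measurable_LI[OF jac_cont])

lemma indicator_measurable_LI: "(indicator {x..y} :: real \<Rightarrow> real) \<in> borel_measurable LI"
  by (rule measurable_restrict_space1) auto

lemma indicator_measurable_LI_ennreal: "(indicator {x..y} :: real \<Rightarrow> ennreal) \<in> borel_measurable LI"
  by (rule measurable_restrict_space1) auto

text \<open>The change of variables as an identity of measures, so that it also transports integrals
  of complex functions.\<close>

lemma branch_distr:
  assumes j: "j < m"
  shows "density LI (\<lambda>x. ennreal (indicator {d j..d (Suc j)} x)) = distr (density LI (\<lambda>x. ennreal (jac j x))) LI (\<beta> j)"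
proof (rule measure_eqI)
  fix A assume "A \<in> sets (density LI (\<lambda>x. ennreal (indicator {d j..d (Suc j)} x)))"
  then have A: "A \<in> sets LI" by simp
  note [measurable] = \<beta>_measurable[OF j] jac_measurable[OF j] indicator_measurable_LI
    indicator_measurable_LI_ennreal A
  have "emeasure (density LI (\<lambda>x. ennreal (indicator {d j..d (Suc j)} x))) A =
      (\<integral>\<^sup>+x. indicator A x * indicator {d j..d (Suc j)} x \<partial>LI)"
    by (subst emeasure_density) (auto simp: mult.commute ennreal_indicator intro!: nn_integral_cong)
  also have "\<dots> = (\<integral>\<^sup>+x. ennreal (jac j x) * indicator A (\<beta> j x) \<partial>LI)"
    by (rule branch_nn_integral[OF j]) simp
  also have "\<dots> = emeasure (distr (density LI (\<lambda>x. ennreal (jac j x))) LI (\<beta> j)) A"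
  proof -
    have "emeasure (distr (density LI (\<lambda>x. ennreal (jac j x))) LI (\<beta> j)) A =
        emeasure (density LI (\<lambda>x. ennreal (jac j x))) (\<beta> j -` A \<inter> space LI)"
      by (subst emeasure_distr) auto
    also have "\<dots> = (\<integral>\<^sup>+x. ennreal (jac j x) * indicator (\<beta> j -` A \<inter> space LI) x \<partial>LI)"
      using measurable_sets[OF \<beta>_measurable[OF j] A] by (subst emeasure_density) auto
    also have "\<dots> = (\<integral>\<^sup>+x. ennreal (jac j x) * indicator A (\<beta> j x) \<partial>LI)"
      by (intro nn_integral_cong) (auto split: split_indicator)
    finally show ?thesis by simp
  qed
  finally show "emeasure (density LI (\<lambda>x. ennreal (indicator {d j..d (Suc j)} x))) A =
      emeasure (distr (density LI (\<lambda>x. ennreal (jac j x))) LI (\<beta> j)) A" .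
qed simp

text \<open>Closed laps overlap at the points of the partition; outside this finite set each point
  is counted once.\<close>

lemma sum_indicator_branches:
  assumes "x \<notin> d ` {..m}" "x \<ge> -1" "k \<le> m"
  shows "(\<Sum>j<k. indicator {d j..d (Suc j)} x) = (indicator {-1..d k} x :: real)"
  using assms(3)
proof (induction k)
  case 0
  have "d 0 \<in> d ` {..m}" by blast
  then have "x \<noteq> -1" using assms(1) d_0 by metis
  then show ?case using assms d_0 by (auto simp: indicator_def)
next
  case (Suc k)
  then have "x \<noteq> d k" "d k < d (Suc k)" "-1 \<le> d k" using assms d_less[of k] d_range[of k] by auto
  then show ?case using Suc assms(2) by (auto simp: indicator_def)
qed

lemma branch_integral:
  fixes u :: "real \<Rightarrow> complex"
  assumes u: "integrable LI u"
  shows "\<And>j. j < m \<Longrightarrow> integrable LI (\<lambda>x. jac j x *\<^sub>R u (\<beta> j x))"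
    and "(\<integral>x. u x \<partial>LI) = (\<Sum>j<m. \<integral>x. jac j x *\<^sub>R u (\<beta> j x) \<partial>LI)"
proof -
  have um: "u \<in> borel_measurable LI" using u by auto
  have int: "integrable LI (\<lambda>x. indicator {d j..d (Suc j)} x *\<^sub>R u x)" for j
  proof -
    have "{d j..d (Suc j)} \<inter> {-1..1} \<in> sets LI" by (auto simp: sets_restrict_space)
    from integrable_mult_indicator[OF this u]
    show ?thesis
      by (rule Bochner_Integration.integrable_cong[THEN iffD1, rotated 2]) (auto simp: indicator_def)
  qed
  show int': "integrable LI (\<lambda>x. jac j x *\<^sub>R u (\<beta> j x))" if j: "j < m" for j
  proof -
    note [measurable] = \<beta>_measurable[OF j] jac_measurable[OF j] um indicator_measurable_LI
    have "integrable (density LI (\<lambda>x. ennreal (indicator {d j..d (Suc j)} x))) u"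
      using int[of j] by (subst integrable_density) auto
    then have "integrable (distr (density LI (\<lambda>x. ennreal (jac j x))) LI (\<beta> j)) u"
      by (simp only: branch_distr[OF j])
    then have "integrable (density LI (\<lambda>x. ennreal (jac j x))) (\<lambda>x. u (\<beta> j x))"
      by (subst (asm) integrable_distr_eq) auto
    then show ?thesis by (subst (asm) integrable_density) (auto simp: jac_def)
  qed
  have eq: "(\<integral>x. indicator {d j..d (Suc j)} x *\<^sub>R u x \<partial>LI) = (\<integral>x. jac j x *\<^sub>R u (\<beta> j x) \<partial>LI)"
    if j: "j < m" for j
  proof -
    note [measurable] = \<beta>_measurable[OF j] jac_measurable[OF j] um indicator_measurable_LI
    have "(\<integral>x. indicator {d j..d (Suc j)} x *\<^sub>R u x \<partial>LI) =
        (\<integral>x. u x \<partial>density LI (\<lambda>x. ennreal (indicator {d j..d (Suc j)} x)))"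
      by (subst integral_density) auto
    also have "\<dots> = (\<integral>x. u (\<beta> j x) \<partial>density LI (\<lambda>x. ennreal (jac j x)))"
      unfolding branch_distr[OF j] by (subst integral_distr) auto
    also have "\<dots> = (\<integral>x. jac j x *\<^sub>R u (\<beta> j x) \<partial>LI)"
      by (subst integral_density) (auto simp: jac_def)
    finally show ?thesis .
  qed
  have "AE x in LI. u x = (\<Sum>j<m. indicator {d j..d (Suc j)} x *\<^sub>R u x)"
  proof (rule AE_mp[OF AE_LI_neq[of "d ` {..m}"]], simp, intro AE_I2 impI)
    fix x assume "x \<in> space LI" "x \<notin> d ` {..m}"
    then have "(\<Sum>j<m. indicator {d j..d (Suc j)} x) = (1::real)"
      using sum_indicator_branches[of x m] d_m by (auto simp: indicator_def)
    then show "u x = (\<Sum>j<m. indicator {d j..d (Suc j)} x *\<^sub>R u x)"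
      by (simp flip: scaleR_sum_left)
  qed
  then have "(\<integral>x. u x \<partial>LI) = (\<integral>x. (\<Sum>j<m. indicator {d j..d (Suc j)} x *\<^sub>R u x) \<partial>LI)"
    by (intro integral_cong_AE um borel_measurable_sum borel_measurable_integrable[OF int])
  also have "\<dots> = (\<Sum>j<m. \<integral>x. indicator {d j..d (Suc j)} x *\<^sub>R u x \<partial>LI)"
    by (rule Bochner_Integration.integral_sum) (rule int)
  also have "\<dots> = (\<Sum>j<m. \<integral>x. jac j x *\<^sub>R u (\<beta> j x) \<partial>LI)" by (simp add: eq)
  finally show "(\<integral>x. u x \<partial>LI) = (\<Sum>j<m. \<integral>x. jac j x *\<^sub>R u (\<beta> j x) \<partial>LI)" .
qed

text \<open>On \<open>[-1,1]\<close> this is the Perron-Frobenius operator of the conjugated map.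
  The signs replace absolute values of derivatives, so that \<open>L\<close> preserves
  holomorphy.\<close>

definition L :: "(complex \<Rightarrow> complex) \<Rightarrow> complex \<Rightarrow> complex" where
  "L \<phi> z = (\<Sum>j<m. (-1) ^ j * deriv (b j) z * \<phi> (b j z))"

lemma L_of_real: "x \<in> {-1..1} \<Longrightarrow> L \<phi> (of_real x) = (\<Sum>j<m. of_real (jac j x) * \<phi> (of_real (\<beta> j x)))"
  unfolding L_def by (intro sum.cong refl) (simp add: signed_deriv_b of_real_\<beta>)

lemma cont_of_real: "continuous_on seg \<phi> \<Longrightarrow> continuous_on {-1..1} (\<lambda>x. \<phi> (complex_of_real x))"
  by (rule continuous_on_compose2[of seg]) (auto intro!: continuous_intros)

lemma L_cont: "continuous_on seg \<phi> \<Longrightarrow> continuous_on seg (L \<phi>)"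
  unfolding L_def[abs_def]
proof (intro continuous_intros)
  fix j assume \<phi>: "continuous_on seg \<phi>" and "j \<in> {..<m}"
  then have j: "j < m" by simp
  show "continuous_on seg (deriv (b j))"
    by (rule continuous_on_subset[OF holomorphic_on_imp_continuous_on[OF holomorphic_deriv[OF b_hol[OF j] U_open]] seg_U])
  show "continuous_on seg (\<lambda>x. \<phi> (b j x))"
    by (rule continuous_on_compose2[OF \<phi> continuous_on_subset[OF holomorphic_on_imp_continuous_on[OF b_hol[OF j]] seg_U]])
       (use b_seg j in auto)
qed

lemma Ln_cont: "continuous_on seg \<phi> \<Longrightarrow> continuous_on seg ((L ^^ n) \<phi>)"
  by (induction n) (auto intro: L_cont)

text \<open>The hypothesis on \<open>B\<close> and \<open>B'\<close> says that \<open>B\<close> is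
  \<open>B'\<close> composed with the expanding map, expressed through the inverse branches without
  naming that map.\<close>

lemma transfer_duality:
  assumes \<phi>: "continuous_on seg \<phi>"
    and B: "B \<in> borel_measurable LI" "\<And>x. x \<in> {-1..1} \<Longrightarrow> norm (B x :: complex) \<le> K"
    and BB: "\<And>j x. j < m \<Longrightarrow> x \<in> {-1..1} \<Longrightarrow> B (\<beta> j x) = B' x"
  shows "(\<integral>x. B x * \<phi> (of_real x) \<partial>LI) = (\<integral>x. B' x * L \<phi> (of_real x) \<partial>LI)"
proof -
  have \<phi>m: "(\<lambda>x. \<phi> (complex_of_real x)) \<in> borel_measurable LI"
    by (rule continuous_imp_measurable_LI[OF cont_of_real[OF \<phi>]])
  have int: "integrable LI (\<lambda>x. B x * \<phi> (of_real x))"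
  proof (rule Bochner_Integration.integrable_bound)
    show "integrable LI (\<lambda>x. of_real K * \<phi> (of_real x))"
      by (intro integrable_mult_right continuous_imp_integrable_LI cont_of_real \<phi>)
    show "(\<lambda>x. B x * \<phi> (complex_of_real x)) \<in> borel_measurable LI" using B \<phi>m by measurable
    show "AE x in LI. norm (B x * \<phi> (complex_of_real x)) \<le> norm (complex_of_real K * \<phi> (complex_of_real x))"
      using B(2) by (intro AE_I2) (force simp: norm_mult intro!: mult_right_mono)
  qed
  have "(\<integral>x. B x * \<phi> (of_real x) \<partial>LI) = (\<Sum>j<m. \<integral>x. jac j x *\<^sub>R (B (\<beta> j x) * \<phi> (of_real (\<beta> j x))) \<partial>LI)"
    by (rule branch_integral(2)[OF int])
  also have "\<dots> = (\<integral>x. (\<Sum>j<m. jac j x *\<^sub>R (B (\<beta> j x) * \<phi> (of_real (\<beta> j x)))) \<partial>LI)"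
    by (rule Bochner_Integration.integral_sum[symmetric]) (use branch_integral(1)[OF int] in auto)
  also have "\<dots> = (\<integral>x. B' x * L \<phi> (of_real x) \<partial>LI)"
    by (rule Bochner_Integration.integral_cong)
       (auto simp: L_of_real sum_distrib_left BB scaleR_conv_of_real mult_ac intro!: sum.cong)
  finally show ?thesis .
qed

lemma integral_L:
  assumes "continuous_on seg \<phi>"
  shows "(\<integral>x. L \<phi> (of_real x) \<partial>LI) = (\<integral>x. \<phi> (of_real x) \<partial>LI)"
  using transfer_duality[OF assms, of "\<lambda>_. 1" 1 "\<lambda>_. 1"] by simp

lemma integral_Ln:
  assumes "continuous_on seg \<phi>"
  shows "(\<integral>x. (L ^^ n) \<phi> (of_real x) \<partial>LI) = (\<integral>x. \<phi> (of_real x) \<partial>LI)"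
  by (induction n) (simp_all add: integral_L Ln_cont assms)

text \<open>The product of the signs \<open>(-1) ^ j\<close> of the letters.\<close>

definition sgw :: "nat list \<Rightarrow> complex" where
  "sgw w = (-1) ^ sum_list w"

lemma norm_sgw [simp]: "norm (sgw w) = 1"
  by (simp add: sgw_def norm_power)

text \<open>The induction applies the formula to \<open>L \<phi>\<close>, so the new letter becomes
  the outermost branch, in agreement with \<open>word_map\<close>.\<close>

lemma Ln_words:
  assumes "z \<in> U"
  shows "(L ^^ n) \<phi> z = (\<Sum>w\<in>words m n. sgw w * deriv (bw w) z * \<phi> (bw w z))"
proof (induction n arbitrary: \<phi>)
  case (Suc n)
  have "(L ^^ Suc n) \<phi> z = (\<Sum>w\<in>words m n. sgw w * deriv (bw w) z * L \<phi> (bw w z))"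
    using Suc[of "L \<phi>"] by (simp only: funpow_Suc_right o_apply)
  also have "\<dots> = (\<Sum>w\<in>words m n. \<Sum>j<m. sgw (j # w) * deriv (bw (j # w)) z * \<phi> (bw (j # w) z))"
  proof (intro sum.cong refl)
    fix w assume "w \<in> words m n"
    then have "deriv (bw (j # w)) z = deriv (b j) (bw w z) * deriv (bw w) z" if "j < m" for j
      using that assms by (intro deriv_bw_Cons) (auto simp: words_def)
    then show "sgw w * deriv (bw w) z * L \<phi> (bw w z) =
        (\<Sum>j<m. sgw (j # w) * deriv (bw (j # w)) z * \<phi> (bw (j # w) z))"
      unfolding L_def sum_distrib_left by (intro sum.cong refl) (simp add: sgw_def power_add mult_ac)
  qed
  also have "\<dots> = (\<Sum>j<m. \<Sum>w\<in>words m n. sgw (j # w) * deriv (bw (j # w)) z * \<phi> (bw (j # w) z))"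
    by (rule sum.swap)
  finally show ?case by (simp add: sum_words_Suc)
qed (simp add: sgw_def)

lemma signed_deriv_bw:
  assumes "set w \<subseteq> {..<m}" "x \<in> {-1..1}"
  shows "sgw w * deriv (bw w) (of_real x) = of_real (norm (deriv (bw w) (of_real x)))"
  using assms(1)
proof (induction w)
  case (Cons j w)
  have j: "j < m" "set w \<subseteq> {..<m}" using Cons.prems by auto
  have "bw w (of_real x) \<in> seg" using bw_seg[OF j(2)] assms(2) by simp
  then obtain y where y: "y \<in> {-1..1}" "bw w (of_real x) = of_real y" by (auto simp: seg_def)
  have "deriv (bw (j # w)) (of_real x) = deriv (b j) (of_real y) * deriv (bw w) (of_real x)"
    using deriv_bw_Cons[OF Cons.prems seg_in_U[OF assms(2)]] y by simp
  then have "sgw (j # w) * deriv (bw (j # w)) (of_real x) =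
      ((-1) ^ j * deriv (b j) (of_real y)) * (sgw w * deriv (bw w) (of_real x))"
    by (simp add: sgw_def power_add mult_ac)
  also have "\<dots> = of_real (jac j y) * of_real (norm (deriv (bw w) (of_real x)))"
    using signed_deriv_b[OF j(1) y(1)] Cons.IH[OF j(2)] by simp
  also have "\<dots> = of_real (norm (deriv (bw (j # w)) (of_real x)))"
    using deriv_bw_Cons[OF Cons.prems seg_in_U[OF assms(2)]] y by (simp add: jac_def norm_mult)
  finally show ?case .
qed (simp add: sgw_def)

lemma Ln_one_of_real:
  assumes "x \<in> {-1..1}"
  shows "(L ^^ n) (\<lambda>_. 1) (of_real x) = of_real (\<Sum>w\<in>words m n. norm (deriv (bw w) (of_real x)))"
  unfolding Ln_words[OF seg_in_U[OF assms]] of_real_sum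
  by (intro sum.cong refl) (use signed_deriv_bw[OF _ assms] in \<open>auto simp: words_def\<close>)

end

subsection \<open>Bounded distortion\<close>

lemma integral_LI_eq_integral:
  fixes f :: "real \<Rightarrow> 'a :: euclidean_space"
  assumes "integrable LI f"
  shows "(\<integral>x. f x \<partial>LI) = integral {-1..1} f"
proof -
  have "set_integrable lborel {-1..1} f"
    unfolding set_integrable_def using assms by (subst (asm) integrable_restrict_space) auto
  then have "(LINT x:{-1..1}|lborel. f x) = integral {-1..1} f"
    by (rule set_borel_integral_eq_integral(2))
  moreover have "(LINT x:{-1..1}|lborel. f x) = (\<integral>x. f x \<partial>LI)"
    unfolding set_lebesgue_integral_def by (subst integral_restrict_space) auto
  ultimately show ?thesis by simp
qed

lemma continuous_nonneg_integral_LI_eq_0: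
  fixes f :: "real \<Rightarrow> real"
  assumes "continuous_on {-1..1} f" "\<And>x. x \<in> {-1..1} \<Longrightarrow> f x \<ge> 0" "(\<integral>x. f x \<partial>LI) = 0"
    and "x \<in> {-1..1}"
  shows "f x = 0"
  using integral_eq_0_iff[of "-1" 1 f] assms integral_LI_eq_integral[OF continuous_imp_integrable_LI[OF assms(1)]]
  by auto

text \<open>Equality in the triangle inequality for \<open>T v\<close> and \<open>T w\<close> would
  make them nonnegative multiples of one direction, on which the real linear form
  \<open>Re (\<gamma> * _)\<close> cannot take both signs.\<close>

lemma norm_sum_less_of_opposite:
  fixes T :: "'a \<Rightarrow> complex"
  assumes "finite W" "v \<in> W" "w \<in> W" "Re (\<gamma> * T v) > 0" "Re (\<gamma> * T w) < 0"
  shows "norm (\<Sum>x\<in>W. T x) < (\<Sum>x\<in>W. norm (T x))"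
proof -
  have vw: "v \<noteq> w" using assms by auto
  have split: "(\<Sum>x\<in>W. F x) = F v + F w + (\<Sum>x\<in>W - {v, w}. F x)" for F :: "'a \<Rightarrow> 'b :: real_normed_vector"
  proof -
    have "(\<Sum>x\<in>W. F x) = (\<Sum>x\<in>{v, w}. F x) + (\<Sum>x\<in>W - {v, w}. F x)"
      using assms by (intro sum.subset_diff[THEN trans]) (auto simp: add.commute)
    then show ?thesis using vw by simp
  qed
  have "norm (T v + T w) \<noteq> norm (T v) + norm (T w)"
  proof
    assume "norm (T v + T w) = norm (T v) + norm (T w)"
    then have "norm (T v) *\<^sub>R T w = norm (T w) *\<^sub>R T v" by (simp add: norm_triangle_eq)
    then have "Re (\<gamma> * (norm (T v) *\<^sub>R T w)) = Re (\<gamma> * (norm (T w) *\<^sub>R T v))" by simp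
    then have "norm (T v) * Re (\<gamma> * T w) = norm (T w) * Re (\<gamma> * T v)"
      by (simp add: algebra_simps)
    moreover have "norm (T v) > 0" using assms by auto
    then have "norm (T v) * Re (\<gamma> * T w) < 0" using assms mult_pos_neg by blast
    moreover have "norm (T w) * Re (\<gamma> * T v) \<ge> 0" using assms by simp
    ultimately show False by simp
  qed
  then have "norm (T v + T w) < norm (T v) + norm (T w)"
    using norm_triangle_ineq[of "T v" "T w"] by simp
  moreover have "norm (\<Sum>x\<in>W - {v, w}. T x) \<le> (\<Sum>x\<in>W - {v, w}. norm (T x))" by (rule norm_sum)
  ultimately have "norm (T v + T w + (\<Sum>x\<in>W - {v, w}. T x)) <
      norm (T v) + norm (T w) + (\<Sum>x\<in>W - {v, w}. norm (T x))"
    using norm_triangle_ineq[of "T v + T w" "\<Sum>x\<in>W - {v, w}. T x"] by simp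
  then show ?thesis unfolding split[of T] split[of "\<lambda>x. norm (T x)"] .
qed

context branches
begin

text \<open>Compactness: none of the finitely many derivatives vanishes on \<open>seg\<close>, hence
  none vanishes on a closed neighbourhood of it, where the logarithmic derivatives are
  continuous.\<close>

lemma log_deriv_bound:
  obtains K r where "K \<ge> 0" "r > 0" "nbhd r \<subseteq> U"
    "\<And>j z. j < m \<Longrightarrow> z \<in> nbhd r \<Longrightarrow> deriv (b j) z \<noteq> 0"
    "\<And>j z. j < m \<Longrightarrow> z \<in> nbhd r \<Longrightarrow> norm (deriv (deriv (b j)) z) \<le> K * norm (deriv (b j) z)"
proof -
  have hol1: "deriv (b j) holomorphic_on U" if "j < m" for j
    using holomorphic_deriv[OF b_hol[OF that] U_open] .
  have hol2: "deriv (deriv (b j)) holomorphic_on U" if "j < m" for j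
    using holomorphic_deriv[OF hol1[OF that] U_open] .
  define W where "W = (\<Inter>j\<in>{..<m}. U \<inter> deriv (b j) -` (- {0}))"
  have "open W"
    unfolding W_def
    by (intro open_INT ballI continuous_open_preimage holomorphic_on_imp_continuous_on hol1 U_open) auto
  moreover have "seg \<subseteq> W" using seg_U b_deriv by (auto simp: W_def seg_def)
  ultimately obtain r where r: "r > 0" "closure (nbhd r) \<subseteq> W" by (rule closure_nbhd_subset_open)
  have m0: "0 < m" using m2 by simp
  have WU: "W \<subseteq> U" using m0 by (auto simp: W_def)
  have ne: "deriv (b j) z \<noteq> 0" if "j < m" "z \<in> W" for j z
    using that unfolding W_def by blast
  have "\<exists>K. \<forall>z\<in>closure (nbhd r). norm (deriv (deriv (b j)) z / deriv (b j) z) \<le> K" if j: "j < m" for j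
  proof -
    have "continuous_on (closure (nbhd r)) (\<lambda>z. deriv (deriv (b j)) z / deriv (b j) z)"
      using r(2) WU ne[OF j]
      by (intro continuous_intros continuous_on_subset[OF holomorphic_on_imp_continuous_on[OF hol1[OF j]]]
          continuous_on_subset[OF holomorphic_on_imp_continuous_on[OF hol2[OF j]]]) auto
    then have "bounded ((\<lambda>z. deriv (deriv (b j)) z / deriv (b j) z) ` closure (nbhd r))"
      by (intro compact_imp_bounded compact_continuous_image compact_closure_nbhd)
    then show ?thesis unfolding bounded_iff by auto
  qed
  then obtain K where K: "\<And>j z. j < m \<Longrightarrow> z \<in> closure (nbhd r) \<Longrightarrow> norm (deriv (deriv (b j)) z / deriv (b j) z) \<le> K j"
    by metis
  define K' where "K' = (\<Sum>j<m. \<bar>K j\<bar>)"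
  have "norm (deriv (deriv (b j)) z) \<le> K' * norm (deriv (b j) z)" if j: "j < m" and z: "z \<in> nbhd r" for j z
  proof -
    have zc: "z \<in> closure (nbhd r)" using z closure_subset by blast
    then have n: "deriv (b j) z \<noteq> 0" using ne[OF j] r(2) by blast
    have "K j \<le> \<bar>K j\<bar>" by simp
    also have "\<bar>K j\<bar> \<le> K'" unfolding K'_def using j by (intro member_le_sum) auto
    finally have "norm (deriv (deriv (b j)) z / deriv (b j) z) \<le> K'" using K[OF j zc] by simp
    then show ?thesis using n by (simp add: norm_divide divide_le_eq)
  qed
  moreover have "K' \<ge> 0" by (simp add: K'_def sum_nonneg)
  moreover have "deriv (b j) z \<noteq> 0" if "j < m" "z \<in> nbhd r" for j z
    using ne that r(2) closure_subset[of "nbhd r"] by blast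
  moreover have "nbhd r \<subseteq> U" using r(2) WU closure_subset[of "nbhd r"] by blast
  ultimately show ?thesis using that[of K' r] r(1) by blast
qed

lemma deriv2_bw_Cons:
  assumes w: "set (j # w) \<subseteq> {..<m}" and z: "z \<in> U"
  shows "deriv (deriv (bw (j # w))) z =
    deriv (deriv (b j)) (bw w z) * deriv (bw w) z ^ 2 + deriv (b j) (bw w z) * deriv (deriv (bw w)) z"
proof -
  have j: "j < m" "set w \<subseteq> {..<m}" using w by auto
  have 1: "(deriv (b j) has_field_derivative deriv (deriv (b j)) (bw w z)) (at (bw w z))"
    using holomorphic_deriv[OF b_hol[OF j(1)] U_open] U_open bw_U[OF j(2) z] by (metis holomorphic_derivI)
  have 2: "(deriv (bw w) has_field_derivative deriv (deriv (bw w)) z) (at z)"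
    using holomorphic_deriv[OF bw_hol[OF j(2)] U_open] U_open z by (metis holomorphic_derivI)
  have "((\<lambda>z. deriv (b j) (bw w z) * deriv (bw w) z) has_field_derivative
      deriv (deriv (b j)) (bw w z) * deriv (bw w) z * deriv (bw w) z + deriv (deriv (bw w)) z * deriv (b j) (bw w z)) (at z)"
    by (rule DERIV_mult[OF DERIV_chain2[OF 1 bw_has_deriv[OF j(2) z]] 2])
  then have "(deriv (bw (j # w)) has_field_derivative
      deriv (deriv (b j)) (bw w z) * deriv (bw w) z * deriv (bw w) z + deriv (deriv (bw w)) z * deriv (b j) (bw w z)) (at z)"
    by (rule has_field_derivative_transform_within_open[OF _ U_open z]) (use deriv_bw_Cons[OF w] in auto)
  then show ?thesis by (simp add: DERIV_imp_deriv power2_eq_square mult_ac)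
qed

text \<open>Along a word the logarithmic derivatives add up with weights \<open>C * q ^ k\<close>,
  so the distortion of all composed branches is bounded by one constant \<open>E\<close>. Comparing
  a point near the interval with all points of the interval, and integrating over the latter, bounds
  the sum of derivatives, because \<open>L\<close> preserves the integral of
  \<open>1\<close>.\<close>

lemma uniform_bounds:
  obtains C D q r where "C \<ge> 1" "D > 0" "0 < q" "q < 1" "r > 0" "nbhd r \<subseteq> U"
    "\<And>w z. set w \<subseteq> {..<m} \<Longrightarrow> z \<in> nbhd r \<Longrightarrow> norm (deriv (bw w) z) \<le> C * q ^ length w"
    "\<And>n z. z \<in> nbhd r \<Longrightarrow> (\<Sum>w\<in>words m n. norm (deriv (bw w) z)) \<le> D"
proof -
  obtain C q r0 where C: "C \<ge> 1" and q: "0 < q" "q < 1" and r0: "r0 > 0" "nbhd r0 \<subseteq> U"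
    and contr: "\<And>w z. set w \<subseteq> {..<m} \<Longrightarrow> z \<in> nbhd r0 \<Longrightarrow> norm (deriv (bw w) z) \<le> C * q ^ length w"
    by (rule contraction) metis
  obtain K r1 where K: "K \<ge> 0" and r1: "r1 > 0" "nbhd r1 \<subseteq> U"
    and ne: "\<And>j z. j < m \<Longrightarrow> z \<in> nbhd r1 \<Longrightarrow> deriv (b j) z \<noteq> 0"
    and d2: "\<And>j z. j < m \<Longrightarrow> z \<in> nbhd r1 \<Longrightarrow> norm (deriv (deriv (b j)) z) \<le> K * norm (deriv (b j) z)"
    by (rule log_deriv_bound) metis
  define r2 where "r2 = min r0 r1"
  \<comment> \<open>A composed branch may expand distances by up to \<open>C\<close>; starting
    within \<open>r2 / C\<close> of \<open>seg\<close> keeps the images under all words within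
    \<open>r2\<close>.\<close>
  define s where "s = r2 / C"
  have r2: "r2 > 0" using r0 r1 by (simp add: r2_def)
  have s: "s > 0" "s \<le> r2" using r2 C by (auto simp: s_def field_simps)
  have sr0: "nbhd s \<subseteq> nbhd r0" "nbhd s \<subseteq> U"
    using nbhd_mono[of s r0] s r0 by (auto simp: r2_def)
  have in_r1: "bw w z \<in> nbhd r1" if w: "set w \<subseteq> {..<m}" and z: "z \<in> nbhd s" for w z
  proof -
    obtain x where x: "x \<in> seg" "dist x z < s" using z by (auto simp: in_nbhd_iff)
    have "norm (bw w z - bw w x) \<le> (C * q ^ length w) * norm (z - x)"
    proof (rule field_differentiable_bound[OF convex_nbhd[of r0]])
      show "(bw w has_field_derivative deriv (bw w) y) (at y within nbhd r0)" if "y \<in> nbhd r0" for y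
        using bw_has_deriv[OF w] that r0 has_field_derivative_at_within by blast
    qed (use contr[OF w] z sr0 x seg_subset_nbhd[OF r0(1)] in auto)
    also have "\<dots> \<le> (C * 1) * norm (z - x)"
      using C q by (intro mult_right_mono mult_left_mono power_le_one) auto
    also have "\<dots> < C * s" using x C by (simp add: dist_norm norm_minus_commute)
    also have "\<dots> = r2" using C by (simp add: s_def)
    also have "\<dots> \<le> r1" by (simp add: r2_def)
    finally show ?thesis
      unfolding in_nbhd_iff by (intro bexI[of _ "bw w x"] bw_seg[OF w x(1)]) (simp add: dist_norm norm_minus_commute)
  qed
  have dist0: "deriv (bw w) z \<noteq> 0 \<and>
      norm (deriv (deriv (bw w)) z) \<le> K * C * (\<Sum>k<length w. q ^ k) * norm (deriv (bw w) z)"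
    if "set w \<subseteq> {..<m}" "z \<in> nbhd s" for w z
    using that
  proof (induction w)
    case Nil
    have "deriv (bw []) = (\<lambda>_. 1)" by (rule ext) simp
    then show ?case by simp
  next
    case (Cons j w)
    have j: "j < m" "set w \<subseteq> {..<m}" using Cons.prems by auto
    have zU: "z \<in> U" using Cons.prems sr0 by auto
    note IH = Cons.IH[OF j(2) Cons.prems(2)]
    let ?y = "bw w z" let ?D = "deriv (bw w) z"
    have y: "?y \<in> nbhd r1" by (rule in_r1[OF j(2) Cons.prems(2)])
    have ne': "deriv (bw (j # w)) z \<noteq> 0"
      unfolding deriv_bw_Cons[OF Cons.prems(1) zU] using ne[OF j(1) y] IH by simp
    have D: "norm ?D \<le> C * q ^ length w" using contr[OF j(2)] Cons.prems(2) sr0 by blast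
    have 1: "norm (deriv (deriv (bw (j # w))) z) \<le>
        norm (deriv (deriv (b j)) ?y) * norm ?D ^ 2 + norm (deriv (b j) ?y) * norm (deriv (deriv (bw w)) z)"
      unfolding deriv2_bw_Cons[OF Cons.prems(1) zU] norm_mult[symmetric] norm_power[symmetric]
      by (rule norm_triangle_ineq)
    have "norm (deriv (deriv (b j)) ?y) * norm ?D ^ 2 \<le> (K * norm (deriv (b j) ?y)) * norm ?D ^ 2"
      by (intro mult_right_mono d2 j y) auto
    also have "(K * norm (deriv (b j) ?y)) * norm ?D ^ 2 = (K * norm ?D) * (norm (deriv (b j) ?y) * norm ?D)"
      by (simp add: power2_eq_square mult_ac)
    also have "\<dots> \<le> (K * (C * q ^ length w)) * (norm (deriv (b j) ?y) * norm ?D)"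
      using K D by (intro mult_right_mono mult_left_mono) auto
    finally have 2: "norm (deriv (deriv (b j)) ?y) * norm ?D ^ 2 \<le>
        (K * (C * q ^ length w)) * (norm (deriv (b j) ?y) * norm ?D)" .
    have 3: "norm (deriv (b j) ?y) * norm (deriv (deriv (bw w)) z) \<le>
        norm (deriv (b j) ?y) * (K * C * (\<Sum>k<length w. q ^ k) * norm ?D)"
      using IH by (intro mult_left_mono) auto
    have "norm (deriv (deriv (bw (j # w))) z) \<le> (K * (C * q ^ length w)) * (norm (deriv (b j) ?y) * norm ?D)
        + norm (deriv (b j) ?y) * (K * C * (\<Sum>k<length w. q ^ k) * norm ?D)"
      using order_trans[OF 1 add_mono[OF 2 3]] .
    also have "\<dots> = K * C * (\<Sum>k<length (j # w). q ^ k) * (norm (deriv (b j) ?y) * norm ?D)"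
      by (simp add: algebra_simps)
    finally show ?case using ne' unfolding deriv_bw_Cons[OF Cons.prems(1) zU] norm_mult by blast
  qed
  define K' where "K' = K * C / (1 - q)"
  have K': "K' \<ge> 0" using K C q by (simp add: K'_def)
  have d2w: "norm (deriv (deriv (bw w)) z) \<le> K' * norm (deriv (bw w) z)"
    if w: "set w \<subseteq> {..<m}" and z: "z \<in> nbhd s" for w z
  proof -
    have "(\<Sum>k<length w. q ^ k) \<le> 1 / (1 - q)"
      using q sum_le_suminf[of "\<lambda>k. q ^ k" "{..<length w}"] by (simp add: suminf_geometric)
    then have "K * C * (\<Sum>k<length w. q ^ k) \<le> K * C * (1 / (1 - q))"
      using K C by (intro mult_left_mono) auto
    then have "K * C * (\<Sum>k<length w. q ^ k) * norm (deriv (bw w) z) \<le> K' * norm (deriv (bw w) z)"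
      by (intro mult_right_mono) (auto simp: K'_def)
    then show ?thesis using dist0[OF w z] by linarith
  qed
  \<comment> \<open>A point of \<open>nbhd s\<close> and a point of \<open>seg\<close> are at
    distance at most \<open>2 + s\<close>.\<close>
  define E where "E = exp (K' * (2 + s))"
  have dist: "norm (deriv (bw w) z) \<le> E * norm (deriv (bw w) (of_real y))"
    if w: "set w \<subseteq> {..<m}" and z: "z \<in> nbhd s" and y: "y \<in> {-1..1}" for w z y
  proof -
    have ys: "complex_of_real y \<in> nbhd s" using y seg_subset_nbhd[OF s(1)] by auto
    have "norm (deriv (bw w) z) \<le> exp (K' * norm (z - of_real y)) * norm (deriv (bw w) (of_real y))"
      by (rule norm_le_exp_of_log_deriv_bound[OF open_nbhd convex_nbhd _ _ _ z ys])
         (use dist0[OF w] d2w[OF w] holomorphic_on_subset[OF holomorphic_deriv[OF bw_hol[OF w] U_open] sr0(2)] in auto)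
    also have "exp (K' * norm (z - of_real y)) \<le> E"
    proof -
      obtain x where x: "x \<in> seg" "dist x z < s" using z by (auto simp: in_nbhd_iff)
      have "norm (x - of_real y) \<le> 2"
      proof -
        have "\<bar>y\<bar> \<le> 1" using y by auto
        then show ?thesis using seg_norm_le[OF x(1)] norm_triangle_ineq4[of x "of_real y"] by simp
      qed
      then have "norm (z - of_real y) \<le> 2 + s"
        using x(2) norm_triangle_ineq[of "z - x" "x - of_real y"] by (simp add: dist_norm norm_minus_commute)
      then show ?thesis unfolding E_def using K' by (simp add: mult_left_mono)
    qed
    finally show ?thesis by (simp add: mult_right_mono)
  qed
  \<comment> \<open>The comparison holds for every \<open>y\<close>. Its integral has
    \<open>2 * S\<close> on the left and \<open>2 * E\<close> on the right, both factors
    \<open>2\<close> being the length of the interval.\<close>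
  have sum_bd: "(\<Sum>w\<in>words m n. norm (deriv (bw w) z)) \<le> E" if z: "z \<in> nbhd s" for n z
  proof -
    define S where "S = (\<Sum>w\<in>words m n. norm (deriv (bw w) z))"
    have cont: "continuous_on {-1..1} (\<lambda>x. (L ^^ n) (\<lambda>_. 1) (complex_of_real x))"
      by (intro cont_of_real Ln_cont) auto
    have "S \<le> E * Re ((L ^^ n) (\<lambda>_. 1) (complex_of_real y))" if y: "y \<in> {-1..1}" for y
    proof -
      have "S \<le> (\<Sum>w\<in>words m n. E * norm (deriv (bw w) (of_real y)))"
        unfolding S_def by (intro sum_mono dist z y) (auto simp: words_def)
      then show ?thesis by (simp add: Ln_one_of_real[OF y] sum_distrib_left)
    qed
    then have "(\<integral>x. S \<partial>LI) \<le> (\<integral>x. E * Re ((L ^^ n) (\<lambda>_. 1) (complex_of_real x)) \<partial>LI)"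
      using cont by (intro integral_mono) (auto intro!: continuous_imp_integrable_LI continuous_intros)
    also have "\<dots> = E * (\<integral>x. Re ((L ^^ n) (\<lambda>_. 1) (complex_of_real x)) \<partial>LI)" by simp
    also have "(\<integral>x. Re ((L ^^ n) (\<lambda>_. 1) (complex_of_real x)) \<partial>LI) =
        Re (\<integral>x. (L ^^ n) (\<lambda>_. 1) (complex_of_real x) \<partial>LI)"
      by (intro integral_Re continuous_imp_integrable_LI cont)
    also have "\<dots> = 2" using measure_LI_space by (simp add: integral_Ln)
    finally show ?thesis using measure_LI_space by (simp add: S_def)
  qed
  show ?thesis
    by (rule that[of C E q s]) (use C q s sr0 contr sum_bd in \<open>auto simp: E_def\<close>)
qed

lemma branch_surj:
  assumes "x \<in> {-1..1}"
  shows "\<exists>j<m. \<exists>y\<in>{-1..1}. \<beta> j y = x"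
proof -
  have "\<exists>j<k. x \<in> {d j..d (Suc j)}" if "-1 \<le> x" "x \<le> d k" "0 < k" "k \<le> m" for k
    using that
  proof (induction k)
    case (Suc k)
    show ?case
    proof (cases "x \<le> d k \<and> 0 < k")
      case True
      then show ?thesis using Suc by (meson Suc_leD less_SucI)
    next
      case False
      then have "d k \<le> x" using d_0 Suc.prems by (cases "k = 0") auto
      then show ?thesis using Suc.prems by (intro exI[of _ k]) auto
    qed
  qed simp
  from this[of m] obtain j where j: "j < m" "x \<in> {d j..d (Suc j)}"
    using assms d_m m2 by auto
  have ends: "\<beta> j (- ((-1) ^ j)) = d j" "\<beta> j ((-1) ^ j) = d (Suc j)"
    using b_lower[OF j(1)] b_upper[OF j(1)] by (auto simp: \<beta>_def)
  have conn: "connected (\<beta> j ` {-1..1})" by (intro connected_continuous_image \<beta>_cont j) auto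
  have mem: "(-1::real) ^ j \<in> {-1..1}" "- ((-1::real) ^ j) \<in> {-1..1}" by (cases "even j"; simp)+
  have "d j \<in> \<beta> j ` {-1..1}" "d (Suc j) \<in> \<beta> j ` {-1..1}" using ends mem by (metis image_eqI)+
  then have "x \<in> \<beta> j ` {-1..1}" using connectedD_interval[OF conn, of "d j" "d (Suc j)" x] j by auto
  then show ?thesis using j by auto
qed

lemma word_surj:
  assumes "x \<in> seg"
  shows "\<exists>w\<in>words m n. \<exists>y\<in>seg. bw w y = x"
  using assms
proof (induction n arbitrary: x)
  case (Suc n)
  obtain t where t: "t \<in> {-1..1}" "x = of_real t" using Suc.prems by (auto simp: seg_def)
  obtain j y where j: "j < m" "y \<in> {-1..1}" "\<beta> j y = t" using branch_surj[OF t(1)] by blast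
  obtain w v where w: "w \<in> words m n" "v \<in> seg" "bw w v = of_real y" using Suc.IH[of "of_real y"] j by auto
  have "bw (j # w) v = x" using w j t of_real_\<beta>[OF j(1,2)] by simp
  then show ?case using w j by (intro bexI[of _ "j # w"] bexI[of _ v]) (auto simp: words_def)
qed auto

text \<open>Because the weights are positive on the interval, \<open>L\<close> applied to the
  modulus gives the sum of the moduli of all terms, that is, the right side of the triangle
  inequality for \<open>(L ^^ n) \<phi>\<close>.\<close>

lemma Ln_norm_of_real:
  assumes "x \<in> {-1..1}"
  shows "(L ^^ n) (\<lambda>z. of_real (norm (\<phi> z))) (of_real x) =
    of_real (\<Sum>w\<in>words m n. norm (sgw w * deriv (bw w) (of_real x) * \<phi> (bw w (of_real x))))"
  unfolding Ln_words[OF seg_in_U[OF assms]] of_real_sum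
proof (intro sum.cong refl)
  fix w assume "w \<in> words m n"
  then have w: "set w \<subseteq> {..<m}" by (auto simp: words_def)
  show "sgw w * deriv (bw w) (of_real x) * of_real (norm (\<phi> (bw w (of_real x)))) =
      of_real (norm (sgw w * deriv (bw w) (of_real x) * \<phi> (bw w (of_real x))))"
    unfolding signed_deriv_bw[OF w assms] by (simp add: norm_mult)
qed

lemma integral_norm_Ln_le:
  assumes "continuous_on seg \<phi>"
  shows "(\<integral>x. norm ((L ^^ n) \<phi> (of_real x)) \<partial>LI) \<le> (\<integral>x. norm (\<phi> (of_real x)) \<partial>LI)"
proof -
  have c: "continuous_on seg (\<lambda>z. complex_of_real (norm (\<phi> z)))" by (intro continuous_intros assms)
  have cL: "continuous_on {-1..1} (\<lambda>x. (L ^^ n) (\<lambda>z. complex_of_real (norm (\<phi> z))) (of_real x))"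
    by (intro cont_of_real Ln_cont c)
  have "(\<integral>x. norm ((L ^^ n) \<phi> (of_real x)) \<partial>LI) \<le>
      (\<integral>x. Re ((L ^^ n) (\<lambda>z. of_real (norm (\<phi> z))) (of_real x)) \<partial>LI)"
  proof (rule integral_mono)
    fix x assume "x \<in> space LI"
    then have x: "x \<in> {-1..1}" by simp
    show "norm ((L ^^ n) \<phi> (of_real x)) \<le> Re ((L ^^ n) (\<lambda>z. of_real (norm (\<phi> z))) (of_real x))"
      unfolding Ln_norm_of_real[OF x] unfolding Ln_words[OF seg_in_U[OF x]] Re_complex_of_real by (rule norm_sum)
  qed (intro continuous_imp_integrable_LI continuous_intros cont_of_real Ln_cont assms cL)+
  also have "\<dots> = Re (\<integral>x. (L ^^ n) (\<lambda>z. of_real (norm (\<phi> z))) (of_real x) \<partial>LI)"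
    by (intro integral_Re continuous_imp_integrable_LI cL)
  also have "\<dots> = Re (\<integral>x. of_real (norm (\<phi> (of_real x))) \<partial>LI)"
    by (simp only: integral_Ln[OF c])
  also have "\<dots> = (\<integral>x. norm (\<phi> (of_real x)) \<partial>LI)" by simp
  finally show ?thesis .
qed

end

locale uniform_branches = branches +
  fixes C D q r :: real
  assumes C1: "C \<ge> 1" and D0: "D > 0" and q: "0 < q" "q < 1" and r0: "r > 0" and r_U: "nbhd r \<subseteq> U"
    and contr: "\<And>w z. set w \<subseteq> {..<m} \<Longrightarrow> z \<in> nbhd r \<Longrightarrow> norm (deriv (bw w) z) \<le> C * q ^ length w"
    and sum_bound: "\<And>n z. z \<in> nbhd r \<Longrightarrow> (\<Sum>w\<in>words m n. norm (deriv (bw w) z)) \<le> D"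
begin

lemma bw_lipschitz:
  assumes w: "set w \<subseteq> {..<m}" and "z \<in> nbhd r" "x \<in> nbhd r"
  shows "norm (bw w z - bw w x) \<le> (C * q ^ length w) * norm (z - x)"
proof (rule field_differentiable_bound[OF convex_nbhd[of r]])
  show "(bw w has_field_derivative deriv (bw w) y) (at y within nbhd r)" if "y \<in> nbhd r" for y
    using bw_has_deriv[OF w] that r_U has_field_derivative_at_within by blast
qed (use contr[OF w] assms in auto)

lemma bw_nbhd:
  assumes w: "set w \<subseteq> {..<m}" and z: "z \<in> nbhd t" and t: "t \<le> r" "C * q ^ length w * t \<le> t'"
  shows "bw w z \<in> nbhd t'"
proof -
  obtain x where x: "x \<in> seg" "dist x z < t" using z by (auto simp: in_nbhd_iff)
  have "norm (bw w z - bw w x) \<le> (C * q ^ length w) * norm (z - x)"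
    by (rule bw_lipschitz[OF w]) (use z x t nbhd_mono[of t r] seg_subset_nbhd[OF r0] in auto)
  also have "\<dots> < C * q ^ length w * t" using x C1 q by (simp add: dist_norm norm_minus_commute)
  finally show ?thesis
    unfolding in_nbhd_iff using t(2)
    by (intro bexI[of _ "bw w x"] bw_seg[OF w x(1)]) (simp add: dist_norm norm_minus_commute)
qed

text \<open>Dividing the radius by \<open>C\<close> once makes it suitable for words of every
  length, so all iterates of \<open>L\<close> live on one common neighbourhood.\<close>

lemma bw_nbhd_C:
  assumes "set w \<subseteq> {..<m}" "z \<in> nbhd (t / C)" "t \<le> r" "0 \<le> t"
  shows "bw w z \<in> nbhd t"
proof (rule bw_nbhd[OF assms(1,2)])
  have "t / C \<le> t" using C1 assms by (simp add: divide_le_eq mult_le_cancel_left1)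
  then show "t / C \<le> r" using assms by simp
  have "q ^ length w * t \<le> 1 * t" using q assms by (intro mult_right_mono power_le_one) auto
  then show "C * q ^ length w * (t / C) \<le> t" using C1 by simp
qed

lemma nbhd_div_C: "t \<le> r \<Longrightarrow> 0 \<le> t \<Longrightarrow> nbhd (t / C) \<subseteq> nbhd t" "t \<le> r \<Longrightarrow> 0 \<le> t \<Longrightarrow> nbhd (t / C) \<subseteq> nbhd r"
proof -
  assume t: "t \<le> r" "0 \<le> t"
  then have "t / C \<le> t" using C1 by (simp add: divide_le_eq mult_le_cancel_left1)
  then show "nbhd (t / C) \<subseteq> nbhd t" "nbhd (t / C) \<subseteq> nbhd r" using t by (intro nbhd_mono; simp)+
qed

lemma Ln_bound:
  assumes B: "\<And>z. z \<in> nbhd t \<Longrightarrow> norm (\<phi> z) \<le> B" and t: "0 < t" "t \<le> r" and z: "z \<in> nbhd (t / C)"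
  shows "norm ((L ^^ n) \<phi> z) \<le> D * B"
proof -
  have zr: "z \<in> nbhd r" using nbhd_div_C(2)[of t] t z by auto
  have "0 \<in> nbhd t" using seg_subset_nbhd[OF t(1)] by auto
  then have B0: "B \<ge> 0" using B norm_ge_zero order_trans by blast
  have "norm ((L ^^ n) \<phi> z) \<le> (\<Sum>w\<in>words m n. norm (deriv (bw w) z) * B)"
    unfolding Ln_words[OF subsetD[OF r_U zr]]
  proof (rule sum_norm_le)
    fix w assume "w \<in> words m n"
    then have "bw w z \<in> nbhd t" using t z by (intro bw_nbhd_C) (auto simp: words_def)
    then show "norm (sgw w * deriv (bw w) z * \<phi> (bw w z)) \<le> norm (deriv (bw w) z) * B"
      using B by (simp add: norm_mult mult_left_mono)
  qed
  also have "\<dots> = (\<Sum>w\<in>words m n. norm (deriv (bw w) z)) * B" by (simp add: sum_distrib_right)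
  also have "\<dots> \<le> D * B" using B0 sum_bound[OF zr] by (rule mult_right_mono[rotated])
  finally show ?thesis .
qed

lemma Ln_hol:
  assumes \<phi>: "\<phi> holomorphic_on nbhd t" and t: "0 < t" "t \<le> r"
  shows "(L ^^ n) \<phi> holomorphic_on nbhd (t / C)"
proof -
  have sub: "nbhd (t / C) \<subseteq> U" using nbhd_div_C(2)[of t] t r_U by auto
  have "(\<lambda>z. \<Sum>w\<in>words m n. sgw w * deriv (bw w) z * \<phi> (bw w z)) holomorphic_on nbhd (t / C)"
  proof (rule holomorphic_on_sum)
    fix w assume "w \<in> words m n"
    then have w: "set w \<subseteq> {..<m}" by (auto simp: words_def)
    have "deriv (bw w) holomorphic_on nbhd (t / C)"
      by (rule holomorphic_on_subset[OF holomorphic_deriv[OF bw_hol[OF w] U_open] sub])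
    moreover have "(\<phi> \<circ> bw w) holomorphic_on nbhd (t / C)"
      by (rule holomorphic_on_compose_gen[OF holomorphic_on_subset[OF bw_hol[OF w] sub] \<phi>])
         (use bw_nbhd_C[OF w] t in auto)
    then have "(\<lambda>z. \<phi> (bw w z)) holomorphic_on nbhd (t / C)" by (simp add: o_def)
    ultimately show "(\<lambda>z. sgw w * deriv (bw w) z * \<phi> (bw w z)) holomorphic_on nbhd (t / C)"
      by (intro holomorphic_on_mult holomorphic_on_const)
  qed
  then show ?thesis
    by (rule holomorphic_transform) (use Ln_words sub in auto)
qed

lemma hol_cont_seg: "\<phi> holomorphic_on nbhd t \<Longrightarrow> t > 0 \<Longrightarrow> continuous_on seg \<phi>"
  using holomorphic_on_imp_continuous_on continuous_on_subset seg_subset_nbhd by blast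

end

subsection \<open>Invariant density and mixing\<close>

context branches
begin

lemma L_add: "L (\<lambda>z. u z + v z) = (\<lambda>z. L u z + L v z)"
  by (rule ext) (simp add: L_def distrib_left sum.distrib)

lemma L_scale: "L (\<lambda>z. c * u z) = (\<lambda>z. c * L u z)"
  by (rule ext) (simp add: L_def sum_distrib_left mult_ac)

lemma Ln_add: "(L ^^ n) (\<lambda>z. u z + v z) = (\<lambda>z. (L ^^ n) u z + (L ^^ n) v z)"
  by (induction n) (simp_all add: L_add)

lemma Ln_scale: "(L ^^ n) (\<lambda>z. c * u z) = (\<lambda>z. c * (L ^^ n) u z)"
  by (induction n) (simp_all add: L_scale)

lemma L_sum: "L (\<lambda>z. \<Sum>k\<in>A. u k z) = (\<lambda>z. \<Sum>k\<in>A. L (u k) z)"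
proof (rule ext)
  fix z
  have "L (\<lambda>z. \<Sum>k\<in>A. u k z) z = (\<Sum>j<m. \<Sum>k\<in>A. (-1) ^ j * deriv (b j) z * u k (b j z))"
    by (simp add: L_def sum_distrib_left)
  also have "\<dots> = (\<Sum>k\<in>A. \<Sum>j<m. (-1) ^ j * deriv (b j) z * u k (b j z))" by (rule sum.swap)
  finally show "L (\<lambda>z. \<Sum>k\<in>A. u k z) z = (\<Sum>k\<in>A. L (u k) z)" by (simp add: L_def)
qed

end

context uniform_branches
begin

lemma const_one_bound: "z \<in> nbhd r \<Longrightarrow> norm ((L ^^ n) (\<lambda>_. 1) z) \<le> D"
  using sum_norm_le[of "words m n" "\<lambda>w. sgw w * deriv (bw w) z" "\<lambda>w. norm (deriv (bw w) z)"] sum_bound[of z n] r_U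
  by (subst Ln_words) (auto simp: norm_mult)

lemma const_one_hol: "(L ^^ n) (\<lambda>_. 1) holomorphic_on nbhd r"
proof -
  have "(\<lambda>z. \<Sum>w\<in>words m n. sgw w * deriv (bw w) z) holomorphic_on nbhd r"
  proof (rule holomorphic_on_sum)
    fix w assume "w \<in> words m n"
    then have w: "set w \<subseteq> {..<m}" by (auto simp: words_def)
    have "deriv (bw w) holomorphic_on nbhd r"
      by (rule holomorphic_on_subset[OF holomorphic_deriv[OF bw_hol[OF w] U_open] r_U])
    then show "(\<lambda>z. sgw w * deriv (bw w) z) holomorphic_on nbhd r"
      by (intro holomorphic_on_mult holomorphic_on_const)
  qed
  then show ?thesis by (rule holomorphic_transform) (use Ln_words r_U in auto)
qed

lemma integral_LI_limit:
  fixes s :: "nat \<Rightarrow> real \<Rightarrow> 'a :: {banach, second_countable_topology}"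
  assumes "\<And>n. continuous_on {-1..1} (s n)" "continuous_on {-1..1} f"
    and "\<And>x. x \<in> {-1..1} \<Longrightarrow> (\<lambda>n. s n x) \<longlonglongrightarrow> f x"
    and "\<And>n x. x \<in> {-1..1} \<Longrightarrow> norm (s n x) \<le> B"
  shows "(\<lambda>n. \<integral>x. s n x \<partial>LI) \<longlonglongrightarrow> (\<integral>x. f x \<partial>LI)"
  by (rule integral_dominated_convergence[where w = "\<lambda>_. B"])
     (use assms in \<open>auto intro: continuous_imp_measurable_LI\<close>)

text \<open>A limit of Cesaro means of the bounded sequence \<open>L\<^sup>n 1\<close>.\<close>

lemma invariant_density:
  obtains h t where "t > 0" "h holomorphic_on nbhd t" "\<And>z. z \<in> nbhd t \<Longrightarrow> L h z = h z"
    "\<And>x. x \<in> {-1..1} \<Longrightarrow> Im (h (of_real x)) = 0" "\<And>x. x \<in> {-1..1} \<Longrightarrow> Re (h (of_real x)) \<ge> 0"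
    "(\<integral>x. h (of_real x) \<partial>LI) = 1"
proof -
  define a where "a n z = (\<Sum>k\<le>n. (L ^^ k) (\<lambda>_. 1) z) / of_nat (Suc n)" for n z
  have a_hol: "a n holomorphic_on nbhd r" for n
    unfolding a_def by (intro holomorphic_intros const_one_hol) auto
  have a_bd: "norm (a n z) \<le> D" if "z \<in> nbhd r" for n z
  proof -
    have "norm (\<Sum>k\<le>n. (L ^^ k) (\<lambda>_. 1) z) \<le> (\<Sum>k\<le>n. D)"
      by (intro sum_norm_le const_one_bound that)
    then show ?thesis by (simp add: a_def norm_divide divide_le_eq mult.commute del: of_nat_Suc)
  qed
  obtain g \<rho> where g: "g holomorphic_on nbhd r" and \<rho>: "strict_mono (\<rho> :: nat \<Rightarrow> nat)"
    and lim: "\<And>x. x \<in> nbhd r \<Longrightarrow> ((\<lambda>n. a (\<rho> n) x) \<longlongrightarrow> g x) sequentially"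
  proof (rule Montel[of "nbhd r" "range a" a])
    show "\<exists>B. \<forall>h\<in>range a. \<forall>z\<in>K. norm (h z) \<le> B" if "compact K" "K \<subseteq> nbhd r" for K
      using a_bd that by (intro exI[of _ D]) auto
  qed (use a_hol in auto)
  have lim_seg: "(\<lambda>n. a (\<rho> n) (of_real x)) \<longlonglongrightarrow> g (of_real x)" if "x \<in> {-1..1}" for x
    using that seg_subset_nbhd[OF r0] by (intro lim) auto
  have seg_r: "complex_of_real x \<in> nbhd r" if "x \<in> {-1..1}" for x
    using that seg_subset_nbhd[OF r0] by auto
  have a_cont: "continuous_on {-1..1} (\<lambda>x. a n (complex_of_real x))" for n
    by (intro cont_of_real hol_cont_seg[OF a_hol r0])
  have int_a: "(\<integral>x. a n (complex_of_real x) \<partial>LI) = 2" for n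
  proof -
    have c: "continuous_on {-1..1} (\<lambda>x. (L ^^ k) (\<lambda>_. 1) (complex_of_real x))" for k
      by (intro cont_of_real Ln_cont) auto
    have "(\<integral>x. a n (complex_of_real x) \<partial>LI) =
        (\<Sum>k\<le>n. \<integral>x. (L ^^ k) (\<lambda>_. 1) (complex_of_real x) \<partial>LI) / of_nat (Suc n)"
      unfolding a_def by (simp only: integral_divide_zero Bochner_Integration.integral_sum[OF continuous_imp_integrable_LI[OF c]])
    also have "\<dots> = 2"
      using measure_LI_space by (simp add: integral_Ln scaleR_conv_of_real del: of_nat_Suc)
    finally show ?thesis .
  qed
  have "(\<lambda>n. \<integral>x. a (\<rho> n) (complex_of_real x) \<partial>LI) \<longlonglongrightarrow> (\<integral>x. g (of_real x) \<partial>LI)"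
    by (rule integral_LI_limit[of _ _ D])
       (use a_cont lim_seg a_bd seg_r cont_of_real[OF hol_cont_seg[OF g r0]] in auto)
  then have int_g: "(\<integral>x. g (of_real x) \<partial>LI) = 2"
    unfolding int_a by (simp add: LIMSEQ_const_iff)
  have Lg: "L g z = g z" if z: "z \<in> nbhd (r / C)" for z
  proof -
    have zr: "z \<in> nbhd r" using z nbhd_div_C(2)[of r] r0 by auto
    have bz: "b j z \<in> nbhd r" if "j < m" for j
      using bw_nbhd_C[of "[j]" z r] z r0 that by simp
    have "(\<lambda>n. L (a (\<rho> n)) z) \<longlonglongrightarrow> L g z"
      unfolding L_def by (intro tendsto_intros lim bz) auto
    moreover have "(\<lambda>n. L (a (\<rho> n)) z - a (\<rho> n) z) \<longlonglongrightarrow> 0"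
    proof -
      \<comment> \<open>Telescoping: applying \<open>L\<close> changes a Cesaro mean only by its
        first and last terms, which are bounded and are divided by \<open>Suc n\<close>.\<close>
      have eq: "L (a n) z - a n z = ((L ^^ Suc n) (\<lambda>_. 1) z - 1) / of_nat (Suc n)" for n
      proof -
        have a_eq: "a n = (\<lambda>z. (1 / of_nat (Suc n)) * (\<Sum>k\<le>n. (L ^^ k) (\<lambda>_. 1) z))"
          by (rule ext) (simp add: a_def)
        have "L (a n) z = (1 / of_nat (Suc n)) * (\<Sum>k\<le>n. (L ^^ Suc k) (\<lambda>_. 1) z)"
          unfolding a_eq L_scale L_sum by simp
        then have "L (a n) z - a n z = (1 / of_nat (Suc n)) * (\<Sum>k\<le>n. (L ^^ Suc k) (\<lambda>_. 1) z - (L ^^ k) (\<lambda>_. 1) z)"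
          by (simp add: a_def sum_subtractf diff_divide_distrib del: of_nat_Suc funpow.simps)
        also have "(\<Sum>k\<le>n. (L ^^ Suc k) (\<lambda>_. 1) z - (L ^^ k) (\<lambda>_. 1) z) = (L ^^ Suc n) (\<lambda>_. 1) z - 1"
          by (induction n) simp_all
        finally show ?thesis by simp
      qed
      have "(\<lambda>n. L (a n) z - a n z) \<longlonglongrightarrow> 0"
      proof (rule Lim_null_comparison)
        have "norm (L (a n) z - a n z) \<le> (D + 1) * (1 / real (Suc n))" for n
        proof -
          have "norm ((L ^^ Suc n) (\<lambda>_. 1) z - 1) \<le> D + 1"
            using const_one_bound[OF zr, of "Suc n"] norm_triangle_ineq4[of "(L ^^ Suc n) (\<lambda>_. 1) z" 1] by simp
          then show ?thesis unfolding eq by (simp add: norm_divide divide_right_mono del: of_nat_Suc funpow.simps)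
        qed
        then show "\<forall>\<^sub>F n in sequentially. norm (L (a n) z - a n z) \<le> (D + 1) * (1 / real (Suc n))" by simp
        show "(\<lambda>n. (D + 1) * (1 / real (Suc n))) \<longlonglongrightarrow> 0"
          using tendsto_mult_right_zero[OF LIMSEQ_inverse_real_of_nat, of "D + 1"] by (simp add: field_simps)
      qed
      from LIMSEQ_subseq_LIMSEQ[OF this \<rho>] show ?thesis by (simp add: o_def)
    qed
    ultimately have "(\<lambda>n. L (a (\<rho> n)) z - (L (a (\<rho> n)) z - a (\<rho> n) z)) \<longlonglongrightarrow> L g z - 0"
      by (intro tendsto_diff)
    then have "(\<lambda>n. a (\<rho> n) z) \<longlonglongrightarrow> L g z" by simp
    then show ?thesis using lim[OF zr] LIMSEQ_unique by blast
  qed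
  have a_real: "a n (of_real x) = of_real (Re (a n (of_real x)))" "Re (a n (of_real x)) \<ge> 0" if x: "x \<in> {-1..1}" for n x
  proof -
    define v where "v = (\<Sum>k\<le>n. \<Sum>w\<in>words m k. norm (deriv (bw w) (complex_of_real x))) / real (Suc n)"
    have v: "a n (of_real x) = of_real v"
      by (simp add: a_def v_def Ln_one_of_real[OF x] del: of_nat_Suc)
    moreover have "v \<ge> 0" by (simp add: v_def sum_nonneg)
    ultimately show "a n (of_real x) = of_real (Re (a n (of_real x)))" "Re (a n (of_real x)) \<ge> 0" by simp_all
  qed
  have Im_g: "Im (g (of_real x)) = 0" if x: "x \<in> {-1..1}" for x
  proof -
    have "(\<lambda>n. Im (a (\<rho> n) (of_real x))) \<longlonglongrightarrow> Im (g (of_real x))" by (intro tendsto_intros lim_seg x)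
    moreover have "Im (a (\<rho> n) (of_real x)) = 0" for n
      using a_real(1)[OF x, of "\<rho> n"] by (metis Im_complex_of_real)
    ultimately show ?thesis by (simp add: LIMSEQ_const_iff)
  qed
  have Re_g: "Re (g (of_real x)) \<ge> 0" if x: "x \<in> {-1..1}" for x
    by (rule tendsto_lowerbound[OF tendsto_Re[OF lim_seg[OF x]]]) (use a_real(2)[OF x] in auto)
  \<comment> \<open>The integral of \<open>1\<close> over the interval is \<open>2\<close> and is
    preserved by every \<open>L ^^ k\<close>, so halving normalises the density.\<close>
  define h where "h z = (1/2) * g z" for z
  show ?thesis
  proof (rule that[of "r / C" h])
    show "r / C > 0" using r0 C1 by simp
    show "h holomorphic_on nbhd (r / C)"
      unfolding h_def using holomorphic_on_subset[OF g nbhd_div_C(2)[of r]] r0 by (intro holomorphic_intros) auto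
    show "L h z = h z" if "z \<in> nbhd (r / C)" for z
      unfolding h_def[abs_def] L_scale by (simp add: Lg[OF that])
    show "(\<integral>x. h (complex_of_real x) \<partial>LI) = 1"
      unfolding h_def using int_g by simp
  qed (use Im_g Re_g in \<open>auto simp: h_def\<close>)
qed

text \<open>By compactness the \<open>L\<^sup>1\<close> norms of the iterates converge to the norm of a limit function \<open>\<eta>\<close>,
  which \<open>L\<close> cannot decrease. But \<open>\<eta>\<close> has mean zero, and every point has preimages under a
  long iterate near points where \<open>\<eta>\<close> has opposite phases, so there is cancellation unless \<open>\<eta> = 0\<close>.\<close>

lemma mixing:
  assumes \<phi>: "\<phi> holomorphic_on nbhd t" and t: "0 < t" "t \<le> r" and B: "\<And>z. z \<in> nbhd t \<Longrightarrow> norm (\<phi> z) \<le> B"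
    and mean: "(\<integral>x. \<phi> (of_real x) \<partial>LI) = 0"
  shows "(\<lambda>n. \<integral>x. norm ((L ^^ n) \<phi> (of_real x)) \<partial>LI) \<longlonglongrightarrow> 0"
proof -
  define s where "s n = (\<integral>x. norm ((L ^^ n) \<phi> (complex_of_real x)) \<partial>LI)" for n
  have \<phi>c: "continuous_on seg \<phi>" by (rule hol_cont_seg[OF \<phi> t(1)])
  have s_dec: "decseq s"
    unfolding decseq_Suc_iff s_def using integral_norm_Ln_le[OF Ln_cont[OF \<phi>c], of 1] by simp
  have s_nn: "s n \<ge> 0" for n unfolding s_def by (rule Bochner_Integration.integral_nonneg) simp
  obtain s0 where s0: "s \<longlonglongrightarrow> s0"
    using decseq_convergent[OF s_dec, of 0] s_nn by blast
  define v where "v = t / C"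
  have v: "v > 0" "nbhd v \<subseteq> nbhd t" "nbhd v \<subseteq> U"
    using t C1 nbhd_div_C[of t] r_U by (auto simp: v_def)
  have F_hol: "(L ^^ n) \<phi> holomorphic_on nbhd v" for n unfolding v_def by (rule Ln_hol[OF \<phi> t])
  have F_bd: "norm ((L ^^ n) \<phi> z) \<le> D * B" if "z \<in> nbhd v" for n z
    using that unfolding v_def by (intro Ln_bound[OF B t])
  have seg_v: "complex_of_real x \<in> nbhd v" if "x \<in> {-1..1}" for x using seg_subset_nbhd[OF v(1)] that by auto
  obtain \<eta> \<rho> where \<eta>: "\<eta> holomorphic_on nbhd v" and \<rho>: "strict_mono (\<rho> :: nat \<Rightarrow> nat)"
    and lim: "\<And>x. x \<in> nbhd v \<Longrightarrow> ((\<lambda>n. (L ^^ \<rho> n) \<phi> x) \<longlongrightarrow> \<eta> x) sequentially"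
  proof (rule Montel[of "nbhd v" "range (\<lambda>n. (L ^^ n) \<phi>)" "\<lambda>n. (L ^^ n) \<phi>"])
    show "\<exists>M. \<forall>h\<in>range (\<lambda>n. (L ^^ n) \<phi>). \<forall>z\<in>K. norm (h z) \<le> M" if "compact K" "K \<subseteq> nbhd v" for K
      using F_bd that by (intro exI[of _ "D * B"]) auto
  qed (use F_hol in auto)
  have \<eta>c: "continuous_on seg \<eta>" by (rule hol_cont_seg[OF \<eta> v(1)])
  \<comment> \<open>\<open>(L ^^ i) \<eta>\<close> is the limit of the iterates with indices
    \<open>i + \<rho> n\<close>. Their norms form a subsequence of \<open>s\<close>, so every
    iterate of \<open>\<eta>\<close> has the same norm \<open>s0\<close>.\<close>
  have iter_lim: "(\<integral>x. norm ((L ^^ i) \<eta> (of_real x)) \<partial>LI) = s0" for i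
  proof -
    have "(\<lambda>n. \<integral>x. norm ((L ^^ (i + \<rho> n)) \<phi> (complex_of_real x)) \<partial>LI) \<longlonglongrightarrow> (\<integral>x. norm ((L ^^ i) \<eta> (of_real x)) \<partial>LI)"
    proof (rule integral_LI_limit[of _ _ "D * B"])
      fix x :: real assume x: "x \<in> {-1..1}"
      have "(\<lambda>n. (L ^^ i) ((L ^^ \<rho> n) \<phi>) (of_real x)) \<longlonglongrightarrow> (L ^^ i) \<eta> (of_real x)"
        unfolding Ln_words[OF seg_in_U[OF x]]
      proof (intro tendsto_intros lim)
        fix w assume "w \<in> words m i"
        then show "bw w (of_real x) \<in> nbhd v"
          using bw_seg[of w "of_real x"] x seg_subset_nbhd[OF v(1)] by (auto simp: words_def)
      qed
      then show "(\<lambda>n. norm ((L ^^ (i + \<rho> n)) \<phi> (of_real x))) \<longlonglongrightarrow> norm ((L ^^ i) \<eta> (of_real x))"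
        by (simp add: funpow_add tendsto_norm)
    qed (use F_bd seg_v in \<open>auto intro!: continuous_on_norm cont_of_real Ln_cont \<phi>c \<eta>c\<close>)
    moreover have "(\<lambda>n. s (i + \<rho> n)) \<longlonglongrightarrow> s0"
    proof -
      have "strict_mono (\<lambda>n. i + \<rho> n)" using \<rho> by (auto simp: strict_mono_def)
      from LIMSEQ_subseq_LIMSEQ[OF s0 this] show ?thesis by (simp add: o_def)
    qed
    ultimately show ?thesis unfolding s_def using LIMSEQ_unique by blast
  qed
  have mean_\<eta>: "(\<integral>x. \<eta> (of_real x) \<partial>LI) = 0"
  proof -
    have "(\<lambda>n. \<integral>x. (L ^^ \<rho> n) \<phi> (complex_of_real x) \<partial>LI) \<longlonglongrightarrow> (\<integral>x. \<eta> (of_real x) \<partial>LI)"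
      by (rule integral_LI_limit[of _ _ "D * B"])
         (use F_bd seg_v lim in \<open>auto intro!: cont_of_real Ln_cont \<phi>c \<eta>c\<close>)
    then show ?thesis by (simp add: integral_Ln[OF \<phi>c] mean LIMSEQ_const_iff)
  qed
  have "\<eta> (of_real x1) = 0" if x1: "x1 \<in> {-1..1}" for x1
  proof (rule ccontr)
    assume nz: "\<eta> (of_real x1) \<noteq> 0"
    \<comment> \<open>With this phase \<open>u\<close> is positive at \<open>x1\<close>. It has
      integral zero together with \<open>\<eta>\<close>, hence it is negative somewhere
      else.\<close>
    define \<gamma> where "\<gamma> = cnj (\<eta> (of_real x1))"
    define u where "u z = Re (\<gamma> * \<eta> z)" for z
    have uc: "continuous_on seg u" unfolding u_def[abs_def] by (intro continuous_intros \<eta>c)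
    have uc': "continuous_on {-1..1} (\<lambda>x. u (complex_of_real x))"
      by (rule continuous_on_compose2[OF uc]) (auto intro!: continuous_intros)
    have u1: "u (of_real x1) > 0"
      using nz by (simp add: u_def \<gamma>_def sum_squares_gt_zero_iff complex_eq_iff)
    have "(\<integral>x. u (of_real x) \<partial>LI) = Re (\<gamma> * (\<integral>x. \<eta> (of_real x) \<partial>LI))"
      unfolding u_def
      by (subst integral_Re) (auto intro!: continuous_imp_integrable_LI continuous_intros cont_of_real \<eta>c)
    then have int_u: "(\<integral>x. u (of_real x) \<partial>LI) = 0" by (simp add: mean_\<eta>)
    have "\<exists>x2\<in>{-1..1}. u (of_real x2) < 0"
    proof (rule ccontr)
      assume "\<not> ?thesis"
      then have "u (of_real x) \<ge> 0" if "x \<in> {-1..1}" for x using that by (meson not_le)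
      from continuous_nonneg_integral_LI_eq_0[OF uc' this int_u x1] u1 show False by simp
    qed
    then obtain x2 where x2: "x2 \<in> {-1..1}" "u (of_real x2) < 0" by blast
    have "\<exists>\<delta>>0. \<forall>z\<in>seg. dist z (of_real x) < \<delta> \<longrightarrow> dist (u z) (u (of_real x)) < \<bar>u (of_real x)\<bar>"
      if "x \<in> {-1..1}" "u (of_real x) \<noteq> 0" for x
      using uc[unfolded continuous_on_iff] that by force
    then obtain \<delta>1 \<delta>2 where \<delta>: "\<delta>1 > 0" "\<delta>2 > 0"
      "\<And>z. z \<in> seg \<Longrightarrow> dist z (of_real x1) < \<delta>1 \<Longrightarrow> dist (u z) (u (of_real x1)) < \<bar>u (of_real x1)\<bar>"
      "\<And>z. z \<in> seg \<Longrightarrow> dist z (of_real x2) < \<delta>2 \<Longrightarrow> dist (u z) (u (of_real x2)) < \<bar>u (of_real x2)\<bar>"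
      using x1 x2 u1 by (metis less_irrefl)
    have "(\<lambda>i. C * q ^ i * 2) \<longlonglongrightarrow> C * 0 * 2"
      using q by (intro tendsto_intros LIMSEQ_realpow_zero) auto
    then have "eventually (\<lambda>i. C * q ^ i * 2 < min \<delta>1 \<delta>2) sequentially"
      using \<delta> by (intro order_tendstoD(2)[of _ 0]) auto
    \<comment> \<open>The interval has diameter \<open>2\<close>, so each word of length
      \<open>i\<close> maps it to a set of diameter at most \<open>C * q ^ i * 2\<close>.\<close>
    then obtain i where i: "C * q ^ i * 2 < min \<delta>1 \<delta>2" by (auto simp: eventually_sequentially)
    have close: "\<exists>w\<in>words m i. \<forall>y\<in>seg. bw w y \<in> seg \<and> dist (bw w y) (of_real x) < min \<delta>1 \<delta>2"
      if x: "x \<in> {-1..1}" for x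
    proof -
      obtain w y0 where w: "w \<in> words m i" "y0 \<in> seg" "bw w y0 = of_real x"
        using word_surj[of "of_real x" i] x by auto
      have ws: "set w \<subseteq> {..<m}" "length w = i" using w by (auto simp: words_def)
      have "dist (bw w y) (of_real x) < min \<delta>1 \<delta>2" if y: "y \<in> seg" for y
      proof -
        have "norm (bw w y - bw w y0) \<le> (C * q ^ length w) * norm (y - y0)"
          by (rule bw_lipschitz[OF ws(1)]) (use y w seg_subset_nbhd[OF r0] in auto)
        also have "\<dots> \<le> (C * q ^ length w) * 2"
          using C1 q seg_norm_le[OF y] seg_norm_le[OF w(2)] norm_triangle_ineq4[of y y0]
          by (intro mult_left_mono) auto
        finally show ?thesis using i ws w by (simp add: dist_norm)
      qed
      then show ?thesis using w ws bw_seg by blast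
    qed
    obtain w1 where w1: "w1 \<in> words m i" "\<And>y. y \<in> seg \<Longrightarrow> u (bw w1 y) > 0"
    proof -
      obtain w where w: "w \<in> words m i" "\<forall>y\<in>seg. bw w y \<in> seg \<and> dist (bw w y) (of_real x1) < min \<delta>1 \<delta>2"
        using close[OF x1] by blast
      have "u (bw w y) > 0" if "y \<in> seg" for y
        using \<delta>(3)[of "bw w y"] w(2) that u1 by (force simp: dist_real_def)
      then show ?thesis using that w(1) by blast
    qed
    obtain w2 where w2: "w2 \<in> words m i" "\<And>y. y \<in> seg \<Longrightarrow> u (bw w2 y) < 0"
    proof -
      obtain w where w: "w \<in> words m i" "\<forall>y\<in>seg. bw w y \<in> seg \<and> dist (bw w y) (of_real x2) < min \<delta>1 \<delta>2"
        using close[OF x2(1)] by blast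
      have "u (bw w y) < 0" if "y \<in> seg" for y
        using \<delta>(4)[of "bw w y"] w(2) that x2 by (force simp: dist_real_def)
      then show ?thesis using that w(1) by blast
    qed
    have c: "continuous_on seg (\<lambda>z. complex_of_real (norm (\<eta> z)))" by (intro continuous_intros \<eta>c)
    have cL: "continuous_on {-1..1} (\<lambda>x. (L ^^ i) (\<lambda>z. complex_of_real (norm (\<eta> z))) (of_real x))"
      by (intro cont_of_real Ln_cont c)
    have "(\<integral>x. norm ((L ^^ i) \<eta> (of_real x)) \<partial>LI) <
        (\<integral>x. Re ((L ^^ i) (\<lambda>z. of_real (norm (\<eta> z))) (of_real x)) \<partial>LI)"
    proof (rule integral_LI_reverse_mono_strict)
      fix x :: real assume x: "x \<in> {-1..1}"
      have xs: "complex_of_real x \<in> seg" using x by simp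
      define T where "T w = sgw w * deriv (bw w) (of_real x) * \<eta> (bw w (of_real x))" for w
      have T: "Re (\<gamma> * T w) = norm (deriv (bw w) (of_real x)) * u (bw w (of_real x))" "norm (deriv (bw w) (of_real x)) \<ge> 0"
        if "w \<in> words m i" for w
        unfolding T_def u_def using signed_deriv_bw[OF _ x, of w] that by (auto simp: words_def algebra_simps)
      have pos: "norm (deriv (bw w) (of_real x)) > 0" if "w \<in> words m i" for w
      proof -
        have "deriv (bw w) (of_real x) \<noteq> 0" if "set w \<subseteq> {..<m}" for w
          using that
        proof (induction w)
          case (Cons j w)
          have "bw w (of_real x) \<in> seg" using bw_seg[OF _ xs, of w] Cons.prems by simp
          then obtain y where "y \<in> {-1..1}" "bw w (of_real x) = of_real y" by (auto simp: seg_def)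
          then show ?case
            unfolding deriv_bw_Cons[OF Cons.prems seg_in_U[OF x]] using Cons b_deriv[of j y] by simp
        qed simp
        then show ?thesis using that by (simp add: words_def)
      qed
      \<comment> \<open>One word sends the whole interval near \<open>x1\<close>, another one near
        \<open>x2\<close>. The two terms are therefore opposed at every \<open>x\<close>, and the
        inequality is strict on the whole interval.\<close>
      have "norm (\<Sum>w\<in>words m i. T w) < (\<Sum>w\<in>words m i. norm (T w))"
        by (rule norm_sum_less_of_opposite[OF finite_words w1(1) w2(1), of \<gamma>])
           (use T(1)[OF w1(1)] T(1)[OF w2(1)] pos[OF w1(1)] pos[OF w2(1)] w1(2)[OF xs] w2(2)[OF xs]
            in \<open>auto simp: mult_pos_neg\<close>)
      then show "norm ((L ^^ i) \<eta> (of_real x)) < Re ((L ^^ i) (\<lambda>z. of_real (norm (\<eta> z))) (of_real x))"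
        unfolding Ln_norm_of_real[OF x] unfolding Ln_words[OF seg_in_U[OF x]] Re_complex_of_real T_def .
    qed (intro continuous_intros cont_of_real Ln_cont \<eta>c cL)+
    also have "\<dots> = Re (\<integral>x. (L ^^ i) (\<lambda>z. of_real (norm (\<eta> z))) (of_real x) \<partial>LI)"
      by (intro integral_Re continuous_imp_integrable_LI cL)
    also have "\<dots> = Re (\<integral>x. of_real (norm (\<eta> (of_real x))) \<partial>LI)"
      by (simp only: integral_Ln[OF c])
    also have "\<dots> = (\<integral>x. norm (\<eta> (of_real x)) \<partial>LI)" by simp
    finally show False using iter_lim[of i] iter_lim[of 0] by simp
  qed
  then have "(\<integral>x. norm (\<eta> (of_real x)) \<partial>LI) = (\<integral>x. 0 \<partial>LI)"
    by (intro Bochner_Integration.integral_cong) auto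
  then have "s0 = 0" using iter_lim[of 0] by simp
  then show ?thesis using s0 unfolding s_def by simp
qed

end

subsection \<open>Meromorphic correlation functions\<close>

text \<open>On each of the \<open>n\<close> cells of length \<open>1 / n\<close> the integrand
  differs from its left value by at most \<open>K / n\<close>.\<close>

lemma riemann_sum_error:
  fixes F :: "real \<Rightarrow> complex"
  assumes lip: "\<And>s t. s \<in> {0..1} \<Longrightarrow> t \<in> {0..1} \<Longrightarrow> norm (F s - F t) \<le> K * \<bar>s - t\<bar>" and n: "n > 0"
  shows "norm (integral {0..1} F - (\<Sum>k<n. F (real k / real n) / of_nat n)) \<le> K / n"
proof -
  have K0: "K \<ge> 0" using order_trans[OF norm_ge_zero lip[of 0 1]] by simp
  have "K-lipschitz_on {0..1} F"
    using lip K0 by (intro lipschitz_onI) (auto simp: dist_norm)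
  then have contF: "continuous_on {0..1} F" by (rule lipschitz_on_continuous_on)
  have "norm (integral {0..real k / n} F - (\<Sum>i<k. F (real i / real n) / of_nat n)) \<le> real k * (K / n ^ 2)"
    if "k \<le> n" for k
    using that
  proof (induction k)
    case (Suc k)
    define a c where "a = real k / n" and "c = real (Suc k) / n"
    have ac: "0 \<le> a" "a \<le> c" "c \<le> 1" "c - a = 1 / n"
      using Suc.prems n by (auto simp: a_def c_def field_simps)
    have int: "F integrable_on {x..y}" if "0 \<le> x" "y \<le> 1" for x y
      using contF that by (intro integrable_continuous_interval continuous_on_subset[OF contF]) auto
    have split: "integral {0..c} F = integral {0..a} F + integral {a..c} F"
      using ac by (intro Henstock_Kurzweil_Integration.integral_combine[symmetric] int) auto
    have "norm (integral {a..c} F - F a / of_nat n) \<le> K / n ^ 2"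
    proof -
      have eq: "integral {a..c} F - F a / of_nat n = integral {a..c} (\<lambda>t. F t - F a)"
      proof -
        have "integral {a..c} (\<lambda>t. F t - F a) = integral {a..c} F - integral {a..c} (\<lambda>t. F a)"
          using ac by (intro Henstock_Kurzweil_Integration.integral_diff int) auto
        also have "integral {a..c} (\<lambda>t. F a) = (c - a) *\<^sub>R F a" using ac by simp
        finally show ?thesis using ac by (simp add: scaleR_conv_of_real field_simps)
      qed
      have "norm (integral {a..c} (\<lambda>t. F t - F a)) \<le> (K / n) * (c - a)"
      proof (rule integral_bound)
        fix t assume t: "t \<in> {a..c}"
        have "norm (F t - F a) \<le> K * \<bar>t - a\<bar>" using t ac by (intro lip) auto
        also have "\<dots> \<le> K * (1 / n)" using t ac K0 by (intro mult_left_mono) auto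
        finally show "norm (F t - F a) \<le> K / n" by simp
      qed (use ac in \<open>auto intro!: continuous_intros continuous_on_subset[OF contF]\<close>)
      then show ?thesis unfolding eq using ac by (simp add: power2_eq_square)
    qed
    moreover have "norm (integral {0..a} F - (\<Sum>i<k. F (real i / real n) / of_nat n)) \<le> real k * (K / n ^ 2)"
      using Suc by (simp add: a_def)
    ultimately have "norm ((integral {0..a} F - (\<Sum>i<k. F (real i / real n) / of_nat n)) + (integral {a..c} F - F a / of_nat n))
        \<le> real k * (K / n ^ 2) + K / n ^ 2"
      by (intro norm_triangle_mono)
    moreover have "(integral {0..a} F - (\<Sum>i<k. F (real i / real n) / of_nat n)) + (integral {a..c} F - F a / of_nat n)
        = integral {0..c} F - (\<Sum>i<Suc k. F (real i / real n) / of_nat n)"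
      unfolding split by (simp add: a_def)
    ultimately have "norm (integral {0..c} F - (\<Sum>i<Suc k. F (real i / real n) / of_nat n))
        \<le> real k * (K / n ^ 2) + K / n ^ 2" by (simp only:)
    moreover have "real k * (K / n ^ 2) + K / n ^ 2 = real (Suc k) * (K / n ^ 2)"
      by (simp only: of_nat_Suc distrib_right mult_1_left add.commute)
    ultimately show ?case unfolding c_def by (simp only:)
  qed simp
  from this[of n] n show ?thesis by (simp add: power2_eq_square)
qed

text \<open>A Riemann sum for Cauchy's integral over the boundary of a rectangle around \<open>seg\<close>.\<close>

lemma Cauchy_Riemann_sum_approx:
  assumes r: "r > 0" and \<epsilon>: "\<epsilon> > 0"
  obtains J :: "(nat \<times> nat) set" and \<zeta> \<kappa> where "finite J"
    "\<And>l. l \<in> J \<Longrightarrow> \<zeta> l \<in> nbhd r"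
    "\<And>l w. l \<in> J \<Longrightarrow> w \<in> nbhd (r / 4) \<Longrightarrow> norm (\<zeta> l - w) \<ge> 3 * r / 20"
    "\<And>\<phi> B w. \<phi> holomorphic_on nbhd r \<Longrightarrow> (\<And>z. z \<in> nbhd r \<Longrightarrow> norm (\<phi> z) \<le> B) \<Longrightarrow> w \<in> nbhd (r / 4) \<Longrightarrow>
      norm (\<phi> w - (\<Sum>l\<in>J. \<kappa> l * \<phi> (\<zeta> l) / (\<zeta> l - w))) \<le> \<epsilon> * B"
proof -
  \<comment> \<open>The rectangle keeps distance \<open>s\<close> from \<open>seg\<close>. Its
    points are within \<open>2 * s < 9 * r / 10\<close> of \<open>seg\<close>, which leaves room for
    discs of radius \<open>\<rho> / 2\<close> inside \<open>nbhd r\<close>, and at least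
    \<open>s - r / 4 = \<rho>\<close> away from \<open>nbhd (r / 4)\<close>.\<close>
  define s where "s = 2 * r / 5"
  define \<rho> where "\<rho> = 3 * r / 20"
  have s: "s > 0" "\<rho> > 0" "s - r / 4 = \<rho>" using r by (auto simp: s_def \<rho>_def)
  \<comment> \<open>The vertices in counterclockwise order; the index mod \<open>4\<close> closes
    the rectangle.\<close>
  define v where "v = (\<lambda>i::nat. [Complex (-1 - s) (-s), Complex (1 + s) (-s), Complex (1 + s) s, Complex (-1 - s) s] ! (i mod 4))"
  define pt where "pt i t = linepath (v i) (v (Suc i)) t" for i and t :: real
  define Bd where "Bd = (\<Union>i<4. closed_segment (v i) (v (Suc i)))"
  have v_simps: "v 0 = Complex (-1 - s) (-s)" "v (Suc 0) = Complex (1 + s) (-s)" "v 2 = Complex (1 + s) s"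
      "v 3 = Complex (-1 - s) s" "v 4 = Complex (-1 - s) (-s)" "v (Suc 2) = Complex (-1 - s) s" "v (Suc 3) = Complex (-1 - s) (-s)"
      "v (Suc (Suc 0)) = Complex (1 + s) s"
    by (simp_all add: v_def)
  have less4: "i = 0 \<or> i = 1 \<or> i = 2 \<or> i = 3" if "i < 4" for i :: nat using that by auto
  have Bd_props: "(\<bar>Im \<zeta>\<bar> = s \<or> \<bar>Re \<zeta>\<bar> = 1 + s) \<and> \<bar>Im \<zeta>\<bar> \<le> s \<and> \<bar>Re \<zeta>\<bar> \<le> 1 + s" if \<zeta>: "\<zeta> \<in> Bd" for \<zeta>
  proof -
    obtain i where i: "i < 4" "\<zeta> \<in> closed_segment (v i) (v (Suc i))" using \<zeta> by (auto simp: Bd_def)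
    have horizontal: ?thesis if "\<zeta> \<in> closed_segment (Complex p e) (Complex q e)" "\<bar>e\<bar> = s"
      "min p q = -1 - s" "max p q = 1 + s" for p q e
    proof -
      have "Im \<zeta> = e" "Re \<zeta> \<in> closed_segment p q"
        using that(1) closed_segment_same_Im[of "Complex p e" "Complex q e"] by simp_all
      then have "min p q \<le> Re \<zeta>" "Re \<zeta> \<le> max p q"
        by (auto simp: closed_segment_eq_real_ivl split: if_splits)
      then show ?thesis using that \<open>Im \<zeta> = e\<close> by (simp add: abs_le_iff)
    qed
    have vertical: ?thesis if "\<zeta> \<in> closed_segment (Complex e p) (Complex e q)" "\<bar>e\<bar> = 1 + s"
      "min p q = - s" "max p q = s" for p q e
    proof -
      have "Re \<zeta> = e" "Im \<zeta> \<in> closed_segment p q"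
        using that(1) closed_segment_same_Re[of "Complex e p" "Complex e q"] by simp_all
      then have "min p q \<le> Im \<zeta>" "Im \<zeta> \<le> max p q"
        by (auto simp: closed_segment_eq_real_ivl split: if_splits)
      then show ?thesis using that \<open>Re \<zeta> = e\<close> by (simp add: abs_le_iff)
    qed
    show ?thesis
      using less4[OF i(1)]
    proof (elim disjE)
      assume "i = 0"
      then show ?thesis using i(2) s(1)
        by (intro horizontal[of "-1 - s" "-s" "1 + s"]) (simp_all add: v_simps)
    next
      assume "i = 1"
      then show ?thesis using i(2) s(1)
        by (intro vertical[of "1 + s" "-s" s]) (simp_all add: v_simps)
    next
      assume "i = 2"
      then show ?thesis using i(2) s(1)
        by (intro horizontal[of "1 + s" s "-1 - s"]) (simp_all add: v_simps)
    next
      assume "i = 3"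
      then show ?thesis using i(2) s(1)
        by (intro vertical[of "-1 - s" s "-s"]) (simp_all add: v_simps)
    qed
  qed
  have Bd_in: "\<zeta> \<in> nbhd (9 * r / 10)" if \<zeta>: "\<zeta> \<in> Bd" for \<zeta>
  proof -
    define x where "x = max (-1) (min 1 (Re \<zeta>))"
    have "\<bar>x - Re \<zeta>\<bar> \<le> s" "x \<in> {-1..1}" using Bd_props[OF \<zeta>] s(1) by (auto simp: x_def)
    moreover have "norm (of_real x - \<zeta>) \<le> \<bar>Re (of_real x - \<zeta>)\<bar> + \<bar>Im (of_real x - \<zeta>)\<bar>" by (rule cmod_le)
    ultimately have "dist (of_real x) \<zeta> \<le> s + s" using Bd_props[OF \<zeta>] by (simp add: dist_norm)
    then show ?thesis
      unfolding in_nbhd_iff using \<open>x \<in> {-1..1}\<close> r by (intro bexI[of _ "of_real x"]) (auto simp: s_def)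
  qed
  have gap: "norm (\<zeta> - w) \<ge> \<rho>" if \<zeta>: "\<zeta> \<in> Bd" and w: "w \<in> nbhd (r / 4)" for \<zeta> w
  proof -
    obtain x where x: "x \<in> seg" "dist x w < r / 4" using w by (auto simp: in_nbhd_iff)
    then obtain y where y: "y \<in> {-1..1}" "x = of_real y" by (auto simp: seg_def)
    have "\<bar>Re (\<zeta> - x)\<bar> \<le> norm (\<zeta> - x)" "\<bar>Im (\<zeta> - x)\<bar> \<le> norm (\<zeta> - x)"
      by (rule abs_Re_le_cmod abs_Im_le_cmod)+
    then have "s \<le> norm (\<zeta> - x)" using Bd_props[OF \<zeta>] y by auto
    then show ?thesis
      using x(2) s(3) norm_triangle_ineq[of "\<zeta> - w" "w - x"] by (simp add: dist_norm norm_minus_commute)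
  qed
  have pt_in: "pt i t \<in> Bd" if "i < 4" "t \<in> {0..1}" for i t
    using that linepath_in_path[of t "v i" "v (Suc i)"] by (auto simp: pt_def Bd_def)
  define \<Lambda> where "\<Lambda> = 2 + 4 * r"
  have side: "norm (v (Suc i) - v i) \<le> \<Lambda>" if "i < 4" for i
    using less4[OF that] s(1) r by (auto simp: v_simps \<Lambda>_def s_def cmod_def)
  \<comment> \<open>On a disc of radius \<open>\<rho> / 2\<close> about a boundary point the Cauchy
    integrand \<open>G\<close> is at most \<open>2 * B / \<rho>\<close>, so its derivative at the
    centre is at most \<open>8 * B / \<rho>\<^sup>2\<close>. Parametrising a side contributes its
    length twice, once from the chain rule and once from \<open>dz\<close>.\<close>
  define M where "M = 8 * \<Lambda>\<^sup>2 / \<rho>\<^sup>2"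
  obtain n :: nat where n: "n > 0" "M / n \<le> \<epsilon>"
  proof -
    obtain n :: nat where "n > M / \<epsilon>" using reals_Archimedean2 by blast
    then have "M / \<epsilon> < real (Suc n)" by simp
    then have "M / real (Suc n) \<le> \<epsilon>" using \<epsilon> by (simp add: field_simps)
    then show ?thesis using that[of "Suc n"] by simp
  qed
  define J where "J = {..<4::nat} \<times> {..<n}"
  define \<zeta> where "\<zeta> = (\<lambda>(i, k). pt i (real k / real n))"
  \<comment> \<open>Complex length of one cell of the side, divided by the
    \<open>2 * pi * \<i>\<close> of Cauchy's formula.\<close>
  define \<kappa> where "\<kappa> = (\<lambda>(i, k::nat). (v (Suc i) - v i) / (of_nat n * (2 * of_real pi * \<i>)))"
  have \<zeta>_Bd: "\<zeta> l \<in> Bd" if "l \<in> J" for l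
    using that n by (auto simp: J_def \<zeta>_def intro!: pt_in)
  show ?thesis
  proof (rule that[of J \<zeta> \<kappa>])
    show "finite J" by (simp add: J_def)
    show "\<zeta> l \<in> nbhd r" if "l \<in> J" for l
      using Bd_in[OF \<zeta>_Bd[OF that]] nbhd_mono[of "9 * r / 10" r] r by auto
    show "norm (\<zeta> l - w) \<ge> 3 * r / 20" if "l \<in> J" "w \<in> nbhd (r / 4)" for l w
      using gap[OF \<zeta>_Bd[OF that(1)] that(2)] by (simp add: \<rho>_def)
  next
    fix \<phi> B w
    assume \<phi>: "\<phi> holomorphic_on nbhd r" and B: "\<And>z. z \<in> nbhd r \<Longrightarrow> norm (\<phi> z) \<le> B" and w: "w \<in> nbhd (r / 4)"
    have B0: "B \<ge> 0" using B[of 0] seg_subset_nbhd[OF r] norm_ge_zero order_trans by (metis one_in_seg(3) subsetD)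
    define G where "G z = \<phi> z / (z - w)" for z
    have G_hol: "G holomorphic_on nbhd r - {w}"
      unfolding G_def by (intro holomorphic_intros holomorphic_on_subset[OF \<phi>]) auto
    have dG: "(G has_field_derivative deriv G z) (at z)" "norm (deriv G z) \<le> 8 * B / \<rho>\<^sup>2" if z: "z \<in> Bd" for z
    proof -
      have ball: "ball z (\<rho> / 2) \<subseteq> nbhd r"
        using ball_subset_nbhd[OF Bd_in[OF z], of "\<rho> / 2"] nbhd_mono[of "9 * r / 10 + \<rho> / 2" r] r by (auto simp: \<rho>_def)
      have far: "norm (y - w) \<ge> \<rho> / 2" if "y \<in> ball z (\<rho> / 2)" for y
        using gap[OF z w] that norm_triangle_ineq[of "z - y" "y - w"] by (simp add: dist_norm)
      have sub: "ball z (\<rho> / 2) \<subseteq> nbhd r - {w}" using ball far s(2) by fastforce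
      have hol: "G holomorphic_on ball z (\<rho> / 2)" by (rule holomorphic_on_subset[OF G_hol sub])
      show "(G has_field_derivative deriv G z) (at z)"
        by (rule holomorphic_derivI[OF hol]) (use s in auto)
      have "norm (deriv G z) \<le> 2 * (B / (\<rho> / 2)) / (\<rho> / 2)"
      proof (rule norm_deriv_le_of_bounded[OF hol])
        fix y assume y: "y \<in> ball z (\<rho> / 2)"
        then have "norm (\<phi> y) \<le> B" using B ball by blast
        then show "norm (G y) \<le> B / (\<rho> / 2)"
          unfolding G_def norm_divide using far[OF y] s B0 by (intro frac_le) auto
      qed (use s in auto)
      then show "norm (deriv G z) \<le> 8 * B / \<rho>\<^sup>2" by (simp add: power2_eq_square field_simps)
    qed
    have lip: "norm (G (pt i a) * (v (Suc i) - v i) - G (pt i t) * (v (Suc i) - v i)) \<le> (M * B) * \<bar>a - t\<bar>"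
      if i: "i < 4" and at: "a \<in> {0..1}" "t \<in> {0..1}" for i a t
    proof -
      have segBd: "closed_segment (v i) (v (Suc i)) \<subseteq> Bd" using i by (auto simp: Bd_def)
      have "norm (G (pt i a) - G (pt i t)) \<le> (8 * B / \<rho>\<^sup>2) * norm (pt i a - pt i t)"
      proof (rule field_differentiable_bound[of "closed_segment (v i) (v (Suc i))" G "deriv G"])
        show "pt i a \<in> closed_segment (v i) (v (Suc i))" "pt i t \<in> closed_segment (v i) (v (Suc i))"
          using at by (auto simp: pt_def linepath_in_path)
      qed (use segBd dG has_field_derivative_at_within in \<open>blast+\<close>)
      also have "norm (pt i a - pt i t) = \<bar>a - t\<bar> * norm (v (Suc i) - v i)"
      proof -
        have "pt i a - pt i t = (a - t) *\<^sub>R (v (Suc i) - v i)" by (simp add: pt_def linepath_def algebra_simps)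
        then show ?thesis by simp
      qed
      finally have "norm (G (pt i a) - G (pt i t)) * norm (v (Suc i) - v i) \<le>
          (8 * B / \<rho>\<^sup>2) * (\<bar>a - t\<bar> * norm (v (Suc i) - v i)) * norm (v (Suc i) - v i)"
        by (rule mult_right_mono) simp
      also have "\<dots> = (8 * B / \<rho>\<^sup>2) * \<bar>a - t\<bar> * (norm (v (Suc i) - v i))\<^sup>2"
        by (simp add: power2_eq_square mult_ac)
      also have "\<dots> \<le> (8 * B / \<rho>\<^sup>2) * \<bar>a - t\<bar> * \<Lambda>\<^sup>2"
        using side[OF i] B0 by (intro mult_left_mono power_mono) auto
      also have "\<dots> = (M * B) * \<bar>a - t\<bar>" by (simp add: M_def mult_ac)
      finally show ?thesis by (simp add: norm_mult left_diff_distrib[symmetric])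
    qed
    have side_int: "(G has_contour_integral integral {0..1} (\<lambda>t. G (pt i t) * (v (Suc i) - v i))) (linepath (v i) (v (Suc i)))"
      if i: "i < 4" for i
    proof -
      have "(M * B)-lipschitz_on {0..1} (\<lambda>t. G (pt i t) * (v (Suc i) - v i))"
        using lip[OF i] B0 s by (intro lipschitz_onI) (auto simp: dist_norm M_def)
      then have "continuous_on {0..1} (\<lambda>t. G (pt i t) * (v (Suc i) - v i))" by (rule lipschitz_on_continuous_on)
      then have "((\<lambda>t. G (pt i t) * (v (Suc i) - v i)) has_integral integral {0..1} (\<lambda>t. G (pt i t) * (v (Suc i) - v i))) {0..1}"
        by (intro integrable_integral integrable_continuous_interval)
      then show ?thesis by (simp add: has_contour_integral_linepath pt_def)
    qed
    define S where "S i = integral {0..1} (\<lambda>t. G (pt i t) * (v (Suc i) - v i))" for i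
    have rect: "rectpath (v 0) (v 2) = linepath (v 0) (v (Suc 0)) +++ linepath (v (Suc 0)) (v 2) +++ linepath (v 2) (v 3) +++ linepath (v 3) (v 4)"
      by (simp add: rectpath_def Let_def v_simps)
    have "(G has_contour_integral (S 0 + (S 1 + (S 2 + S 3)))) (rectpath (v 0) (v 2))"
      unfolding rect S_def using side_int[of 0] side_int[of 1] side_int[of 2] side_int[of 3]
      by (intro has_contour_integral_join) (auto simp: numeral_2_eq_2 numeral_3_eq_3 eval_nat_numeral v_simps)
    moreover have "(G has_contour_integral (2 * of_real pi * \<i> * winding_number (rectpath (v 0) (v 2)) w * \<phi> w)) (rectpath (v 0) (v 2))"
      unfolding G_def
    proof (rule Cauchy_integral_formula_convex_simple[OF convex_nbhd[of r] \<phi>, unfolded of_real_mult of_real_numeral])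
      show "w \<in> interior (nbhd r)" using w nbhd_mono[of "r / 4" r] r by (auto simp: interior_open)
      have "path_image (rectpath (v 0) (v 2)) \<subseteq> Bd"
        unfolding rect using numeral_2_eq_2 numeral_3_eq_3
        by (auto simp: path_image_join Bd_def v_simps lessThan_nat_numeral lessThan_Suc)
      moreover have "w \<notin> Bd" using gap[OF _ w, of w] s(2) by auto
      ultimately show "path_image (rectpath (v 0) (v 2)) \<subseteq> nbhd r - {w}"
        using Bd_in nbhd_mono[of "9 * r / 10" r] r by fastforce
    qed (auto simp: rect v_simps)
    moreover have "winding_number (rectpath (v 0) (v 2)) w = 1"
    proof (rule winding_number_rectpath)
      obtain x where x: "x \<in> seg" "dist x w < r / 4" using w by (auto simp: in_nbhd_iff)
      then obtain y where y: "y \<in> {-1..1}" "x = of_real y" by (auto simp: seg_def)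
      have "\<bar>Re (x - w)\<bar> \<le> norm (x - w)" "\<bar>Im (x - w)\<bar> \<le> norm (x - w)"
        by (rule abs_Re_le_cmod abs_Im_le_cmod)+
      then show "w \<in> box (v 0) (v 2)"
        using x(2) y r by (auto simp: v_simps in_box_complex_iff dist_norm s_def)
    qed
    ultimately have cauchy: "S 0 + (S 1 + (S 2 + S 3)) = 2 * of_real pi * \<i> * \<phi> w"
      using has_contour_integral_unique by fastforce
    have sum4: "(\<Sum>i<4. F i) = F 0 + (F 1 + (F 2 + F 3))" for F :: "nat \<Rightarrow> complex"
      by (simp add: eval_nat_numeral)
    have \<phi>w: "\<phi> w = (\<Sum>i<4. S i) / (2 * of_real pi * \<i>)" unfolding sum4 cauchy by simp
    have "(\<Sum>l\<in>J. \<kappa> l * \<phi> (\<zeta> l) / (\<zeta> l - w)) =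
        (\<Sum>i<4. \<Sum>k<n. G (pt i (real k / real n)) * (v (Suc i) - v i) / of_nat n) / (2 * of_real pi * \<i>)"
      unfolding J_def sum_divide_distrib sum.cartesian_product
      by (intro sum.cong refl) (auto simp: \<zeta>_def \<kappa>_def G_def mult_ac)
    then have "\<phi> w - (\<Sum>l\<in>J. \<kappa> l * \<phi> (\<zeta> l) / (\<zeta> l - w)) =
        (\<Sum>i<4. S i - (\<Sum>k<n. G (pt i (real k / real n)) * (v (Suc i) - v i) / of_nat n)) / (2 * of_real pi * \<i>)"
      unfolding \<phi>w by (simp add: sum_subtractf diff_divide_distrib)
    moreover have "norm (\<Sum>i<4. S i - (\<Sum>k<n. G (pt i (real k / real n)) * (v (Suc i) - v i) / of_nat n)) \<le> (\<Sum>i<(4::nat). M * B / n)"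
      unfolding S_def by (intro sum_norm_le riemann_sum_error n) (use lip in auto)
    then have "norm ((\<Sum>i<4. S i - (\<Sum>k<n. G (pt i (real k / real n)) * (v (Suc i) - v i) / of_nat n)) / (2 * of_real pi * \<i>)) \<le> (4 * (M * B / n)) / (2 * pi)"
      unfolding norm_divide using B0 by (intro frac_le) (auto simp: norm_mult M_def)
    ultimately have "norm (\<phi> w - (\<Sum>l\<in>J. \<kappa> l * \<phi> (\<zeta> l) / (\<zeta> l - w))) \<le> (4 * (M * B / n)) / (2 * pi)"
      by (simp only:)
    also have "\<dots> = (M * B / n) * (2 / pi)" by (simp add: mult_ac)
    \<comment> \<open>The four sides contribute a factor \<open>4\<close>, which is less than
      \<open>2 * pi\<close>.\<close>
    also have "\<dots> \<le> (M * B / n) * 1"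
      using pi_gt3 B0 by (intro mult_left_mono) (auto simp: M_def)
    also have "\<dots> = (M / n) * B" by simp
    also have "\<dots> \<le> \<epsilon> * B" using n B0 by (intro mult_right_mono)
    finally show "norm (\<phi> w - (\<Sum>l\<in>J. \<kappa> l * \<phi> (\<zeta> l) / (\<zeta> l - w))) \<le> \<epsilon> * B" .
  qed
qed

lemma fps_interleave:
  fixes a :: "nat \<Rightarrow> complex"
  assumes "N > 0"
  shows "Abs_fps a = (\<Sum>k<N. fps_X ^ k * (Abs_fps (\<lambda>n. a (N * n + k)) oo fps_X ^ N))"
proof (rule fps_ext)
  fix n
  have "fps_nth (fps_X ^ k * (Abs_fps (\<lambda>n. a (N * n + k)) oo fps_X ^ N)) n = (if k = n mod N then a n else 0)"
    if k: "k < N" for k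
  proof (cases "n < k")
    case True
    then show ?thesis using k by (auto simp: fps_X_power_mult_nth)
  next
    case False
    then have "N dvd (n - k) \<longleftrightarrow> n mod N = k mod N"
      using mod_eq_dvd_iff_nat[of k n N] by auto
    moreover have "N * ((n - k) div N) + k = n" if "N dvd n - k" using that False by simp
    ultimately show ?thesis using False k
      by (auto simp: fps_X_power_mult_nth fps_nth_compose_X_power)
  qed
  then have "fps_nth (\<Sum>k<N. fps_X ^ k * (Abs_fps (\<lambda>n. a (N * n + k)) oo fps_X ^ N)) n =
      (\<Sum>k<N. if k = n mod N then a n else 0)"
    by (simp add: fps_sum_nth)
  also have "\<dots> = a n" using assms by simp
  finally show "fps_nth (Abs_fps a) n = fps_nth (\<Sum>k<N. fps_X ^ k * (Abs_fps (\<lambda>n. a (N * n + k)) oo fps_X ^ N)) n"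
    by simp
qed

section \<open>Resolvents of powers of the transfer operator\<close>

context uniform_branches
begin

text \<open>Boundedness is imposed separately, as a function holomorphic on the open set
  \<open>nbhd v\<close> may blow up at its boundary.\<close>

definition bounded_hol :: "real \<Rightarrow> (complex \<Rightarrow> complex) set" where
  "bounded_hol v = {\<phi>. \<phi> holomorphic_on nbhd v \<and> bounded (\<phi> ` nbhd v)}"

lemma function_space_bounded_hol: "function_space (bounded_hol v)"
proof
  fix u w c assume u: "u \<in> bounded_hol v"
  show "(\<lambda>z. c * u z) \<in> bounded_hol v"
  proof -
    obtain M where "\<forall>z\<in>nbhd v. norm (u z) \<le> M" using u by (auto simp: bounded_hol_def bounded_iff)
    then have "\<forall>z\<in>nbhd v. norm (c * u z) \<le> norm c * M" by (simp add: norm_mult mult_left_mono)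
    then have "bounded ((\<lambda>z. c * u z) ` nbhd v)" unfolding bounded_iff by blast
    then show ?thesis using u by (auto simp: bounded_hol_def intro!: holomorphic_intros)
  qed
  assume w: "w \<in> bounded_hol v"
  show "(\<lambda>z. u z + w z) \<in> bounded_hol v"
    using u w bounded_plus_comp[of u "nbhd v" w]
    by (auto simp: bounded_hol_def intro!: holomorphic_intros)
qed

lemma integral_functional_bounded:
  assumes v: "v > 0" and B: "B \<in> borel_measurable LI" "\<And>x. x \<in> {-1..1} \<Longrightarrow> norm (B x :: complex) \<le> K"
  shows "(\<lambda>\<phi>. \<integral>x. B x * \<phi> (of_real x) \<partial>LI) \<in> function_space.bounded_functionals (bounded_hol v) (nbhd v)"
proof -
  interpret E: function_space "bounded_hol v" by (rule function_space_bounded_hol)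
  have K: "K \<ge> 0" using order_trans[OF norm_ge_zero B(2)[of 0]] by simp
  have int: "integrable LI (\<lambda>x. B x * u (of_real x))" if u: "u \<in> bounded_hol v" for u
  proof -
    have c: "continuous_on {-1..1} (\<lambda>x. u (complex_of_real x))"
      using u v by (intro cont_of_real hol_cont_seg[of _ v]) (auto simp: bounded_hol_def)
    show ?thesis
    proof (rule Bochner_Integration.integrable_bound)
      show "integrable LI (\<lambda>x. of_real K * u (of_real x))"
        by (intro integrable_mult_right continuous_imp_integrable_LI c)
      show "(\<lambda>x. B x * u (complex_of_real x)) \<in> borel_measurable LI"
        using B continuous_imp_measurable_LI[OF c] by measurable
      show "AE x in LI. norm (B x * u (complex_of_real x)) \<le> norm (complex_of_real K * u (complex_of_real x))"
        using B(2) K by (intro AE_I2) (auto simp: norm_mult intro!: mult_right_mono)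
    qed
  qed
  have bd: "norm (\<integral>x. B x * u (of_real x) \<partial>LI) \<le> (2 * K) * M"
    if u: "u \<in> bounded_hol v" and M: "\<forall>z\<in>nbhd v. norm (u z) \<le> M" for u M
  proof -
    have "norm (\<integral>x. B x * u (of_real x) \<partial>LI) \<le> (\<integral>x. norm (B x * u (of_real x)) \<partial>LI)"
      by (rule integral_norm_bound)
    also have "\<dots> \<le> (\<integral>x. K * M \<partial>LI)"
    proof (rule integral_mono)
      fix x assume "x \<in> space LI"
      then have "x \<in> {-1..1}" "complex_of_real x \<in> nbhd v" using seg_subset_nbhd[OF v] by auto
      then show "norm (B x * u (of_real x)) \<le> K * M"
        using B(2)[of x] M K by (simp add: norm_mult mult_mono)
    qed (use int[OF u] in auto)
    also have "\<dots> = (2 * K) * M" using measure_LI_space by simp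
    finally show ?thesis .
  qed
  show ?thesis
    unfolding E.bounded_functionals_def linear_functionals_on_def mem_Collect_eq
  proof (intro conjI ballI allI)
    fix u w assume uw: "u \<in> bounded_hol v" "w \<in> bounded_hol v"
    show "(\<integral>x. B x * (u (of_real x) + w (of_real x)) \<partial>LI) =
        (\<integral>x. B x * u (of_real x) \<partial>LI) + (\<integral>x. B x * w (of_real x) \<partial>LI)"
      using Bochner_Integration.integral_add[OF int[OF uw(1)] int[OF uw(2)]] by (simp add: distrib_left)
  next
    fix c u assume "u \<in> bounded_hol v"
    have "(\<lambda>x. B x * (c * u (complex_of_real x))) = (\<lambda>x. c * (B x * u (of_real x)))" by (simp add: mult_ac)
    then show "(\<integral>x. B x * (c * u (of_real x)) \<partial>LI) = c * (\<integral>x. B x * u (of_real x) \<partial>LI)" by simp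
  next
    show "\<exists>K'. \<forall>u\<in>bounded_hol v. \<forall>M. (\<forall>z\<in>nbhd v. norm (u z) \<le> M) \<longrightarrow>
        norm (\<integral>x. B x * u (of_real x) \<partial>LI) \<le> K' * M"
      using bd by blast
  qed
qed

lemma evaluation_functional_bounded:
  "\<zeta> \<in> nbhd v \<Longrightarrow> (\<lambda>\<phi>. \<phi> \<zeta>) \<in> function_space.bounded_functionals (bounded_hol v) (nbhd v)"
  unfolding function_space.bounded_functionals_def[OF function_space_bounded_hol] linear_functionals_on_def
  by (auto intro!: exI[of _ 1])

text \<open>All words of length \<open>N\<close> send \<open>nbhd v\<close> into
  \<open>nbhd (v / 4)\<close>, which the contour of the Cauchy sum avoids. Replacing each
  \<open>\<phi> (bw w z)\<close> by that sum gives a finite rank operator, whose functionals are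
  evaluations at the nodes of the contour.\<close>

lemma iterate_resolvent_meromorphic:
  assumes v: "0 < v" "v \<le> r" and N: "C * q ^ N \<le> 1 / 4" and R: "R > 0"
  shows "function_space.resolvent_meromorphic (bounded_hol v) (ball 0 R)
    (function_space.bounded_functionals (bounded_hol v) (nbhd v)) (L ^^ N)"
proof -
  interpret E: function_space "bounded_hol v" by (rule function_space_bounded_hol)
  have vr: "nbhd v \<subseteq> nbhd r" "nbhd v \<subseteq> U" using nbhd_mono[OF v(2)] r_U by auto
  have into: "bw w z \<in> nbhd (v / 4)" if "w \<in> words m N" "z \<in> nbhd v" for w z
  proof (rule bw_nbhd[OF _ that(2) v(2)])
    show "set w \<subseteq> {..<m}" using that by (auto simp: words_def)
    have "C * q ^ N * v \<le> 1 / 4 * v" by (intro mult_right_mono N) (use v in auto)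
    then show "C * q ^ length w * v \<le> v / 4" using that by (auto simp: words_def)
  qed
  have weighted: "(\<lambda>z. \<Sum>w\<in>words m N. sgw w * deriv (bw w) z * g (bw w z)) \<in> bounded_hol v"
    if g: "g holomorphic_on nbhd (v / 4)" "\<And>z. z \<in> nbhd (v / 4) \<Longrightarrow> norm (g z) \<le> M" "M \<ge> 0" for g M
  proof -
    have "(\<lambda>z. \<Sum>w\<in>words m N. sgw w * deriv (bw w) z * g (bw w z)) holomorphic_on nbhd v"
    proof (rule holomorphic_on_sum)
      fix w assume w: "w \<in> words m N"
      then have ws: "set w \<subseteq> {..<m}" by (auto simp: words_def)
      have "deriv (bw w) holomorphic_on nbhd v"
        by (rule holomorphic_on_subset[OF holomorphic_deriv[OF bw_hol[OF ws] U_open] vr(2)])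
      moreover have "(g \<circ> bw w) holomorphic_on nbhd v"
        by (rule holomorphic_on_compose_gen[OF holomorphic_on_subset[OF bw_hol[OF ws] vr(2)] g(1)])
           (use into w in auto)
      then have "(\<lambda>z. g (bw w z)) holomorphic_on nbhd v" by (simp add: o_def)
      ultimately show "(\<lambda>z. sgw w * deriv (bw w) z * g (bw w z)) holomorphic_on nbhd v"
        by (intro holomorphic_on_mult holomorphic_on_const)
    qed
    moreover have "norm (\<Sum>w\<in>words m N. sgw w * deriv (bw w) z * g (bw w z)) \<le> D * M"
      if z: "z \<in> nbhd v" for z
    proof -
      have "norm (\<Sum>w\<in>words m N. sgw w * deriv (bw w) z * g (bw w z)) \<le> (\<Sum>w\<in>words m N. norm (deriv (bw w) z) * M)"
        by (rule sum_norm_le) (use g(2) into z in \<open>auto simp: norm_mult intro!: mult_left_mono\<close>)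
      also have "\<dots> \<le> D * M"
        unfolding sum_distrib_right[symmetric] using sum_bound[of z N] vr z g(3)
        by (intro mult_right_mono) auto
      finally show ?thesis .
    qed
    ultimately show ?thesis unfolding bounded_hol_def bounded_iff by blast
  qed
  show ?thesis
  proof (rule E.resolvent_meromorphic_if_approximable[OF _ _ _ R])
    show "bounded (u ` nbhd v)" if "u \<in> bounded_hol v" for u using that by (auto simp: bounded_hol_def)
    show "E.linear_on (L ^^ N)"
      unfolding E.linear_on_def
    proof (intro conjI ballI allI)
      fix u assume u: "u \<in> bounded_hol v"
      then obtain M where M: "\<And>z. z \<in> nbhd v \<Longrightarrow> norm (u z) \<le> M" by (auto simp: bounded_hol_def bounded_iff)
      have sub: "nbhd (v / 4) \<subseteq> nbhd v" using v by (intro nbhd_mono) auto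
      have "0 \<in> nbhd v" using seg_subset_nbhd[OF v(1)] by auto
      then have M0: "M \<ge> 0" using M norm_ge_zero order_trans by blast
      have "(\<lambda>z. \<Sum>w\<in>words m N. sgw w * deriv (bw w) z * u (bw w z)) \<in> bounded_hol v"
        by (rule weighted[of u M]) (use u sub M M0 in \<open>auto simp: bounded_hol_def intro: holomorphic_on_subset\<close>)
      moreover have "(L ^^ N) u z = (\<Sum>w\<in>words m N. sgw w * deriv (bw w) z * u (bw w z))" if "z \<in> nbhd v" for z
        using Ln_words vr that by blast
      ultimately show "(L ^^ N) u \<in> bounded_hol v"
        unfolding bounded_hol_def
        by (auto cong: image_cong_simp intro: holomorphic_transform)
    qed (auto simp: Ln_add Ln_scale)
  next
    fix \<epsilon> :: real assume \<epsilon>: "\<epsilon> > 0"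
    \<comment> \<open>The error in each term is weighted by the derivative of a word, and these
      weights add up to at most \<open>D\<close>.\<close>
    have \<epsilon>D: "\<epsilon> / D > 0" using \<epsilon> D0 by simp
    obtain J :: "(nat \<times> nat) set" and \<zeta> \<kappa> where J: "finite J"
      and \<zeta>: "\<And>l. l \<in> J \<Longrightarrow> \<zeta> l \<in> nbhd v"
      and gap: "\<And>l w. l \<in> J \<Longrightarrow> w \<in> nbhd (v / 4) \<Longrightarrow> norm (\<zeta> l - w) \<ge> 3 * v / 20"
      and approx: "\<And>\<phi> B w. \<phi> holomorphic_on nbhd v \<Longrightarrow> (\<And>z. z \<in> nbhd v \<Longrightarrow> norm (\<phi> z) \<le> B) \<Longrightarrow>
        w \<in> nbhd (v / 4) \<Longrightarrow> norm (\<phi> w - (\<Sum>l\<in>J. \<kappa> l * \<phi> (\<zeta> l) / (\<zeta> l - w))) \<le> \<epsilon> / D * B"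
      by (rule Cauchy_Riemann_sum_approx[OF v(1) \<epsilon>D]) blast
    obtain h where h: "bij_betw h {..<card J} J"
      using ex_bij_betw_nat_finite[OF J] by (auto simp: atLeast0LessThan)
    have hJ: "h l \<in> J" if "l < card J" for l using h that bij_betwE by blast
    define u where "u l z = (\<Sum>w\<in>words m N. sgw w * deriv (bw w) z * (\<kappa> (h l) / (\<zeta> (h l) - bw w z)))" for l z
    have uE: "u l \<in> bounded_hol v" if l: "l < card J" for l
    proof -
      have ne: "\<zeta> (h l) - z \<noteq> 0" if "z \<in> nbhd (v / 4)" for z
        using gap[OF hJ[OF l] that] v by auto
      have "(\<lambda>z. \<Sum>w\<in>words m N. sgw w * deriv (bw w) z * (\<kappa> (h l) / (\<zeta> (h l) - bw w z))) \<in> bounded_hol v"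
      proof (rule weighted[of "\<lambda>y. \<kappa> (h l) / (\<zeta> (h l) - y)" "norm (\<kappa> (h l)) / (3 * v / 20)"])
        show "(\<lambda>y. \<kappa> (h l) / (\<zeta> (h l) - y)) holomorphic_on nbhd (v / 4)"
          using ne by (intro holomorphic_intros) auto
        show "norm (\<kappa> (h l) / (\<zeta> (h l) - z)) \<le> norm (\<kappa> (h l)) / (3 * v / 20)" if "z \<in> nbhd (v / 4)" for z
          unfolding norm_divide using gap[OF hJ[OF l] that] ne[OF that] v
          by (intro divide_left_mono mult_pos_pos) auto
      qed (use v in auto)
      then show ?thesis by (simp add: u_def[abs_def])
    qed
    have app: "norm ((L ^^ N) \<phi> z - (\<Sum>l<card J. \<phi> (\<zeta> (h l)) * u l z)) \<le> \<epsilon> * B"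
      if \<phi>: "\<phi> \<in> bounded_hol v" and B: "\<forall>z\<in>nbhd v. norm (\<phi> z) \<le> B" and z: "z \<in> nbhd v" for \<phi> B z
    proof -
      have "0 \<in> nbhd v" using seg_subset_nbhd[OF v(1)] by auto
      then have B0: "B \<ge> 0" using B norm_ge_zero order_trans by blast
      define Q where "Q w = (\<Sum>l\<in>J. \<kappa> l * \<phi> (\<zeta> l) / (\<zeta> l - bw w z))" for w
      have Q: "Q w = (\<Sum>l<card J. \<phi> (\<zeta> (h l)) * (\<kappa> (h l) / (\<zeta> (h l) - bw w z)))" for w
        unfolding Q_def using sum.reindex_bij_betw[OF h, of "\<lambda>l. \<kappa> l * \<phi> (\<zeta> l) / (\<zeta> l - bw w z)"]
        by (simp add: mult_ac)
      have "(\<Sum>l<card J. \<phi> (\<zeta> (h l)) * u l z) = (\<Sum>l<card J. \<Sum>w\<in>words m N. sgw w * deriv (bw w) z * (\<phi> (\<zeta> (h l)) * (\<kappa> (h l) / (\<zeta> (h l) - bw w z))))"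
        unfolding u_def sum_distrib_left by (intro sum.cong refl) (simp add: mult_ac)
      also have "\<dots> = (\<Sum>w\<in>words m N. \<Sum>l<card J. sgw w * deriv (bw w) z * (\<phi> (\<zeta> (h l)) * (\<kappa> (h l) / (\<zeta> (h l) - bw w z))))"
        by (rule sum.swap)
      also have "\<dots> = (\<Sum>w\<in>words m N. sgw w * deriv (bw w) z * Q w)"
        unfolding Q sum_distrib_left ..
      finally have "(L ^^ N) \<phi> z - (\<Sum>l<card J. \<phi> (\<zeta> (h l)) * u l z) =
          (\<Sum>w\<in>words m N. sgw w * deriv (bw w) z * (\<phi> (bw w z) - Q w))"
        using Ln_words[of z N \<phi>] z vr by (auto simp: sum_subtractf right_diff_distrib)
      also have "norm \<dots> \<le> (\<Sum>w\<in>words m N. norm (deriv (bw w) z) * (\<epsilon> / D * B))"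
      proof (rule sum_norm_le)
        fix w assume "w \<in> words m N"
        then have "norm (\<phi> (bw w z) - Q w) \<le> \<epsilon> / D * B"
          unfolding Q_def using \<phi> B z into by (intro approx) (auto simp: bounded_hol_def)
        then show "norm (sgw w * deriv (bw w) z * (\<phi> (bw w z) - Q w)) \<le> norm (deriv (bw w) z) * (\<epsilon> / D * B)"
          unfolding norm_mult norm_sgw mult_1_left by (rule mult_left_mono) simp
      qed
      also have "\<dots> \<le> D * (\<epsilon> / D * B)"
        unfolding sum_distrib_right[symmetric] using sum_bound[of z N] vr z \<epsilon> D0 B0
        by (intro mult_right_mono) auto
      also have "\<dots> = \<epsilon> * B" using D0 by simp
      finally show ?thesis .
    qed
    show "\<exists>(n::nat) \<kappa> u. (\<forall>l<n. \<kappa> l \<in> E.bounded_functionals (nbhd v) \<and> u l \<in> bounded_hol v) \<and>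
        (\<forall>\<phi>\<in>bounded_hol v. \<forall>B. (\<forall>z\<in>nbhd v. norm (\<phi> z) \<le> B) \<longrightarrow>
          (\<forall>z\<in>nbhd v. norm ((L ^^ N) \<phi> z - (\<Sum>l<n. \<kappa> l \<phi> * u l z)) \<le> \<epsilon> * B))"
      by (rule exI[of _ "card J"], rule exI[of _ "\<lambda>l \<phi>. \<phi> (\<zeta> (h l))"], rule exI[of _ u])
         (use uE app \<zeta> hJ evaluation_functional_bounded in blast)
  qed
qed

text \<open>For each \<open>R\<close> the series is split into residue classes mod \<open>N\<close>.
  Each class is a correlation series of \<open>L ^^ N\<close>, continued in the variable
  \<open>z ^ N\<close> to radius \<open>R ^ N\<close>; the classes are then reassembled and the
  discs glued.\<close>

lemma correlation_meromorphic:
  assumes \<phi>: "\<phi> holomorphic_on nbhd t" and t: "0 < t" "t \<le> r" and M: "\<And>z. z \<in> nbhd t \<Longrightarrow> norm (\<phi> z) \<le> M"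
    and B: "B \<in> borel_measurable LI" "\<And>x. x \<in> {-1..1} \<Longrightarrow> norm (B x :: complex) \<le> K"
  shows "meromorphic_fps UNIV (Abs_fps (\<lambda>n. \<integral>x. B x * (L ^^ n) \<phi> (of_real x) \<partial>LI))"
proof (rule meromorphic_fps_glue)
  fix R :: real assume R: "R > 0"
  define a where "a n = (\<integral>x. B x * (L ^^ n) \<phi> (of_real x) \<partial>LI)" for n
  define v where "v = t / C"
  have v: "0 < v" "v \<le> r"
  proof -
    show "0 < v" using t C1 by (simp add: v_def)
    have "t / C \<le> t" using t C1 by (simp add: divide_le_eq mult_le_cancel_left1)
    then show "v \<le> r" using t by (simp add: v_def)
  qed
  have "(\<lambda>i. C * q ^ i) \<longlonglongrightarrow> C * 0"
    using q by (intro tendsto_intros LIMSEQ_realpow_zero) auto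
  then have "eventually (\<lambda>i. C * q ^ i < 1 / 4) sequentially"
    by (intro order_tendstoD(2)[of _ 0]) auto
  then obtain N0 where N0: "\<And>i. i \<ge> N0 \<Longrightarrow> C * q ^ i < 1 / 4" by (auto simp: eventually_sequentially)
  \<comment> \<open>The successor ensures a positive modulus.\<close>
  define N where "N = Suc N0"
  have N: "N > 0" "C * q ^ N \<le> 1 / 4" using N0[of N] by (auto simp: N_def)
  have mero: "meromorphic_fps (ball 0 (R ^ N)) (Abs_fps (\<lambda>n. a (N * n + k)))" for k
  proof -
    have "bounded ((L ^^ k) \<phi> ` nbhd v)"
      unfolding v_def bounded_iff using Ln_bound[of t \<phi> M _ k, OF M t] by blast
    then have in_E: "(L ^^ k) \<phi> \<in> bounded_hol v"
      using Ln_hol[OF \<phi> t] by (simp add: bounded_hol_def v_def)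
    have "meromorphic_fps (ball 0 (R ^ N)) (Abs_fps (\<lambda>n. \<integral>x. B x * ((L ^^ N) ^^ n) ((L ^^ k) \<phi>) (of_real x) \<partial>LI))"
      using iterate_resolvent_meromorphic[OF v N(2), of "R ^ N"] R in_E integral_functional_bounded[OF v(1) B]
      unfolding function_space.resolvent_meromorphic_def[OF function_space_bounded_hol] by auto
    moreover have "((L ^^ N) ^^ n) ((L ^^ k) \<phi>) = (L ^^ (N * n + k)) \<phi>" for n
      by (simp add: funpow_mult funpow_add)
    ultimately show ?thesis by (simp add: a_def)
  qed
  have "meromorphic_fps (ball 0 R) (Abs_fps a)"
    unfolding fps_interleave[OF N(1), of a]
    by (intro meromorphic_fps_sum meromorphic_fps_mult meromorphic_fps_power meromorphic_fps_X
        meromorphic_fps_compose_X_power[OF mero N(1) R])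
  then show "meromorphic_fps (ball 0 R) (Abs_fps (\<lambda>n. \<integral>x. B x * (L ^^ n) \<phi> (of_real x) \<partial>LI))"
    by (simp add: a_def[abs_def])
qed

end

subsection \<open>The absolutely continuous invariant measure\<close>

text \<open>The inner exponential tends to \<open>0\<close> on the left of \<open>a\<close> and to
  infinity on the right. At \<open>x = a\<close> the sequence is constantly \<open>exp (-1)\<close>,
  which is why that point is excluded.\<close>

lemma double_exponential_step_limit:
  fixes x a :: real
  assumes "x \<noteq> a"
  shows "(\<lambda>k. exp (- exp (real k * (x - a)))) \<longlonglongrightarrow> indicator {..a} x"
proof (cases "x < a")
  case True
  have "(\<lambda>k. exp (x - a) ^ k) \<longlonglongrightarrow> 0"
    using True by (intro LIMSEQ_realpow_zero) auto
  then have "(\<lambda>k. exp (- (exp (x - a) ^ k))) \<longlonglongrightarrow> exp (- 0)"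
    by (intro tendsto_exp tendsto_minus)
  then show ?thesis using True by (simp add: exp_of_nat_mult)
next
  case False
  then have "1 < exp (x - a)" using assms by simp
  then have "(\<lambda>k. inverse (exp (x - a) ^ k)) \<longlonglongrightarrow> 0" by (rule LIMSEQ_inverse_realpow_zero)
  note lim = this
  have le: "norm (exp (- (exp (x - a) ^ k))) \<le> inverse (exp (x - a) ^ k)" for k
  proof -
    have "0 < exp (x - a) ^ k" by simp
    moreover from this have "exp (x - a) ^ k \<le> exp (exp (x - a) ^ k)"
      using exp_ge_add_one_self[of "exp (x - a) ^ k"] by linarith
    ultimately have "inverse (exp (exp (x - a) ^ k)) \<le> inverse (exp (x - a) ^ k)"
      by (rule le_imp_inverse_le[rotated])
    then show ?thesis by (simp add: exp_minus)
  qed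
  have "(\<lambda>k. exp (- (exp (x - a) ^ k))) \<longlonglongrightarrow> 0"
    by (rule Lim_null_comparison[OF always_eventually[OF allI[OF le]] lim])
  then show ?thesis using False assms by (simp add: exp_of_nat_mult)
qed

locale interval_map = uniform_branches +
  fixes f :: "real \<Rightarrow> real" and \<omega> :: "complex \<Rightarrow> complex" and W0 :: "complex set"
    and h :: "complex \<Rightarrow> complex" and rh :: real
  assumes f_cont: "continuous_on {-1..1} f" and f_maps: "x \<in> {-1..1} \<Longrightarrow> f x \<in> {-1..1}"
    and \<omega>_hol: "\<omega> holomorphic_on W0" and W0: "open W0" "seg \<subseteq> W0"
    and \<omega>_real: "x \<in> {-1..1} \<Longrightarrow> Im (\<omega> (of_real x)) = 0"
    and \<omega>_range: "x \<in> {-1..1} \<Longrightarrow> Re (\<omega> (of_real x)) \<in> {-1..1}"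
    and \<omega>_ends: "\<omega> 1 = 1" "\<omega> (-1) = -1"
    and \<omega>_deriv_pos: "-1 < x \<Longrightarrow> x < 1 \<Longrightarrow> Re (deriv \<omega> (of_real x)) > 0"
    and \<omega>_deriv_ends: "deriv \<omega> 1 = 0" "deriv \<omega> (-1) = 0"
    and conj: "j < m \<Longrightarrow> x \<in> {-1..1} \<Longrightarrow> f (Re (\<omega> (b j (of_real x)))) = Re (\<omega> (of_real x))"
    and rh: "rh > 0" and h_hol: "h holomorphic_on nbhd rh" and h_fix: "z \<in> nbhd rh \<Longrightarrow> L h z = h z"
    and h_real: "x \<in> {-1..1} \<Longrightarrow> Im (h (of_real x)) = 0"
    and h_nonneg: "x \<in> {-1..1} \<Longrightarrow> Re (h (of_real x)) \<ge> 0"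
    and h_int: "(\<integral>x. h (of_real x) \<partial>LI) = 1"
begin

definition \<theta> :: "real \<Rightarrow> real" where "\<theta> x = Re (\<omega> (of_real x))"
definition \<theta>' :: "real \<Rightarrow> real" where "\<theta>' x = Re (deriv \<omega> (of_real x))"

lemma \<omega>_of_real: "x \<in> {-1..1} \<Longrightarrow> \<omega> (of_real x) = of_real (\<theta> x)"
  using \<omega>_real by (simp add: \<theta>_def complex_eq_iff)

lemma seg_W0: "x \<in> {-1..1} \<Longrightarrow> complex_of_real x \<in> W0"
  using W0(2) by auto

lemma \<theta>_has_deriv: "x \<in> {-1..1} \<Longrightarrow> (\<theta> has_real_derivative \<theta>' x) (at x)"
  unfolding \<theta>_def[abs_def] \<theta>'_def by (rule Re_of_real_has_derivative(1)[OF \<omega>_hol W0(1) seg_W0])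

lemma \<theta>'_cont: "continuous_on {-1..1} \<theta>'"
proof -
  have "continuous_on {-1..1} (\<lambda>x. deriv \<omega> (complex_of_real x))"
    by (rule continuous_on_compose2[OF holomorphic_on_imp_continuous_on[OF holomorphic_deriv[OF \<omega>_hol W0(1)]]])
       (use seg_W0 in \<open>auto intro!: continuous_intros\<close>)
  then show ?thesis unfolding \<theta>'_def[abs_def] by (intro continuous_intros)
qed

lemma \<theta>'_pos: "-1 < x \<Longrightarrow> x < 1 \<Longrightarrow> \<theta>' x > 0"
  using \<omega>_deriv_pos by (simp add: \<theta>'_def)

lemma \<theta>'_nonneg: "x \<in> {-1..1} \<Longrightarrow> \<theta>' x \<ge> 0"
  using \<theta>'_pos[of x] \<omega>_deriv_ends by (cases "x = 1 \<or> x = -1") (auto simp: \<theta>'_def)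

lemma \<theta>_cont: "continuous_on {-1..1} \<theta>"
  by (meson \<theta>_has_deriv DERIV_isCont continuous_at_imp_continuous_on)

lemma \<theta>_range: "x \<in> {-1..1} \<Longrightarrow> \<theta> x \<in> {-1..1}"
  using \<omega>_range by (simp add: \<theta>_def)

lemma \<theta>_ends: "\<theta> 1 = 1" "\<theta> (-1) = -1"
  using \<omega>_ends by (auto simp: \<theta>_def)

lemma conj_\<theta>: "j < m \<Longrightarrow> x \<in> {-1..1} \<Longrightarrow> f (\<theta> (\<beta> j x)) = \<theta> x"
  using conj[of j x] of_real_\<beta>[of j x] by (simp add: \<theta>_def)

lemma \<theta>_measurable: "\<theta> \<in> measurable LI LI"
  by (rule measurable_restrict_space2) (use \<theta>_range continuous_imp_measurable_LI[OF \<theta>_cont] in auto)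

lemma \<theta>'_measurable: "\<theta>' \<in> borel_measurable LI"
  by (rule continuous_imp_measurable_LI[OF \<theta>'_cont])

lemma f_measurable: "f \<in> measurable LI LI"
  by (rule measurable_restrict_space2) (use f_maps continuous_imp_measurable_LI[OF f_cont] in auto)

lemma fn_measurable: "f ^^ n \<in> measurable LI LI"
proof (induction n)
  case (Suc n)
  then show ?case using measurable_comp[OF Suc f_measurable] by (simp add: o_def)
qed simp

lemma fn_maps: "x \<in> {-1..1} \<Longrightarrow> (f ^^ n) x \<in> {-1..1}"
proof (induction n)
  case (Suc n)
  then show ?case using f_maps[of "(f ^^ n) x"] by simp
qed simp

text \<open>Lebesgue measure in the coordinate of \<open>f\<close> is the image of the measure with
  density \<open>\<theta>'\<close> in the conjugated coordinate; all integrals are moved between the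
  two coordinates through this.\<close>

lemma \<theta>_distr: "distr (density LI (\<lambda>x. ennreal (\<theta>' x))) LI \<theta> = LI"
proof (rule measure_eqI)
  fix A assume "A \<in> sets (distr (density LI (\<lambda>x. ennreal (\<theta>' x))) LI \<theta>)"
  then have A: "A \<in> sets LI" by simp
  note [measurable] = \<theta>_measurable \<theta>'_measurable A
  have "emeasure (distr (density LI (\<lambda>x. ennreal (\<theta>' x))) LI \<theta>) A =
      emeasure (density LI (\<lambda>x. ennreal (\<theta>' x))) (\<theta> -` A \<inter> space LI)"
    by (subst emeasure_distr) auto
  also have "\<dots> = (\<integral>\<^sup>+x. ennreal (\<theta>' x) * indicator (\<theta> -` A \<inter> space LI) x \<partial>LI)"
    using measurable_sets[OF \<theta>_measurable A] by (subst emeasure_density) auto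
  also have "\<dots> = (\<integral>\<^sup>+x. ennreal (\<theta>' x) * indicator A (\<theta> x) \<partial>LI)"
    by (intro nn_integral_cong) (auto split: split_indicator)
  also have "\<dots> = (\<integral>\<^sup>+x. indicator A x * indicator {\<theta> (-1)..\<theta> 1} x \<partial>LI)"
    by (rule nn_integral_LI_substitution[symmetric])
       (use \<theta>_has_deriv \<theta>'_cont \<theta>'_nonneg \<theta>_ends in auto)
  also have "\<dots> = (\<integral>\<^sup>+x. indicator A x \<partial>LI)"
    by (intro nn_integral_cong) (auto simp: \<theta>_ends)
  also have "\<dots> = emeasure LI A" using A by simp
  finally show "emeasure (distr (density LI (\<lambda>x. ennreal (\<theta>' x))) LI \<theta>) A = emeasure LI A" .
qed simp

lemma integral_\<theta>:
  fixes u :: "real \<Rightarrow> complex"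
  assumes u: "u \<in> borel_measurable LI"
  shows "(\<integral>x. u x \<partial>LI) = (\<integral>x. \<theta>' x *\<^sub>R u (\<theta> x) \<partial>LI)"
    and "integrable LI u \<longleftrightarrow> integrable LI (\<lambda>x. \<theta>' x *\<^sub>R u (\<theta> x))"
proof -
  note [measurable] = \<theta>_measurable \<theta>'_measurable u
  have nn: "AE x in LI. 0 \<le> \<theta>' x" using \<theta>'_nonneg by (intro AE_I2) simp
  have "(\<integral>x. u x \<partial>LI) = (\<integral>x. u x \<partial>distr (density LI (\<lambda>x. ennreal (\<theta>' x))) LI \<theta>)"
    by (simp only: \<theta>_distr)
  also have "\<dots> = (\<integral>x. u (\<theta> x) \<partial>density LI (\<lambda>x. ennreal (\<theta>' x)))"
    by (rule integral_distr) auto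
  also have "\<dots> = (\<integral>x. \<theta>' x *\<^sub>R u (\<theta> x) \<partial>LI)"
    using nn by (intro integral_density) auto
  finally show "(\<integral>x. u x \<partial>LI) = (\<integral>x. \<theta>' x *\<^sub>R u (\<theta> x) \<partial>LI)" .
  have "integrable LI u \<longleftrightarrow> integrable (distr (density LI (\<lambda>x. ennreal (\<theta>' x))) LI \<theta>) u"
    by (simp only: \<theta>_distr)
  also have "\<dots> \<longleftrightarrow> integrable (density LI (\<lambda>x. ennreal (\<theta>' x))) (\<lambda>x. u (\<theta> x))"
    by (rule integrable_distr_eq) auto
  also have "\<dots> \<longleftrightarrow> integrable LI (\<lambda>x. \<theta>' x *\<^sub>R u (\<theta> x))"
    using nn by (intro integrable_density) auto
  finally show "integrable LI u \<longleftrightarrow> integrable LI (\<lambda>x. \<theta>' x *\<^sub>R u (\<theta> x))" .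
qed

lemma iterate_measurable:
  "B \<in> borel_measurable LI \<Longrightarrow> (\<lambda>x. B ((f ^^ n) (\<theta> x)) :: complex) \<in> borel_measurable LI"
  by (rule measurable_compose[OF measurable_compose[OF \<theta>_measurable fn_measurable]])

lemma iterate_duality:
  assumes \<phi>: "continuous_on seg \<phi>"
    and B: "B \<in> borel_measurable LI" "\<And>x. x \<in> {-1..1} \<Longrightarrow> norm (B x :: complex) \<le> K"
  shows "(\<integral>x. B ((f ^^ n) (\<theta> x)) * \<phi> (of_real x) \<partial>LI) = (\<integral>x. B (\<theta> x) * (L ^^ n) \<phi> (of_real x) \<partial>LI)"
  using \<phi>
proof (induction n arbitrary: \<phi>)
  case (Suc n)
  have "(\<integral>x. B ((f ^^ Suc n) (\<theta> x)) * \<phi> (of_real x) \<partial>LI) = (\<integral>x. B ((f ^^ n) (\<theta> x)) * L \<phi> (of_real x) \<partial>LI)"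
  proof (rule transfer_duality[OF Suc.prems iterate_measurable[OF B(1)]])
    show "norm (B ((f ^^ Suc n) (\<theta> x))) \<le> K" if "x \<in> {-1..1}" for x
      by (rule B(2)[OF fn_maps[OF \<theta>_range[OF that]]])
    show "B ((f ^^ Suc n) (\<theta> (\<beta> j x))) = B ((f ^^ n) (\<theta> x))" if "j < m" "x \<in> {-1..1}" for j x
      unfolding funpow_Suc_right o_apply conj_\<theta>[OF that] ..
  qed
  also have "\<dots> = (\<integral>x. B (\<theta> x) * (L ^^ n) (L \<phi>) (of_real x) \<partial>LI)"
    by (rule Suc.IH[OF L_cont[OF Suc.prems]])
  finally show ?case by (simp only: funpow_Suc_right o_apply)
qed simp

lemma L_cong: "(\<And>j. j < m \<Longrightarrow> u (b j z) = v (b j z)) \<Longrightarrow> L u z = L v z"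
  unfolding L_def by (intro sum.cong) auto

lemma Ln_h: "z \<in> seg \<Longrightarrow> (L ^^ n) h z = h z"
proof (induction n arbitrary: z)
  case (Suc n)
  have "(L ^^ Suc n) h z = L h z"
    unfolding funpow.simps o_apply by (rule L_cong) (use Suc b_seg in auto)
  also have "\<dots> = h z" using Suc.prems seg_subset_nbhd[OF rh] by (intro h_fix) auto
  finally show ?case .
qed simp

lemma h_cont: "continuous_on seg h"
  by (rule hol_cont_seg[OF h_hol rh])

lemma h_analytic: "h analytic_on seg"
  using h_hol rh analytic_on_seg_iff by blast

section \<open>Mixing for bounded observables and integrable densities\<close>

lemma integrable_bounded_mult:
  fixes u B :: "real \<Rightarrow> complex"
  assumes "integrable LI u" "B \<in> borel_measurable LI" "\<And>x. x \<in> {-1..1} \<Longrightarrow> norm (B x) \<le> K"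
  shows "integrable LI (\<lambda>x. B x * u x)" "norm (\<integral>x. B x * u x \<partial>LI) \<le> K * (\<integral>x. norm (u x) \<partial>LI)"
proof -
  have K: "K \<ge> 0" using order_trans[OF norm_ge_zero assms(3)[of 0]] by simp
  show int: "integrable LI (\<lambda>x. B x * u x)"
  proof (rule Bochner_Integration.integrable_bound)
    show "integrable LI (\<lambda>x. of_real K * u x)" using assms(1) by simp
    show "(\<lambda>x. B x * u x) \<in> borel_measurable LI" using assms by measurable
    show "AE x in LI. norm (B x * u x) \<le> norm (of_real K * u x)"
      using assms(3) K by (intro AE_I2) (auto simp: norm_mult intro!: mult_right_mono)
  qed
  have "norm (\<integral>x. B x * u x \<partial>LI) \<le> (\<integral>x. norm (B x * u x) \<partial>LI)" by (rule integral_norm_bound)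
  also have "\<dots> \<le> (\<integral>x. K * norm (u x) \<partial>LI)"
  proof (rule integral_mono)
    show "norm (B x * u x) \<le> K * norm (u x)" if "x \<in> space LI" for x
      using assms(3)[of x] that by (simp add: norm_mult mult_right_mono)
  qed (use int assms(1) in simp_all)
  finally show "norm (\<integral>x. B x * u x \<partial>LI) \<le> K * (\<integral>x. norm (u x) \<partial>LI)" by simp
qed

text \<open>Duality moves the iterates onto \<open>\<phi>\<close>, which splits into a multiple of
  the fixed density \<open>h\<close> and a part of mean zero that \<open>mixing\<close> sends to
  \<open>0\<close> in L1.\<close>

lemma decay_analytic:
  assumes \<phi>: "\<phi> analytic_on seg"
    and B: "B \<in> borel_measurable LI" "\<And>x. x \<in> {-1..1} \<Longrightarrow> norm (B x :: complex) \<le> K"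
  shows "(\<lambda>n. \<integral>x. B ((f ^^ n) (\<theta> x)) * \<phi> (of_real x) \<partial>LI)
    \<longlonglongrightarrow> (\<integral>x. \<phi> (of_real x) \<partial>LI) * (\<integral>x. B (\<theta> x) * h (of_real x) \<partial>LI)"
proof -
  define c where "c = (\<integral>x. \<phi> (complex_of_real x) \<partial>LI)"
  \<comment> \<open>Since \<open>h\<close> has integral \<open>1\<close>, subtracting
    \<open>c\<close> times \<open>h\<close> removes the mean.\<close>
  define \<psi> where "\<psi> z = \<phi> z + (- c) * h z" for z
  have \<phi>c: "continuous_on seg \<phi>"
    using \<phi> analytic_imp_holomorphic holomorphic_on_imp_continuous_on by blast
  have \<psi>c: "continuous_on seg \<psi>" unfolding \<psi>_def[abs_def] by (intro continuous_intros \<phi>c h_cont)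
  have "\<psi> analytic_on seg" unfolding \<psi>_def[abs_def] by (intro analytic_intros \<phi> h_analytic)
  then obtain s M where s: "s > 0" "\<psi> holomorphic_on nbhd s" "\<And>z. z \<in> nbhd s \<Longrightarrow> norm (\<psi> z) \<le> M"
    by (rule analytic_on_seg_bounded) metis
  define t where "t = min s r"
  have t: "0 < t" "t \<le> r" "nbhd t \<subseteq> nbhd s" using s r0 by (auto simp: t_def intro!: nbhd_mono)
  have mean: "(\<integral>x. \<psi> (of_real x) \<partial>LI) = 0"
  proof -
    have "(\<integral>x. \<psi> (of_real x) \<partial>LI) = c + (\<integral>x. - c * h (of_real x) \<partial>LI)"
      unfolding \<psi>_def c_def
      by (intro Bochner_Integration.integral_add continuous_imp_integrable_LI continuous_intros cont_of_real \<phi>c h_cont)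
    then show ?thesis using h_int by simp
  qed
  have lim0: "(\<lambda>n. \<integral>x. norm ((L ^^ n) \<psi> (of_real x)) \<partial>LI) \<longlonglongrightarrow> 0"
    by (rule mixing[OF _ t(1,2) _ mean]) (use s t in \<open>auto intro: holomorphic_on_subset\<close>)
  have Bm: "(\<lambda>x. B (\<theta> x)) \<in> borel_measurable LI" using iterate_measurable[OF B(1), of 0] by simp
  have Bb: "norm (B (\<theta> x)) \<le> K" if "x \<in> {-1..1}" for x by (rule B(2)[OF \<theta>_range[OF that]])
  have int: "integrable LI (\<lambda>x. (L ^^ n) \<psi> (of_real x))" "integrable LI (\<lambda>x. h (of_real x))" for n
    by (intro continuous_imp_integrable_LI cont_of_real Ln_cont \<psi>c h_cont)+
  have eq: "(\<integral>x. B ((f ^^ n) (\<theta> x)) * \<phi> (of_real x) \<partial>LI) =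
      (\<integral>x. B (\<theta> x) * (L ^^ n) \<psi> (of_real x) \<partial>LI) + c * (\<integral>x. B (\<theta> x) * h (of_real x) \<partial>LI)" for n
  proof -
    have "(\<integral>x. B ((f ^^ n) (\<theta> x)) * \<phi> (of_real x) \<partial>LI) = (\<integral>x. B (\<theta> x) * (L ^^ n) \<phi> (of_real x) \<partial>LI)"
      by (rule iterate_duality[OF \<phi>c B])
    also have "\<dots> = (\<integral>x. B (\<theta> x) * (L ^^ n) \<psi> (of_real x) + c * (B (\<theta> x) * h (of_real x)) \<partial>LI)"
    proof (rule Bochner_Integration.integral_cong[OF refl])
      fix x assume "x \<in> space LI"
      then have x: "complex_of_real x \<in> seg" by simp
      have "(L ^^ n) \<psi> = (\<lambda>z. (L ^^ n) \<phi> z + - c * (L ^^ n) h z)"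
        unfolding \<psi>_def[abs_def] Ln_add Ln_scale ..
      then show "B (\<theta> x) * (L ^^ n) \<phi> (of_real x) = B (\<theta> x) * (L ^^ n) \<psi> (of_real x) + c * (B (\<theta> x) * h (of_real x))"
        using Ln_h[OF x] by (simp add: algebra_simps)
    qed
    also have "\<dots> = (\<integral>x. B (\<theta> x) * (L ^^ n) \<psi> (of_real x) \<partial>LI) + (\<integral>x. c * (B (\<theta> x) * h (of_real x)) \<partial>LI)"
      by (intro Bochner_Integration.integral_add integrable_mult_right integrable_bounded_mult(1)[OF _ Bm Bb] int)
    finally show ?thesis by simp
  qed
  have "(\<lambda>n. \<integral>x. B (\<theta> x) * (L ^^ n) \<psi> (of_real x) \<partial>LI) \<longlonglongrightarrow> 0"
  proof (rule Lim_null_comparison)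
    show "\<forall>\<^sub>F n in sequentially. norm (\<integral>x. B (\<theta> x) * (L ^^ n) \<psi> (of_real x) \<partial>LI) \<le>
        K * (\<integral>x. norm ((L ^^ n) \<psi> (of_real x)) \<partial>LI)"
      by (intro always_eventually allI integrable_bounded_mult(2)[OF int(1) Bm Bb])
    show "(\<lambda>n. K * (\<integral>x. norm ((L ^^ n) \<psi> (of_real x)) \<partial>LI)) \<longlonglongrightarrow> 0"
      using tendsto_mult_right_zero[OF lim0] by simp
  qed
  from tendsto_add[OF this tendsto_const[of "c * (\<integral>x. B (\<theta> x) * h (of_real x) \<partial>LI)"]]
  show ?thesis by (simp add: eq c_def)
qed

text \<open>The limit is the product of the mean of \<open>u\<close> and the mean of
  \<open>B\<close> under the invariant measure. The class of such \<open>u\<close> is enlarged step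
  by step from analytic functions to all integrable ones.\<close>

definition decays :: "(real \<Rightarrow> complex) \<Rightarrow> (real \<Rightarrow> complex) \<Rightarrow> bool" where
  "decays B u \<longleftrightarrow> integrable LI u \<and>
     (\<lambda>n. \<integral>x. B ((f ^^ n) (\<theta> x)) * u x \<partial>LI) \<longlonglongrightarrow> (\<integral>x. u x \<partial>LI) * (\<integral>x. B (\<theta> x) * h (of_real x) \<partial>LI)"

context
  fixes B :: "real \<Rightarrow> complex" and K :: real
  assumes B: "B \<in> borel_measurable LI" "\<And>x. x \<in> {-1..1} \<Longrightarrow> norm (B x) \<le> K"
begin

lemma Bn_bound: "x \<in> {-1..1} \<Longrightarrow> norm (B ((f ^^ n) (\<theta> x))) \<le> K"
  by (rule B(2)[OF fn_maps[OF \<theta>_range]])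

lemma decays_add: "decays B u \<Longrightarrow> decays B v \<Longrightarrow> decays B (\<lambda>x. u x + v x)"
  unfolding decays_def
proof safe
  assume u: "integrable LI u" and v: "integrable LI v"
    and "(\<lambda>n. \<integral>x. B ((f ^^ n) (\<theta> x)) * u x \<partial>LI) \<longlonglongrightarrow> (\<integral>x. u x \<partial>LI) * (\<integral>x. B (\<theta> x) * h (of_real x) \<partial>LI)"
    and "(\<lambda>n. \<integral>x. B ((f ^^ n) (\<theta> x)) * v x \<partial>LI) \<longlonglongrightarrow> (\<integral>x. v x \<partial>LI) * (\<integral>x. B (\<theta> x) * h (of_real x) \<partial>LI)"
  note lim = tendsto_add[OF this(3,4)]
  have "(\<integral>x. B ((f ^^ n) (\<theta> x)) * (u x + v x) \<partial>LI) =
      (\<integral>x. B ((f ^^ n) (\<theta> x)) * u x \<partial>LI) + (\<integral>x. B ((f ^^ n) (\<theta> x)) * v x \<partial>LI)" for n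
    unfolding distrib_left
    by (intro Bochner_Integration.integral_add integrable_bounded_mult(1)[OF _ iterate_measurable[OF B(1)] Bn_bound] u v)
  with lim show "(\<lambda>n. \<integral>x. B ((f ^^ n) (\<theta> x)) * (u x + v x) \<partial>LI)
      \<longlonglongrightarrow> (\<integral>x. u x + v x \<partial>LI) * (\<integral>x. B (\<theta> x) * h (of_real x) \<partial>LI)"
    using u v by (simp add: distrib_right)
  show "integrable LI (\<lambda>x. u x + v x)" using u v by simp
qed

lemma decays_scale: "decays B u \<Longrightarrow> decays B (\<lambda>x. u x * c)"
  unfolding decays_def
proof safe
  assume u: "integrable LI u"
    and "(\<lambda>n. \<integral>x. B ((f ^^ n) (\<theta> x)) * u x \<partial>LI) \<longlonglongrightarrow> (\<integral>x. u x \<partial>LI) * (\<integral>x. B (\<theta> x) * h (of_real x) \<partial>LI)"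
  note lim = tendsto_mult_right[OF this(2), of c]
  have "(\<integral>x. B ((f ^^ n) (\<theta> x)) * (u x * c) \<partial>LI) = (\<integral>x. B ((f ^^ n) (\<theta> x)) * u x \<partial>LI) * c" for n
    unfolding mult.assoc[symmetric] by (rule integral_mult_left_zero)
  moreover have "(\<integral>x. u x * c \<partial>LI) * (\<integral>x. B (\<theta> x) * h (of_real x) \<partial>LI) =
      (\<integral>x. u x \<partial>LI) * (\<integral>x. B (\<theta> x) * h (of_real x) \<partial>LI) * c"
    unfolding integral_mult_left_zero by (simp only: mult_ac)
  ultimately
  show "(\<lambda>n. \<integral>x. B ((f ^^ n) (\<theta> x)) * (u x * c) \<partial>LI)
      \<longlonglongrightarrow> (\<integral>x. u x * c \<partial>LI) * (\<integral>x. B (\<theta> x) * h (of_real x) \<partial>LI)"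
    using lim by (simp only:)
  show "integrable LI (\<lambda>x. u x * c)" using u by simp
qed

text \<open>The pairing with the observable along the orbit is bounded by \<open>K\<close> times the
  L1 norm uniformly in \<open>n\<close>, so the limits in \<open>k\<close> and \<open>n\<close> may
  be interchanged.\<close>

lemma decays_limit:
  assumes dec: "\<And>k. decays B (s k)" and u: "integrable LI u"
    and lim: "(\<lambda>k. \<integral>x. norm (s k x - u x) \<partial>LI) \<longlonglongrightarrow> 0"
  shows "decays B u"
  unfolding decays_def
proof (intro conjI u tendstoI)
  fix e :: real assume e: "e > 0"
  define c where "c = (\<integral>x. B (\<theta> x) * h (complex_of_real x) \<partial>LI)"
  define K' where "K' = K + norm c + 1"
  have K: "K \<ge> 0" using order_trans[OF norm_ge_zero B(2)[of 0]] by simp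
  have K': "K' > 0" using K norm_ge_zero[of c] unfolding K'_def by linarith
  have "eventually (\<lambda>k. (\<integral>x. norm (s k x - u x) \<partial>LI) < e / (3 * K')) sequentially"
    using lim e K' by (intro order_tendstoD(2)[of _ 0]) auto
  then obtain k where k: "(\<integral>x. norm (s k x - u x) \<partial>LI) < e / (3 * K')" by (auto simp: eventually_sequentially)
  have sk: "integrable LI (s k)" and
    skl: "(\<lambda>n. \<integral>x. B ((f ^^ n) (\<theta> x)) * s k x \<partial>LI) \<longlonglongrightarrow> (\<integral>x. s k x \<partial>LI) * c"
    using dec[of k] by (auto simp: decays_def c_def)
  define \<eta> where "\<eta> = (\<integral>x. norm (s k x - u x) \<partial>LI)"
  have \<eta>0: "\<eta> \<ge> 0" unfolding \<eta>_def by (rule Bochner_Integration.integral_nonneg) simp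
  have \<eta>: "K * \<eta> \<le> e / 3" "norm c * \<eta> \<le> e / 3"
  proof -
    have "K' * \<eta> \<le> e / 3" using k K' unfolding \<eta>_def[symmetric] by (simp add: field_simps)
    moreover have "K * \<eta> \<le> K' * \<eta>" "norm c * \<eta> \<le> K' * \<eta>"
      using \<eta>0 K by (auto simp: K'_def intro!: mult_right_mono)
    ultimately show "K * \<eta> \<le> e / 3" "norm c * \<eta> \<le> e / 3" by linarith+
  qed
  have 1: "norm ((\<integral>x. B ((f ^^ n) (\<theta> x)) * s k x \<partial>LI) - (\<integral>x. B ((f ^^ n) (\<theta> x)) * u x \<partial>LI)) \<le> K * \<eta>" for n
  proof -
    note bm = integrable_bounded_mult[OF _ iterate_measurable[OF B(1)] Bn_bound]
    have "(\<integral>x. B ((f ^^ n) (\<theta> x)) * s k x \<partial>LI) - (\<integral>x. B ((f ^^ n) (\<theta> x)) * u x \<partial>LI) =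
        (\<integral>x. B ((f ^^ n) (\<theta> x)) * (s k x - u x) \<partial>LI)"
      unfolding right_diff_distrib by (intro Bochner_Integration.integral_diff[symmetric] bm(1) sk u)
    also have "norm \<dots> \<le> K * \<eta>" unfolding \<eta>_def by (intro bm(2) Bochner_Integration.integrable_diff sk u)
    finally show ?thesis .
  qed
  have 2: "norm ((\<integral>x. s k x \<partial>LI) * c - (\<integral>x. u x \<partial>LI) * c) \<le> norm c * \<eta>"
  proof -
    have "(\<integral>x. s k x \<partial>LI) * c - (\<integral>x. u x \<partial>LI) * c = c * (\<integral>x. s k x - u x \<partial>LI)"
      using sk u by (simp add: algebra_simps)
    then show ?thesis unfolding \<eta>_def by (simp add: norm_mult mult_left_mono integral_norm_bound)
  qed
  have "eventually (\<lambda>n. dist (\<integral>x. B ((f ^^ n) (\<theta> x)) * s k x \<partial>LI) ((\<integral>x. s k x \<partial>LI) * c) < e / 3) sequentially"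
    using tendstoD[OF skl, of "e / 3"] e by simp
  then show "eventually (\<lambda>n. dist (\<integral>x. B ((f ^^ n) (\<theta> x)) * u x \<partial>LI) ((\<integral>x. u x \<partial>LI) * c) < e) sequentially"
  proof eventually_elim
    case (elim n)
    let ?a = "\<integral>x. B ((f ^^ n) (\<theta> x)) * u x \<partial>LI" and ?b = "\<integral>x. B ((f ^^ n) (\<theta> x)) * s k x \<partial>LI"
    have "dist ?a ((\<integral>x. u x \<partial>LI) * c) \<le> dist ?a ?b + dist ?b ((\<integral>x. s k x \<partial>LI) * c)
        + dist ((\<integral>x. s k x \<partial>LI) * c) ((\<integral>x. u x \<partial>LI) * c)"
      using dist_triangle[of ?a "(\<integral>x. u x \<partial>LI) * c" ?b]
        dist_triangle[of ?b "(\<integral>x. u x \<partial>LI) * c" "(\<integral>x. s k x \<partial>LI) * c"] by linarith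
    moreover have "dist ?a ?b \<le> e / 3" using order_trans[OF 1[of n] \<eta>(1)] by (simp add: dist_norm norm_minus_commute)
    moreover have "dist ((\<integral>x. s k x \<partial>LI) * c) ((\<integral>x. u x \<partial>LI) * c) \<le> e / 3"
      using order_trans[OF 2 \<eta>(2)] by (simp add: dist_norm)
    ultimately show ?case using elim by linarith
  qed
qed

lemma decays_dominated_limit:
  assumes dec: "\<And>k. decays B (s k)" and u: "u \<in> borel_measurable LI"
    and lim: "AE x in LI. (\<lambda>k. s k x) \<longlonglongrightarrow> u x"
    and bd: "\<And>k. AE x in LI. norm (s k x) \<le> w x" and w: "integrable LI w"
  shows "decays B u"
proof (rule decays_limit[OF dec])
  have sm: "s k \<in> borel_measurable LI" for k using dec[of k] by (auto simp: decays_def)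
  show int: "integrable LI u"
    by (rule integrable_dominated_convergence[OF u sm w lim bd])
  have ubd: "AE x in LI. norm (u x) \<le> w x"
  proof -
    have "AE x in LI. \<forall>k. norm (s k x) \<le> w x" using bd by (simp add: AE_all_countable)
    with lim show ?thesis
    proof eventually_elim
      case (elim x)
      then show ?case by (intro LIMSEQ_le_const2[OF tendsto_norm[OF elim(1)]]) auto
    qed
  qed
  have "(\<lambda>k. \<integral>x. norm (s k x - u x) \<partial>LI) \<longlonglongrightarrow> (\<integral>x. 0 \<partial>LI)"
  proof (rule integral_dominated_convergence[where w = "\<lambda>x. 2 * w x"])
    show "AE x in LI. (\<lambda>k. norm (s k x - u x)) \<longlonglongrightarrow> 0"
      using lim by eventually_elim (simp add: LIM_zero tendsto_norm_zero)
    show "AE x in LI. norm (norm (s k x - u x)) \<le> 2 * w x" for k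
      using ubd bd[of k]
    proof eventually_elim
      case (elim x)
      then show ?case using norm_triangle_ineq4[of "s k x" "u x"] by simp
    qed
  qed (use sm u w in auto)
  then show "(\<lambda>k. \<integral>x. norm (s k x - u x) \<partial>LI) \<longlonglongrightarrow> 0" by simp
qed

lemma decays_analytic: "\<phi> analytic_on seg \<Longrightarrow> decays B (\<lambda>x. \<phi> (of_real x))"
  unfolding decays_def using decay_analytic[OF _ B]
    continuous_imp_integrable_LI[OF cont_of_real[OF holomorphic_on_imp_continuous_on[OF analytic_imp_holomorphic]]]
  by blast

text \<open>The entire functions \<open>exp (- exp (k (x - a)))\<close> approximate the indicator of a half line.\<close>

lemma decays_atMost: "decays B (indicator {..a})"
proof (rule decays_dominated_limit[where s = "\<lambda>k x. exp (- exp (of_nat k * (of_real x - of_real a)))" and w = "\<lambda>_. 1"])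
  show "decays B (\<lambda>x. exp (- exp (of_nat k * (complex_of_real x - complex_of_real a))))" for k
    by (rule decays_analytic[of "\<lambda>z. exp (- exp (of_nat k * (z - complex_of_real a)))"]) (intro analytic_intros)
  have eq: "exp (- exp (of_nat k * (complex_of_real x - complex_of_real a))) = of_real (exp (- exp (real k * (x - a))))" for k x
    by (simp flip: exp_of_real)
  show "AE x in LI. norm (exp (- exp (of_nat k * (complex_of_real x - complex_of_real a)))) \<le> 1" for k
    by (intro AE_I2) (simp only: eq norm_of_real, simp)
  have "AE x in LI. x \<notin> {a}" by (rule AE_LI_neq) simp
  then show "AE x in LI. (\<lambda>k. exp (- exp (of_nat k * (complex_of_real x - complex_of_real a)))) \<longlonglongrightarrow> indicator {..a} x"
  proof eventually_elim
    case (elim x)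
    have "(\<lambda>k. complex_of_real (exp (- exp (real k * (x - a))))) \<longlonglongrightarrow> of_real (indicator {..a} x)"
      using elim by (intro tendsto_of_real double_exponential_step_limit) auto
    then show ?case by (simp only: eq of_real_indicator)
  qed
  show "indicator {..a} \<in> borel_measurable LI"
    by (rule measurable_restrict_space1) auto
qed simp

text \<open>Dynkin's argument: half lines are stable under intersection and generate the Borel sets,
  while complements and disjoint unions are handled by linearity and dominated convergence.\<close>

lemma decays_indicator:
  assumes "A \<in> sets borel"
  shows "decays B (indicator A)"
proof -
  have "Int_stable (range (atMost :: real \<Rightarrow> real set))" "range (atMost :: real \<Rightarrow> real set) \<subseteq> Pow UNIV"
    "A \<in> sigma_sets UNIV (range atMost)"
    using assms by (auto simp: Int_stable_def borel_eq_atMost)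
  then show ?thesis
  proof (induction A rule: sigma_sets_induct_disjoint)
    case (basic A)
    then show ?case using decays_atMost by auto
  next
    case empty
    have "decays B (\<lambda>x. (\<lambda>_. 0) (of_real x))" by (rule decays_analytic) auto
    then show ?case by (simp add: indicator_def[abs_def])
  next
    case (compl A)
    have "decays B (\<lambda>x. (\<lambda>_. 1) (of_real x))" by (rule decays_analytic) auto
    from decays_add[OF this decays_scale[OF compl(2), of "-1"]]
    have "decays B (\<lambda>x. 1 + indicator A x * -1)" .
    moreover have "(\<lambda>x. 1 + indicator A x * -1) = (indicator (UNIV - A) :: real \<Rightarrow> complex)"
      by (rule ext) (simp add: indicator_def)
    ultimately show ?case by metis
  next
    case (union A)
    have A: "A i \<in> sets borel" for i
    proof -
      have "A i \<in> sigma_sets UNIV (range atMost)" using union(2) by blast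
      then show ?thesis by (simp add: borel_eq_atMost)
    qed
    have disj: "disjoint_family A" using union(1) .
    show ?case
    proof (rule decays_dominated_limit[where s = "\<lambda>k x. \<Sum>i<k. indicator (A i) x" and w = "\<lambda>_. 1"])
      show "decays B (\<lambda>x. \<Sum>i<k. indicator (A i) x)" for k
      proof (induction k)
        case 0
        have "decays B (\<lambda>x. (\<lambda>_. 0) (of_real x))" by (rule decays_analytic) auto
        then show ?case by simp
      next
        case (Suc k)
        then show ?case using decays_add[OF Suc union(3)[of k]] by simp
      qed
      have ind: "(\<Sum>i<k. indicator (A i) x) = (indicator (\<Union>i<k. A i) x :: complex)" for k x
        using disj by (intro indicator_UN_disjoint[symmetric]) (auto intro: disjoint_family_on_mono)
      show "AE x in LI. norm (\<Sum>i<k. indicator (A i) x :: complex) \<le> 1" for k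
        unfolding ind by (intro AE_I2) (auto simp: indicator_def)
      show "AE x in LI. (\<lambda>k. \<Sum>i<k. indicator (A i) x) \<longlonglongrightarrow> (indicator (\<Union>i. A i) x :: complex)"
        unfolding ind by (intro AE_I2 LIMSEQ_indicator_UN)
      show "indicator (\<Union>i. A i) \<in> borel_measurable LI"
        by (rule measurable_restrict_space1) (use A in auto)
    qed simp
  qed
qed

text \<open>The extension to all integrable densities is what uniqueness of the invariant measure
  requires, since nothing is known about the regularity of a competing density.\<close>

lemma decays_integrable:
  assumes "integrable LI u"
  shows "decays B u"
  using assms
proof (induction u rule: integrable_induct)
  case (base A c)
  then obtain A' where A': "A' \<in> sets borel" "A = {-1..1} \<inter> A'"
    by (auto simp: sets_restrict_space)
  have "decays B (\<lambda>x. indicator (A' \<inter> {-1..1}) x * c)"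
    by (intro decays_scale decays_indicator) (use A' in auto)
  moreover have "(\<lambda>x. indicator (A' \<inter> {-1..1}) x * c) = (\<lambda>x. indicator A x *\<^sub>R c)"
    using A' by (auto simp: indicator_def)
  ultimately show ?case by simp
next
  case (add u v)
  then show ?case by (intro decays_add)
next
  case (lim u s)
  show ?case
    by (rule decays_dominated_limit[of s u "\<lambda>x. 2 * norm (u x)"]) (use lim in auto)
qed

end

end

section \<open>Existence and uniqueness of the invariant measure\<close>

context interval_map
begin

text \<open>\<open>h\<close> is a density in the conjugated coordinate; the image under
  \<open>\<theta>\<close> is the corresponding measure for \<open>f\<close>.\<close>

definition acim :: "real measure" where
  "acim = distr (density LI (\<lambda>x. ennreal (Re (h (of_real x))))) LI \<theta>"

lemma sets_acim [simp]: "sets acim = sets LI"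
  by (simp add: acim_def)

lemma space_acim [simp]: "space acim = {-1..1}"
  by (simp add: acim_def)

lemma Re_h_measurable: "(\<lambda>x. Re (h (of_real x))) \<in> borel_measurable LI"
  by (intro continuous_imp_measurable_LI continuous_intros cont_of_real h_cont)

lemma h_of_real: "x \<in> {-1..1} \<Longrightarrow> h (of_real x) = of_real (Re (h (of_real x)))"
  using h_real by (simp add: complex_eq_iff)

lemma integral_acim:
  fixes B :: "real \<Rightarrow> complex"
  assumes "B \<in> borel_measurable LI"
  shows "(\<integral>x. B x \<partial>acim) = (\<integral>x. B (\<theta> x) * h (of_real x) \<partial>LI)"
proof -
  note [measurable] = \<theta>_measurable Re_h_measurable assms
  have "(\<integral>x. B x \<partial>acim) = (\<integral>x. B (\<theta> x) \<partial>density LI (\<lambda>x. ennreal (Re (h (of_real x)))))"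
    unfolding acim_def by (rule integral_distr) auto
  also have "\<dots> = (\<integral>x. Re (h (of_real x)) *\<^sub>R B (\<theta> x) \<partial>LI)"
    using h_nonneg by (intro integral_density AE_I2) auto
  also have "\<dots> = (\<integral>x. B (\<theta> x) * h (of_real x) \<partial>LI)"
  proof (rule Bochner_Integration.integral_cong[OF refl])
    fix x assume "x \<in> space LI"
    then have "h (of_real x) = of_real (Re (h (of_real x)))" by (intro h_of_real) simp
    then show "Re (h (of_real x)) *\<^sub>R B (\<theta> x) = B (\<theta> x) * h (of_real x)"
      by (metis mult.commute scaleR_conv_of_real)
  qed
  finally show ?thesis .
qed

lemma prob_space_acim: "prob_space acim"
proof -
  have int: "integrable LI (\<lambda>x. Re (h (of_real x)))"
    by (intro continuous_imp_integrable_LI continuous_intros cont_of_real h_cont)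
  have "(\<integral>x. Re (h (of_real x)) \<partial>LI) = Re (\<integral>x. h (of_real x) \<partial>LI)"
    by (intro integral_Re continuous_imp_integrable_LI cont_of_real h_cont)
  then have "(\<integral>\<^sup>+x. ennreal (Re (h (of_real x))) \<partial>LI) = 1"
    using h_nonneg by (subst nn_integral_eq_integral[OF int]) (auto simp: h_int)
  moreover have "emeasure (density LI (\<lambda>x. ennreal (Re (h (of_real x))))) {-1..1} =
      (\<integral>\<^sup>+x. ennreal (Re (h (of_real x))) \<partial>LI)"
    using Re_h_measurable sets.top[of LI]
    by (subst emeasure_density) (auto intro!: nn_integral_cong)
  ultimately have "prob_space (density LI (\<lambda>x. ennreal (Re (h (of_real x)))))"
    by (intro prob_spaceI) simp
  moreover have "\<theta> \<in> measurable (density LI (\<lambda>x. ennreal (Re (h (of_real x))))) LI"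
    using \<theta>_measurable by simp
  ultimately show ?thesis unfolding acim_def by (rule prob_space.prob_space_distr)
qed

text \<open>Lets the complex valued duality and mixing statements be used for comparing
  measures.\<close>

lemma measure_eqI_complex_integral:
  assumes "finite_measure \<mu>" "finite_measure \<nu>" "sets \<mu> = sets LI" "sets \<nu> = sets LI"
    and eq: "\<And>A. A \<in> sets LI \<Longrightarrow> (\<integral>x. complex_of_real (indicator A x) \<partial>\<mu>) = (\<integral>x. complex_of_real (indicator A x) \<partial>\<nu>)"
  shows "\<mu> = \<nu>"
proof (rule measure_eqI)
  fix A assume A: "A \<in> sets \<mu>"
  have sub: "A \<subseteq> space \<mu>" "A \<subseteq> space \<nu>"
    using A assms(3,4) sets.sets_into_space by metis+
  have "complex_of_real (measure \<mu> A) = complex_of_real (measure \<nu> A)"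
    using eq[of A] A assms(3) sub unfolding integral_complex_of_real by (simp add: Int_absorb2)
  then show "emeasure \<mu> A = emeasure \<nu> A"
    using assms(1,2) by (simp add: finite_measure.emeasure_eq_measure)
qed (use assms in simp)

lemma indicator_bounded_measurable:
  assumes "A \<in> sets LI"
  shows "(\<lambda>x. complex_of_real (indicator A x)) \<in> borel_measurable LI"
    and "norm (complex_of_real (indicator A x)) \<le> 1"
  using assms by (auto simp: indicator_def)

lemma ac_invariant_prob_acim: "ac_invariant_prob f acim"
  unfolding ac_invariant_prob_def
proof (intro conjI)
  have f_meas: "f \<in> measurable acim acim"
    using f_measurable by (simp cong: measurable_cong_sets)
  then show "f \<in> measurable acim acim" .
  interpret P: prob_space acim by (rule prob_space_acim)
  show "distr acim acim f = acim"
  proof (rule measure_eqI_complex_integral)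
    show "finite_measure (distr acim acim f)" by (rule P.finite_measure_distr[OF f_meas])
    fix A assume A: "A \<in> sets LI"
    note ind = indicator_bounded_measurable[OF A]
    have "(\<integral>x. complex_of_real (indicator A x) \<partial>distr acim acim f) = (\<integral>x. complex_of_real (indicator A (f x)) \<partial>acim)"
      using ind(1) by (intro integral_distr f_meas) (simp cong: measurable_cong_sets)
    also have "\<dots> = (\<integral>x. complex_of_real (indicator A (f (\<theta> x))) * h (of_real x) \<partial>LI)"
      by (rule integral_acim) (rule measurable_compose[OF f_measurable ind(1)])
    also have "\<dots> = (\<integral>x. complex_of_real (indicator A (\<theta> x)) * L h (of_real x) \<partial>LI)"
      using iterate_duality[OF h_cont ind, of 1] by simp
    also have "\<dots> = (\<integral>x. complex_of_real (indicator A (\<theta> x)) * h (of_real x) \<partial>LI)"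
      using Ln_h[of _ 1] by (intro Bochner_Integration.integral_cong) auto
    also have "\<dots> = (\<integral>x. complex_of_real (indicator A x) \<partial>acim)"
      by (rule integral_acim[symmetric, OF ind(1)])
    finally show "(\<integral>x. complex_of_real (indicator A x) \<partial>distr acim acim f) = (\<integral>x. complex_of_real (indicator A x) \<partial>acim)" .
  qed (use P.finite_measure_axioms in auto)
  show "absolutely_continuous LI acim"
    unfolding absolutely_continuous_def
  proof
    fix A assume "A \<in> null_sets LI"
    then have A: "A \<in> sets LI" "emeasure LI A = 0" by auto
    note [measurable] = \<theta>_measurable \<theta>'_measurable Re_h_measurable A(1)
    have "(\<integral>\<^sup>+x. ennreal (\<theta>' x) * indicator A (\<theta> x) \<partial>LI) = (\<integral>\<^sup>+x. indicator A x * indicator {\<theta> (-1)..\<theta> 1} x \<partial>LI)"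
      by (rule nn_integral_LI_substitution[symmetric])
         (use \<theta>_has_deriv \<theta>'_cont \<theta>'_nonneg \<theta>_ends in auto)
    also have "\<dots> = (\<integral>\<^sup>+x. indicator A x \<partial>LI)"
      by (intro nn_integral_cong) (auto simp: \<theta>_ends)
    also have "\<dots> = 0" using A by simp
    finally have "AE x in LI. ennreal (\<theta>' x) * indicator A (\<theta> x) = 0"
      by (subst (asm) nn_integral_0_iff_AE) auto
    moreover have "AE x in LI. x \<notin> {-1, 1}" by (rule AE_LI_neq) simp
    moreover have "AE x in LI. x \<in> {-1..1}" by (intro AE_I2) simp
    \<comment> \<open>\<open>\<theta>'\<close> is positive except at the two ends, so the preimage
      under \<open>\<theta>\<close> of a null set is null.\<close>
    ultimately have AE_notin: "AE x in LI. \<theta> x \<notin> A"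
    proof eventually_elim
      case (elim x)
      then have "\<theta>' x > 0" by (intro \<theta>'_pos) auto
      then show ?case using elim(1) by (auto simp: indicator_def split: if_splits)
    qed
    have "(\<integral>\<^sup>+x. ennreal (Re (h (of_real x))) * indicator (\<theta> -` A \<inter> space LI) x \<partial>LI) = (\<integral>\<^sup>+x. 0 \<partial>LI)"
    proof (rule nn_integral_cong_AE)
      show "AE x in LI. ennreal (Re (h (of_real x))) * indicator (\<theta> -` A \<inter> space LI) x = 0"
        using AE_notin by eventually_elim simp
    qed
    moreover have "emeasure acim A = (\<integral>\<^sup>+x. ennreal (Re (h (of_real x))) * indicator (\<theta> -` A \<inter> space LI) x \<partial>LI)"
    proof -
      have "emeasure acim A = emeasure (density LI (\<lambda>x. ennreal (Re (h (of_real x))))) (\<theta> -` A \<inter> space LI)"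
        unfolding acim_def by (subst emeasure_distr) auto
      also have "\<dots> = (\<integral>\<^sup>+x. ennreal (Re (h (of_real x))) * indicator (\<theta> -` A \<inter> space LI) x \<partial>LI)"
        using measurable_sets[OF \<theta>_measurable A(1)] by (intro emeasure_density) auto
      finally show ?thesis .
    qed
    ultimately show "A \<in> null_sets acim" using A(1) by (simp add: null_sets_def)
  qed
qed (use prob_space_acim in auto)

text \<open>For an invariant measure the correlations of an observable with its density form a
  constant sequence, while mixing sends them to the integral against \<open>acim\<close>. The two
  values therefore agree for every indicator.\<close>

lemma ac_invariant_prob_unique:
  assumes "ac_invariant_prob f \<rho>"
  shows "\<rho> = acim"
proof -
  have sets: "sets \<rho> = sets LI" and prob: "prob_space \<rho>" and fm: "f \<in> measurable \<rho> \<rho>"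
    and inv: "distr \<rho> \<rho> f = \<rho>" and ac: "absolutely_continuous LI \<rho>"
    using assms by (auto simp: ac_invariant_prob_def)
  interpret P: prob_space \<rho> by (rule prob)
  have meas_iff: "g \<in> borel_measurable \<rho> \<longleftrightarrow> g \<in> borel_measurable LI" for g :: "real \<Rightarrow> complex"
    by (rule arg_cong[where f = "\<lambda>S. g \<in> S"]) (rule measurable_cong_sets[OF sets refl])
  obtain p where p: "p \<in> borel_measurable LI" "density LI p = \<rho>"
    using LI.Radon_Nikodym[OF ac sets] by auto
  have "(\<integral>\<^sup>+x. p x \<partial>LI) = emeasure \<rho> {-1..1}"
    unfolding p(2)[symmetric] using p(1) sets.top[of LI]
    by (subst emeasure_density) (auto intro!: nn_integral_cong)
  moreover have "space \<rho> = {-1..1}" using sets_eq_imp_space_eq[OF sets] by simp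
  ultimately have pfin: "(\<integral>\<^sup>+x. p x \<partial>LI) = 1" using P.emeasure_space_1 by simp
  then have pae: "AE x in LI. p x \<noteq> \<infinity>" using p(1) by (intro nn_integral_PInf_AE) auto
  define pr where "pr x = enn2real (p x)" for x
  have prm: "pr \<in> borel_measurable LI" unfolding pr_def using p(1) by measurable
  have prnn: "pr x \<ge> 0" for x by (simp add: pr_def)
  have p_eq: "AE x in LI. p x = ennreal (pr x)"
    using pae by eventually_elim (simp add: pr_def less_top)
  have \<rho>_eq: "\<rho> = density LI (\<lambda>x. ennreal (pr x))"
    unfolding p(2)[symmetric] using p(1) prm p_eq by (intro density_cong) auto
  have pr_int: "integrable LI (\<lambda>x. complex_of_real (pr x))"
  proof -
    have "(\<integral>\<^sup>+x. ennreal (pr x) \<partial>LI) = 1"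
      using nn_integral_cong_AE[OF p_eq] pfin by simp
    then have "integrable LI pr" using prm prnn by (intro integrableI_nonneg) auto
    then show ?thesis by (rule integrable_of_real)
  qed
  \<comment> \<open>The Radon-Nikodym density of \<open>\<rho>\<close> expressed in the conjugated
    coordinate; the factor \<open>\<theta>'\<close> comes from the substitution.\<close>
  define u where "u x = \<theta>' x *\<^sub>R complex_of_real (pr (\<theta> x))" for x
  have u_int: "integrable LI u"
    using integral_\<theta>(2)[of "\<lambda>x. complex_of_real (pr x)"] pr_int unfolding u_def[abs_def] by auto
  have int_\<rho>: "(\<integral>x. B x \<partial>\<rho>) = (\<integral>x. B (\<theta> x) * u x \<partial>LI)" if B: "B \<in> borel_measurable LI" for B :: "real \<Rightarrow> complex"
  proof -
    have "(\<integral>x. B x \<partial>\<rho>) = (\<integral>x. pr x *\<^sub>R B x \<partial>LI)"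
      unfolding \<rho>_eq using B prm prnn by (intro integral_density) auto
    also have "\<dots> = (\<integral>x. \<theta>' x *\<^sub>R (pr (\<theta> x) *\<^sub>R B (\<theta> x)) \<partial>LI)"
      using B prm by (intro integral_\<theta>(1)) auto
    also have "\<dots> = (\<integral>x. B (\<theta> x) * u x \<partial>LI)"
      by (intro Bochner_Integration.integral_cong) (auto simp: u_def scaleR_conv_of_real mult_ac)
    finally show ?thesis .
  qed
  have inv_n: "(\<integral>x. B ((f ^^ n) x) \<partial>\<rho>) = (\<integral>x. B x \<partial>\<rho>)" if B: "B \<in> borel_measurable LI" for B :: "real \<Rightarrow> complex" and n
  proof (induction n)
    case (Suc n)
    have "(\<lambda>x. B ((f ^^ n) x)) \<in> borel_measurable LI"
      by (rule measurable_compose[OF fn_measurable B])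
    then have "(\<integral>x. B ((f ^^ n) x) \<partial>distr \<rho> \<rho> f) = (\<integral>x. B ((f ^^ n) (f x)) \<partial>\<rho>)"
      by (intro integral_distr fm) (simp only: meas_iff)
    then show ?case using Suc by (simp only: inv funpow_Suc_right o_apply)
  qed simp
  have "(\<integral>x. 1 \<partial>\<rho>) = (\<integral>x. 1 * u x \<partial>LI)" by (rule int_\<rho>) simp
  then have u1: "(\<integral>x. u x \<partial>LI) = 1" by (simp add: P.prob_space)
  show ?thesis
  proof (rule measure_eqI_complex_integral)
    show "finite_measure \<rho>" by (rule P.finite_measure_axioms)
    show "finite_measure acim" using prob_space_acim by (simp add: prob_space_def)
    fix A assume A: "A \<in> sets LI"
    define B where "B x = complex_of_real (indicator A x)" for x
    have B: "B \<in> borel_measurable LI" "\<And>x. x \<in> {-1..1} \<Longrightarrow> norm (B x) \<le> 1"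
      using indicator_bounded_measurable[OF A] by (auto simp: B_def[abs_def])
    have "(\<integral>x. B ((f ^^ n) (\<theta> x)) * u x \<partial>LI) = (\<integral>x. B x \<partial>\<rho>)" for n
      using int_\<rho>[OF measurable_compose[OF fn_measurable B(1)], of n] inv_n[OF B(1), of n] by simp
    moreover have "(\<lambda>n. \<integral>x. B ((f ^^ n) (\<theta> x)) * u x \<partial>LI) \<longlonglongrightarrow> (\<integral>x. u x \<partial>LI) * (\<integral>x. B (\<theta> x) * h (of_real x) \<partial>LI)"
      using decays_integrable[OF B u_int] by (simp add: decays_def)
    ultimately have "(\<integral>x. B x \<partial>\<rho>) = (\<integral>x. B (\<theta> x) * h (of_real x) \<partial>LI)"
      by (simp add: u1 LIMSEQ_const_iff)
    then show "(\<integral>x. complex_of_real (indicator A x) \<partial>\<rho>) = (\<integral>x. complex_of_real (indicator A x) \<partial>acim)"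
      using integral_acim[OF B(1)] by (simp add: B_def)
  qed (use sets in simp_all)
qed

end

subsection \<open>Local analysis at the end points\<close>

text \<open>The Laurent expansion at the simple pole has no constant term. Write
  \<open>D = (y - a) * E\<close>; then \<open>deriv (deriv D) a = 2 * deriv E a\<close>, so
  \<open>E\<close> and \<open>N / E\<close> have derivative zero at \<open>a\<close>, and the
  expression in question is a difference quotient of \<open>N / E\<close>.\<close>

lemma polar_remainder_tendsto_0:
  assumes S: "open S" "a \<in> S" and N: "N holomorphic_on S" and D: "D holomorphic_on S"
    and N': "deriv N a = 0" and D0: "D a = 0" and D1: "deriv D a \<noteq> 0" and D2: "deriv (deriv D) a = 0"
  shows "((\<lambda>y. N y / D y - (N a / deriv D a) / (y - a)) \<longlongrightarrow> 0) (at a)"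
proof -
  define E where "E y = (if y = a then deriv D a else D y / (y - a))" for y
  have E: "E holomorphic_on S"
  proof -
    have "E = (\<lambda>y. if y = a then deriv D a else (D y - D a) / (y - a))"
      by (rule ext) (simp add: E_def D0)
    then show ?thesis using pole_lemma_open[OF D S(1), of a] by (simp only:)
  qed
  have DE: "D y = (y - a) * E y" for y by (auto simp: E_def D0)
  have dE: "(E has_field_derivative deriv E y) (at y)" if "y \<in> S" for y
    using E S(1) that by (metis holomorphic_derivI)
  have ddE: "(deriv E has_field_derivative deriv (deriv E) a) (at a)"
    using holomorphic_deriv[OF E S(1)] S by (metis holomorphic_derivI)
  have dD: "deriv D y = E y + (y - a) * deriv E y" if "y \<in> S" for y
  proof -
    have "((\<lambda>y. (y - a) * E y) has_field_derivative E y + (y - a) * deriv E y) (at y)"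
      using dE[OF that] by (auto intro!: derivative_eq_intros)
    then have "(D has_field_derivative E y + (y - a) * deriv E y) (at y)" by (simp add: DE[abs_def])
    then show ?thesis by (rule DERIV_imp_deriv)
  qed
  have "((\<lambda>y. E y + (y - a) * deriv E y) has_field_derivative deriv E a + deriv E a) (at a)"
    using dE[OF S(2)] ddE by (auto intro!: derivative_eq_intros)
  then have "(deriv D has_field_derivative deriv E a + deriv E a) (at a)"
    by (rule has_field_derivative_transform_within_open[OF _ S]) (simp add: dD)
  then have "deriv (deriv D) a = deriv E a + deriv E a" by (rule DERIV_imp_deriv)
  then have E'0: "deriv E a = 0" using D2 by simp
  have Ea: "E a = deriv D a" by (simp add: E_def)
  have dN: "(N has_field_derivative 0) (at a)"
    using holomorphic_derivI[OF N S] N' by simp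
  have "((\<lambda>y. N y / E y) has_field_derivative (0 * E a - N a * deriv E a) / (E a * E a)) (at a)"
    using dN dE[OF S(2)] D1 Ea by (intro DERIV_divide) auto
  then have "((\<lambda>y. N y / E y) has_field_derivative 0) (at a)" by (simp add: E'0)
  then have "((\<lambda>y. (N y / E y - N a / E a) / (y - a)) \<longlongrightarrow> 0) (at a)"
    by (simp add: has_field_derivative_iff)
  moreover have "eventually (\<lambda>y. (N y / E y - N a / E a) / (y - a) = N y / D y - (N a / deriv D a) / (y - a)) (at a)"
    unfolding eventually_at_filter
    by (intro always_eventually) (auto simp: DE Ea diff_divide_distrib mult.commute)
  ultimately show ?thesis by (rule Lim_transform_eventually)
qed

text \<open>Riemann's theorem on removable singularities, with the values at the ends fixed to
  \<open>0\<close> so that the remainder qualifies for integration by parts.\<close>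

lemma analytic_on_seg_remove_ends:
  assumes t: "t > 0" and hol: "u holomorphic_on nbhd t - {1, -1}"
    and lim: "\<And>a. a = 1 \<or> a = -1 \<Longrightarrow> (u \<longlongrightarrow> 0) (at a)"
  shows "(\<lambda>y. if y = 1 \<or> y = -1 then 0 else u y) analytic_on seg"
proof -
  let ?v = "\<lambda>y. if y = 1 \<or> y = -1 then 0 else u y"
  have "?v holomorphic_on nbhd t"
  proof (rule no_isolated_singularity')
    show "finite {1, -1 :: complex}" by simp
    show "?v holomorphic_on nbhd t - {1, -1}"
      by (rule holomorphic_transform[OF hol]) auto
    fix a :: complex assume a: "a \<in> {1, -1}"
    have "(?v \<longlongrightarrow> 0) (at a)"
    proof (rule Lim_transform_eventually)
      show "(u \<longlongrightarrow> 0) (at a)" using lim a by auto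
      have "eventually (\<lambda>y. y \<in> - {- a}) (nhds a)"
        using a by (intro eventually_nhds_in_open) auto
      then show "eventually (\<lambda>y. u y = ?v y) (at a)"
        unfolding eventually_at_filter by eventually_elim (use a in auto)
    qed
    then show "(?v \<longlongrightarrow> ?v a) (at a within nbhd t)"
      using a by (auto intro: tendsto_within_subset)
  qed auto
  then show ?thesis using t analytic_on_seg_iff by blast
qed

text \<open>The terms \<open>0\<close> and \<open>1\<close>, \<open>2\<close> and \<open>3\<close>,
  and so on cancel; a last term remains exactly when \<open>m\<close> is odd, and then its sign is
  positive.\<close>

lemma alternating_sum_pairs_even:
  fixes t :: "nat \<Rightarrow> complex"
  assumes "\<And>j. Suc j < m \<Longrightarrow> even j \<Longrightarrow> t j = t (Suc j)"
  shows "(\<Sum>j<m. (-1) ^ j * t j) = (if odd m then t (m - 1) else 0)"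
  using assms
proof (induction m)
  case (Suc m)
  then have IH: "(\<Sum>j<m. (-1) ^ j * t j) = (if odd m then t (m - 1) else 0)" by simp
  show ?case
  proof (cases "odd m")
    case True
    then obtain k where k: "m = Suc k" "even k" by (metis Suc_pred odd_pos even_Suc)
    then have "t k = t (Suc k)" using Suc.prems[of k] by simp
    then show ?thesis using IH k by simp
  next
    case False
    then show ?thesis using IH by simp
  qed
qed simp

text \<open>Now \<open>1\<close> and \<open>2\<close>, \<open>3\<close> and \<open>4\<close>, and so
  on cancel. The first term always remains, and for even \<open>m\<close> so does the last one, with
  negative sign.\<close>

lemma alternating_sum_pairs_odd:
  fixes t :: "nat \<Rightarrow> complex"
  assumes "\<And>j. Suc j < m \<Longrightarrow> odd j \<Longrightarrow> t j = t (Suc j)" "m > 0"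
  shows "(\<Sum>j<m. (-1) ^ j * t j) = t 0 - (if even m then t (m - 1) else 0)"
  using assms
proof (induction m)
  case (Suc m)
  show ?case
  proof (cases "m = 0")
    case False
    then have IH: "(\<Sum>j<m. (-1) ^ j * t j) = t 0 - (if even m then t (m - 1) else 0)" using Suc by simp
    show ?thesis
    proof (cases "even m")
      case True
      then obtain k where k: "m = Suc k" "odd k" using False by (metis not0_implies_Suc even_Suc)
      then have "t k = t (Suc k)" using Suc.prems(1)[of k] by simp
      then show ?thesis using IH k by simp
    next
      case odd: False
      then show ?thesis using IH by simp
    qed
  qed simp
qed simp

text \<open>\<open>b_pair\<close> concerns two branches with the same value at an end of the
  interval, \<open>b_end2\<close> a branch that maps an end to an end. Both assumptions are second
  order information on the branches, obtained from derivatives of the functional equation of the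
  branches up to order three.\<close>

locale endpoint_map = interval_map +
  fixes f' :: "real \<Rightarrow> real"
  assumes f_has_deriv: "x \<in> {-1..1} \<Longrightarrow> (f has_real_derivative f' x) (at x within {-1..1})"
    and f'_cont: "continuous_on {-1..1} f'"
    and \<omega>2: "a = 1 \<or> a = -1 \<Longrightarrow> deriv (deriv \<omega>) a \<noteq> 0"
    and \<omega>3: "a = 1 \<or> a = -1 \<Longrightarrow> deriv (deriv (deriv \<omega>)) a = 0"
    and b_pair: "a = 1 \<or> a = -1 \<Longrightarrow> i < m \<Longrightarrow> j < m \<Longrightarrow> b i a = b j a \<Longrightarrow>
      deriv (b i) a ^ 2 = deriv (b j) a ^ 2 \<and> deriv (deriv (b i)) a = deriv (deriv (b j)) a"
    and b_end2: "a = 1 \<or> a = -1 \<Longrightarrow> j < m \<Longrightarrow> b j a = 1 \<or> b j a = -1 \<Longrightarrow> deriv (deriv (b j)) a = 0"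
begin

lemma b_at_1: "j < m \<Longrightarrow> b j 1 = of_real (if even j then d (Suc j) else d j)"
  using b_upper[of j] b_lower[of j] by auto

lemma b_at_m1: "j < m \<Longrightarrow> b j (-1) = of_real (if even j then d j else d (Suc j))"
  using b_upper[of j] b_lower[of j] by auto

lemma sum_at_1:
  fixes t :: "nat \<Rightarrow> complex"
  assumes "\<And>i j. i < m \<Longrightarrow> j < m \<Longrightarrow> b i 1 = b j 1 \<Longrightarrow> t i = t j"
  shows "(\<Sum>j<m. (-1) ^ j * t j) = (if odd m then t (m - 1) else 0)"
  by (rule alternating_sum_pairs_even) (auto intro!: assms simp: b_at_1)

lemma sum_at_m1:
  fixes t :: "nat \<Rightarrow> complex"
  assumes "\<And>i j. i < m \<Longrightarrow> j < m \<Longrightarrow> b i (-1) = b j (-1) \<Longrightarrow> t i = t j"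
  shows "(\<Sum>j<m. (-1) ^ j * t j) = t 0 - (if even m then t (m - 1) else 0)"
  by (rule alternating_sum_pairs_odd) (use m2 in \<open>auto intro!: assms simp: b_at_m1\<close>)

lemma b_last_1: "odd m \<Longrightarrow> b (m - 1) 1 = 1"
  using b_at_1[of "m - 1"] m2 d_m by (simp add: even_diff_nat)

lemma b_last_m1: "even m \<Longrightarrow> b (m - 1) (-1) = 1"
  using b_at_m1[of "m - 1"] m2 d_m by (simp add: even_diff_nat)

lemma b_first_m1: "b 0 (-1) = -1"
  using b_at_m1[of 0] m2 d_0 by simp

text \<open>Terms of neighbouring laps cancel, and a branch left without partner takes one of the
  values \<open>1\<close> and \<open>-1\<close>, where the term vanishes by assumption.\<close>

lemma sum_ends_eq_0:
  fixes t :: "nat \<Rightarrow> complex"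
  assumes a: "a = 1 \<or> a = -1" and "\<And>i j. i < m \<Longrightarrow> j < m \<Longrightarrow> b i a = b j a \<Longrightarrow> t i = t j"
    and "\<And>j. j < m \<Longrightarrow> b j a = 1 \<or> b j a = -1 \<Longrightarrow> t j = 0"
  shows "(\<Sum>j<m. (-1) ^ j * t j) = 0"
  using a
proof
  assume "a = 1"
  have "(\<Sum>j<m. (-1) ^ j * t j) = (if odd m then t (m - 1) else 0)"
    by (rule sum_at_1) (use assms(2) \<open>a = 1\<close> in blast)
  moreover have "t (m - 1) = 0" if "odd m"
    using assms(3)[of "m - 1"] b_last_1[OF that] m2 \<open>a = 1\<close> by simp
  ultimately show ?thesis by simp
next
  assume "a = -1"
  have "(\<Sum>j<m. (-1) ^ j * t j) = t 0 - (if even m then t (m - 1) else 0)"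
    by (rule sum_at_m1) (use assms(2) \<open>a = -1\<close> in blast)
  moreover have "t (m - 1) = 0" if "even m"
    using assms(3)[of "m - 1"] b_last_m1[OF that] m2 \<open>a = -1\<close> by simp
  moreover have "t 0 = 0"
    using assms(3)[of 0] b_first_m1 m2 \<open>a = -1\<close> by simp
  ultimately show ?thesis by simp
qed

text \<open>By the chain rule the \<open>n\<close>-th power of the multiplier is the derivative of
  the \<open>n\<close>-fold word at the fixed point, hence at most \<open>C * q ^ n\<close> in
  modulus; this cannot stay above \<open>1\<close>.\<close>

lemma fixed_point_contracts:
  assumes j: "j < m" and a: "a \<in> seg" "b j a = a"
  shows "norm (deriv (b j) a) < 1"
proof (rule ccontr)
  assume "\<not> ?thesis"
  then have ge: "norm (deriv (b j) a) \<ge> 1" by simp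
  have aU: "a \<in> U" "a \<in> nbhd r" using a seg_U seg_subset_nbhd[OF r0] by auto
  have fix_pt: "bw (replicate n j) a = a" for n by (induction n) (auto simp: a)
  have "deriv (bw (replicate n j)) a = deriv (b j) a ^ n" for n
  proof (induction n)
    case (Suc n)
    have "deriv (bw (j # replicate n j)) a = deriv (b j) (bw (replicate n j) a) * deriv (bw (replicate n j)) a"
      by (rule deriv_bw_Cons[OF _ aU(1)]) (use j in auto)
    then show ?case by (simp only: replicate_Suc fix_pt Suc power_Suc)
  qed simp
  moreover have "set (replicate n j) \<subseteq> {..<m}" for n using j by (cases n) auto
  ultimately have "norm (deriv (b j) a) ^ n \<le> C * q ^ n" for n
    using contr[OF _ aU(2), of "replicate n j"] by (simp add: norm_power)
  then have "1 \<le> C * q ^ n" for n using one_le_power[OF ge, of n] order_trans by blast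
  moreover have "(\<lambda>i. C * q ^ i) \<longlonglongrightarrow> C * 0"
    using q by (intro tendsto_intros LIMSEQ_realpow_zero) auto
  ultimately have "1 \<le> C * 0" by (intro LIMSEQ_le_const) auto
  then show False by simp
qed

text \<open>Differentiating \<open>L h = h\<close> at an end gives an alternating sum in which
  paired branches cancel and second derivatives of the unpaired ones vanish. What remains multiplies
  the derivative of \<open>h\<close> at an end by a squared multiplier, which is not
  \<open>1\<close>. The point \<open>1\<close> comes first, because for even \<open>m\<close> the
  equation at \<open>-1\<close> also contains the derivative of \<open>h\<close> at
  \<open>1\<close>.\<close>

lemma h_deriv_ends: "deriv h 1 = 0" "deriv h (-1) = 0"
proof -
  define T where "T a j = deriv (deriv (b j)) a * h (b j a) + deriv (b j) a ^ 2 * deriv h (b j a)" for a j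
  have hd: "deriv h a = (\<Sum>j<m. (-1) ^ j * T a j)" if a: "a = 1 \<or> a = -1" for a
  proof -
    have as: "a \<in> seg" using a by auto
    have aU: "a \<in> U" using as seg_U by auto
    have an: "a \<in> nbhd rh" using as seg_subset_nbhd[OF rh] by auto
    have "(L h has_field_derivative (\<Sum>j<m. (-1) ^ j * T a j)) (at a)"
      unfolding L_def[abs_def]
    proof (rule DERIV_sum)
      fix j assume "j \<in> {..<m}"
      then have j: "j < m" by simp
      have "b j a \<in> nbhd rh" using b_seg[OF j as] seg_subset_nbhd[OF rh] by auto
      then have "(h has_field_derivative deriv h (b j a)) (at (b j a))"
        using h_hol by (metis holomorphic_derivI open_nbhd)
      from DERIV_chain2[OF this b_has_deriv[OF j aU]]
      have 1: "((\<lambda>z. h (b j z)) has_field_derivative deriv h (b j a) * deriv (b j) a) (at a)" .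
      have 2: "(deriv (b j) has_field_derivative deriv (deriv (b j)) a) (at a)"
        using holomorphic_deriv[OF b_hol[OF j] U_open] U_open aU by (metis holomorphic_derivI)
      have "((\<lambda>z. (-1) ^ j * (deriv (b j) z * h (b j z))) has_field_derivative
          (-1) ^ j * (deriv (deriv (b j)) a * h (b j a) + deriv h (b j a) * deriv (b j) a * deriv (b j) a)) (at a)"
        by (rule DERIV_cmult[OF DERIV_mult[OF 2 1]])
      then show "((\<lambda>z. (-1) ^ j * deriv (b j) z * h (b j z)) has_field_derivative (-1) ^ j * T a j) (at a)"
        by (simp add: T_def power2_eq_square mult_ac)
    qed
    then have "(h has_field_derivative (\<Sum>j<m. (-1) ^ j * T a j)) (at a)"
      by (rule has_field_derivative_transform_within_open[OF _ open_nbhd an]) (rule h_fix)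
    then show ?thesis by (rule DERIV_imp_deriv)
  qed
  have T_pair: "T a i = T a j" if "a = 1 \<or> a = -1" "i < m" "j < m" "b i a = b j a" for a i j
    using b_pair[OF that] that by (simp add: T_def)
  have sq: "deriv (b j) a ^ 2 \<noteq> 1" if "j < m" "a \<in> seg" "b j a = a" for j a
  proof
    assume "deriv (b j) a ^ 2 = 1"
    then have "norm (deriv (b j) a) ^ 2 = 1" by (metis norm_one norm_power)
    moreover have "norm (deriv (b j) a) ^ 2 < 1 ^ 2"
      using fixed_point_contracts[OF that] by (intro power_strict_mono) auto
    ultimately show False by simp
  qed
  have hd1: "deriv h 1 = (if odd m then T 1 (m - 1) else 0)"
    unfolding hd[OF disjI1[OF refl]] by (rule sum_at_1) (rule T_pair[OF disjI1[OF refl]])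
  have hdm1: "deriv h (-1) = T (-1) 0 - (if even m then T (-1) (m - 1) else 0)"
    unfolding hd[OF disjI2[OF refl]] by (rule sum_at_m1) (rule T_pair[OF disjI2[OF refl]])
  show h1: "deriv h 1 = 0"
  proof (cases "odd m")
    case True
    have m1: "m - 1 < m" using m2 by simp
    have "deriv h 1 = T 1 (m - 1)"
      using hd1 True by simp
    also have "\<dots> = deriv (b (m - 1)) 1 ^ 2 * deriv h 1"
      using b_end2[of 1 "m - 1"] m1 b_last_1[OF True] by (simp add: T_def)
    finally have "(1 - deriv (b (m - 1)) 1 ^ 2) * deriv h 1 = 0" by (simp add: left_diff_distrib)
    then show ?thesis using sq[of "m - 1" 1] m1 b_last_1[OF True] by auto
  next
    case False
    then show ?thesis using hd1 by simp
  qed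
  have m0: "0 < m" using m2 by simp
  note hdm1
  also have "(if even m then T (-1) (m - 1) else 0) = 0"
    using b_end2[of "-1" "m - 1"] m2 b_last_m1 h1 by (auto simp: T_def)
  also have "T (-1) 0 = deriv (b 0) (-1) ^ 2 * deriv h (-1)"
    using b_end2[of "-1" 0] m0 b_first_m1 by (simp add: T_def)
  finally have "(1 - deriv (b 0) (-1) ^ 2) * deriv h (-1) = 0" by (simp add: left_diff_distrib)
  then show "deriv h (-1) = 0" using sq[of 0 "-1"] m0 b_first_m1 by auto
qed

text \<open>A simple pole at \<open>s\<close> whose constant term vanishes, as does its value at the other end point.\<close>

definition pol :: "complex \<Rightarrow> complex \<Rightarrow> complex" where
  "pol s y = 1 / (y - s) - (y - s) / 4"

text \<open>The residue at \<open>a\<close> of \<open>M (pol s)\<close>: a branch that maps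
  \<open>a\<close> to \<open>s\<close> turns the pole of \<open>pol s\<close> into one of residue
  \<open>1 / deriv (b j) a\<close>.\<close>

definition res :: "complex \<Rightarrow> complex \<Rightarrow> complex" where
  "res s a = (\<Sum>j<m. if b j a = s then (-1) ^ j / deriv (b j) a else 0)"

text \<open>The weights carry no Jacobian, since the one from the change of variables is absorbed by
  the chain rule in \<open>gn_recursion\<close>. For holomorphic \<open>\<phi>\<close>, the
  derivative of \<open>M \<phi>\<close> is \<open>L\<close> applied to the derivative of
  \<open>\<phi>\<close>.\<close>

definition M :: "(complex \<Rightarrow> complex) \<Rightarrow> complex \<Rightarrow> complex" where
  "M \<phi> z = (\<Sum>j<m. (-1) ^ j * \<phi> (b j z))"

lemma pol_same_tendsto: "((\<lambda>y. c / (y - a) - c * pol a y) \<longlongrightarrow> 0) (at a)"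
proof -
  have "(\<lambda>y. c / (y - a) - c * pol a y) = (\<lambda>y. c * ((y - a) / 4))"
    by (rule ext) (simp add: pol_def algebra_simps)
  moreover have "((\<lambda>y. c * ((y - a) / 4)) \<longlongrightarrow> c * ((a - a) / 4)) (at a)" by (intro tendsto_intros) simp
  ultimately show ?thesis by simp
qed

lemma pol_other_tendsto: "a = 1 \<or> a = -1 \<Longrightarrow> (pol (- a) \<longlongrightarrow> 0) (at a)"
proof -
  assume a: "a = 1 \<or> a = -1"
  have "((\<lambda>y. 1 / (y - - a) - (y - - a) / 4) \<longlongrightarrow> 1 / (a - - a) - (a - - a) / 4) (at a)"
    using a by (intro tendsto_intros) auto
  then show ?thesis using a by (auto simp: pol_def[abs_def])
qed

lemma \<beta>_interior:
  assumes j: "j < m" and x: "-1 < x" "x < 1"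
  shows "-1 < \<beta> j x" "\<beta> j x < 1"
proof -
  have less: "(-1) ^ j * \<beta> j u < (-1) ^ j * \<beta> j v" if "-1 \<le> u" "u < v" "v \<le> 1" for u v
  proof (rule DERIV_pos_imp_increasing[OF that(2), of "\<lambda>x. (-1) ^ j * \<beta> j x"])
    fix y assume "u \<le> y" "y \<le> v"
    then have y: "y \<in> {-1..1}" using that by auto
    show "\<exists>D. ((\<lambda>x. (-1) ^ j * \<beta> j x) has_real_derivative D) (at y) \<and> 0 < D"
      using DERIV_cmult[OF \<beta>_has_deriv[OF j y], of "(-1) ^ j"] Re_deriv_b_sign[OF j y] by blast
  qed
  have rng: "\<beta> j (-1) \<in> {-1..1}" "\<beta> j 1 \<in> {-1..1}" using \<beta>_range[OF j] by auto
  have "(-1) ^ j * \<beta> j (-1) < (-1) ^ j * \<beta> j x" "(-1) ^ j * \<beta> j x < (-1) ^ j * \<beta> j 1"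
    using x by (intro less; simp)+
  then show "-1 < \<beta> j x" "\<beta> j x < 1" using rng by (cases "even j"; auto)+
qed

lemma norm_b_interior:
  assumes j: "j < m" and x: "-1 < x" "x < 1"
  shows "norm (b j (of_real x)) < 1"
proof -
  have "b j (of_real x) = of_real (\<beta> j x)" using of_real_\<beta>[OF j, of x] x by simp
  then show ?thesis using \<beta>_interior[OF j x] by (simp add: abs_less_iff)
qed

text \<open>Near \<open>seg\<close> the zeros of \<open>b j - s\<close> lie on \<open>seg\<close>,
  and strict monotonicity excludes its interior. Hence \<open>M (pol s)\<close> has no singularities
  near \<open>seg\<close> other than \<open>1\<close> and \<open>-1\<close>.\<close>

lemma b_avoids_ends:
  obtains t where "t > 0" "nbhd t \<subseteq> U"
    "\<And>j z s. j < m \<Longrightarrow> z \<in> nbhd t - {1, -1} \<Longrightarrow> s = 1 \<or> s = -1 \<Longrightarrow> b j z \<noteq> s"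
proof -
  define P where "P = (\<lambda>(j, s) t. \<forall>z\<in>nbhd t. b j z = s \<longrightarrow> z \<in> seg)"
  have "\<exists>t>0. \<forall>js\<in>{..<m} \<times> {1, -1::complex}. P js t"
  proof (rule finite_common_radius)
    fix js assume "js \<in> {..<m} \<times> {1, -1::complex}"
    then obtain j s where js: "js = (j, s)" "j < m" "s = 1 \<or> s = -1" by auto
    have "(\<lambda>z. b j z - s) holomorphic_on nbhd r"
      by (intro holomorphic_intros holomorphic_on_subset[OF b_hol[OF js(2)] r_U])
    moreover have "0 \<in> nbhd r" using seg_subset_nbhd[OF r0] by auto
    moreover have "b j 0 - s \<noteq> 0"
      using norm_b_interior[OF js(2), of 0] js(3) by auto
    ultimately obtain t where "0 < t" "\<And>z. z \<in> nbhd t \<Longrightarrow> b j z - s = 0 \<Longrightarrow> z \<in> seg"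
      using zeros_near_seg[of "\<lambda>z. b j z - s" r 0] r0 by metis
    then show "\<exists>t>0. P js t" by (auto simp: P_def js)
  next
    show "P js s'" if "P js t" "0 < s'" "s' \<le> t" for js t s'
      using that nbhd_mono[of s' t] by (auto simp: P_def)
  qed auto
  then obtain t where t: "t > 0" "\<And>j s z. j < m \<Longrightarrow> s = 1 \<or> s = -1 \<Longrightarrow> z \<in> nbhd t \<Longrightarrow> b j z = s \<Longrightarrow> z \<in> seg"
    unfolding P_def by fastforce
  show ?thesis
  proof (rule that[of "min t r"])
    show "min t r > 0" using t r0 by simp
    show "nbhd (min t r) \<subseteq> U" using nbhd_mono[of "min t r" r] r_U by auto
    fix j z s assume j: "j < m" and z: "z \<in> nbhd (min t r) - {1, -1}" and s: "s = 1 \<or> s = (-1::complex)"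
    show "b j z \<noteq> s"
    proof
      assume eq: "b j z = s"
      then have "z \<in> seg" using t(2)[OF j s _ eq] z nbhd_mono[of "min t r" t] by auto
      then obtain x where x: "x \<in> {-1..1}" "z = of_real x" by (auto simp: seg_def)
      then have "-1 < x" "x < 1" using z by (cases "x = 1 \<or> x = -1"; auto)+
      from norm_b_interior[OF j this] eq s x(2) show False by auto
    qed
  qed
qed

text \<open>At an end \<open>a\<close> each branch with value \<open>s\<close> gives a simple pole
  without constant term, as its second derivative vanishes. The finite contributions of the other
  branches cancel in pairs or are \<open>0\<close> by the choice of \<open>pol\<close>, so after
  removal of the polar parts the value at \<open>a\<close> is \<open>0\<close>.\<close>

lemma M_pol:
  assumes s: "s = 1 \<or> s = -1"
  obtains e where "e analytic_on seg" "e 1 = 0" "e (-1) = 0"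
    "\<And>z. z \<noteq> 1 \<Longrightarrow> z \<noteq> -1 \<Longrightarrow> M (pol s) z = res s 1 * pol 1 z + res s (-1) * pol (-1) z + e z"
proof -
  obtain t where t: "t > 0" "nbhd t \<subseteq> U"
    "\<And>j z s. j < m \<Longrightarrow> z \<in> nbhd t - {1, -1} \<Longrightarrow> s = 1 \<or> s = -1 \<Longrightarrow> b j z \<noteq> s"
    by (rule b_avoids_ends) metis
  define u where "u z = M (pol s) z - res s 1 * pol 1 z - res s (-1) * pol (-1) z" for z
  define e where "e z = (if z = 1 \<or> z = -1 then 0 else u z)" for z
  have "(\<lambda>z. if z = 1 \<or> z = -1 then 0 else u z) analytic_on seg"
  proof (rule analytic_on_seg_remove_ends[OF t(1)])
    have bh: "b j holomorphic_on nbhd t - {1, -1}" if "j < m" for j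
      using holomorphic_on_subset[OF b_hol[OF that], of "nbhd t - {1, -1}"] t(2) by blast
    have "(\<lambda>z. pol s (b j z)) holomorphic_on nbhd t - {1, -1}" if j: "j < m" for j
      unfolding pol_def using t(3)[OF j _ s] by (intro holomorphic_intros bh j) auto
    moreover have "pol a holomorphic_on nbhd t - {1, -1}" if "a = 1 \<or> a = -1" for a
      unfolding pol_def[abs_def] using that by (intro holomorphic_intros) auto
    ultimately show "u holomorphic_on nbhd t - {1, -1}"
      unfolding u_def[abs_def] M_def[abs_def] by (intro holomorphic_intros) auto
    fix a :: complex assume a: "a = 1 \<or> a = -1"
    \<comment> \<open>The finite part of \<open>pol s\<close>: at \<open>s\<close> the Laurent
      expansion has no constant term, and at the opposite end the summand
      \<open>- (y - s) / 4\<close> compensates the value of \<open>1 / (y - s)\<close>.\<close>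
    define E where "E z = (if z = 1 \<or> z = -1 then 0 else pol s z)" for z
    have as: "a \<in> seg" using a by auto
    have aU: "a \<in> U" using as seg_U by auto
    have term_lim: "((\<lambda>y. pol s (b j y) - (if b j a = s then (1 / deriv (b j) a) / (y - a) else 0)) \<longlongrightarrow> E (b j a)) (at a)"
      if j: "j < m" for j
    proof (cases "b j a = s")
      case True
      have "((\<lambda>y. 1 / (b j y - s) - (1 / deriv (\<lambda>y. b j y - s) a) / (y - a)) \<longlongrightarrow> 0) (at a)"
      proof (rule polar_remainder_tendsto_0[OF U_open aU, of "\<lambda>_. 1" "\<lambda>y. b j y - s"])
        have d1: "deriv (\<lambda>y. b j y - s) z = deriv (b j) z" if "z \<in> U" for z
          using b_has_deriv[OF j that] by (intro DERIV_imp_deriv) (auto intro!: derivative_eq_intros)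
        show "(\<lambda>y. b j y - s) holomorphic_on U" by (intro holomorphic_intros b_hol j)
        show "deriv (\<lambda>y. b j y - s) a \<noteq> 0"
          unfolding d1[OF aU] using as b_deriv[OF j] by (auto simp: seg_def)
        have "deriv (deriv (\<lambda>y. b j y - s)) a = deriv (deriv (b j)) a"
          by (rule deriv_cong_ev) (use eventually_nhds_in_open[OF U_open aU] d1 in \<open>auto elim: eventually_mono\<close>)
        also have "\<dots> = 0" using b_end2[OF a j] True s by auto
        finally show "deriv (deriv (\<lambda>y. b j y - s)) a = 0" .
      qed (use True in auto)
      moreover have "deriv (\<lambda>y. b j y - s) a = deriv (b j) a"
        using b_has_deriv[OF j aU] by (intro DERIV_imp_deriv) (auto intro!: derivative_eq_intros)
      moreover have "((\<lambda>y. (b j y - s) / 4) \<longlongrightarrow> (b j a - s) / 4) (at a)"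
        using DERIV_isCont[OF b_has_deriv[OF j aU]] by (intro tendsto_intros) (auto simp: isCont_def)
      ultimately have "((\<lambda>y. (1 / (b j y - s) - (1 / deriv (b j) a) / (y - a)) - (b j y - s) / 4) \<longlongrightarrow> 0 - (b j a - s) / 4) (at a)"
        by (intro tendsto_diff) auto
      then show ?thesis using True s by (simp add: pol_def E_def algebra_simps)
    next
      case False
      have "((\<lambda>y. 1 / (b j y - s) - (b j y - s) / 4) \<longlongrightarrow> 1 / (b j a - s) - (b j a - s) / 4) (at a)"
        using DERIV_isCont[OF b_has_deriv[OF j aU]] False by (intro tendsto_intros) (auto simp: isCont_def)
      moreover have "1 / (b j a - s) - (b j a - s) / 4 = E (b j a)"
        using False s by (auto simp: E_def pol_def)
      ultimately show ?thesis using False by (simp add: pol_def)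
    qed
    have sum_lim: "((\<lambda>y. \<Sum>j<m. (-1) ^ j * (pol s (b j y) - (if b j a = s then (1 / deriv (b j) a) / (y - a) else 0)))
        \<longlongrightarrow> (\<Sum>j<m. (-1) ^ j * E (b j a))) (at a)"
      by (intro tendsto_sum tendsto_mult_left term_lim) simp
    have "(\<Sum>j<m. (-1) ^ j * E (b j a)) = 0"
      by (rule sum_ends_eq_0[OF a]) (auto simp: E_def)
    moreover have "(\<Sum>j<m. (-1) ^ j * (pol s (b j y) - (if b j a = s then (1 / deriv (b j) a) / (y - a) else 0))) =
        M (pol s) y - res s a / (y - a)" for y
      unfolding M_def res_def right_diff_distrib sum_subtractf sum_divide_distrib
      by (intro arg_cong2[where f = "(-)"] refl sum.cong) auto
    ultimately have l1: "((\<lambda>y. M (pol s) y - res s a / (y - a)) \<longlongrightarrow> 0) (at a)" using sum_lim by simp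
    have "((\<lambda>y. (M (pol s) y - res s a / (y - a)) + (res s a / (y - a) - res s a * pol a y) - res s (- a) * pol (- a) y) \<longlongrightarrow> 0 + 0 - res s (- a) * 0) (at a)"
      by (intro tendsto_intros l1 pol_same_tendsto pol_other_tendsto a)
    moreover have "(\<lambda>y. (M (pol s) y - res s a / (y - a)) + (res s a / (y - a) - res s a * pol a y) - res s (- a) * pol (- a) y) = u"
      using a by (auto simp: u_def)
    ultimately show "(u \<longlongrightarrow> 0) (at a)" by simp
  qed
  then show ?thesis using that[of e] by (auto simp: e_def[abs_def] u_def)
qed

text \<open>All branches map \<open>1\<close> to some \<open>d k\<close> with
  \<open>k \<ge> 1\<close>, hence to a point above \<open>-1\<close>. This makes the matrix of
  residues triangular.\<close>

lemma res_m1_1: "res (-1) 1 = 0"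
  unfolding res_def
proof (intro sum.neutral ballI)
  fix j assume "j \<in> {..<m}"
  then have j: "j < m" by simp
  have "b j 1 \<noteq> -1"
  proof
    assume "b j 1 = -1"
    then have "complex_of_real (if even j then d (Suc j) else d j) = of_real (-1)"
      using b_at_1[OF j] by simp
    then have "(if even j then d (Suc j) else d j) = -1" by (simp only: of_real_eq_iff)
    moreover have "-1 < d (Suc j)" using d_less[OF j] d_range[of j] j by auto
    moreover have "-1 < d j" if "odd j"
    proof -
      have "0 < j" using that by (rule odd_pos)
      then have "d 0 < d 1" "d 1 \<le> d j" using d_less[of 0] d_mono[of 1 j] j by auto
      then show ?thesis using d_0 by simp
    qed
    ultimately show False by (auto split: if_splits)
  qed
  then show "(if b j 1 = -1 then (-1) ^ j / deriv (b j) 1 else 0) = 0" by simp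
qed

text \<open>Only the last branch can fix \<open>1\<close> and only the first one can fix
  \<open>-1\<close>, so a diagonal residue consists of at most one term.\<close>

lemma fixed_end_unique:
  assumes s: "s = 1 \<or> s = -1" and j: "j < m" "b j s = s" and i: "i < m" "b i s = s"
  shows "i = j"
proof -
  have last: "k = m - 1" if k: "k < m" "b k 1 = 1" for k
  proof (rule ccontr)
    assume "k \<noteq> m - 1"
    then have "d (Suc k) < d (Suc (Suc k))" "d (Suc (Suc k)) \<le> 1" "d k < d (Suc k)"
      using k d_less[of "Suc k"] d_less[of k] d_range[of "Suc (Suc k)"] by auto
    moreover have "complex_of_real (if even k then d (Suc k) else d k) = of_real 1"
      using b_at_1[OF k(1)] k(2) by simp
    then have "(if even k then d (Suc k) else d k) = 1" by (simp only: of_real_eq_iff)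
    ultimately show False by (auto split: if_splits)
  qed
  have first: "k = 0" if k: "k < m" "b k (-1) = -1" for k
  proof (rule ccontr)
    assume "k \<noteq> 0"
    then have "d 0 < d 1" "d 1 \<le> d k" "d k < d (Suc k)"
      using k d_less[of 0] d_less[of k] d_mono[of 1 k] by auto
    moreover have "complex_of_real (if even k then d k else d (Suc k)) = of_real (-1)"
      using b_at_m1[OF k(1)] k(2) by simp
    then have "(if even k then d k else d (Suc k)) = -1" by (simp only: of_real_eq_iff)
    ultimately show False using d_0 by (auto split: if_splits)
  qed
  show ?thesis using s
  proof
    assume "s = 1"
    then show ?thesis using last[of i] last[of j] i j by simp
  next
    assume "s = -1"
    then show ?thesis using first[of i] first[of j] i j by simp
  qed
qed

text \<open>The entry is \<open>0\<close> if no branch fixes the end; otherwise it is, up to sign,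
  the reciprocal of a contracting multiplier and has modulus greater than \<open>1\<close>.\<close>

lemma res_diag_neq_1:
  assumes s: "s = 1 \<or> s = -1"
  shows "res s s \<noteq> 1"
proof (cases "\<exists>j<m. b j s = s")
  case False
  then have "res s s = 0" unfolding res_def by (intro sum.neutral) auto
  then show ?thesis by simp
next
  case True
  then obtain j where j: "j < m" "b j s = s" by blast
  have ss: "s \<in> seg" using s by auto
  have "res s s = (\<Sum>i<m. if i = j then (-1) ^ j / deriv (b j) s else 0)"
    unfolding res_def
  proof (intro sum.cong refl)
    fix i assume "i \<in> {..<m}"
    then have "b i s = s \<longleftrightarrow> i = j" using fixed_end_unique[OF s j, of i] j by blast
    then show "(if b i s = s then (-1) ^ i / deriv (b i) s else 0) = (if i = j then (-1) ^ j / deriv (b j) s else 0)"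
      by presburger
  qed
  also have "\<dots> = (-1) ^ j / deriv (b j) s" using j by simp
  finally have "norm (res s s) = 1 / norm (deriv (b j) s)" by (simp add: norm_divide norm_power)
  moreover have "deriv (b j) s \<noteq> 0" using b_deriv[OF j(1)] ss by (auto simp: seg_def)
  then have "0 < norm (deriv (b j) s)" by simp
  moreover have "norm (deriv (b j) s) < 1" by (rule fixed_point_contracts[OF j(1) ss j(2)])
  ultimately have "norm (res s s) > 1" by (simp add: less_divide_eq)
  then show ?thesis by auto
qed

end

subsection \<open>The susceptibility function\<close>

context endpoint_map
begin

text \<open>With \<open>A'\<close> the derivative of \<open>A\<close>, this is the derivative of
  \<open>A \<circ> f ^^ n\<close>, the chain rule being unfolded from the innermost factor as in
  \<open>f ^^ Suc n = f ^^ n \<circ> f\<close>.\<close>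

primrec Dn :: "(real \<Rightarrow> real) \<Rightarrow> nat \<Rightarrow> real \<Rightarrow> real" where
  "Dn A' 0 x = A' x"
| "Dn A' (Suc n) x = Dn A' n (f x) * f' x"

text \<open>Likewise the derivative of \<open>A \<circ> f ^^ n \<circ> \<theta>\<close>.\<close>

definition gn :: "(real \<Rightarrow> real) \<Rightarrow> nat \<Rightarrow> real \<Rightarrow> real" where
  "gn A' n y = Dn A' n (\<theta> y) * \<theta>' y"

definition cn :: "(real \<Rightarrow> real) \<Rightarrow> (complex \<Rightarrow> complex) \<Rightarrow> nat \<Rightarrow> complex" where
  "cn A' \<phi> n = (\<integral>y. \<phi> (of_real y) * of_real (gn A' n y) \<partial>LI)"

text \<open>The factor \<open>\<theta>'\<close> contained in \<open>gn\<close> vanishes at both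
  ends. Requiring a bound only after multiplication by it admits simple poles there and still makes
  the integrals \<open>cn\<close> converge.\<close>

definition admissible :: "(complex \<Rightarrow> complex) \<Rightarrow> bool" where
  "admissible \<phi> \<longleftrightarrow> (\<lambda>y. \<phi> (complex_of_real y)) \<in> borel_measurable LI \<and>
     (\<exists>K. \<forall>y\<in>{-1..1}. norm (\<phi> (of_real y)) * \<theta>' y \<le> K)"

lemma deriv_\<omega>_lipschitz:
  obtains K where "K \<ge> 0" "\<And>x y. x \<in> {-1..1} \<Longrightarrow> y \<in> {-1..1} \<Longrightarrow>
    norm (deriv \<omega> (of_real x) - deriv \<omega> (of_real y)) \<le> K * \<bar>x - y\<bar>"
proof -
  have "deriv (deriv \<omega>) analytic_on seg"
    using \<omega>_hol W0 analytic_on_holomorphic holomorphic_deriv by meson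
  then obtain t K where t: "t > 0" "deriv (deriv \<omega>) holomorphic_on nbhd t" "\<And>z. z \<in> nbhd t \<Longrightarrow> norm (deriv (deriv \<omega>) z) \<le> K"
    by (rule analytic_on_seg_bounded) metis
  have K: "K \<ge> 0" using t(3)[of 0] seg_subset_nbhd[OF t(1)] norm_ge_zero order_trans by (metis one_in_seg(3) subsetD)
  have "norm (deriv \<omega> u - deriv \<omega> v) \<le> K * norm (u - v)" if "u \<in> seg" "v \<in> seg" for u v
  proof (rule field_differentiable_bound[OF convex_seg])
    show "(deriv \<omega> has_field_derivative deriv (deriv \<omega>) z) (at z within seg)" if "z \<in> seg" for z
      using holomorphic_derivI[OF holomorphic_deriv[OF \<omega>_hol W0(1)] W0(1)] W0(2) that has_field_derivative_at_within by blast
    show "norm (deriv (deriv \<omega>) z) \<le> K" if "z \<in> seg" for z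
      using t(3) seg_subset_nbhd[OF t(1)] that by auto
  qed (use that in auto)
  then have "norm (deriv \<omega> (of_real x) - deriv \<omega> (of_real y)) \<le> K * \<bar>x - y\<bar>"
    if "x \<in> {-1..1}" "y \<in> {-1..1}" for x y
    using that by (metis norm_of_real of_real_diff of_real_in_seg_iff)
  with K show ?thesis using that by blast
qed

lemma admissible_analytic:
  assumes "\<phi> analytic_on seg"
  shows "admissible \<phi>"
proof -
  have c: "continuous_on {-1..1} (\<lambda>y. \<phi> (complex_of_real y))"
    using assms analytic_imp_holomorphic holomorphic_on_imp_continuous_on cont_of_real by blast
  have "compact ((\<lambda>y. norm (\<phi> (complex_of_real y)) * \<theta>' y) ` {-1..1})"
    by (intro compact_continuous_image continuous_intros c \<theta>'_cont) auto
  then obtain K where "\<forall>v\<in>(\<lambda>y. norm (\<phi> (complex_of_real y)) * \<theta>' y) ` {-1..1}. norm v \<le> K"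
    using compact_imp_bounded bounded_iff by blast
  then have "\<forall>y\<in>{-1..1}. norm (\<phi> (complex_of_real y)) * \<theta>' y \<le> K" by (auto simp: abs_le_iff)
  then show ?thesis unfolding admissible_def using continuous_imp_measurable_LI[OF c] by blast
qed

text \<open>As \<open>deriv \<omega>\<close> vanishes at \<open>s\<close> and is Lipschitz,
  \<open>\<theta>' y \<le> K * \<bar>y - \<sigma>\<bar>\<close>, which compensates the pole. The
  constant is \<open>2 * K\<close> because
  \<open>1 + \<bar>y - \<sigma>\<bar>\<^sup>2 / 4 \<le> 2\<close> on the interval.\<close>

lemma admissible_pol:
  assumes s: "s = 1 \<or> s = -1"
  shows "admissible (pol s)"
proof -
  obtain K where K: "K \<ge> 0" "\<And>x y. x \<in> {-1..1} \<Longrightarrow> y \<in> {-1..1} \<Longrightarrow>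
    norm (deriv \<omega> (of_real x) - deriv \<omega> (of_real y)) \<le> K * \<bar>x - y\<bar>"
    by (rule deriv_\<omega>_lipschitz) metis
  obtain \<sigma> where \<sigma>: "s = of_real \<sigma>" "\<sigma> \<in> {-1..1}" "deriv \<omega> (of_real \<sigma>) = 0"
  proof (cases "s = 1")
    case True
    then show ?thesis using that[of 1] \<omega>_deriv_ends by simp
  next
    case False
    then show ?thesis using that[of "-1"] s \<omega>_deriv_ends by simp
  qed
  have "norm (pol s (of_real y)) * \<theta>' y \<le> 2 * K" if y: "y \<in> {-1..1}" for y
  proof (cases "y = \<sigma>")
    case True
    then have "\<theta>' y = 0" using \<sigma> by (simp add: \<theta>'_def)
    then show ?thesis using K by simp
  next
    case False
    have d: "\<bar>y - \<sigma>\<bar> > 0" "\<bar>y - \<sigma>\<bar> \<le> 2" using False y \<sigma> by auto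
    have "\<theta>' y \<le> norm (deriv \<omega> (of_real y))" unfolding \<theta>'_def by (rule complex_Re_le_cmod)
    also have "\<dots> \<le> K * \<bar>y - \<sigma>\<bar>" using K(2)[OF y \<sigma>(2)] \<sigma>(3) by simp
    finally have 1: "\<theta>' y \<le> K * \<bar>y - \<sigma>\<bar>" .
    have "norm (pol s (of_real y)) \<le> norm (1 / (of_real y - s)) + norm ((of_real y - s) / 4)"
      unfolding pol_def by (rule norm_triangle_ineq4)
    also have "\<dots> = 1 / \<bar>y - \<sigma>\<bar> + \<bar>y - \<sigma>\<bar> / 4"
      unfolding \<sigma>(1) of_real_diff[symmetric] norm_divide norm_of_real by simp
    finally have "norm (pol s (of_real y)) * \<theta>' y \<le> (1 / \<bar>y - \<sigma>\<bar> + \<bar>y - \<sigma>\<bar> / 4) * (K * \<bar>y - \<sigma>\<bar>)"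
      using 1 \<theta>'_nonneg[OF y] d by (intro mult_mono) auto
    also have "\<dots> = K * (1 + \<bar>y - \<sigma>\<bar> * \<bar>y - \<sigma>\<bar> / 4)" using d by (simp add: field_simps)
    also have "\<dots> \<le> K * (1 + 2 * 2 / 4)"
      using d K by (intro mult_left_mono add_left_mono divide_right_mono mult_mono) auto
    finally show ?thesis by simp
  qed
  moreover have "(\<lambda>y. pol s (complex_of_real y)) \<in> borel_measurable LI"
  proof -
    have [measurable]: "complex_of_real \<in> borel_measurable LI"
      by (intro continuous_imp_measurable_LI continuous_intros)
    show ?thesis unfolding pol_def by measurable
  qed
  ultimately show ?thesis unfolding admissible_def by blast
qed

section \<open>Coefficients of the susceptibility in the conjugated coordinate\<close>

context
  fixes A A' :: "real \<Rightarrow> real"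
  assumes A: "\<And>x. x \<in> {-1..1} \<Longrightarrow> (A has_real_derivative A' x) (at x within {-1..1})"
    and A'_cont: "continuous_on {-1..1} A'"
begin

lemma Dn_cont: "continuous_on {-1..1} (Dn A' n)"
proof (induction n)
  case (Suc n)
  show ?case unfolding Dn.simps[abs_def]
    by (intro continuous_intros continuous_on_compose2[OF Suc f_cont] f'_cont) (use f_maps in auto)
qed (use A'_cont in simp)

lemma A_fn_deriv:
  "x \<in> {-1..1} \<Longrightarrow> ((\<lambda>y. A ((f ^^ n) y)) has_real_derivative Dn A' n x) (at x within {-1..1})"
proof (induction n arbitrary: x)
  case (Suc n)
  have "f ` {-1..1} \<subseteq> {-1..1}" using f_maps by blast
  then have "((\<lambda>y. A ((f ^^ n) y)) has_real_derivative Dn A' n (f x)) (at (f x) within f ` {-1..1})"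
    by (rule has_field_derivative_subset[OF Suc.IH[OF f_maps[OF Suc.prems]]])
  from DERIV_image_chain[OF this f_has_deriv[OF Suc.prems]]
  show ?case by (simp only: o_def funpow_Suc_right Dn.simps)
qed (use A in simp)

lemma interval_deriv_A_fn:
  "x \<in> {-1..1} \<Longrightarrow> interval_deriv (\<lambda>y. A ((f ^^ n) y)) x = Dn A' n x"
  unfolding interval_deriv_def using A_fn_deriv
  by (intro vector_derivative_within_closed_interval) (auto simp: has_real_derivative_iff_has_vector_derivative)

lemma A_fn_\<theta>_deriv:
  assumes "y \<in> {-1..1}"
  shows "((\<lambda>y. A ((f ^^ n) (\<theta> y))) has_real_derivative gn A' n y) (at y within {-1..1})"
proof -
  have "\<theta> ` {-1..1} \<subseteq> {-1..1}" using \<theta>_range by blast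
  then have "((\<lambda>y. A ((f ^^ n) y)) has_real_derivative Dn A' n (\<theta> y)) (at (\<theta> y) within \<theta> ` {-1..1})"
    by (rule has_field_derivative_subset[OF A_fn_deriv[OF \<theta>_range[OF assms]]])
  from DERIV_image_chain[OF this has_field_derivative_at_within[OF \<theta>_has_deriv[OF assms]]]
  show ?thesis by (simp add: o_def gn_def)
qed

lemma gn_cont: "continuous_on {-1..1} (gn A' n)"
  unfolding gn_def[abs_def]
  by (intro continuous_intros continuous_on_compose2[OF Dn_cont \<theta>_cont] \<theta>'_cont) (use \<theta>_range in auto)

text \<open>Since \<open>f \<circ> \<theta> \<circ> \<beta> j = \<theta>\<close>, both sides arise
  from the derivative of one function \<open>A \<circ> f ^^ n \<circ> \<theta>\<close>, computed
  directly and through the branch. The sign remains because \<open>jac j\<close> is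
  \<open>(-1) ^ j\<close> times the derivative of \<open>\<beta> j\<close>.\<close>

lemma gn_recursion:
  assumes j: "j < m" and y: "y \<in> {-1..1}"
  shows "jac j y * gn A' (Suc n) (\<beta> j y) = (-1) ^ j * gn A' n y"
proof -
  let ?D = "Re (deriv (b j) (of_real y))"
  have "\<beta> j ` {-1..1} \<subseteq> {-1..1}" using \<beta>_range[OF j] by blast
  then have "((\<lambda>y. A ((f ^^ Suc n) (\<theta> y))) has_real_derivative gn A' (Suc n) (\<beta> j y)) (at (\<beta> j y) within \<beta> j ` {-1..1})"
    by (rule has_field_derivative_subset[OF A_fn_\<theta>_deriv[OF \<beta>_range[OF j y]]])
  from DERIV_image_chain[OF this has_field_derivative_at_within[OF \<beta>_has_deriv[OF j y]]]
  have "((\<lambda>y. A ((f ^^ Suc n) (\<theta> (\<beta> j y)))) has_vector_derivative gn A' (Suc n) (\<beta> j y) * ?D) (at y within {-1..1})"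
    by (simp only: o_def has_real_derivative_iff_has_vector_derivative)
  then have 1: "((\<lambda>y. A ((f ^^ n) (\<theta> y))) has_vector_derivative gn A' (Suc n) (\<beta> j y) * ?D) (at y within {-1..1})"
    by (rule has_vector_derivative_transform[OF y, rotated])
       (simp only: funpow_Suc_right o_apply conj_\<theta>[OF j])
  have 2: "((\<lambda>y. A ((f ^^ n) (\<theta> y))) has_vector_derivative gn A' n y) (at y within {-1..1})"
    using A_fn_\<theta>_deriv[OF y] by (simp only: has_real_derivative_iff_has_vector_derivative)
  have eq: "gn A' (Suc n) (\<beta> j y) * ?D = gn A' n y"
    by (rule vector_derivative_unique_within_closed_interval[of "-1" 1 y, OF _ _ 1[folded box_real] 2[folded box_real]])
       (use y in auto)
  have "jac j y = (-1) ^ j * ?D"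
    using arg_cong[OF signed_deriv_b[OF j y], of Re] by (cases "even j") auto
  then show ?thesis unfolding eq[symmetric] by (simp add: mult_ac)
qed

lemma cn_integrable:
  assumes "admissible \<phi>"
  shows "integrable LI (\<lambda>y. \<phi> (of_real y) * of_real (gn A' n y))"
proof -
  obtain K where meas: "(\<lambda>y. \<phi> (complex_of_real y)) \<in> borel_measurable LI"
    and K: "\<And>y. y \<in> {-1..1} \<Longrightarrow> norm (\<phi> (of_real y)) * \<theta>' y \<le> K"
    using assms unfolding admissible_def by blast
  have "compact (Dn A' n ` {-1..1})" by (intro compact_continuous_image Dn_cont) auto
  then obtain B where B: "\<forall>v\<in>Dn A' n ` {-1..1}. norm v \<le> B"
    using compact_imp_bounded bounded_iff by blast
  have K0: "K \<ge> 0" using K[of 1] \<omega>_deriv_ends by (simp add: \<theta>'_def)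
  show ?thesis
  proof (rule bounded_imp_integrable_LI[of _ "K * B"])
    show "(\<lambda>y. \<phi> (complex_of_real y) * complex_of_real (gn A' n y)) \<in> borel_measurable LI"
      using meas continuous_imp_measurable_LI[OF gn_cont] by measurable
    fix y :: real assume y: "y \<in> {-1..1}"
    have "norm (\<phi> (of_real y) * complex_of_real (gn A' n y)) = (norm (\<phi> (of_real y)) * \<theta>' y) * \<bar>Dn A' n (\<theta> y)\<bar>"
      using \<theta>'_nonneg[OF y] by (simp add: gn_def norm_mult abs_mult)
    also have "\<dots> \<le> K * B"
      using K[OF y] B \<theta>_range[OF y] K0 by (intro mult_mono) (auto simp del: atLeastAtMost_iff)
    finally show "norm (\<phi> (of_real y) * complex_of_real (gn A' n y)) \<le> K * B" .
  qed
qed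

text \<open>Shifts one step of the dynamics from the observable to the density.\<close>

lemma cn_Suc:
  assumes "admissible \<phi>"
  shows "cn A' \<phi> (Suc n) = (\<integral>y. M \<phi> (of_real y) * of_real (gn A' n y) \<partial>LI)"
proof -
  let ?u = "\<lambda>y. \<phi> (of_real y) * complex_of_real (gn A' (Suc n) y)"
  note int = cn_integrable[OF assms, of "Suc n"]
  have "cn A' \<phi> (Suc n) = (\<Sum>j<m. \<integral>y. jac j y *\<^sub>R ?u (\<beta> j y) \<partial>LI)"
    unfolding cn_def by (rule branch_integral(2)[OF int])
  also have "\<dots> = (\<integral>y. (\<Sum>j<m. jac j y *\<^sub>R ?u (\<beta> j y)) \<partial>LI)"
    by (rule Bochner_Integration.integral_sum[symmetric]) (use branch_integral(1)[OF int] in auto)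
  also have "\<dots> = (\<integral>y. M \<phi> (of_real y) * of_real (gn A' n y) \<partial>LI)"
  proof (rule Bochner_Integration.integral_cong[OF refl])
    fix y assume "y \<in> space LI"
    then have y: "y \<in> {-1..1}" by simp
    show "(\<Sum>j<m. jac j y *\<^sub>R ?u (\<beta> j y)) = M \<phi> (of_real y) * of_real (gn A' n y)"
      unfolding M_def sum_distrib_right
    proof (intro sum.cong refl)
      fix j assume "j \<in> {..<m}"
      then have j: "j < m" by simp
      have "jac j y *\<^sub>R ?u (\<beta> j y) = \<phi> (of_real (\<beta> j y)) * of_real (jac j y * gn A' (Suc n) (\<beta> j y))"
        by (simp only: scaleR_conv_of_real of_real_mult mult_ac)
      then show "jac j y *\<^sub>R ?u (\<beta> j y) = (-1) ^ j * \<phi> (b j (of_real y)) * of_real (gn A' n y)"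
        unfolding gn_recursion[OF j y] of_real_\<beta>[OF j y] by (simp add: mult_ac)
    qed
  qed
  finally show ?thesis .
qed

text \<open>Integration by parts. The vanishing of \<open>\<phi>\<close> at both ends removes the
  boundary terms and also gives its derivative mean zero.\<close>

lemma cn_analytic_eq:
  assumes \<phi>: "\<phi> analytic_on seg" and "\<phi> 1 = 0" "\<phi> (-1) = 0"
  shows "cn A' \<phi> n = - (\<integral>y. of_real (A ((f ^^ n) (\<theta> y))) * deriv \<phi> (of_real y) \<partial>LI)"
    and "(\<integral>y. deriv \<phi> (of_real y) \<partial>LI) = 0"
proof -
  obtain S where S: "open S" "seg \<subseteq> S" "\<phi> holomorphic_on S" using \<phi> analytic_on_holomorphic by blast
  have in_S: "complex_of_real y \<in> S" if "y \<in> {-1..1}" for y using S that by auto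
  have d\<phi>: "((\<lambda>y. \<phi> (of_real y)) has_vector_derivative deriv \<phi> (of_real y)) (at y within {-1..1})" if "y \<in> {-1..1}" for y
    by (rule Re_of_real_has_derivative(3)[OF S(3,1) in_S[OF that]])
  have d\<phi>c: "continuous_on {-1..1} (\<lambda>y. deriv \<phi> (complex_of_real y))"
    by (rule continuous_on_compose2[OF holomorphic_on_imp_continuous_on[OF holomorphic_deriv[OF S(3,1)]]])
       (use in_S in \<open>auto intro!: continuous_intros\<close>)
  have \<phi>c: "continuous_on {-1..1} (\<lambda>y. \<phi> (complex_of_real y))"
    by (rule continuous_on_compose2[OF holomorphic_on_imp_continuous_on[OF S(3)]])
       (use in_S in \<open>auto intro!: continuous_intros\<close>)
  have Ac: "continuous_on {-1..1} (\<lambda>y. A ((f ^^ n) (\<theta> y)))"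
    using DERIV_continuous_on[OF A_fn_\<theta>_deriv] by simp
  have "((\<lambda>y. deriv \<phi> (complex_of_real y)) has_integral \<phi> (of_real 1) - \<phi> (of_real (-1))) {-1..1}"
    by (rule fundamental_theorem_of_calculus) (use d\<phi> in auto)
  then show "(\<integral>y. deriv \<phi> (of_real y) \<partial>LI) = 0"
    using assms by (simp add: integral_LI_eq_integral[OF continuous_imp_integrable_LI[OF d\<phi>c]] integral_unique)
  let ?F = "\<lambda>y. \<phi> (complex_of_real y) * complex_of_real (A ((f ^^ n) (\<theta> y)))"
  let ?F' = "\<lambda>y. \<phi> (complex_of_real y) * complex_of_real (gn A' n y) + deriv \<phi> (of_real y) * complex_of_real (A ((f ^^ n) (\<theta> y)))"
  have "(?F' has_integral ?F 1 - ?F (-1)) {-1..1}"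
  proof (rule fundamental_theorem_of_calculus)
    fix y :: real assume y: "y \<in> {-1..1}"
    show "(?F has_vector_derivative ?F' y) (at y within {-1..1})"
      by (rule has_vector_derivative_mult[OF d\<phi>[OF y] has_vector_derivative_of_real[OF A_fn_\<theta>_deriv[OF y]]])
  qed simp
  then have 0: "integral {-1..1} ?F' = 0" using assms by (simp add: integral_unique)
  have i1: "integrable LI (\<lambda>y. \<phi> (complex_of_real y) * complex_of_real (gn A' n y))"
    by (intro continuous_imp_integrable_LI continuous_intros \<phi>c gn_cont)
  have i2: "integrable LI (\<lambda>y. deriv \<phi> (of_real y) * complex_of_real (A ((f ^^ n) (\<theta> y))))"
    by (intro continuous_imp_integrable_LI continuous_intros d\<phi>c Ac)
  have "(\<integral>y. ?F' y \<partial>LI) = 0"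
    using integral_LI_eq_integral[OF Bochner_Integration.integrable_add[OF i1 i2]] 0 by simp
  then have "(\<integral>y. \<phi> (complex_of_real y) * complex_of_real (gn A' n y) \<partial>LI) +
      (\<integral>y. deriv \<phi> (of_real y) * complex_of_real (A ((f ^^ n) (\<theta> y))) \<partial>LI) = 0"
    using Bochner_Integration.integral_add[OF i1 i2] by simp
  then show "cn A' \<phi> n = - (\<integral>y. of_real (A ((f ^^ n) (\<theta> y))) * deriv \<phi> (of_real y) \<partial>LI)"
    unfolding cn_def by (simp add: add_eq_0_iff2 mult.commute[of "deriv \<phi> _"])
qed

text \<open>The continuation comes from the correlation series of \<open>deriv \<phi>\<close>. As
  \<open>deriv \<phi>\<close> has mean zero, the coefficients tend to \<open>0\<close>, which
  excludes a pole at \<open>1\<close>.\<close>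

lemma cn_analytic_regular:
  assumes \<phi>: "\<phi> analytic_on seg" and ends: "\<phi> 1 = 0" "\<phi> (-1) = 0"
  shows "meromorphic_fps_regular 1 (Abs_fps (cn A' \<phi>))"
proof -
  have d\<phi>: "deriv \<phi> analytic_on seg" using \<phi> by (rule analytic_deriv)
  then obtain s K where s: "s > 0" "deriv \<phi> holomorphic_on nbhd s" "\<And>z. z \<in> nbhd s \<Longrightarrow> norm (deriv \<phi> z) \<le> K"
    by (rule analytic_on_seg_bounded) metis
  define t where "t = min s r"
  have t: "0 < t" "t \<le> r" "nbhd t \<subseteq> nbhd s" using s r0 by (auto simp: t_def intro!: nbhd_mono)
  have Ac: "continuous_on {-1..1} A" using A by (meson DERIV_continuous_on)
  then have "compact (A ` {-1..1})" by (intro compact_continuous_image) auto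
  then obtain KA where KA: "\<forall>v\<in>A ` {-1..1}. norm v \<le> KA" using compact_imp_bounded bounded_iff by blast
  define B where "B x = complex_of_real (A x)" for x
  have B: "B \<in> borel_measurable LI" "\<And>x. x \<in> {-1..1} \<Longrightarrow> norm (B x) \<le> KA"
    unfolding B_def[abs_def] using KA by (auto intro!: continuous_imp_measurable_LI continuous_intros Ac simp del: atLeastAtMost_iff)
  have Bm: "(\<lambda>x. B (\<theta> x)) \<in> borel_measurable LI" using iterate_measurable[OF B(1), of 0] by simp
  have Bb: "norm (B (\<theta> x)) \<le> KA" if "x \<in> {-1..1}" for x by (rule B(2)[OF \<theta>_range[OF that]])
  have d\<phi>c: "continuous_on seg (deriv \<phi>)" by (rule hol_cont_seg[OF s(2,1)])
  note eq = cn_analytic_eq[OF \<phi> ends, folded B_def]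
  have "meromorphic_fps UNIV (Abs_fps (\<lambda>n. \<integral>x. B (\<theta> x) * (L ^^ n) (deriv \<phi>) (of_real x) \<partial>LI))"
    by (rule correlation_meromorphic[OF _ t(1,2) _ Bm Bb]) (use s t in \<open>auto intro: holomorphic_on_subset\<close>)
  then have "meromorphic_fps UNIV (fps_const (-1) * Abs_fps (\<lambda>n. \<integral>x. B (\<theta> x) * (L ^^ n) (deriv \<phi>) (of_real x) \<partial>LI))"
    by (intro meromorphic_fps_mult meromorphic_fps_const)
  also have "fps_const (-1) * Abs_fps (\<lambda>n. \<integral>x. B (\<theta> x) * (L ^^ n) (deriv \<phi>) (of_real x) \<partial>LI) = Abs_fps (cn A' \<phi>)"
  proof (rule fps_ext)
    fix n
    show "fps_nth (fps_const (-1) * Abs_fps (\<lambda>n. \<integral>x. B (\<theta> x) * (L ^^ n) (deriv \<phi>) (of_real x) \<partial>LI)) n =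
        fps_nth (Abs_fps (cn A' \<phi>)) n"
      using iterate_duality[OF d\<phi>c B, of n] eq(1)[of n] by simp
  qed
  finally have mero: "meromorphic_fps UNIV (Abs_fps (cn A' \<phi>))" .
  have "(\<lambda>n. - (\<integral>y. B ((f ^^ n) (\<theta> y)) * deriv \<phi> (of_real y) \<partial>LI)) \<longlonglongrightarrow> - 0"
    using tendsto_minus[OF decay_analytic[OF d\<phi> B]] by (simp add: eq(2))
  then have "cn A' \<phi> \<longlonglongrightarrow> 0" by (simp add: eq(1)[abs_def])
  then show ?thesis by (rule meromorphic_fps_regular_if_coeffs_null[OF mero])
qed

lemma cn_pol_Suc:
  assumes s: "s = 1 \<or> s = -1"
  obtains e where "meromorphic_fps_regular 1 (Abs_fps (cn A' e))"
    "\<And>n. cn A' (pol s) (Suc n) = res s 1 * cn A' (pol 1) n + res s (-1) * cn A' (pol (-1)) n + cn A' e n"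
proof -
  obtain e where e: "e analytic_on seg" "e 1 = 0" "e (-1) = 0"
    "\<And>z. z \<noteq> 1 \<Longrightarrow> z \<noteq> -1 \<Longrightarrow> M (pol s) z = res s 1 * pol 1 z + res s (-1) * pol (-1) z + e z"
    by (rule M_pol[OF s]) metis
  have "cn A' (pol s) (Suc n) = res s 1 * cn A' (pol 1) n + res s (-1) * cn A' (pol (-1)) n + cn A' e n" for n
  proof -
    let ?g = "\<lambda>y. complex_of_real (gn A' n y)"
    note int = cn_integrable[OF admissible_pol, of 1 n, simplified] cn_integrable[OF admissible_pol, of "-1" n, simplified]
      cn_integrable[OF admissible_analytic[OF e(1)], of n]
    have meas: "(\<lambda>y. M (pol s) (of_real y) * ?g y) \<in> borel_measurable LI"
    proof -
      have "(\<lambda>y. pol s (b j (of_real y))) \<in> borel_measurable LI" if j: "j < m" for j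
      proof -
        have "continuous_on {-1..1} (\<lambda>y. b j (complex_of_real y))"
          by (intro cont_of_real continuous_on_subset[OF holomorphic_on_imp_continuous_on[OF b_hol[OF j]] seg_U])
        then have [measurable]: "(\<lambda>y. b j (complex_of_real y)) \<in> borel_measurable LI" by (rule continuous_imp_measurable_LI)
        show ?thesis unfolding pol_def by measurable
      qed
      moreover have "?g \<in> borel_measurable LI"
        by (intro continuous_imp_measurable_LI continuous_intros gn_cont)
      ultimately show ?thesis unfolding M_def
        by (intro borel_measurable_times borel_measurable_sum) auto
    qed
    have "cn A' (pol s) (Suc n) = (\<integral>y. M (pol s) (of_real y) * ?g y \<partial>LI)"
      by (rule cn_Suc[OF admissible_pol[OF s]])
    also have "\<dots> = (\<integral>y. res s 1 * (pol 1 (of_real y) * ?g y) + res s (-1) * (pol (-1) (of_real y) * ?g y) + e (of_real y) * ?g y \<partial>LI)"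
    proof (rule integral_cong_AE[OF meas])
      show "(\<lambda>y. res s 1 * (pol 1 (of_real y) * ?g y) + res s (-1) * (pol (-1) (of_real y) * ?g y) + e (of_real y) * ?g y) \<in> borel_measurable LI"
        using int by (intro borel_measurable_add borel_measurable_times borel_measurable_const borel_measurable_integrable) auto
      \<comment> \<open>The decomposition of \<open>M (pol s)\<close> holds off the two ends, a null
        set.\<close>
      have "AE y in LI. y \<notin> {-1, 1}" by (rule AE_LI_neq) simp
      then show "AE y in LI. M (pol s) (of_real y) * ?g y =
          res s 1 * (pol 1 (of_real y) * ?g y) + res s (-1) * (pol (-1) (of_real y) * ?g y) + e (of_real y) * ?g y"
      proof eventually_elim
        case (elim y)
        then have "complex_of_real y \<noteq> of_real 1" "complex_of_real y \<noteq> of_real (-1)"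
          unfolding of_real_eq_iff by auto
        then show ?case using e(4)[of "of_real y"] by (simp add: algebra_simps)
      qed
    qed
    also have "\<dots> = res s 1 * cn A' (pol 1) n + res s (-1) * cn A' (pol (-1)) n + cn A' e n"
      using int by (simp add: cn_def)
    finally show ?thesis .
  qed
  then show ?thesis using that[of e] cn_analytic_regular[OF e(1-3)] by blast
qed

text \<open>The triangular recursion is solved starting with \<open>pol (-1)\<close>, which does not
  involve \<open>pol 1\<close>; its series then enters the equation for \<open>pol 1\<close> as a
  known term. Each step divides by \<open>1 - \<mu> * fps_X\<close> with \<open>\<mu>\<close> a
  diagonal residue, which is not \<open>1\<close>.\<close>

lemma cn_pol_regular:
  "meromorphic_fps_regular 1 (Abs_fps (cn A' (pol (-1))))"
  "meromorphic_fps_regular 1 (Abs_fps (cn A' (pol 1)))"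
proof -
  let ?G = "\<lambda>s. Abs_fps (cn A' (pol s))"
  have fps_rec: "?G s = fps_const (cn A' (pol s) 0) + fps_X * (fps_const \<mu> * ?G s + H)"
    if "\<And>n. cn A' (pol s) (Suc n) = \<mu> * cn A' (pol s) n + fps_nth H n" for s \<mu> H
  proof (rule fps_ext)
    fix n
    show "fps_nth (?G s) n = fps_nth (fps_const (cn A' (pol s) 0) + fps_X * (fps_const \<mu> * ?G s + H)) n"
      using that by (cases n) simp_all
  qed
  have reg: "meromorphic_fps_regular 1 (?G s)"
    if rec: "\<And>n. cn A' (pol s) (Suc n) = \<mu> * cn A' (pol s) n + fps_nth H n"
      and "\<mu> \<noteq> 1" and H: "meromorphic_fps_regular 1 H" for s \<mu> H
  proof (rule meromorphic_fps_regular_div_linear)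
    show "meromorphic_fps_regular 1 (fps_const (cn A' (pol s) 0) + fps_X * H)"
      by (intro meromorphic_fps_regular_add meromorphic_fps_regular_mult meromorphic_fps_regular_const
          meromorphic_fps_regular_X H)
    have "?G s - fps_X * (fps_const \<mu> * ?G s) = fps_const (cn A' (pol s) 0) + fps_X * H"
      using fps_rec[of s \<mu> H, OF rec] by (simp add: algebra_simps)
    then show "?G s * (1 - fps_const \<mu> * fps_X) = fps_const (cn A' (pol s) 0) + fps_X * H"
      by (simp add: algebra_simps)
    show "\<mu> * 1 \<noteq> 1" using \<open>\<mu> \<noteq> 1\<close> by simp
  qed
  obtain e where e: "meromorphic_fps_regular 1 (Abs_fps (cn A' e))"
    "\<And>n. cn A' (pol (-1)) (Suc n) = res (-1) 1 * cn A' (pol 1) n + res (-1) (-1) * cn A' (pol (-1)) n + cn A' e n"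
    by (rule cn_pol_Suc[of "-1"]) auto
  show m1: "meromorphic_fps_regular 1 (?G (-1))"
    by (rule reg[of "-1" "res (-1) (-1)" "Abs_fps (cn A' e)"])
       (use e res_m1_1 res_diag_neq_1[of "-1"] in auto)
  obtain e' where e': "meromorphic_fps_regular 1 (Abs_fps (cn A' e'))"
    "\<And>n. cn A' (pol 1) (Suc n) = res 1 1 * cn A' (pol 1) n + res 1 (-1) * cn A' (pol (-1)) n + cn A' e' n"
    by (rule cn_pol_Suc[of 1]) auto
  show "meromorphic_fps_regular 1 (?G 1)"
  proof (rule reg[of 1 "res 1 1" "fps_const (res 1 (-1)) * ?G (-1) + Abs_fps (cn A' e')"])
    show "meromorphic_fps_regular 1 (fps_const (res 1 (-1)) * ?G (-1) + Abs_fps (cn A' e'))"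
      by (intro meromorphic_fps_regular_add meromorphic_fps_regular_mult meromorphic_fps_regular_const m1 e'(1))
  qed (use e' res_diag_neq_1[of 1] in auto)
qed

text \<open>At each end the numerator has derivative zero because \<open>deriv h\<close> and
  \<open>deriv \<omega>\<close> vanish there, and the denominator \<open>deriv \<omega>\<close> has
  a simple zero with vanishing second derivative. The quotient thus has a simple pole without
  constant term, and its residue is the coefficient of \<open>pol\<close>.\<close>

lemma density_decomposition:
  assumes X: "open WX" "seg \<subseteq> WX" "Xc holomorphic_on WX"
  obtains a1 a2 \<Phi>0 where "\<Phi>0 analytic_on seg" "\<Phi>0 1 = 0" "\<Phi>0 (-1) = 0"
    "\<And>z. z \<noteq> 1 \<Longrightarrow> z \<noteq> -1 \<Longrightarrow> h z * Xc (\<omega> z) / deriv \<omega> z = a1 * pol 1 z + a2 * pol (-1) z + \<Phi>0 z"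
proof -
  define S where "S = (W0 \<inter> \<omega> -` WX) \<inter> nbhd rh"
  have "open (W0 \<inter> \<omega> -` WX)"
    by (rule continuous_open_preimage[OF holomorphic_on_imp_continuous_on[OF \<omega>_hol] W0(1) X(1)])
  then have S: "open S" by (simp add: S_def open_Int)
  have \<omega>_seg: "\<omega> z \<in> seg" if z: "z \<in> seg" for z
  proof -
    obtain x where "x \<in> {-1..1}" "z = of_real x" using z by (auto simp: seg_def)
    then show ?thesis using \<omega>_of_real \<theta>_range by simp
  qed
  have seg_S: "seg \<subseteq> S" using W0(2) X(2) \<omega>_seg seg_subset_nbhd[OF rh] by (auto simp: S_def)
  have S_sub: "S \<subseteq> W0" "S \<subseteq> nbhd rh" by (auto simp: S_def)
  define N where "N z = h z * Xc (\<omega> z)" for z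
  have "(Xc \<circ> \<omega>) holomorphic_on S"
    by (rule holomorphic_on_compose_gen[OF holomorphic_on_subset[OF \<omega>_hol S_sub(1)] X(3)]) (auto simp: S_def)
  then have XS: "(\<lambda>z. Xc (\<omega> z)) holomorphic_on S" by (simp add: o_def)
  have N_hol: "N holomorphic_on S"
    unfolding N_def[abs_def] by (intro holomorphic_intros XS holomorphic_on_subset[OF h_hol S_sub(2)])
  have D_hol: "deriv \<omega> holomorphic_on S"
    using holomorphic_on_subset[OF holomorphic_deriv[OF \<omega>_hol W0(1)] S_sub(1)] .
  obtain R where R: "R > 0" "nbhd R \<subseteq> S" using nbhd_subset_open[OF S seg_S] .
  have D0: "deriv \<omega> 0 \<noteq> 0" using \<omega>_deriv_pos[of 0] by auto
  have "0 \<in> nbhd R" using seg_subset_nbhd[OF R(1)] by auto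
  from zeros_near_seg[OF holomorphic_on_subset[OF D_hol R(2)] R(1) this D0]
  obtain t where t: "0 < t" "t \<le> R" "\<And>z. z \<in> nbhd t \<Longrightarrow> deriv \<omega> z = 0 \<Longrightarrow> z \<in> seg" by metis
  have tS: "nbhd t \<subseteq> S" using nbhd_mono[OF t(2)] R(2) by auto
  have D_ne: "deriv \<omega> z \<noteq> 0" if z: "z \<in> nbhd t - {1, -1}" for z
  proof
    assume eq: "deriv \<omega> z = 0"
    then have "z \<in> seg" using t(3) z by auto
    then obtain x where x: "x \<in> {-1..1}" "z = of_real x" by (auto simp: seg_def)
    then have "-1 < x" "x < 1" using z by (cases "x = 1 \<or> x = -1"; auto)+
    then show False using \<omega>_deriv_pos[of x] eq x by simp
  qed
  define c where "c a = N a / deriv (deriv \<omega>) a" for a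
  define u where "u z = h z * Xc (\<omega> z) / deriv \<omega> z - c 1 * pol 1 z - c (-1) * pol (-1) z" for z
  define \<Phi>0 where "\<Phi>0 z = (if z = 1 \<or> z = -1 then 0 else u z)" for z
  have "(\<lambda>z. if z = 1 \<or> z = -1 then 0 else u z) analytic_on seg"
  proof (rule analytic_on_seg_remove_ends[OF t(1)])
    have sub: "nbhd t - {1, -1} \<subseteq> S" using tS by auto
    have "pol a holomorphic_on nbhd t - {1, -1}" if "a = 1 \<or> a = -1" for a
      unfolding pol_def[abs_def] using that by (intro holomorphic_intros) auto
    moreover have "(\<lambda>z. N z / deriv \<omega> z) holomorphic_on nbhd t - {1, -1}"
      using D_ne by (intro holomorphic_on_divide holomorphic_on_subset[OF N_hol sub] holomorphic_on_subset[OF D_hol sub]) auto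
    ultimately show "u holomorphic_on nbhd t - {1, -1}"
      unfolding u_def[abs_def] N_def[symmetric]
      by (intro holomorphic_on_diff holomorphic_on_mult holomorphic_on_const) auto
    fix a :: complex assume a: "a = 1 \<or> a = -1"
    have aS: "a \<in> S" using a seg_S by auto
    have "deriv N a = 0"
    proof -
      have "(h has_field_derivative deriv h a) (at a)"
        using holomorphic_derivI[OF holomorphic_on_subset[OF h_hol S_sub(2)] S aS] by simp
      moreover have "(\<omega> has_field_derivative deriv \<omega> a) (at a)"
        using holomorphic_derivI[OF holomorphic_on_subset[OF \<omega>_hol S_sub(1)] S aS] by simp
      moreover have "\<omega> a \<in> WX" using aS by (simp add: S_def)
      then have "(Xc has_field_derivative deriv Xc (\<omega> a)) (at (\<omega> a))"
        using holomorphic_derivI[OF X(3,1)] by simp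
      ultimately have "(N has_field_derivative deriv h a * Xc (\<omega> a) + deriv Xc (\<omega> a) * deriv \<omega> a * h a) (at a)"
        unfolding N_def[abs_def] by (intro DERIV_mult DERIV_chain2[of Xc])
      moreover have "deriv h a = 0" "deriv \<omega> a = 0" using a h_deriv_ends \<omega>_deriv_ends by auto
      ultimately show ?thesis by (simp add: DERIV_imp_deriv)
    qed
    moreover have "deriv \<omega> a = 0" using a \<omega>_deriv_ends by auto
    ultimately have l1: "((\<lambda>z. N z / deriv \<omega> z - c a / (z - a)) \<longlongrightarrow> 0) (at a)"
      unfolding c_def using polar_remainder_tendsto_0[OF S aS N_hol D_hol _ _ \<omega>2[OF a] \<omega>3[OF a]] by blast
    have "((\<lambda>z. (N z / deriv \<omega> z - c a / (z - a)) + (c a / (z - a) - c a * pol a z) - c (- a) * pol (- a) z) \<longlongrightarrow> 0 + 0 - c (- a) * 0) (at a)"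
      by (intro tendsto_intros l1 pol_same_tendsto pol_other_tendsto a)
    moreover have "(\<lambda>z. (N z / deriv \<omega> z - c a / (z - a)) + (c a / (z - a) - c a * pol a z) - c (- a) * pol (- a) z) = u"
      using a by (auto simp: u_def N_def)
    ultimately show "(u \<longlongrightarrow> 0) (at a)" by simp
  qed
  then show ?thesis
    using that[of \<Phi>0 "c 1" "c (-1)"] by (auto simp: \<Phi>0_def[abs_def] u_def)
qed

text \<open>In the conjugated coordinate the density is multiplied and divided by
  \<open>\<theta>'\<close>: the product turns the derivative of the observable into
  \<open>gn\<close>, the quotient is the function with poles at the ends that
  \<open>density_decomposition\<close> splits.\<close>

theorem susceptibility_regular:
  assumes X: "open WX" "seg \<subseteq> WX" "Xc holomorphic_on WX"
    and XX: "\<And>x. x \<in> {-1..1} \<Longrightarrow> Xc (of_real x) = of_real (X x)"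
  shows "meromorphic_fps_regular 1 (Abs_fps (\<lambda>n. complex_of_real (Psi_coeff f acim X A n)))"
proof -
  obtain a1 a2 \<Phi>0 where \<Phi>0: "\<Phi>0 analytic_on seg" "\<Phi>0 1 = 0" "\<Phi>0 (-1) = 0"
    and dec: "\<And>z. z \<noteq> 1 \<Longrightarrow> z \<noteq> -1 \<Longrightarrow> h z * Xc (\<omega> z) / deriv \<omega> z = a1 * pol 1 z + a2 * pol (-1) z + \<Phi>0 z"
    by (rule density_decomposition[OF X]) metis
  have Xcont: "continuous_on {-1..1} X"
  proof -
    have "continuous_on {-1..1} (\<lambda>x. Re (Xc (complex_of_real x)))"
      by (intro continuous_intros cont_of_real continuous_on_subset[OF holomorphic_on_imp_continuous_on[OF X(3)] X(2)])
    then show ?thesis by (rule continuous_on_eq) (simp add: XX)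
  qed
  have coeff: "complex_of_real (Psi_coeff f acim X A n) = a1 * cn A' (pol 1) n + a2 * cn A' (pol (-1)) n + cn A' \<Phi>0 n" for n
  proof -
    let ?g = "\<lambda>y. complex_of_real (gn A' n y)"
    define B where "B x = complex_of_real (X x * Dn A' n x)" for x
    have Bc: "continuous_on {-1..1} B"
      unfolding B_def[abs_def] by (intro continuous_intros Xcont Dn_cont)
    have "Psi_coeff f acim X A n = (\<integral>x. X x * Dn A' n x \<partial>acim)"
      unfolding Psi_coeff_def
      by (rule Bochner_Integration.integral_cong[OF refl]) (simp add: interval_deriv_A_fn)
    then have "complex_of_real (Psi_coeff f acim X A n) = (\<integral>x. B x \<partial>acim)"
      unfolding B_def by (simp only: integral_complex_of_real)
    also have "\<dots> = (\<integral>y. B (\<theta> y) * h (of_real y) \<partial>LI)"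
      by (rule integral_acim[OF continuous_imp_measurable_LI[OF Bc]])
    also have "\<dots> = (\<integral>y. a1 * (pol 1 (of_real y) * ?g y) + a2 * (pol (-1) (of_real y) * ?g y) + \<Phi>0 (of_real y) * ?g y \<partial>LI)"
    proof (rule integral_cong_AE)
      note int = cn_integrable[OF admissible_pol, of 1 n, simplified] cn_integrable[OF admissible_pol, of "-1" n, simplified]
        cn_integrable[OF admissible_analytic[OF \<Phi>0(1)], of n]
      show "(\<lambda>y. a1 * (pol 1 (of_real y) * ?g y) + a2 * (pol (-1) (of_real y) * ?g y) + \<Phi>0 (of_real y) * ?g y) \<in> borel_measurable LI"
        using int by (intro borel_measurable_add borel_measurable_times borel_measurable_const borel_measurable_integrable) auto
      show "(\<lambda>y. B (\<theta> y) * h (of_real y)) \<in> borel_measurable LI"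
        by (intro continuous_imp_measurable_LI continuous_intros cont_of_real h_cont continuous_on_compose2[OF Bc \<theta>_cont])
           (use \<theta>_range in auto)
      have "AE y in LI. y \<notin> {-1, 1}" by (rule AE_LI_neq) simp
      moreover have "AE y in LI. y \<in> {-1..1}" by (intro AE_I2) simp
      ultimately show "AE y in LI. B (\<theta> y) * h (of_real y) =
          a1 * (pol 1 (of_real y) * ?g y) + a2 * (pol (-1) (of_real y) * ?g y) + \<Phi>0 (of_real y) * ?g y"
      proof eventually_elim
        case (elim y)
        then have ne: "complex_of_real y \<noteq> of_real 1" "complex_of_real y \<noteq> of_real (-1)"
          unfolding of_real_eq_iff by auto
        have pos: "\<theta>' y > 0" using elim by (intro \<theta>'_pos) auto
        have "Im (deriv \<omega> (of_real y)) = 0"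
          by (rule Im_deriv_eq_0_of_real_on_seg[OF \<omega>_hol W0(1) W0(2) \<omega>_real elim(2)])
        then have d\<omega>: "deriv \<omega> (of_real y) = of_real (\<theta>' y)" by (simp add: \<theta>'_def complex_eq_iff)
        have "B (\<theta> y) * h (of_real y) = (h (of_real y) * Xc (\<omega> (of_real y)) / deriv \<omega> (of_real y)) * ?g y"
          unfolding d\<omega> \<omega>_of_real[OF elim(2)] XX[OF \<theta>_range[OF elim(2)]] B_def gn_def
          using pos by (simp add: field_simps)
        also have "h (of_real y) * Xc (\<omega> (of_real y)) / deriv \<omega> (of_real y) =
            a1 * pol 1 (of_real y) + a2 * pol (-1) (of_real y) + \<Phi>0 (of_real y)"
          using ne by (intro dec) auto
        finally show ?case by (simp only: distrib_right mult.assoc)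
      qed
    qed
    also have "\<dots> = a1 * cn A' (pol 1) n + a2 * cn A' (pol (-1)) n + cn A' \<Phi>0 n"
      using cn_integrable[OF admissible_pol, of 1 n, simplified] cn_integrable[OF admissible_pol, of "-1" n, simplified]
        cn_integrable[OF admissible_analytic[OF \<Phi>0(1)], of n]
      by (simp add: cn_def)
    finally show ?thesis .
  qed
  have "Abs_fps (\<lambda>n. complex_of_real (Psi_coeff f acim X A n)) =
      fps_const a1 * Abs_fps (cn A' (pol 1)) + fps_const a2 * Abs_fps (cn A' (pol (-1))) + Abs_fps (cn A' \<Phi>0)"
    by (rule fps_ext) (simp add: coeff)
  then show ?thesis
    using cn_pol_regular cn_analytic_regular[OF \<Phi>0]
    by (auto intro!: meromorphic_fps_regular_add meromorphic_fps_regular_mult meromorphic_fps_regular_const)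
qed

end

end

subsection \<open>Holomorphic extension of real-analytic functions\<close>

lemma of_real_islimpt_interval:
  assumes "u < p" "p < v"
  shows "complex_of_real p islimpt complex_of_real ` {u<..<v}"
  unfolding islimpt_approachable
proof (intro allI impI)
  fix e :: real assume e: "e > 0"
  define k where "k = min (e / 2) ((v - p) / 2)"
  have k: "k > 0" "k < e" "p + k < v" using e assms by (auto simp: k_def min_def field_simps)
  have "complex_of_real (p + k) \<in> complex_of_real ` {u<..<v}"
    by (rule imageI) (use k assms in auto)
  moreover have "complex_of_real (p + k) \<noteq> of_real p" "dist (complex_of_real (p + k)) (of_real p) < e"
    using k by (simp_all add: dist_norm)
  ultimately show "\<exists>x'\<in>complex_of_real ` {u<..<v}. x' \<noteq> of_real p \<and> dist x' (of_real p) < e"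
    by blast
qed

lemma holomorphic_eq_on_connected:
  assumes "F holomorphic_on S" "G holomorphic_on S" "open S" "connected S"
    and "u < v" "complex_of_real ` {u<..<v} \<subseteq> S"
    and eq: "\<And>x. u < x \<Longrightarrow> x < v \<Longrightarrow> F (of_real x) = G (of_real x)"
    and "z \<in> S"
  shows "F z = G z"
proof -
  define p where "p = (u + v) / 2"
  have p: "u < p" "p < v" using assms(5) by (auto simp: p_def)
  have "F z - G z = 0"
  proof (rule analytic_continuation[of "\<lambda>z. F z - G z" S "complex_of_real ` {u<..<v}" "of_real p"])
    show "(\<lambda>z. F z - G z) holomorphic_on S" using assms by (intro holomorphic_intros)
    show "complex_of_real p islimpt complex_of_real ` {u<..<v}" by (rule of_real_islimpt_interval[OF p])
    show "complex_of_real p \<in> S" using assms(6) p by auto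
  qed (use assms in auto)
  then show ?thesis by simp
qed

lemma real_analytic_local_extension:
  assumes "real_analytic_on f {-1..1}" "x0 \<in> {-1..1}"
  shows "\<exists>R F. R > 0 \<and> F holomorphic_on ball (complex_of_real x0) R \<and>
    (\<forall>x\<in>{-1..1}. \<bar>x - x0\<bar> < R \<longrightarrow> F (of_real x) = complex_of_real (f x))"
proof -
  obtain r a where r: "r > 0" and sums: "\<And>x. x \<in> {-1..1} \<Longrightarrow> \<bar>x - x0\<bar> < r \<Longrightarrow> (\<lambda>n. a n * (x - x0) ^ n) sums f x"
    using assms unfolding real_analytic_on_def by metis
  define R where "R = min r 1 / 2"
  have R: "R > 0" "R < r" "R \<le> 1" using r by (auto simp: R_def min_def)
  \<comment> \<open>Convergence at one real point at distance \<open>R\<close> from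
    \<open>x0\<close> gives convergence in the complex disc of radius \<open>R\<close>. The point is
    taken on the side of \<open>x0\<close> towards the centre, so that it stays in
    \<open>[-1,1]\<close>.\<close>
  define e where "e = (if x0 \<le> 0 then R else - R)"
  have e: "x0 + e \<in> {-1..1}" "\<bar>e\<bar> = R" using assms(2) R by (auto simp: e_def)
  have "summable (\<lambda>n. a n * e ^ n)"
    using sums[OF e(1)] e R by (auto simp: sums_iff)
  then have "summable (\<lambda>n. complex_of_real (a n) * of_real e ^ n)"
    using summable_of_real[of "\<lambda>n. a n * e ^ n"] by simp
  then have summ: "summable (\<lambda>n. complex_of_real (a n) * z ^ n)" if "norm z < R" for z
    using powser_inside[of "\<lambda>n. complex_of_real (a n)" "of_real e" z] that e by simp
  define F where "F z = (\<Sum>n. complex_of_real (a n) * (z - of_real x0) ^ n)" for z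
  have F: "(\<lambda>n. complex_of_real (a n) * (z - of_real x0) ^ n) sums F z" if "z \<in> ball (of_real x0) R" for z
    unfolding F_def using summ[of "z - of_real x0"] that by (intro summable_sums) (simp add: dist_norm norm_minus_commute)
  have "F holomorphic_on ball (of_real x0) R"
    by (rule power_series_holomorphic[OF F])
  moreover have "F (of_real x) = complex_of_real (f x)" if x: "x \<in> {-1..1}" "\<bar>x - x0\<bar> < R" for x
  proof -
    have "(\<lambda>n. complex_of_real (a n * (x - x0) ^ n)) sums of_real (f x)"
      using sums[OF x(1)] x(2) R by (intro sums_of_real) auto
    moreover have "norm (complex_of_real x0 - of_real x) = \<bar>x - x0\<bar>"
      by (metis abs_minus_commute norm_of_real of_real_diff)
    then have "complex_of_real x \<in> ball (of_real x0) R"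
      using x by (simp add: dist_norm)
    from F[OF this] have "(\<lambda>n. complex_of_real (a n * (x - x0) ^ n)) sums F (of_real x)" by simp
    ultimately show ?thesis using sums_unique2 by blast
  qed
  ultimately show ?thesis using R(1) by blast
qed

text \<open>The local power series live on discs with real centres. Two such discs that meet have a
  convex intersection containing a real segment between the centres, so the identity principle makes
  the extensions compatible.\<close>

lemma real_analytic_extension:
  assumes "real_analytic_on f {-1..1}"
  obtains W fc where "open W" "seg \<subseteq> W" "fc holomorphic_on W"
    "\<And>x. x \<in> {-1..1} \<Longrightarrow> fc (of_real x) = complex_of_real (f x)"
proof -
  have "\<forall>x0\<in>{-1..1}. \<exists>R F. R > 0 \<and> F holomorphic_on ball (complex_of_real x0) R \<and>
    (\<forall>x\<in>{-1..1}. \<bar>x - x0\<bar> < R \<longrightarrow> F (of_real x) = complex_of_real (f x))"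
    using real_analytic_local_extension[OF assms] by blast
  then obtain R F where RF: "\<And>x0. x0 \<in> {-1..1} \<Longrightarrow> R x0 > 0"
    "\<And>x0. x0 \<in> {-1..1} \<Longrightarrow> F x0 holomorphic_on ball (complex_of_real x0) (R x0)"
    "\<And>x0 x. x0 \<in> {-1..1} \<Longrightarrow> x \<in> {-1..1} \<Longrightarrow> \<bar>x - x0\<bar> < R x0 \<Longrightarrow> F x0 (of_real x) = complex_of_real (f x)"
    by metis
  have agree_less: "F x z = F y z"
    if xy: "x \<in> {-1..1}" "y \<in> {-1..1}" "x < y" and z: "z \<in> ball (of_real x) (R x) \<inter> ball (of_real y) (R y)" for x y z
  proof -
    let ?S = "ball (complex_of_real x) (R x) \<inter> ball (of_real y) (R y)"
    have "dist (complex_of_real x) (of_real y) < R x + R y"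
      using z dist_triangle[of "of_real x" "of_real y" z] by (auto simp: dist_commute)
    then have xy_lt: "y - x < R x + R y" using xy by (simp add: dist_real_def)
    \<comment> \<open>The real points between the two centres that lie in both discs. They belong to
      \<open>[-1,1]\<close>, where both local extensions equal \<open>f\<close>.\<close>
    define u v where "u = max x (y - R y)" and "v = min y (x + R x)"
    have uv: "u < v" using xy RF(1)[of x] RF(1)[of y] xy_lt by (auto simp: u_def v_def)
    show ?thesis
    proof (rule holomorphic_eq_on_connected[of "F x" ?S "F y" u v])
      show "F x holomorphic_on ?S" "F y holomorphic_on ?S"
        using holomorphic_on_subset[OF RF(2)[OF xy(1)]] holomorphic_on_subset[OF RF(2)[OF xy(2)]] by auto
      show "connected ?S" by (intro convex_connected convex_Int convex_ball)
      show "complex_of_real ` {u<..<v} \<subseteq> ?S"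
        by (auto simp: dist_real_def u_def v_def)
      fix p assume "u < p" "p < v"
      then have "p \<in> {-1..1}" "\<bar>p - x\<bar> < R x" "\<bar>p - y\<bar> < R y"
        using xy by (auto simp: u_def v_def)
      then show "F x (of_real p) = F y (of_real p)" using RF(3)[OF xy(1), of p] RF(3)[OF xy(2), of p] by simp
    qed (use uv z in \<open>simp_all add: open_Int\<close>)
  qed
  have agree: "F x z = F y z"
    if "x \<in> {-1..1}" "y \<in> {-1..1}" "z \<in> ball (of_real x) (R x)" "z \<in> ball (of_real y) (R y)" for x y z
  proof (cases x y rule: linorder_cases)
    case less
    show ?thesis by (rule agree_less[OF that(1,2) less IntI[OF that(3,4)]])
  next
    case greater
    show ?thesis by (rule agree_less[OF that(2,1) greater IntI[OF that(4,3)], symmetric])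
  qed simp
  define W where "W = (\<Union>x\<in>{-1..1}. ball (complex_of_real x) (R x))"
  define fc where "fc z = F (SOME x. x \<in> {-1..1} \<and> z \<in> ball (complex_of_real x) (R x)) z" for z
  have fc: "fc z = F x z" if "x \<in> {-1..1}" "z \<in> ball (of_real x) (R x)" for x z
  proof -
    define y where "y = (SOME x. x \<in> {-1..1} \<and> z \<in> ball (complex_of_real x) (R x))"
    have "y \<in> {-1..1} \<and> z \<in> ball (complex_of_real y) (R y)"
      unfolding y_def by (rule someI[of _ x]) (use that in blast)
    then show ?thesis unfolding fc_def y_def[symmetric] using agree[of y x z] that by blast
  qed
  show ?thesis
  proof (rule that[of W fc])
    show "open W" by (auto simp: W_def)
    show "seg \<subseteq> W" using RF(1) by (force simp: W_def seg_def)
    show "fc holomorphic_on W"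
      unfolding W_def
    proof (rule holomorphic_on_UN_open)
      fix x :: real assume x: "x \<in> {-1..1}"
      show "fc holomorphic_on ball (complex_of_real x) (R x)"
        by (rule holomorphic_transform[OF RF(2)[OF x]]) (use fc[OF x] in auto)
    qed auto
    show "fc (of_real x) = complex_of_real (f x)" if "x \<in> {-1..1}" for x
      using fc[OF that, of "of_real x"] RF(1,3) that by simp
  qed
qed

subsection \<open>The functional equation of the inverse branches\<close>

text \<open>The chain rule up to order three, which is as far as the second derivatives of the
  branches at the ends require.\<close>

lemma composition_derivatives:
  assumes F: "F holomorphic_on S" "open S" and B: "B holomorphic_on T" "open T" "\<And>z. z \<in> T \<Longrightarrow> B z \<in> S"
    and G: "\<And>z. z \<in> T \<Longrightarrow> F (B z) = G z" and z: "z \<in> T"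
  shows "deriv F (B z) * deriv B z = deriv G z"
    and "deriv (deriv F) (B z) * deriv B z ^ 2 + deriv F (B z) * deriv (deriv B) z = deriv (deriv G) z"
    and "deriv (deriv (deriv F)) (B z) * deriv B z ^ 3 + 3 * deriv (deriv F) (B z) * deriv B z * deriv (deriv B) z
      + deriv F (B z) * deriv (deriv (deriv B)) z = deriv (deriv (deriv G)) z"
proof -
  note F1 = holomorphic_deriv[OF F] and B1 = holomorphic_deriv[OF B(1,2)]
  note F2 = holomorphic_deriv[OF F1 F(2)] and B2 = holomorphic_deriv[OF B1 B(2)]
  have B0': "(B has_field_derivative deriv B w) (at w)" if "w \<in> T" for w
    using holomorphic_derivI[OF B(1,2) that] .
  have B1': "(deriv B has_field_derivative deriv (deriv B) w) (at w)" if "w \<in> T" for w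
    using holomorphic_derivI[OF B1 B(2) that] .
  have B2': "(deriv (deriv B) has_field_derivative deriv (deriv (deriv B)) w) (at w)" if "w \<in> T" for w
    using holomorphic_derivI[OF B2 B(2) that] .
  have F0': "((\<lambda>w. F (B w)) has_field_derivative deriv F (B w) * deriv B w) (at w)" if "w \<in> T" for w
    by (rule DERIV_chain2[OF holomorphic_derivI[OF F B(3)[OF that]] B0'[OF that]])
  have F1': "((\<lambda>w. deriv F (B w)) has_field_derivative deriv (deriv F) (B w) * deriv B w) (at w)" if "w \<in> T" for w
    by (rule DERIV_chain2[OF holomorphic_derivI[OF F1 F(2) B(3)[OF that]] B0'[OF that]])
  have F2': "((\<lambda>w. deriv (deriv F) (B w)) has_field_derivative deriv (deriv (deriv F)) (B w) * deriv B w) (at w)" if "w \<in> T" for w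
    by (rule DERIV_chain2[OF holomorphic_derivI[OF F2 F(2) B(3)[OF that]] B0'[OF that]])
  have 1: "deriv F (B w) * deriv B w = deriv G w" if "w \<in> T" for w
    using has_field_derivative_transform_within_open[OF F0'[OF that] B(2) that G] DERIV_imp_deriv by metis
  then show "deriv F (B z) * deriv B z = deriv G z" using z by blast
  have 2: "deriv (deriv F) (B w) * deriv B w ^ 2 + deriv F (B w) * deriv (deriv B) w = deriv (deriv G) w" if w: "w \<in> T" for w
  proof -
    have "(deriv G has_field_derivative deriv (deriv F) (B w) * deriv B w * deriv B w + deriv (deriv B) w * deriv F (B w)) (at w)"
      by (rule has_field_derivative_transform_within_open[OF DERIV_mult[OF F1'[OF w] B1'[OF w]] B(2) w 1])
    from DERIV_imp_deriv[OF this] show ?thesis by (simp add: power2_eq_square mult_ac)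
  qed
  then show "deriv (deriv F) (B z) * deriv B z ^ 2 + deriv F (B z) * deriv (deriv B) z = deriv (deriv G) z" using z by blast
  have "((\<lambda>w. deriv (deriv F) (B w) * deriv B w ^ 2 + deriv F (B w) * deriv (deriv B) w) has_field_derivative
      deriv (deriv (deriv F)) (B z) * deriv B z ^ 3 + 3 * deriv (deriv F) (B z) * deriv B z * deriv (deriv B) z
      + deriv F (B z) * deriv (deriv (deriv B)) z) (at z)"
    by (rule derivative_eq_intros F2'[OF z] F1'[OF z] B1'[OF z] B2'[OF z] refl)+
       (simp add: power2_eq_square power3_eq_cube algebra_simps)
  then have "(deriv (deriv G) has_field_derivative
      deriv (deriv (deriv F)) (B z) * deriv B z ^ 3 + 3 * deriv (deriv F) (B z) * deriv B z * deriv (deriv B) z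
      + deriv F (B z) * deriv (deriv (deriv B)) z) (at z)"
    by (rule has_field_derivative_transform_within_open[OF _ B(2) z 2])
  then show "deriv (deriv (deriv F)) (B z) * deriv B z ^ 3 + 3 * deriv (deriv F) (B z) * deriv B z * deriv (deriv B) z
      + deriv F (B z) * deriv (deriv (deriv B)) z = deriv (deriv (deriv G)) z"
    by (simp add: DERIV_imp_deriv)
qed

text \<open>If the second derivative vanished, \<open>\<omega> (s * (1 - \<xi>)) - s\<close> would
  be of smaller order than \<open>\<xi> ^ 2\<close>, whereas the prescribed expansion has the
  coefficient \<open>- s * K\<close> there.\<close>

lemma second_deriv_neq_0:
  assumes S: "open S" "s \<in> S" "\<omega> holomorphic_on S" and \<omega>s: "\<omega> s = s" "deriv \<omega> s = 0"
    and s: "s = 1 \<or> s = -1" and K: "K > 0"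
    and bigo: "(\<lambda>\<xi>. \<omega> (s * (1 - \<xi>)) - s * (1 - of_real K * \<xi> ^ 2 + of_real E * \<xi> ^ 4)) \<in> O[at 0](\<lambda>\<xi>. \<xi> ^ 5)"
  shows "deriv (deriv \<omega>) s \<noteq> 0"
proof
  assume zero: "deriv (deriv \<omega>) s = 0"
  define V where "V z = (if z = s then deriv \<omega> s else (\<omega> z - \<omega> s) / (z - s))" for z
  have V: "V holomorphic_on S" unfolding V_def[abs_def] by (rule pole_lemma_open[OF S(3,1)])
  have Vs: "V s = 0" by (simp add: V_def \<omega>s)
  have \<omega>V: "\<omega> z = s + (z - s) * V z" for z by (auto simp: V_def \<omega>s)
  have dV: "(V has_field_derivative deriv V z) (at z)" if "z \<in> S" for z
    using holomorphic_derivI[OF V S(1) that] .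
  have d1: "deriv \<omega> z = V z + (z - s) * deriv V z" if "z \<in> S" for z
  proof -
    have "((\<lambda>z. s + (z - s) * V z) has_field_derivative V z + (z - s) * deriv V z) (at z)"
      using dV[OF that] by (auto intro!: derivative_eq_intros)
    then show ?thesis unfolding \<omega>V[symmetric] by (rule DERIV_imp_deriv)
  qed
  have "(deriv V has_field_derivative deriv (deriv V) s) (at s)"
    using holomorphic_derivI[OF holomorphic_deriv[OF V S(1)] S(1,2)] .
  then have "((\<lambda>z. V z + (z - s) * deriv V z) has_field_derivative deriv V s + deriv V s) (at s)"
    using dV[OF S(2)] by (auto intro!: derivative_eq_intros)
  then have "(deriv \<omega> has_field_derivative deriv V s + deriv V s) (at s)"
    by (rule has_field_derivative_transform_within_open[OF _ S(1,2)]) (simp add: d1)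
  then have "deriv V s = 0" using zero by (simp add: DERIV_imp_deriv)
  then have "((\<lambda>z. V z / (z - s)) \<longlongrightarrow> 0) (at s)"
    using dV[OF S(2)] Vs by (simp add: has_field_derivative_iff)
  moreover have "filterlim (\<lambda>\<xi>. s * (1 - \<xi>)) (at s) (at 0)"
  proof (rule filterlim_atI)
    have "((\<lambda>\<xi>. s * (1 - \<xi>)) \<longlongrightarrow> s * (1 - 0)) (at 0)" by (intro tendsto_intros)
    then show "((\<lambda>\<xi>. s * (1 - \<xi>)) \<longlongrightarrow> s) (at 0)" by simp
    show "\<forall>\<^sub>F \<xi> in at 0. s * (1 - \<xi>) \<noteq> s"
      unfolding eventually_at_filter using s by (intro always_eventually) auto
  qed
  ultimately have "((\<lambda>\<xi>. V (s * (1 - \<xi>)) / (s * (1 - \<xi>) - s)) \<longlongrightarrow> 0) (at 0)"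
    by (rule filterlim_compose)
  moreover have "eventually (\<lambda>\<xi>. V (s * (1 - \<xi>)) / (s * (1 - \<xi>) - s) = (\<omega> (s * (1 - \<xi>)) - s) / \<xi> ^ 2) (at 0)"
    unfolding eventually_at_filter
  proof (intro always_eventually allI impI)
    fix \<xi> :: complex assume \<xi>: "\<xi> \<noteq> 0"
    have ss: "s * s = 1" using s by auto
    have "(\<omega> (s * (1 - \<xi>)) - s) / \<xi> ^ 2 = (- s * \<xi>) * V (s * (1 - \<xi>)) / \<xi> ^ 2"
      by (subst \<omega>V) (simp add: algebra_simps)
    also have "\<dots> = (- s) * V (s * (1 - \<xi>)) / \<xi>" using \<xi> by (simp add: power2_eq_square)
    also have "\<dots> = V (s * (1 - \<xi>)) / (s * (1 - \<xi>) - s)"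
      using s \<xi> by (auto simp: field_simps)
    finally show "V (s * (1 - \<xi>)) / (s * (1 - \<xi>) - s) = (\<omega> (s * (1 - \<xi>)) - s) / \<xi> ^ 2" by simp
  qed
  ultimately have lim1: "((\<lambda>\<xi>. (\<omega> (s * (1 - \<xi>)) - s) / \<xi> ^ 2) \<longlongrightarrow> 0) (at 0)"
    by (rule Lim_transform_eventually)
  obtain c where c: "c > 0" "eventually (\<lambda>\<xi>. norm (\<omega> (s * (1 - \<xi>)) - s * (1 - of_real K * \<xi> ^ 2 + of_real E * \<xi> ^ 4)) \<le> c * norm (\<xi> ^ 5)) (at 0)"
    using bigo by (elim landau_o.bigE) blast
  have lim2: "((\<lambda>\<xi>. (\<omega> (s * (1 - \<xi>)) - s * (1 - of_real K * \<xi> ^ 2 + of_real E * \<xi> ^ 4)) / \<xi> ^ 2) \<longlongrightarrow> 0) (at 0)"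
  proof (rule Lim_null_comparison)
    have "eventually (\<lambda>\<xi>. \<xi> \<noteq> (0::complex)) (at 0)" by (simp add: eventually_at_filter)
    with c(2) show "\<forall>\<^sub>F \<xi> in at 0. norm ((\<omega> (s * (1 - \<xi>)) - s * (1 - of_real K * \<xi> ^ 2 + of_real E * \<xi> ^ 4)) / \<xi> ^ 2) \<le> c * norm \<xi> ^ 3"
    proof eventually_elim
      case (elim \<xi>)
      have "norm \<xi> ^ 5 = norm \<xi> ^ 3 * norm \<xi> ^ 2" by (simp flip: power_add)
      then show ?case using elim by (simp add: norm_divide norm_power divide_le_eq mult.assoc)
    qed
    have "((\<lambda>\<xi>::complex. c * norm \<xi> ^ 3) \<longlongrightarrow> c * norm (0::complex) ^ 3) (at 0)" by (intro tendsto_intros)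
    then show "((\<lambda>\<xi>::complex. c * norm \<xi> ^ 3) \<longlongrightarrow> 0) (at 0)" by simp
  qed
  have "((\<lambda>\<xi>. (\<omega> (s * (1 - \<xi>)) - s) / \<xi> ^ 2 - (\<omega> (s * (1 - \<xi>)) - s * (1 - of_real K * \<xi> ^ 2 + of_real E * \<xi> ^ 4)) / \<xi> ^ 2
      - s * of_real E * \<xi> ^ 2) \<longlongrightarrow> 0 - 0 - s * of_real E * 0 ^ 2) (at 0)"
    by (intro tendsto_intros lim1 lim2)
  moreover have "eventually (\<lambda>\<xi>. (\<omega> (s * (1 - \<xi>)) - s) / \<xi> ^ 2 - (\<omega> (s * (1 - \<xi>)) - s * (1 - of_real K * \<xi> ^ 2 + of_real E * \<xi> ^ 4)) / \<xi> ^ 2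
      - s * of_real E * \<xi> ^ 2 = - s * of_real K) (at 0)"
    unfolding eventually_at_filter
    by (intro always_eventually) (auto simp: field_simps power2_eq_square power4_eq_xxxx)
  ultimately have "((\<lambda>\<xi>::complex. - s * of_real K) \<longlongrightarrow> 0 - 0 - s * of_real E * 0 ^ 2) (at 0)"
    by (rule Lim_transform_eventually)
  then show False using s K by (auto simp: tendsto_const_iff)
qed

subsection \<open>Inverse branches of the conjugated map\<close>

lemma holomorphic_extension_has_real_derivative:
  assumes W: "open W" "seg \<subseteq> W" "fc holomorphic_on W"
    and fc: "\<And>x. x \<in> {-1..1} \<Longrightarrow> fc (of_real x) = complex_of_real (f x)" and x: "x \<in> {-1..1}"
  shows "(f has_real_derivative Re (deriv fc (of_real x))) (at x within {-1..1})"
proof -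
  have "of_real x \<in> W" using W(2) x by auto
  from has_field_derivative_at_within[OF Re_of_real_has_derivative(1)[OF W(3,1) this]]
  have "((\<lambda>x. Re (fc (of_real x))) has_vector_derivative Re (deriv fc (of_real x))) (at x within {-1..1})"
    unfolding has_real_derivative_iff_has_vector_derivative .
  then have "(f has_vector_derivative Re (deriv fc (of_real x))) (at x within {-1..1})"
    by (rule has_vector_derivative_transform[rotated 2]) (use x fc in auto)
  then show ?thesis unfolding has_real_derivative_iff_has_vector_derivative .
qed

locale analytic_data =
  fixes f :: "real \<Rightarrow> real" and c :: "nat \<Rightarrow> real" and m :: nat and \<omega> :: "complex \<Rightarrow> complex"
    and W0 :: "complex set" and fc :: "complex \<Rightarrow> complex" and Wf :: "complex set"
    and U :: "complex set" and b :: "nat \<Rightarrow> complex \<Rightarrow> complex"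
  assumes m2: "m \<ge> 2" and f_maps: "x \<in> {-1..1} \<Longrightarrow> f x \<in> {-1..1}"
    and W0: "open W0" "seg \<subseteq> W0" and \<omega>_hol: "\<omega> holomorphic_on W0"
    and \<omega>_ends: "\<omega> 1 = 1" "\<omega> (-1) = -1"
    and \<omega>_image: "\<omega> ` of_real ` {-1..1} = of_real ` {-1..1::real}"
    and \<omega>_mono: "strict_mono_on {-1..1} (omega_real \<omega>)"
    and \<omega>_deriv_pos: "-1 < x \<Longrightarrow> x < 1 \<Longrightarrow> Re (deriv \<omega> (of_real x)) > 0"
    and \<omega>1: "a = 1 \<or> a = -1 \<Longrightarrow> deriv \<omega> a = 0"
    and \<omega>2: "a = 1 \<or> a = -1 \<Longrightarrow> deriv (deriv \<omega>) a \<noteq> 0"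
    and \<omega>3: "a = 1 \<or> a = -1 \<Longrightarrow> deriv (deriv (deriv \<omega>)) a = 0"
    and Wf: "open Wf" "seg \<subseteq> Wf" and fc_hol: "fc holomorphic_on Wf"
    and fc: "x \<in> {-1..1} \<Longrightarrow> fc (of_real x) = of_real (f x)"
    and c_0: "c 0 = -1" and c_m: "c m = 1" and c_less: "j < m \<Longrightarrow> c j < c (Suc j)"
    and f_c: "j \<le> m \<Longrightarrow> f (c j) = (-1) ^ Suc j"
    and f_critical: "x \<in> {-1..1} \<Longrightarrow> Re (deriv fc (of_real x)) = 0 \<Longrightarrow> x \<in> c ` {1..m-1}"
    and U: "open U" "bounded U" "seg \<subseteq> U"
    and b_cont: "j < m \<Longrightarrow> continuous_on (closure U) (b j)"
    and b_hol: "j < m \<Longrightarrow> b j holomorphic_on U"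
    and b_into: "j < m \<Longrightarrow> b j ` closure U \<subseteq> U"
    and b_inv_branch: "j < m \<Longrightarrow> x \<in> {-1..1} \<Longrightarrow> b j (of_real x) = of_real (inv_branch \<omega> f c (Suc j) x)"
begin

abbreviation \<theta> :: "real \<Rightarrow> real" where "\<theta> \<equiv> omega_real \<omega>"
abbreviation d :: "nat \<Rightarrow> real" where "d j \<equiv> varpi \<omega> (c j)"

section \<open>Monotone laps of the conjugated map\<close>

lemma \<omega>_of_real: "x \<in> {-1..1} \<Longrightarrow> \<omega> (of_real x) = of_real (\<theta> x)"
  and \<theta>_range: "x \<in> {-1..1} \<Longrightarrow> \<theta> x \<in> {-1..1}"
proof -
  assume "x \<in> {-1..1}"
  then have "\<omega> (of_real x) \<in> of_real ` {-1..1::real}" using \<omega>_image by blast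
  then obtain y :: real where "y \<in> {-1..1}" "\<omega> (of_real x) = of_real y" by blast
  then show "\<omega> (of_real x) = of_real (\<theta> x)" "\<theta> x \<in> {-1..1}" by (auto simp: omega_real_def)
qed

lemma \<theta>_inj: "inj_on \<theta> {-1..1}"
  by (rule strict_mono_on_imp_inj_on[OF \<omega>_mono])

lemma \<theta>_image: "\<theta> ` {-1..1} = {-1..1}"
proof -
  have "complex_of_real ` \<theta> ` {-1..1} = of_real ` {-1..1}"
    by (subst \<omega>_image[symmetric]) (simp only: image_image, intro image_cong refl, simp add: \<omega>_of_real)
  then show ?thesis by (simp add: inj_image_eq_iff inj_of_real)
qed

lemma varpi_range: "y \<in> {-1..1} \<Longrightarrow> varpi \<omega> y \<in> {-1..1}"
  unfolding varpi_def by (rule the_inv_into_into[OF \<theta>_inj]) (auto simp: \<theta>_image)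

lemma \<theta>_varpi: "y \<in> {-1..1} \<Longrightarrow> \<theta> (varpi \<omega> y) = y"
  unfolding varpi_def by (rule f_the_inv_into_f[OF \<theta>_inj]) (auto simp: \<theta>_image)

lemma varpi_\<theta>: "x \<in> {-1..1} \<Longrightarrow> varpi \<omega> (\<theta> x) = x"
  unfolding varpi_def by (rule the_inv_into_f_f[OF \<theta>_inj])

lemma \<theta>_le_iff: "x \<in> {-1..1} \<Longrightarrow> y \<in> {-1..1} \<Longrightarrow> \<theta> x \<le> \<theta> y \<longleftrightarrow> x \<le> y"
  by (rule strict_mono_on_less_eq[OF \<omega>_mono])

lemma \<theta>_ends: "\<theta> 1 = 1" "\<theta> (-1) = -1"
  using \<omega>_ends by (simp_all add: omega_real_def)

lemma varpi_ends: "varpi \<omega> 1 = 1" "varpi \<omega> (-1) = -1"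
  using varpi_\<theta>[of 1] varpi_\<theta>[of "-1"] by (simp_all add: \<theta>_ends)

lemma varpi_power: "varpi \<omega> ((-1) ^ n) = (-1) ^ n" "(-1) ^ n \<in> {-1..1::real}"
  by (cases "even n"; simp add: varpi_ends)+

lemma c_strict: "i < j \<Longrightarrow> j \<le> m \<Longrightarrow> c i < c j"
proof (induction j)
  case (Suc j)
  then show ?case using c_less[of j] by (cases "i = j") auto
qed simp

lemma c_range: "j \<le> m \<Longrightarrow> c j \<in> {-1..1}"
  using c_strict[of 0 j] c_strict[of j m] c_0 c_m by (cases "j = 0"; cases "j = m") auto

lemma d_range: "j \<le> m \<Longrightarrow> d j \<in> {-1..1}"
  by (intro varpi_range c_range)

lemma d_less: "j < m \<Longrightarrow> d j < d (Suc j)"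
  using c_less[of j] \<theta>_le_iff[OF d_range[of "Suc j"] d_range[of j]] \<theta>_varpi[OF c_range[of j]] \<theta>_varpi[OF c_range[of "Suc j"]]
  by (simp add: not_le[symmetric])

lemma f_has_deriv: "x \<in> {-1..1} \<Longrightarrow> (f has_real_derivative Re (deriv fc (of_real x))) (at x within {-1..1})"
  by (rule holomorphic_extension_has_real_derivative[OF Wf fc_hol fc])

lemma f_cont: "continuous_on {-1..1} f"
  unfolding continuous_on_eq_continuous_within using f_has_deriv DERIV_continuous by blast

text \<open>By Rolle's theorem two equal values would produce a critical point strictly inside a
  lap, while all critical points are partition points.\<close>

lemma f_inj:
  assumes j: "j < m"
  shows "inj_on f {c j..c (Suc j)}"
proof (rule linorder_inj_onI)
  fix p q assume pq: "p < q" and p: "p \<in> {c j..c (Suc j)}" and q: "q \<in> {c j..c (Suc j)}"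
  have sub: "{c j..c (Suc j)} \<subseteq> {-1..1}" using c_range[of j] c_range[of "Suc j"] j by auto
  have der: "(f has_real_derivative Re (deriv fc (of_real x))) (at x)" if "p < x" "x < q" for x
  proof -
    have "(f has_real_derivative Re (deriv fc (of_real x))) (at x within {-1..1})"
      using f_has_deriv[of x] that p q sub by auto
    moreover have "at x within {-1..1} = at x"
      using that p q sub by (intro at_within_interior) auto
    ultimately show ?thesis by simp
  qed
  show "f p \<noteq> f q"
  proof
    assume eq: "f p = f q"
    have "continuous_on {p..q} f"
      by (rule continuous_on_subset[OF f_cont]) (use p q sub in auto)
    moreover have "f differentiable (at x)" if "p < x" "x < q" for x
      using der[OF that] real_differentiable_def by blast
    ultimately obtain z where z: "p < z" "z < q" "DERIV f z :> 0"
      using Rolle[OF pq eq] by blast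
    then have "Re (deriv fc (of_real z)) = 0" using der DERIV_unique by blast
    moreover have "z \<in> {-1..1}" using z p q sub by auto
    ultimately obtain i where i: "i \<in> {1..m-1}" "z = c i" using f_critical by blast
    have "i \<le> j \<or> Suc j \<le> i" by linarith
    then show False
    proof
      assume "i \<le> j"
      then have "c i \<le> c j" using c_strict[of i j] j by (cases "i = j") auto
      then show False using z i p by auto
    next
      assume "Suc j \<le> i"
      moreover have "i \<le> m" using i by auto
      ultimately have "c (Suc j) \<le> c i" using c_strict[of "Suc j" i] by (cases "i = Suc j") auto
      then show False using z i q by auto
    qed
  qed
qed auto

lemma f_onto:
  assumes j: "j < m" and y: "y \<in> {-1..1}"
  shows "\<exists>p\<in>{c j..c (Suc j)}. f p = y"
proof -
  have cont: "continuous_on {c j..c (Suc j)} f"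
    by (rule continuous_on_subset[OF f_cont]) (use c_range[of j] c_range[of "Suc j"] j in auto)
  have le: "c j \<le> c (Suc j)" using c_less[OF j] by simp
  show ?thesis
  proof (cases "even j")
    case True
    then show ?thesis using IVT'[OF _ _ le cont, of y] f_c[of j] f_c[of "Suc j"] j y by auto
  next
    case False
    then show ?thesis using IVT2'[OF _ _ le cont, of y] f_c[of j] f_c[of "Suc j"] j y by auto
  qed
qed

lemma \<theta>_piece:
  assumes "j < m" "x \<in> {d j..d (Suc j)}"
  shows "x \<in> {-1..1}" "\<theta> x \<in> {c j..c (Suc j)}"
proof -
  note dr = d_range[of j] d_range[of "Suc j"]
  show x: "x \<in> {-1..1}" using dr assms by auto
  show "\<theta> x \<in> {c j..c (Suc j)}"
    using \<theta>_le_iff[OF dr(1) x] \<theta>_le_iff[OF x dr(2)] \<theta>_varpi[OF c_range[of j]] \<theta>_varpi[OF c_range[of "Suc j"]] assms by auto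
qed

lemma varpi_piece:
  assumes "j < m" "p \<in> {c j..c (Suc j)}"
  shows "varpi \<omega> p \<in> {d j..d (Suc j)}"
proof -
  note dr = d_range[of j] d_range[of "Suc j"]
  have p: "p \<in> {-1..1}" using c_range[of j] c_range[of "Suc j"] assms by auto
  show ?thesis
    using \<theta>_le_iff[OF dr(1) varpi_range[OF p]] \<theta>_le_iff[OF varpi_range[OF p] dr(2)]
      \<theta>_varpi[OF c_range[of j]] \<theta>_varpi[OF c_range[of "Suc j"]] \<theta>_varpi[OF p] assms by auto
qed

lemma conj_map_inj:
  assumes j: "j < m"
  shows "inj_on (conj_map \<omega> f) {d j..d (Suc j)}"
proof (rule inj_onI)
  fix x y assume x: "x \<in> {d j..d (Suc j)}" and y: "y \<in> {d j..d (Suc j)}"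
    and eq: "conj_map \<omega> f x = conj_map \<omega> f y"
  note px = \<theta>_piece[OF j x] and py = \<theta>_piece[OF j y]
  have "\<theta> (conj_map \<omega> f x) = \<theta> (conj_map \<omega> f y)" using eq by simp
  then have "f (\<theta> x) = f (\<theta> y)"
    unfolding conj_map_def o_def using \<theta>_varpi f_maps \<theta>_range px(1) py(1) by simp
  then have "\<theta> x = \<theta> y" using inj_onD[OF f_inj[OF j]] px py by blast
  then show "x = y" using inj_onD[OF \<theta>_inj] px py by blast
qed

lemma conj_map_onto:
  assumes j: "j < m" and y: "y \<in> {-1..1}"
  shows "y \<in> conj_map \<omega> f ` {d j..d (Suc j)}"
proof -
  obtain p where p: "p \<in> {c j..c (Suc j)}" "f p = \<theta> y" using f_onto[OF j \<theta>_range[OF y]] by blast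
  have "p \<in> {-1..1}" using p c_range[of j] c_range[of "Suc j"] j by auto
  then have "conj_map \<omega> f (varpi \<omega> p) = y" by (simp add: conj_map_def \<theta>_varpi p varpi_\<theta>[OF y])
  then show ?thesis using varpi_piece[OF j p(1)] by (metis imageI)
qed

lemma inv_branch:
  assumes j: "j < m" and y: "y \<in> {-1..1}"
  shows "inv_branch \<omega> f c (Suc j) y \<in> {d j..d (Suc j)}" (is ?A)
    and "f (\<theta> (inv_branch \<omega> f c (Suc j) y)) = \<theta> y"
proof -
  let ?p = "inv_branch \<omega> f c (Suc j) y"
  show A: ?A
    unfolding inv_branch_def using the_inv_into_into[OF conj_map_inj[OF j] conj_map_onto[OF j y] subset_refl] by simp
  have "conj_map \<omega> f ?p = y"
    unfolding inv_branch_def using f_the_inv_into_f[OF conj_map_inj[OF j] conj_map_onto[OF j y]] by simp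
  then have "\<theta> (varpi \<omega> (f (\<theta> ?p))) = \<theta> y" by (simp add: conj_map_def)
  then show "f (\<theta> ?p) = \<theta> y" using \<theta>_varpi f_maps \<theta>_range \<theta>_piece(1)[OF j A] by simp
qed

lemma inv_branch_eqI:
  assumes j: "j < m" and p: "p \<in> {d j..d (Suc j)}" "conj_map \<omega> f p = y"
  shows "inv_branch \<omega> f c (Suc j) y = p"
  unfolding inv_branch_def using the_inv_into_f_f[OF conj_map_inj[OF j] p(1)] p(2) by simp

lemma b_range: "j < m \<Longrightarrow> x \<in> {-1..1} \<Longrightarrow> Re (b j (of_real x)) \<in> {d j..d (Suc j)}"
  using inv_branch(1) by (simp add: b_inv_branch)

lemma b_conj: "j < m \<Longrightarrow> x \<in> {-1..1} \<Longrightarrow> f (Re (\<omega> (b j (of_real x)))) = Re (\<omega> (of_real x))"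
  using inv_branch(2) by (simp add: b_inv_branch omega_real_def)

lemma conj_map_d: "j \<le> m \<Longrightarrow> conj_map \<omega> f (d j) = (-1) ^ Suc j"
  unfolding conj_map_def o_def by (simp only: \<theta>_varpi[OF c_range] f_c varpi_power)

lemma b_lower: assumes j: "j < m" shows "b j (of_real (- ((-1) ^ j))) = of_real (d j)"
proof -
  have "inv_branch \<omega> f c (Suc j) ((-1) ^ Suc j) = d j"
    by (rule inv_branch_eqI[OF j _ conj_map_d]) (use d_less[OF j] j in auto)
  then show ?thesis using b_inv_branch[OF j varpi_power(2)[of "Suc j"]] by simp
qed

lemma b_upper: assumes j: "j < m" shows "b j (of_real ((-1) ^ j)) = of_real (d (Suc j))"
proof -
  have "inv_branch \<omega> f c (Suc j) ((-1) ^ Suc (Suc j)) = d (Suc j)"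
    by (rule inv_branch_eqI[OF j _ conj_map_d]) (use d_less[OF j] j in auto)
  then show ?thesis using b_inv_branch[OF j varpi_power(2)[of j]] by simp
qed

lemma b_ends:
  assumes "j < m" "a = 1 \<or> a = (-1::complex)"
  obtains i where "i \<le> m" "b j a = of_real (d i)"
proof -
  have "a = of_real ((-1) ^ j) \<or> a = of_real (- ((-1) ^ j))" using assms(2) by (cases "even j") auto
  then show ?thesis using b_lower[OF assms(1)] b_upper[OF assms(1)] that[of j] that[of "Suc j"] assms(1) by auto
qed

subsection \<open>Derivatives of the inverse branches at the end points\<close>

text \<open>Working with this lift treats the folds of \<open>f\<close> at interior partition points
  and the fold of \<open>\<omega>\<close> at the ends alike: both are critical points of
  \<open>F\<close>.\<close>

definition F :: "complex \<Rightarrow> complex" where "F z = fc (\<omega> z)"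
definition S :: "complex set" where "S = W0 \<inter> \<omega> -` Wf"

lemma S_open: "open S"
  unfolding S_def by (rule continuous_open_preimage[OF holomorphic_on_imp_continuous_on[OF \<omega>_hol] W0(1) Wf(1)])

lemma seg_S: "seg \<subseteq> S"
proof
  fix z assume "z \<in> seg"
  then obtain x where x: "x \<in> {-1..1}" "z = of_real x" by (auto simp: seg_def)
  then have "\<omega> z \<in> seg" using \<theta>_range[OF x(1)] by (simp only: \<omega>_of_real of_real_in_seg_iff)
  then show "z \<in> S" using \<open>z \<in> seg\<close> W0 Wf by (auto simp: S_def)
qed

lemma F_hol: "F holomorphic_on S"
  unfolding F_def[abs_def] S_def
  by (rule holomorphic_on_compose_gen[OF holomorphic_on_subset[OF \<omega>_hol] fc_hol, unfolded o_def]) auto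

lemma F_of_real: "x \<in> {-1..1} \<Longrightarrow> F (of_real x) = of_real (f (\<theta> x))"
  unfolding F_def by (simp only: \<omega>_of_real fc[OF \<theta>_range])

text \<open>In the chain rule of order one or three every term contains a first or third derivative
  of \<open>\<omega>\<close>, and these vanish at the ends.\<close>

lemma F_ends:
  assumes "a = 1 \<or> a = -1"
  shows "deriv F a = 0" "deriv (deriv (deriv F)) a = 0"
proof -
  have a: "a \<in> S" using assms seg_S by auto
  note comp = composition_derivatives[OF fc_hol Wf(1) holomorphic_on_subset[OF \<omega>_hol] S_open _ _ a, of F]
  show "deriv F a = 0" using comp(1) \<omega>1[OF assms] by (simp add: S_def F_def)
  show "deriv (deriv (deriv F)) a = 0" using comp(3) \<omega>1[OF assms] \<omega>3[OF assms] by (simp add: S_def F_def)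
qed

text \<open>At the other points of the partition \<open>f \<circ> \<theta>\<close> takes one of its extreme values \<open>\<plusminus>1\<close> in the
  interior of the interval.\<close>

lemma F_critical:
  assumes x: "x \<in> {-1..1}" and fx: "f (\<theta> x) = 1 \<or> f (\<theta> x) = -1"
  shows "deriv F (of_real x) = 0"
proof (cases "x = 1 \<or> x = -1")
  case True
  then show ?thesis using F_ends(1)[of "of_real x"] by auto
next
  case False
  then have x': "-1 < x" "x < 1" using x by auto
  define e where "e = min (x + 1) (1 - x)"
  have e: "e > 0" "\<And>y. \<bar>x - y\<bar> < e \<Longrightarrow> y \<in> {-1..1}" using x' by (auto simp: e_def)
  have "of_real x \<in> S" using seg_S x by auto
  note der = Re_of_real_has_derivative(1)[OF F_hol S_open this]
  have val: "Re (F (of_real y)) = f (\<theta> y)" "f (\<theta> y) \<in> {-1..1}" if "y \<in> {-1..1}" for y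
    using F_of_real[OF that] f_maps \<theta>_range that by simp_all
  have "Re (deriv F (of_real x)) = 0"
    using fx
  proof
    assume "f (\<theta> x) = 1"
    then show ?thesis
      by (intro DERIV_local_max[OF der e(1)] allI impI) (use val[OF x] val[OF e(2)] in auto)
  next
    assume "f (\<theta> x) = -1"
    then show ?thesis
      by (intro DERIV_local_min[OF der e(1)] allI impI) (use val[OF x] val[OF e(2)] in auto)
  qed
  moreover have "Im (deriv F (of_real x)) = 0"
    by (rule Im_deriv_eq_0_of_real_on_seg[OF F_hol S_open seg_S _ x]) (simp add: F_of_real)
  ultimately show ?thesis by (simp add: complex_eq_iff)
qed

text \<open>The identity holds on the real interval by definition of the inverse branches and
  spreads to a neighbourhood by the identity principle.\<close>

lemma b_functional_equation:
  assumes j: "j < m"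
  obtains T where "open T" "seg \<subseteq> T" "T \<subseteq> U" "\<And>z. z \<in> T \<Longrightarrow> b j z \<in> S" "\<And>z. z \<in> T \<Longrightarrow> F (b j z) = \<omega> z"
proof -
  let ?V = "(U \<inter> b j -` S) \<inter> W0"
  have b_seg: "b j (of_real x) \<in> seg" if "x \<in> {-1..1}" for x
    unfolding b_inv_branch[OF j that] of_real_in_seg_iff by (rule \<theta>_piece(1)[OF j inv_branch(1)[OF j that]])
  have V: "open ?V"
    by (intro open_Int W0 continuous_open_preimage[OF holomorphic_on_imp_continuous_on[OF b_hol[OF j]] U(1) S_open])
  have segV: "seg \<subseteq> ?V"
  proof
    fix z assume z: "z \<in> seg"
    then have "b j z \<in> seg" using b_seg by (auto simp: seg_def)
    then show "z \<in> ?V" using z U seg_S W0 by blast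
  qed
  obtain t where t: "t > 0" "nbhd t \<subseteq> ?V" using nbhd_subset_open[OF V segV] by metis
  have "F (b j z) = \<omega> z" if z: "z \<in> nbhd t" for z
  proof (rule holomorphic_eq_on_connected[of "\<lambda>z. F (b j z)" "nbhd t" \<omega> "-1" 1])
    have "b j holomorphic_on nbhd t" using holomorphic_on_subset[OF b_hol[OF j]] t by blast
    from holomorphic_on_compose_gen[OF this F_hol] t
    show "(\<lambda>z. F (b j z)) holomorphic_on nbhd t" unfolding o_def by (simp add: subset_eq)
    show "\<omega> holomorphic_on nbhd t" using holomorphic_on_subset[OF \<omega>_hol] t by blast
    show "complex_of_real ` {-1<..<1} \<subseteq> nbhd t"
      using seg_subset_nbhd[OF t(1)] by (auto simp: seg_def)
    fix x :: real assume "-1 < x" "x < 1"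
    then have x: "x \<in> {-1..1}" by simp
    have "F (b j (of_real x)) = of_real (f (\<theta> (inv_branch \<omega> f c (Suc j) x)))"
      unfolding b_inv_branch[OF j x] by (rule F_of_real[OF \<theta>_piece(1)[OF j inv_branch(1)[OF j x]]])
    then show "F (b j (of_real x)) = \<omega> (of_real x)"
      by (simp only: inv_branch(2)[OF j x] \<omega>_of_real[OF x])
  qed (use connected_nbhd z in auto)
  then show ?thesis using that[of "nbhd t"] seg_subset_nbhd[OF t(1)] t(2) by blast
qed

lemma b_derivs:
  assumes j: "j < m" and z: "z \<in> seg"
  shows "deriv F (b j z) * deriv (b j) z = deriv \<omega> z"
    and "deriv (deriv F) (b j z) * deriv (b j) z ^ 2 + deriv F (b j z) * deriv (deriv (b j)) z = deriv (deriv \<omega>) z"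
    and "deriv (deriv (deriv F)) (b j z) * deriv (b j) z ^ 3 + 3 * deriv (deriv F) (b j z) * deriv (b j) z * deriv (deriv (b j)) z
      + deriv F (b j z) * deriv (deriv (deriv (b j))) z = deriv (deriv (deriv \<omega>)) z"
proof -
  obtain T where T: "open T" "seg \<subseteq> T" "T \<subseteq> U" "\<And>z. z \<in> T \<Longrightarrow> b j z \<in> S" "\<And>z. z \<in> T \<Longrightarrow> F (b j z) = \<omega> z"
    by (rule b_functional_equation[OF j]) metis
  have "z \<in> T" using z T(2) by blast
  note * = composition_derivatives[OF F_hol S_open holomorphic_on_subset[OF b_hol[OF j] T(3)] T(1,4,5) this]
  show "deriv F (b j z) * deriv (b j) z = deriv \<omega> z"
    and "deriv (deriv F) (b j z) * deriv (b j) z ^ 2 + deriv F (b j z) * deriv (deriv (b j)) z = deriv (deriv \<omega>) z"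
    and "deriv (deriv (deriv F)) (b j z) * deriv (b j) z ^ 3 + 3 * deriv (deriv F) (b j z) * deriv (b j) z * deriv (deriv (b j)) z
      + deriv F (b j z) * deriv (deriv (deriv (b j))) z = deriv (deriv (deriv \<omega>)) z"
    by (rule *; assumption)+
qed

text \<open>At an end the branch takes a partition value, where \<open>deriv F\<close> vanishes. The
  second order equation then determines the square of \<open>deriv (b j)\<close>, which is nonzero,
  and the third order one determines the second derivative. Both depend on \<open>j\<close> only
  through the value \<open>b j a\<close>, which is the reason for the pairing of branches.\<close>

lemma b_end_derivs:
  assumes j: "j < m" and a: "a = 1 \<or> a = -1"
  shows "deriv (deriv F) (b j a) * deriv (b j) a ^ 2 = deriv (deriv \<omega>) a"
    and "deriv (deriv F) (b j a) \<noteq> 0" "deriv (b j) a \<noteq> 0"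
    and "deriv (deriv (b j)) a = - deriv (deriv (deriv F)) (b j a) * deriv (b j) a ^ 2 / (3 * deriv (deriv F) (b j a))"
proof -
  obtain i where i: "i \<le> m" "b j a = of_real (d i)" by (rule b_ends[OF j a])
  have "(-1) ^ Suc i = (1::real) \<or> (-1) ^ Suc i = (-1::real)" by (cases "even i") auto
  then have F0: "deriv F (b j a) = 0"
    unfolding i(2) by (intro F_critical d_range i(1)) (simp only: \<theta>_varpi[OF c_range[OF i(1)]] f_c[OF i(1)])
  have z: "a \<in> seg" using a by auto
  show 1: "deriv (deriv F) (b j a) * deriv (b j) a ^ 2 = deriv (deriv \<omega>) a"
    using b_derivs(2)[OF j z] F0 by simp
  then show ne: "deriv (deriv F) (b j a) \<noteq> 0" "deriv (b j) a \<noteq> 0" using \<omega>2[OF a] by auto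
  have "deriv (b j) a * (deriv (deriv (deriv F)) (b j a) * deriv (b j) a ^ 2 + 3 * deriv (deriv F) (b j a) * deriv (deriv (b j)) a) = 0"
    using b_derivs(3)[OF j z] F0 \<omega>3[OF a] by (simp add: power2_eq_square power3_eq_cube algebra_simps)
  then have "deriv (deriv (deriv F)) (b j a) * deriv (b j) a ^ 2 + 3 * deriv (deriv F) (b j a) * deriv (deriv (b j)) a = 0"
    using ne(2) by simp
  then show "deriv (deriv (b j)) a = - deriv (deriv (deriv F)) (b j a) * deriv (b j) a ^ 2 / (3 * deriv (deriv F) (b j a))"
    using ne(1) by (simp add: field_simps add_eq_0_iff)
qed

text \<open>In the interior the first order equation has the nonzero right side
  \<open>deriv \<omega>\<close>; at the ends it degenerates and the second order equation takes
  over.\<close>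

lemma b_deriv_ne_0:
  assumes j: "j < m" and x: "x \<in> {-1..1}"
  shows "deriv (b j) (of_real x) \<noteq> 0"
proof (cases "x = 1 \<or> x = -1")
  case True
  then show ?thesis using b_end_derivs(3)[OF j, of "of_real x"] by auto
next
  case False
  then have "deriv \<omega> (of_real x) \<noteq> 0" using \<omega>_deriv_pos[of x] x by fastforce
  then show ?thesis using b_derivs(1)[OF j, of "of_real x"] x by auto
qed

lemma branches: "branches U m b d"
proof
  show "d 0 = -1" "d m = 1" by (simp_all add: c_0 c_m varpi_ends)
  show "Im (b j (of_real x)) = 0" if "j < m" "x \<in> {-1..1}" for j x
    by (simp add: b_inv_branch[OF that])
qed (use U m2 b_cont b_hol b_into d_less b_range b_lower b_upper b_deriv_ne_0 in auto)

lemma endpoint_map: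
  obtains C D q r h t where
    "endpoint_map U m b d C D q r f \<omega> W0 h t (\<lambda>x. Re (deriv fc (of_real x)))"
proof -
  interpret B: branches U m b d by (rule branches)
  obtain C D q r where "C \<ge> 1" "D > 0" "0 < q" "q < 1" "r > 0" "nbhd r \<subseteq> U"
    "\<And>w z. set w \<subseteq> {..<m} \<Longrightarrow> z \<in> nbhd r \<Longrightarrow> norm (deriv (B.bw w) z) \<le> C * q ^ length w"
    "\<And>n z. z \<in> nbhd r \<Longrightarrow> (\<Sum>w\<in>words m n. norm (deriv (B.bw w) z)) \<le> D"
    by (rule B.uniform_bounds) metis
  then interpret UB: uniform_branches U m b d C D q r by unfold_locales
  obtain h t where h: "t > 0" "h holomorphic_on nbhd t" "\<And>z. z \<in> nbhd t \<Longrightarrow> B.L h z = h z"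
    "\<And>x. x \<in> {-1..1} \<Longrightarrow> Im (h (of_real x)) = 0" "\<And>x. x \<in> {-1..1} \<Longrightarrow> Re (h (of_real x)) \<ge> 0"
    "(\<integral>x. h (of_real x) \<partial>LI) = 1"
    by (rule UB.invariant_density) metis
  have "continuous_on {-1..1} (\<lambda>x. deriv fc (complex_of_real x))"
    by (rule continuous_on_compose2[OF holomorphic_on_imp_continuous_on[OF holomorphic_deriv[OF fc_hol Wf(1)]]])
       (use Wf(2) in \<open>auto intro!: continuous_intros simp: seg_def\<close>)
  then have f'_cont: "continuous_on {-1..1} (\<lambda>x. Re (deriv fc (complex_of_real x)))"
    by (intro continuous_intros)
  have pair: "deriv (b i) a ^ 2 = deriv (b j) a ^ 2 \<and> deriv (deriv (b i)) a = deriv (deriv (b j)) a"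
    if a: "a = 1 \<or> a = -1" and i: "i < m" and j: "j < m" and eq: "b i a = b j a" for a i j
  proof -
    have "deriv (deriv F) (b j a) * deriv (b i) a ^ 2 = deriv (deriv F) (b j a) * deriv (b j) a ^ 2"
      using b_end_derivs(1)[OF i a] b_end_derivs(1)[OF j a] eq by simp
    then have "deriv (b i) a ^ 2 = deriv (b j) a ^ 2" using b_end_derivs(2)[OF j a] by simp
    then show ?thesis using b_end_derivs(4)[OF i a] b_end_derivs(4)[OF j a] eq by simp
  qed
  have end2: "deriv (deriv (b j)) a = 0"
    if a: "a = 1 \<or> a = -1" and j: "j < m" and D: "b j a = 1 \<or> b j a = -1" for a j
    using b_end_derivs(4)[OF j a] F_ends(2)[OF D] by simp
  have "endpoint_map U m b d C D q r f \<omega> W0 h t (\<lambda>x. Re (deriv fc (of_real x)))"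
  proof unfold_locales
    show "Im (\<omega> (of_real x)) = 0" "Re (\<omega> (of_real x)) \<in> {-1..1}" if "x \<in> {-1..1}" for x
      using \<omega>_of_real[OF that] \<theta>_range[OF that] by simp_all
    show "deriv \<omega> 1 = 0" "deriv \<omega> (-1) = 0" by (simp_all add: \<omega>1)
  qed (fact f_cont f_maps \<omega>_hol W0 \<omega>_ends \<omega>_deriv_pos b_conj h f_has_deriv f'_cont \<omega>2 \<omega>3 pair end2)+
  then show ?thesis by (rule that)
qed

end

theorem mainTheorem1:
  fixes f :: "real \<Rightarrow> real" and c :: "nat \<Rightarrow> real" and m :: nat
    and \<omega> :: "complex \<Rightarrow> complex"
  assumes m: "m \<ge> 2"
    and f_maps: "f ` {-1..1} \<subseteq> {-1..1}"
    and f_analytic: "real_analytic_on f {-1..1}"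
    and c_ends: "c 0 = -1" "c m = 1"
    and c_less: "\<And>j. j < m \<Longrightarrow> c j < c (Suc j)"
    and f_c: "\<And>j. j \<le> m \<Longrightarrow> f (c j) = (-1) ^ (j + 1)"
    and f_deriv: "\<And>x. x \<in> {-1..1} \<Longrightarrow> interval_deriv f x = 0 \<Longrightarrow> x \<in> c ` {1..m-1}"
    and f_deriv2: "\<And>x. x \<in> c ` {1..m-1} \<Longrightarrow> interval_deriv (interval_deriv f) x \<noteq> 0"
    and omega: "change_of_variable \<omega>"
    and expanding: "analytically_expanding \<omega> f c m"
  shows "(\<exists>!\<rho>. ac_invariant_prob f \<rho>) \<and>
    (\<forall>\<rho> X A. ac_invariant_prob f \<rho> \<longrightarrow> real_analytic_on X {-1..1} \<longrightarrow> C1_interval A \<longrightarrow>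
       (\<exists>r>0. \<exists>F :: complex \<Rightarrow> complex.
          (\<forall>z. norm z < r \<longrightarrow>
             (\<lambda>n. z ^ n * complex_of_real (Psi_coeff f \<rho> X A n)) sums F z) \<and>
          F nicely_meromorphic_on UNIV \<and> \<not> is_pole F 1))"
proof -
  obtain Wf fc where Wf: "open Wf" "seg \<subseteq> Wf" and fc_hol: "fc holomorphic_on Wf"
    and fc: "\<And>x. x \<in> {-1..1} \<Longrightarrow> fc (of_real x) = complex_of_real (f x)"
    by (rule real_analytic_extension[OF f_analytic]) metis
  note cv = omega[unfolded change_of_variable_def]
  \<comment> \<open>\<open>cv3\<close>, \<open>cv5\<close> and \<open>cv7\<close> name the
    remainders of the nine-fold conjunction from its third, fifth and seventh member on.\<close>
  note cv3 = cv[THEN conjunct2, THEN conjunct2]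
  note cv5 = cv3[THEN conjunct2, THEN conjunct2]
  note cv7 = cv5[THEN conjunct2, THEN conjunct2]
  obtain W0 where W0: "open W0" "seg \<subseteq> W0" "\<omega> holomorphic_on W0"
    using cv[THEN conjunct1] unfolding seg_def by blast
  obtain K E :: real where K: "K > 0" and bigo: "\<And>\<sigma>. \<sigma> = 1 \<or> \<sigma> = -1 \<Longrightarrow>
      (\<lambda>\<xi>. \<omega> (\<sigma> * (1 - \<xi>)) - \<sigma> * (1 - of_real K * \<xi> ^ 2 + of_real E * \<xi> ^ 4)) \<in> O[at 0](\<lambda>\<xi>. \<xi> ^ 5)"
    using cv7[THEN conjunct2, THEN conjunct2] by blast
  obtain U where U: "bounded U" "open U" "seg \<subseteq> U"
    and ex: "\<forall>j\<in>{1..m}. \<exists>\<psi>. continuous_on (closure U) \<psi> \<and> \<psi> holomorphic_on U \<and>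
           (\<forall>x\<in>{-1..1}. \<psi> (of_real x) = of_real (inv_branch \<omega> f c j x)) \<and> \<psi> ` closure U \<subseteq> U"
    using expanding unfolding analytically_expanding_def seg_def by blast
  from bchoice[OF ex] obtain \<psi> where \<psi>: "\<And>j. j \<in> {1..m} \<Longrightarrow> continuous_on (closure U) (\<psi> j) \<and> \<psi> j holomorphic_on U \<and>
           (\<forall>x\<in>{-1..1}. \<psi> j (of_real x) = of_real (inv_branch \<omega> f c j x)) \<and> \<psi> j ` closure U \<subseteq> U"
    by blast
  note \<omega>_ends = cv3[THEN conjunct1] cv3[THEN conjunct2, THEN conjunct1]
  have \<omega>1: "deriv \<omega> a = 0" and \<omega>3: "deriv (deriv (deriv \<omega>)) a = 0" if "a = 1 \<or> a = -1" for a
    using cv7[THEN conjunct2, THEN conjunct1] that by (auto simp: eval_nat_numeral)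
  have \<omega>2: "deriv (deriv \<omega>) a \<noteq> 0" if a: "a = 1 \<or> a = -1" for a
  proof (rule second_deriv_neq_0[OF W0(1) _ W0(3) _ \<omega>1[OF a] a K bigo[OF a]])
    show "a \<in> W0" using a W0(2) by auto
    show "\<omega> a = a" using a \<omega>_ends by auto
  qed
  have critical: "x \<in> c ` {1..m-1}" if x: "x \<in> {-1..1}" and 0: "Re (deriv fc (of_real x)) = 0" for x
  proof (rule f_deriv[OF x])
    show "interval_deriv f x = 0"
      unfolding interval_deriv_def
      by (rule vector_derivative_within_closed_interval)
         (use x holomorphic_extension_has_real_derivative[OF Wf fc_hol fc x] 0 in \<open>auto simp: has_real_derivative_iff_has_vector_derivative\<close>)
  qed
  \<comment> \<open>The branches of the statement are numbered from \<open>1\<close>, those of the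
    locale from \<open>0\<close>.\<close>
  interpret analytic_data f c m \<omega> W0 fc Wf U "\<lambda>j. \<psi> (Suc j)"
  proof unfold_locales
    show "\<omega> ` of_real ` {-1..1} = of_real ` {-1..1::real}" "strict_mono_on {-1..1} (omega_real \<omega>)"
      using cv5[THEN conjunct1] cv5[THEN conjunct2, THEN conjunct1] unfolding omega_real_def[abs_def] by blast+
    show "Re (deriv \<omega> (of_real x)) > 0" if "-1 < x" "x < 1" for x
      using cv7[THEN conjunct1] that by auto
    show "f x \<in> {-1..1}" if "x \<in> {-1..1}" for x using f_maps that by blast
    show "f (c j) = (-1) ^ Suc j" if "j \<le> m" for j using f_c[OF that] by simp
    show "continuous_on (closure U) (\<psi> (Suc j))" "\<psi> (Suc j) holomorphic_on U" "\<psi> (Suc j) ` closure U \<subseteq> U"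
      if "j < m" for j using \<psi>[of "Suc j"] that by auto
    show "\<psi> (Suc j) (of_real x) = of_real (inv_branch \<omega> f c (Suc j) x)" if "j < m" "x \<in> {-1..1}" for j x
      using \<psi>[of "Suc j"] that by auto
  qed (fact m W0 \<omega>_ends \<omega>1 \<omega>2 \<omega>3 Wf fc_hol fc c_ends c_less critical U)+
  obtain C D q r h t where
    "endpoint_map U m (\<lambda>j. \<psi> (Suc j)) d C D q r f \<omega> W0 h t (\<lambda>x. Re (deriv fc (of_real x)))"
    by (rule endpoint_map)
  then interpret EM: endpoint_map U m "\<lambda>j. \<psi> (Suc j)" d C D q r f \<omega> W0 h t "\<lambda>x. Re (deriv fc (of_real x))" .
  show ?thesis
  proof (intro conjI allI impI)
    show "\<exists>!\<rho>. ac_invariant_prob f \<rho>"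
      using EM.ac_invariant_prob_acim EM.ac_invariant_prob_unique by blast
    fix \<rho> X A assume \<rho>: "ac_invariant_prob f \<rho>" and X: "real_analytic_on X {-1..1}" and A: "C1_interval A"
    obtain WX Xc where "open WX" "seg \<subseteq> WX" "Xc holomorphic_on WX"
      "\<And>x. x \<in> {-1..1} \<Longrightarrow> Xc (of_real x) = complex_of_real (X x)"
      by (rule real_analytic_extension[OF X]) metis
    moreover obtain A' where "continuous_on {-1..1} A'"
      "\<And>x. x \<in> {-1..1} \<Longrightarrow> (A has_real_derivative A' x) (at x within {-1..1})"
      using A unfolding C1_interval_def by blast
    ultimately have "meromorphic_fps_regular 1 (Abs_fps (\<lambda>n. complex_of_real (Psi_coeff f \<rho> X A n)))"
      unfolding EM.ac_invariant_prob_unique[OF \<rho>] by (intro EM.susceptibility_regular)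
    then show "\<exists>r>0. \<exists>F :: complex \<Rightarrow> complex.
          (\<forall>z. norm z < r \<longrightarrow> (\<lambda>n. z ^ n * complex_of_real (Psi_coeff f \<rho> X A n)) sums F z) \<and>
          F nicely_meromorphic_on UNIV \<and> \<not> is_pole F 1"
      by (rule meromorphic_fps_regular_nicely)
  qed
qed

end
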